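(* Let $\nu=0$, $T>0$, $\omega>0$, let $\{\mathcal T_h\}$, $d^p$ (Becker–Hansbo), $d^u$ (discrete upwinding) and the solutions $(\mathbf u_i(t),p_i(t))_i$ of (S1)–(S2) on $[0,T]$ be as follows: $\mathbf u_i\in C^1([0,T])$ and there is $M$ independent of $h$ with $|\mathbf u_i(t)|\le M$, $|p_i(t)|\le M$, $|\tfrac{d\mathbf u_i}{dt}(t)|\le M$ for all $i,t$, and $\int_0^Th|\mathbf u_h|^2_{H^1(\Omega)}dt\le M$. Let $\mathbf u_0\in L^2(\Omega)^d$ be periodic and weakly divergence-free, and assume the initial data are admissible: $\mathbf u_h(\cdot,0)\to\mathbf u_0$ in $L^2(\Omega)$ and $\sum_im_i\eta(\mathbf u_i(0))\to\frac12\int_\Omega|\mathbf u_0|^2dx$. Then there is a subsequence $h\to0$ and a parametrized family of probability measures $\mathcal U=\{\mathcal U_{\mathbf x,t}\}$ on $\mathbb R^d$ such that $\mathbf u_h\to\langle\mathcal U_{\mathbf x,t};\tilde{\mathbf u}\rangle$ weakly-$*$ in $L^\infty(0,T;L^2(\Omega;\mathbb R^d))$, and $\mathcal U$ is a dissipative measure-valued solution of the incompressible Euler equations with initial data $\mathbf u_0$ and defects $$\mathcal D_{cd}(t)=\overline{\eta(\mathbf u)}(t)-\tfrac12\langle\mathcal U_{\mathbf x,t};|\tilde{\mathbf u}|^2\rangle,\qquad\mathfrak M_{cd}(t)=\overline{\mathbf u\otimes\mathbf u}(t)-\langle\mathcal U_{\mathbf x,t};\tilde{\mathbf u}\otimes\tilde{\mathbf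 u}\rangle,$$ where $\overline{\eta(\mathbf u)}$ and $\overline{\mathbf u\otimes\mathbf u}$ are the weak-$*$ limits (along the subsequence) of $\frac12|\mathbf u_h|^2$ in $L^\infty(0,T;\mathcal M^+(\Omega))$ and of $\mathbf u_h\otimes\mathbf u_h$ in $L^\infty(0,T;\mathcal M(\Omega;\mathbb R^{d\times d}))$.
   Context: Setting. Let $d\in\{2,3\}$ and let $\Omega\subset\mathbb R^d$ be a box on which periodic boundary conditions are imposed (functions are periodic; $\Omega$ is a flat torus). $\{\mathcal T_h\}$ is a shape-regular, quasi-uniform family of conforming simplicial meshes compatible with periodicity, $h$ the maximal element diameter, $h\to0$, vertices $\mathbf x_i$; $\varphi_i$ are the continuous piecewise-linear Lagrange basis functions, $V_h=\mathrm{span}\{\varphi_i\}$, $\mathbf u_h=\sum_j\mathbf u_j\varphi_j$, $p_h=\sum_jp_j\varphi_j$; $\mathcal N_i$: indices $j$ (including $i$) with overlapping supports. $m_{ij}=\int\varphi_i\varphi_j$, $m_i=\int\varphi_i$, $\mathbf c_{ij}=\int\varphi_i\nabla\varphi_j$, $s_{ij}=\int\nabla\varphi_i\cdot\nabla\varphi_j$, $\tilde a_{ij}=\frac{\mathbf u_i+\mathbf u_j}{2}\cdot\mathbf c_{ij}$, $a_{ij}=\frac12\int[\varphi_i\mathbf u_h\cdot\nabla\varphi_j-\varphi_j\mathbf u_h\cdot\nabla\varphi_i]$; $\eta(\mathbf u)=|\mathbf u|^2/2$. Scheme (here $\nu=0$): (S1) $m_i\frac{d\mathbf u_i}{dt}=\sum_{j\in\mathcal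 N_i}[(d^u_{ij}-\tilde a_{ij}-\nu s_{ij})\mathbf u_j-\mathbf c_{ij}p_j]$, (S2) $0=\sum_{j\in\mathcal N_k}[d^p_{kj}p_j-\mathbf c_{kj}\cdot\mathbf u_j]$. Becker–Hansbo: $d^p_{ij}=\omega m_{ij}$ ($j\ne i$), $d^p_{ii}=-\sum_{k\ne i}d^p_{ik}$. Discrete upwinding: $d^u_{ij}=(1-\alpha_{ij})|a_{ij}|$ for $j\in\mathcal N_i\setminus\{i\}$ with arbitrary $\alpha_{ij}=\alpha_{ji}\in[0,1]$, $0$ for $j\notin\mathcal N_i$, $d^u_{ii}=-\sum_{k\ne i}d^u_{ik}$. Dissipative measure-valued (DMV) solution. $\mathcal P(\mathbb R^d)$ denotes probability measures on the phase space $\mathbb R^d$ with generic element $\tilde{\mathbf u}$; $\mathcal M^+(\Omega)$ positive Radon measures; $\mathcal M(\Omega;\mathbb R^{d\times d})$ matrix-valued Radon measures. A family $\mathcal U=\{\mathcal U_{\mathbf x,t}\}\in L^\infty_{\text{weak-}*}(\Omega\times(0,T);\mathcal P(\mathbb R^d))$ is a DMV solution of the incompressible Euler equations $\partial_t\mathbf u+\nabla\cdot(\mathbf u\otimes\mathbf u)+\nabla p=0$, $\nabla\cdot\mathbf u=0$ with initial data $\mathbf u_0$ if there are $\mathcal D_{cd}\in L^\infty(0,T;\mathcal M^+(\Omega))$ and $\mathfrak M_{cd}\in L^\infty(0,T;\mathcal M(\Omega;\mathbb R^{d\times d}))$ such that: (energy) $\frac12\int_\Omega\langle\mathcal U_{\mathbf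 x,t};|\tilde{\mathbf u}|^2\rangle dx+\int_\Omega d\mathcal D_{cd}(t)\le\frac12\int_\Omega|\mathbf u_0|^2dx$ for a.e. $t$; (divergence) $\int_\Omega\langle\mathcal U_{\mathbf x,t};\tilde{\mathbf u}\rangle\cdot\nabla q\,dx=0$ for a.e. $t$ and all smooth periodic $q$; (momentum) $\int_0^T\!\int_\Omega(\langle\mathcal U_{\mathbf x,t};\tilde{\mathbf u}\rangle\cdot\partial_t\mathbf v+\langle\mathcal U_{\mathbf x,t};\tilde{\mathbf u}\otimes\tilde{\mathbf u}\rangle:\nabla\mathbf v)\,dx\,dt+\int_0^T\!\int_\Omega\nabla\mathbf v:d\mathfrak M_{cd}(t)\,dt+\int_\Omega\mathbf u_0\cdot\mathbf v(\cdot,0)\,dx=0$ for all smooth $\mathbf v$, periodic in space, compactly supported in $[0,T)$ in time, with $\nabla\cdot\mathbf v=0$; (defect compatibility) there is $c>0$ with $|\mathfrak M_{cd}(t)|(\Omega)\le c\,\mathcal D(t)$ for a.e. $t$, where $\mathcal D(t)=\int_\Omega d\mathcal D_{cd}(t)\ge0$. Here $\langle\mathcal U_{\mathbf x,t};f\rangle=\int_{\mathbb R^d}f(\tilde{\mathbf u})\,d\mathcal U_{\mathbf x,t}(\tilde{\mathbf u})$, $A:\nabla\mathbf w=\sum_{k,l}A_{kl}\partial_lw_k$. *)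

theory Defs
  imports "HOL-Probability.Probability"
begin

text \<open>The box is cbox 0 L with side lengths L k > 0; periodicity w.r.t. the lattice
  generated by the vectors L k e_k.\<close>

definition lat_per :: "real^'d \<Rightarrow> (real^'d \<Rightarrow> 'b) \<Rightarrow> bool" where
  "lat_per L f \<longleftrightarrow> (\<forall>x k. f (x + (L$k) *\<^sub>R axis k 1) = f x)"

definition lat_equiv :: "real^'d \<Rightarrow> real^'d \<Rightarrow> real^'d \<Rightarrow> bool" where
  "lat_equiv L v w \<longleftrightarrow> (\<forall>k. \<exists>m::int. w$k - v$k = of_int m * L$k)"

definition halfbox :: "real^'d \<Rightarrow> (real^'d) set" where
  "halfbox L = {x. \<forall>k. 0 \<le> x$k \<and> x$k < L$k}"

definition cont_per :: "real^'d \<Rightarrow> (real^'d \<Rightarrow> real) \<Rightarrow> bool" where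
  "cont_per L f \<longleftrightarrow> continuous_on UNIV f \<and> lat_per L f"

fun Ck :: "nat \<Rightarrow> ('a::real_normed_vector \<Rightarrow> 'b::real_normed_vector) \<Rightarrow> bool" where
  "Ck 0 f = continuous_on UNIV f"
| "Ck (Suc k) f = ((\<forall>x. f differentiable (at x)) \<and>
                   (\<forall>w. Ck k (\<lambda>x. frechet_derivative f (at x) w)))"

definition smooth :: "('a::real_normed_vector \<Rightarrow> 'b::real_normed_vector) \<Rightarrow> bool" where
  "smooth f \<longleftrightarrow> (\<forall>k. Ck k f)"

text \<open>directional derivative (set to 0 where f is not differentiable; for piecewise
  affine functions this is the a.e. gradient)\<close>
definition pd :: "('a::real_normed_vector \<Rightarrow> 'b::real_normed_vector) \<Rightarrow> 'a \<Rightarrow> 'a \<Rightarrow> 'b" where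
  "pd f w x = (if f differentiable (at x) then frechet_derivative f (at x) w else 0)"

definition grad :: "(real^'d \<Rightarrow> real) \<Rightarrow> real^'d \<Rightarrow> real^'d" where
  "grad f x = (\<chi> k. pd f (axis k 1) x)"

definition verts :: "(real^'d) set \<Rightarrow> (real^'d) set" where
  "verts S = {v. v extreme_point_of S}"

definition periodic_mesh :: "real^'d \<Rightarrow> (real^'d) set set \<Rightarrow> bool" where
  "periodic_mesh L K \<longleftrightarrow>
     (\<forall>S\<in>K. int CARD('d) simplex S) \<and>
     \<Union>K = UNIV \<and>
     (\<forall>S\<in>K. \<forall>S'\<in>K. S \<noteq> S' \<longrightarrow> S \<inter> S' = convex hull (verts S \<inter> verts S')) \<and>
     (\<forall>S\<in>K. \<forall>k. (\<lambda>x. x + (L$k) *\<^sub>R axis k 1) ` S \<in> K \<and>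
                   (\<lambda>x. x - (L$k) *\<^sub>R axis k 1) ` S \<in> K) \<and>
     (\<forall>B. bounded B \<longrightarrow> finite {S\<in>K. S \<inter> B \<noteq> {}})"

definition mesh_size :: "(real^'d) set set \<Rightarrow> real" where
  "mesh_size K = Sup (diameter ` K)"

definition inradius :: "(real^'d) set \<Rightarrow> real" where
  "inradius S = Sup {r. \<exists>c. ball c r \<subseteq> S}"

definition all_verts :: "(real^'d) set set \<Rightarrow> (real^'d) set" where
  "all_verts K = (\<Union>S\<in>K. verts S)"

text \<open>vertex indices i: one representative vertex per lattice class, taken in the
  half-open box\<close>
definition nodes :: "real^'d \<Rightarrow> (real^'d) set set \<Rightarrow> (real^'d) set" where
  "nodes L K = all_verts K \<inter> halfbox L"

definition P1 :: "real^'d \<Rightarrow> (real^'d) set set \<Rightarrow> (real^'d \<Rightarrow> real) \<Rightarrow> bool" where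
  "P1 L K f \<longleftrightarrow> continuous_on UNIV f \<and> lat_per L f \<and>
      (\<forall>S\<in>K. \<exists>a b. \<forall>x\<in>S. f x = a \<bullet> x + b)"

definition hat :: "real^'d \<Rightarrow> (real^'d) set set \<Rightarrow> real^'d \<Rightarrow> real^'d \<Rightarrow> real" where
  "hat L K i = (THE f. P1 L K f \<and>
      (\<forall>v\<in>all_verts K. f v = (if lat_equiv L v i then 1 else 0)))"

definition nbr :: "real^'d \<Rightarrow> (real^'d) set set \<Rightarrow> real^'d \<Rightarrow> real^'d \<Rightarrow> bool" where
  "nbr L K i j \<longleftrightarrow> (\<exists>x. hat L K i x \<noteq> 0 \<and> hat L K j x \<noteq> 0)"

definition uh :: "real^'d \<Rightarrow> (real^'d) set set \<Rightarrow> (real^'d \<Rightarrow> 'b::real_vector) \<Rightarrow> real^'d \<Rightarrow> 'b" where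
  "uh L K U x = (\<Sum>j\<in>nodes L K. hat L K j x *\<^sub>R U j)"

definition mm :: "real^'d \<Rightarrow> (real^'d) set set \<Rightarrow> real^'d \<Rightarrow> real^'d \<Rightarrow> real" where
  "mm L K i j = integral (cbox 0 L) (\<lambda>x. hat L K i x * hat L K j x)"

definition lm :: "real^'d \<Rightarrow> (real^'d) set set \<Rightarrow> real^'d \<Rightarrow> real" where
  "lm L K i = integral (cbox 0 L) (hat L K i)"

definition cc :: "real^'d \<Rightarrow> (real^'d) set set \<Rightarrow> real^'d \<Rightarrow> real^'d \<Rightarrow> real^'d" where
  "cc L K i j = integral (cbox 0 L) (\<lambda>x. hat L K i x *\<^sub>R grad (hat L K j) x)"

definition aa :: "real^'d \<Rightarrow> (real^'d) set set \<Rightarrow> (real^'d \<Rightarrow> real^'d) \<Rightarrow> real^'d \<Rightarrow> real^'d \<Rightarrow> real" where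
  "aa L K U i j = (1/2) * integral (cbox 0 L) (\<lambda>x.
      hat L K i x * (uh L K U x \<bullet> grad (hat L K j) x)
    - hat L K j x * (uh L K U x \<bullet> grad (hat L K i) x))"

definition atil :: "real^'d \<Rightarrow> (real^'d) set set \<Rightarrow> (real^'d \<Rightarrow> real^'d) \<Rightarrow> real^'d \<Rightarrow> real^'d \<Rightarrow> real" where
  "atil L K U i j = ((1/2) *\<^sub>R (U i + U j)) \<bullet> cc L K i j"

definition du_off :: "real^'d \<Rightarrow> (real^'d) set set \<Rightarrow> (real^'d \<Rightarrow> real^'d \<Rightarrow> real)
     \<Rightarrow> (real^'d \<Rightarrow> real^'d) \<Rightarrow> real^'d \<Rightarrow> real^'d \<Rightarrow> real" where
  "du_off L K al U i j = (if nbr L K i j then (1 - al i j) * \<bar>aa L K U i j\<bar> else 0)"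

definition du :: "real^'d \<Rightarrow> (real^'d) set set \<Rightarrow> (real^'d \<Rightarrow> real^'d \<Rightarrow> real)
     \<Rightarrow> (real^'d \<Rightarrow> real^'d) \<Rightarrow> real^'d \<Rightarrow> real^'d \<Rightarrow> real" where
  "du L K al U i j = (if j = i then - (\<Sum>k\<in>nodes L K - {i}. du_off L K al U i k)
                       else du_off L K al U i j)"

definition dp :: "real \<Rightarrow> real^'d \<Rightarrow> (real^'d) set set \<Rightarrow> real^'d \<Rightarrow> real^'d \<Rightarrow> real" where
  "dp \<omega> L K i j = (if j = i then - (\<Sum>k\<in>nodes L K - {i}. \<omega> * mm L K i k)
                      else \<omega> * mm L K i j)"

definition h1semi :: "real^'d \<Rightarrow> (real^'d \<Rightarrow> real^'d) \<Rightarrow> real" where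
  "h1semi L f = integral (cbox 0 L) (\<lambda>x. \<Sum>k\<in>UNIV. (norm (grad (\<lambda>y. f y $ k) x))\<^sup>2)"

definition young :: "(real^'d \<Rightarrow> real \<Rightarrow> (real^'d) measure) \<Rightarrow> bool" where
  "young U \<longleftrightarrow> (\<forall>x t. prob_space (U x t) \<and> sets (U x t) = sets borel) \<and>
     (\<forall>f::real^'d \<Rightarrow> real. continuous_on UNIV f \<and> bounded (range f) \<longrightarrow>
        (\<lambda>(x,t). \<integral>v. f v \<partial>(U x t)) \<in> borel_measurable borel)"

definition mom1 :: "(real^'d \<Rightarrow> real \<Rightarrow> (real^'d) measure) \<Rightarrow> real^'d \<Rightarrow> real \<Rightarrow> real^'d" where
  "mom1 U x t = (\<integral>v. v \<partial>(U x t))"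

definition mom2 :: "(real^'d \<Rightarrow> real \<Rightarrow> (real^'d) measure) \<Rightarrow> real^'d \<Rightarrow> real \<Rightarrow> real" where
  "mom2 U x t = (\<integral>v. (norm v)\<^sup>2 \<partial>(U x t))"

definition tens :: "(real^'d \<Rightarrow> real \<Rightarrow> (real^'d) measure) \<Rightarrow> real^'d \<Rightarrow> real \<Rightarrow> real^'d^'d" where
  "tens U x t = (\<chi> k l. \<integral>v. v$k * v$l \<partial>(U x t))"

text \<open>finite positive (Radon) measure on the torus, represented on the half-open box\<close>
definition tmeas :: "real^'d \<Rightarrow> (real^'d) measure \<Rightarrow> bool" where
  "tmeas L \<mu> \<longleftrightarrow> sets \<mu> = sets borel \<and> finite_measure \<mu> \<and> emeasure \<mu> (- halfbox L) = 0"

text \<open>signed measures on the torus as (positive part, negative part)\<close>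
definition sint :: "(real^'d \<Rightarrow> real) \<Rightarrow> (real^'d) measure \<times> (real^'d) measure \<Rightarrow> real" where
  "sint \<phi> \<mu> = (\<integral>x. \<phi> x \<partial>(fst \<mu>)) - (\<integral>x. \<phi> x \<partial>(snd \<mu>))"

definition tv :: "real^'d \<Rightarrow> ('d \<Rightarrow> 'd \<Rightarrow> (real^'d) measure \<times> (real^'d) measure) \<Rightarrow> real" where
  "tv L Mm = Sup {(\<Sum>k\<in>UNIV. \<Sum>l\<in>UNIV. sint (\<lambda>x. \<Phi> x $ k $ l) (Mm k l)) | \<Phi>.
        (\<forall>k l. cont_per L (\<lambda>x. \<Phi> x $ k $ l)) \<and> (\<forall>x. norm (\<Phi> x) \<le> 1)}"

definition LinfMpos :: "real^'d \<Rightarrow> real \<Rightarrow> (real \<Rightarrow> (real^'d) measure) \<Rightarrow> bool" where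
  "LinfMpos L T D \<longleftrightarrow> (\<forall>t. tmeas L (D t)) \<and>
     (\<forall>\<phi>. cont_per L \<phi> \<longrightarrow> (\<lambda>t. \<integral>x. \<phi> x \<partial>(D t)) \<in> borel_measurable borel) \<and>
     (\<exists>C. AE t in lborel. t \<in> {0..T} \<longrightarrow> measure (D t) UNIV \<le> C)"

definition LinfMmat :: "real^'d \<Rightarrow> real \<Rightarrow> (real \<Rightarrow> 'd \<Rightarrow> 'd \<Rightarrow> (real^'d) measure \<times> (real^'d) measure) \<Rightarrow> bool" where
  "LinfMmat L T Mm \<longleftrightarrow> (\<forall>t k l. tmeas L (fst (Mm t k l)) \<and> tmeas L (snd (Mm t k l))) \<and>
     (\<forall>\<phi> k l. cont_per L \<phi> \<longrightarrow> (\<lambda>t. sint \<phi> (Mm t k l)) \<in> borel_measurable borel) \<and>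
     (\<exists>C. AE t in lborel. t \<in> {0..T} \<longrightarrow> tv L (Mm t) \<le> C)"

definition testC :: "real^'d \<Rightarrow> real \<Rightarrow> (real \<Rightarrow> real^'d \<Rightarrow> real) \<Rightarrow> bool" where
  "testC L T \<psi> \<longleftrightarrow> (\<lambda>(x,t). \<psi> t x) \<in> borel_measurable borel \<and>
     (\<forall>t. cont_per L (\<psi> t)) \<and> (\<lambda>t. SUP x. \<bar>\<psi> t x\<bar>) integrable_on {0..T}"

definition testL2 :: "real^'d \<Rightarrow> real \<Rightarrow> (real \<Rightarrow> real^'d \<Rightarrow> real^'d) \<Rightarrow> bool" where
  "testL2 L T \<psi> \<longleftrightarrow> (\<lambda>(x,t). \<psi> t x) \<in> borel_measurable borel \<and>
     (\<forall>t. (\<lambda>x. (norm (\<psi> t x))\<^sup>2) integrable_on cbox 0 L) \<and>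
     (\<lambda>t. sqrt (integral (cbox 0 L) (\<lambda>x. (norm (\<psi> t x))\<^sup>2))) integrable_on {0..T}"

definition DMV :: "real^'d \<Rightarrow> real \<Rightarrow> (real^'d \<Rightarrow> real^'d) \<Rightarrow> (real^'d \<Rightarrow> real \<Rightarrow> (real^'d) measure)
   \<Rightarrow> (real \<Rightarrow> (real^'d) measure) \<Rightarrow> (real \<Rightarrow> 'd \<Rightarrow> 'd \<Rightarrow> (real^'d) measure \<times> (real^'d) measure) \<Rightarrow> bool" where
  "DMV L T u0 U Dcd Mcd \<longleftrightarrow>
     young U \<and> (\<forall>x t. integrable (U x t) (\<lambda>v. (norm v)\<^sup>2)) \<and>
     (AE t in lborel. t \<in> {0..T} \<longrightarrow> (\<lambda>x. mom2 U x t) integrable_on cbox 0 L) \<and>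
     LinfMpos L T Dcd \<and> LinfMmat L T Mcd \<and>
     (AE t in lborel. t \<in> {0..T} \<longrightarrow>
        (1/2) * integral (cbox 0 L) (\<lambda>x. mom2 U x t) + measure (Dcd t) UNIV
          \<le> (1/2) * integral (cbox 0 L) (\<lambda>x. (norm (u0 x))\<^sup>2)) \<and>
     (AE t in lborel. t \<in> {0..T} \<longrightarrow>
        (\<forall>q::real^'d \<Rightarrow> real. smooth q \<and> lat_per L q \<longrightarrow>
           integral (cbox 0 L) (\<lambda>x. mom1 U x t \<bullet> grad q x) = 0)) \<and>
     (\<forall>v::(real^'d) \<times> real \<Rightarrow> real^'d.
        smooth v \<and> (\<forall>t. lat_per L (\<lambda>x. v (x,t))) \<and>
        (\<exists>\<tau><T. \<forall>x t. \<tau> \<le> t \<longrightarrow> v (x,t) = 0) \<and>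
        (\<forall>x t. (\<Sum>k\<in>UNIV. pd v (axis k (1::real) :: real^'d, 0::real) (x,t) $ k) = 0) \<longrightarrow>
        integral {0..T} (\<lambda>t. integral (cbox 0 L) (\<lambda>x.
            mom1 U x t \<bullet> pd v (0::real^'d, 1::real) (x,t)
          + (\<Sum>k\<in>UNIV. \<Sum>l\<in>UNIV. tens U x t $ k $ l * pd v (axis l (1::real) :: real^'d, 0::real) (x,t) $ k)))
        + integral {0..T} (\<lambda>t. \<Sum>k\<in>UNIV. \<Sum>l\<in>UNIV.
            sint (\<lambda>x. pd v (axis l (1::real) :: real^'d, 0::real) (x,t) $ k) (Mcd t k l))
        + integral (cbox 0 L) (\<lambda>x. u0 x \<bullet> v (x,0)) = 0) \<and>
     (\<exists>c>0. AE t in lborel. t \<in> {0..T} \<longrightarrow> tv L (Mcd t) \<le> c * measure (Dcd t) UNIV)"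

end

theory Submission
  imports Defs "HOL-Library.Diagonal_Subsequence"
begin

text \<open>The approximations satisfy \<open>|u_h| \<le> M\<close> uniformly, so they generate a Young measure supported in a fixed ball
  and nothing concentrates: \<open>|u_h|\<^sup>2/2\<close> and \<open>u_h \<otimes> u_h\<close> converge weakly-* to the second moments of the Young measure,
  and both defects vanish.

  Testing (S1) with the nodal values of a divergence-free \<open>v\<close> is consistent: almost everywhere, the difference between
  the discrete and the continuous integrands is at most a constant times \<open>(\<epsilon> + \<surd>h)(1 + h |\<nabla>u_h|\<^sup>2)\<close>, whose integral
  tends to 0 by the \<open>H\<^sup>1\<close> bound. The convective term is brought into divergence form with an error
  \<open>\<integral> (div u_h)(u_h \<bullet> v)\<close>, which (S2) tested with the nodal values of \<open>u_h \<bullet> v\<close> removes. Skew symmetry of the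
  convective form and the signs of the stabilisations make the lumped kinetic energy nonincreasing, and by
  Jensen's inequality it dominates \<open>\<integral> |u_h|\<^sup>2/2\<close>.\<close>

section \<open>Young measures of bounded sequences\<close>

text \<open>The \<open>H\<^sup>1\<close> bound controls h |\<nabla>u_h|^2 in L^1 but does not make
  it small. An error of that size would be fatal, while h |\<nabla>u_h| and h^2 |\<nabla>u_h|^2 are
  harmless: the former is sqrt h times sqrt (h |\<nabla>u_h|^2), at most sqrt h (1 + h
  |\<nabla>u_h|^2). The cell estimates are arranged so that two gradients of u_h never meet a single
  h; averages over vertices are kept exact where a termwise comparison would leave such a product.
  The pressure is merely bounded, so the gradient is moved to the test field, whose piecewise linear
  interpolant is divergence free up to a Taylor remainder. Sums over pairs of nodes are moved under
  the integral, where at almost every point they collapse to the d + 1 vertices of one cell. The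
  Young measure is built from weak-* limits of the indicators of {u_h in cell}, along a binary tree
  of cells in phase space. Such limits see averages in time only: statements for almost every t come
  from testing with indicators of sets of times, and one null set serves all q because gradients on
  the box form a separable family.\<close>

lemma diagonal_convergent_subsequence:
  fixes X :: "nat \<Rightarrow> nat \<Rightarrow> real"
  assumes "\<And>k n. \<bar>X k n\<bar> \<le> B k"
  shows "\<exists>r::nat\<Rightarrow>nat. strict_mono r \<and> (\<forall>k. convergent (\<lambda>n. X k (r n)))"
proof -
  interpret subseqs "\<lambda>k r. convergent (\<lambda>n. X k (r n))"
  proof
    fix k and s :: "nat \<Rightarrow> nat"
    have "bounded (range (\<lambda>n. X k (s n)))"
      unfolding bounded_iff using assms by auto
    then obtain l r where "strict_mono r" "((\<lambda>n. X k (s n)) \<circ> r) \<longlonglongrightarrow> l"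
      using bounded_imp_convergent_subsequence by blast
    then show "\<exists>r'. strict_mono r' \<and> convergent (\<lambda>n. X k ((s \<circ> r') n))"
      by (auto simp: o_def convergent_def)
  qed
  have "convergent (\<lambda>n. X k (diagseq n))" for k
  proof -
    have "convergent (\<lambda>n. X k ((diagseq \<circ> ((+) (Suc k))) n))"
    proof (rule diagseq_holds)
      fix r s :: "nat \<Rightarrow> nat" and n
      assume "strict_mono r" "convergent (\<lambda>m. X n (s m))"
      then show "convergent (\<lambda>m. X n ((s \<circ> r) m))"
        using convergent_subseq_convergent[of "\<lambda>m. X n (s m)" r] by (simp add: o_def)
    qed
    then have "convergent (\<lambda>n. X k (diagseq (n + Suc k)))"
      by (simp add: o_def add.commute)
    then show ?thesis
      using convergent_ignore_initial_segment[of "\<lambda>n. X k (diagseq n)" "Suc k"] by blast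
  qed
  then show ?thesis using subseq_diagseq by blast
qed

text \<open>Finite intersections of a countable base, with \<open>UNIV\<close> as the empty
  intersection. Stability under intersection is for Dynkin's theorem; countability lets one diagonal
  subsequence treat the whole generator.\<close>

lemma countable_Int_stable_generator_borel:
  "\<exists>G::'z::second_countable_topology set set. countable G \<and> Int_stable G \<and> UNIV \<in> G \<and>
     sets borel = sigma_sets UNIV G"
proof -
  obtain B :: "'z set set" where B: "countable B" "topological_basis B"
    using ex_countable_basis by blast
  define G where "G = Inter ` {F. finite F \<and> F \<subseteq> B}"
  have 1: "countable G"
    unfolding G_def by (intro countable_image countable_Collect_finite_subset B)
  have 2: "Int_stable G"
  proof (rule Int_stableI)
    fix a b assume "a \<in> G" "b \<in> G"
    then obtain F F' where "finite F" "F \<subseteq> B" "a = \<Inter>F" "finite F'" "F' \<subseteq> B" "b = \<Inter>F'"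
      by (auto simp: G_def)
    then have "a \<inter> b = \<Inter>(F \<union> F')" "finite (F \<union> F')" "F \<union> F' \<subseteq> B" by auto
    then show "a \<inter> b \<in> G" unfolding G_def by blast
  qed
  have 3: "UNIV \<in> G" unfolding G_def by (auto intro!: image_eqI[of _ _ "{}"])
  have borel: "sets (borel::'z measure) = sigma_sets UNIV B"
    using arg_cong[OF borel_eq_countable_basis[OF B], of sets] by (subst (asm) sets_measure_of) auto
  have "B \<subseteq> G" unfolding G_def
    by (auto intro!: image_eqI[of _ _ "{_}"])
  then have le: "sigma_sets UNIV B \<subseteq> sigma_sets UNIV G" by (rule sigma_sets_mono')
  have "\<Inter>F \<in> sets (borel::'z measure)" if "finite F" "F \<subseteq> B" for F
  proof -
    have "open (\<Inter>F)" using that B(2) topological_basis_open by (intro open_Inter) auto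
    then show ?thesis by simp
  qed
  then have "G \<subseteq> sets (borel::'z measure)" unfolding G_def by auto
  then have "sigma_sets UNIV G \<subseteq> sets (borel::'z measure)"
    using sets.sigma_sets_subset[of G borel] by simp
  with le borel 1 2 3 show ?thesis by blast
qed

text \<open>Sequential weak-* compactness for countably many sequences of indicators, with one
  subsequence for all \<open>w\<close>. The diagonal argument gives convergence on a countable
  generator, Dynkin induction spreads it to all Borel sets, and since the limit set function is
  dominated by \<open>\<mu>\<close> it has a Radon-Nikodym density \<open>g w\<close>.\<close>

lemma weak_star_limit_indicators:
  fixes \<mu> :: "'z::second_countable_topology measure" and E :: "nat \<Rightarrow> nat \<Rightarrow> 'z set"
  assumes fin: "finite_measure \<mu>" and sets\<mu>: "sets \<mu> = sets borel"
    and E: "\<And>w n. E w n \<in> sets borel"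
  shows "\<exists>(r::nat\<Rightarrow>nat) g. strict_mono r \<and> (\<forall>w. g w \<in> borel_measurable borel \<and> (\<forall>z. 0 \<le> g w z \<and> g w z \<le> (1::real)) \<and>
     (\<forall>A\<in>sets borel. (\<lambda>n. measure \<mu> (A \<inter> E w (r n))) \<longlonglongrightarrow> (\<integral>z. indicator A z * g w z \<partial>\<mu>)))"
proof -
  interpret finite_measure \<mu> by fact
  have space\<mu>: "space \<mu> = UNIV" using sets_eq_imp_space_eq[OF sets\<mu>] by simp
  obtain G :: "'z set set" where G: "countable G" "Int_stable G" "UNIV \<in> G" "sets borel = sigma_sets UNIV G"
    using countable_Int_stable_generator_borel by blast
  have Gne: "G \<noteq> {}" using G by auto
  define A where "A = from_nat_into G"
  have rA: "range A = G" unfolding A_def using range_from_nat_into[OF Gne G(1)] .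
  define X where "X k n = measure \<mu> (A (snd (prod_decode k)) \<inter> E (fst (prod_decode k)) n)" for k n
  have "\<bar>X k n\<bar> \<le> measure \<mu> UNIV" for k n
    unfolding X_def using bounded_measure space\<mu> by simp
  then obtain r :: "nat \<Rightarrow> nat" where r: "strict_mono r" and conv: "\<And>k. convergent (\<lambda>n. X k (r n))"
    using diagonal_convergent_subsequence[of X "\<lambda>_. measure \<mu> UNIV"] by blast
  have convG: "convergent (\<lambda>n. measure \<mu> (a \<inter> E w (r n)))" if aG: "a \<in> G" for a w
  proof -
    obtain i where "a = A i" using aG unfolding rA[symmetric] by blast
    then show ?thesis using conv[of "prod_encode (w,i)"] by (simp add: X_def)
  qed
  define m where "m w n a = measure \<mu> (a \<inter> E w (r n))" for w n a
  have E': "E w n \<in> sets \<mu>" for w n using E sets\<mu> by simp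
  \<comment> \<open>Tannery's theorem with majorant \<open>measure \<mu> (f i)\<close>. It serves
    both the union case of the Dynkin induction and the countable additivity of the limit.\<close>
  have lim_union: "(\<lambda>n. m w n (\<Union>i. f i)) \<longlonglongrightarrow> (\<Sum>i. l i) \<and> summable l"
    if d: "disjoint_family f" and f: "range f \<subseteq> sets borel" and l: "\<And>i. (\<lambda>n. m w n (f i)) \<longlonglongrightarrow> l i" for f l w
  proof -
    have fs: "f i \<in> sets \<mu>" for i using f sets\<mu> by auto
    have sm: "(\<lambda>i. measure \<mu> (f i)) sums measure \<mu> (\<Union>i. f i)"
      by (rule finite_measure_UNION) (use fs d in auto)
    have eq: "m w n (\<Union>i. f i) = (\<Sum>i. m w n (f i))" for n
    proof -
      have "(\<lambda>i. measure \<mu> (f i \<inter> E w (r n))) sums measure \<mu> (\<Union>i. f i \<inter> E w (r n))"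
      proof (rule finite_measure_UNION)
        show "disjoint_family (\<lambda>i. f i \<inter> E w (r n))"
          using d unfolding disjoint_family_on_def by blast
      qed (use fs E' in auto)
      moreover have "(\<Union>i. f i \<inter> E w (r n)) = (\<Union>i. f i) \<inter> E w (r n)" by blast
      ultimately show ?thesis unfolding m_def by (simp add: sums_iff)
    qed
    have le: "norm (m w n (f i)) \<le> measure \<mu> (f i)" for i n
      unfolding m_def using fs E' by (auto intro!: finite_measure_mono)
    have "eventually (\<lambda>n. summable (\<lambda>k. norm (m w n (f k)))) sequentially \<and> summable (\<lambda>n. norm (l n)) \<and>
      ((\<lambda>n. suminf (\<lambda>k. m w n (f k))) \<longlongrightarrow> suminf l) sequentially"
      by (rule tannerys_theorem[where M="\<lambda>i. measure \<mu> (f i)"]) (use l le sm in \<open>auto simp: sums_iff intro!: always_eventually\<close>)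
    then show ?thesis unfolding eq using summable_norm_cancel by blast
  qed
  have conv: "convergent (\<lambda>n. m w n a)" if "a \<in> sets borel" for a w
  proof -
    have a: "a \<in> sigma_sets UNIV G" using that G(4) by simp
    have Gp: "G \<subseteq> Pow UNIV" by simp
    from G(2) Gp a show ?thesis
    proof (induction rule: sigma_sets_induct_disjoint)
      case (basic a) then show ?case using convG by (simp add: m_def)
    next
      case empty then show ?case by (simp add: m_def convergent_const)
    next
      case (compl a)
      then have a: "a \<in> sets \<mu>" using G(4) sets\<mu> by simp
      have "m w n (UNIV - a) = m w n UNIV - m w n a" for n
      proof -
        have "(UNIV - a) \<inter> E w (r n) = UNIV \<inter> E w (r n) - a \<inter> E w (r n)" by blast
        then show ?thesis unfolding m_def
          using finite_measure_Diff[of "UNIV \<inter> E w (r n)" "a \<inter> E w (r n)"] a E' by auto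
      qed
      moreover have "convergent (\<lambda>n. m w n UNIV)" using convG[OF G(3)] by (simp add: m_def)
      ultimately show ?case using compl convergent_diff by simp
    next
      case (union f)
      then have "\<And>i. \<exists>l. (\<lambda>n. m w n (f i)) \<longlonglongrightarrow> l" by (auto simp: convergent_def)
      then obtain l where "\<And>i. (\<lambda>n. m w n (f i)) \<longlonglongrightarrow> l i" by metis
      then have "(\<lambda>n. m w n (\<Union>i. f i)) \<longlonglongrightarrow> (\<Sum>i. l i)"
        using lim_union[OF \<open>disjoint_family f\<close> _, of w l] \<open>range f \<subseteq> sigma_sets UNIV G\<close> G(4) by blast
      then show ?case by (rule convergentI)
    qed
  qed
  define N where "N w a = lim (\<lambda>n. m w n a)" for w a
  have N: "(\<lambda>n. m w n a) \<longlonglongrightarrow> N w a" if "a \<in> sets borel" for a w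
    unfolding N_def using conv[OF that] by (simp add: convergent_LIMSEQ_iff)
  have m01: "0 \<le> m w n a" "m w n a \<le> measure \<mu> a" if "a \<in> sets borel" for w n a
    unfolding m_def using that E' sets\<mu> by (auto intro!: finite_measure_mono)
  have N01: "0 \<le> N w a" "N w a \<le> measure \<mu> a" if "a \<in> sets borel" for w a
    using LIMSEQ_le_const[OF N[OF that]] LIMSEQ_le_const2[OF N[OF that]] m01[OF that] by blast+
  have "\<exists>g. g \<in> borel_measurable borel \<and> (\<forall>z. 0 \<le> g z \<and> g z \<le> (1::real)) \<and>
     (\<forall>A\<in>sets borel. N w A = (\<integral>z. indicator A z * g z \<partial>\<mu>))" for w
  proof -
    define \<nu> where "\<nu> = measure_of UNIV (sets borel) (\<lambda>a. ennreal (N w a))"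
    have sets\<nu>: "sets \<nu> = sets borel"
      unfolding \<nu>_def by (metis sets.sigma_sets_eq sets_measure_of space_borel top_greatest Pow_UNIV)
    have em: "emeasure \<nu> a = ennreal (N w a)" if "a \<in> sets borel" for a
      unfolding \<nu>_def
    proof (rule emeasure_measure_of_sigma)
      show "sigma_algebra UNIV (sets (borel::'z measure))"
        using sets.sigma_algebra_axioms[of borel] by simp
      have "N w {} = 0" unfolding N_def m_def by simp
      then show "positive (sets borel) (\<lambda>a. ennreal (N w a))"
        unfolding positive_def by simp
      show "countably_additive (sets borel) (\<lambda>a. ennreal (N w a))"
      proof (rule countably_additiveI)
        fix f :: "nat \<Rightarrow> 'z set" assume f: "range f \<subseteq> sets borel" "disjoint_family f" "(\<Union>i. f i) \<in> sets borel"
        have *: "(\<lambda>n. m w n (\<Union>i. f i)) \<longlonglongrightarrow> (\<Sum>i. N w (f i)) \<and> summable (\<lambda>i. N w (f i))"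
          by (rule lim_union) (use f N in auto)
        then have "N w (\<Union>i. f i) = (\<Sum>i. N w (f i))"
          using N[OF f(3)] LIMSEQ_unique by blast
        moreover have "(\<Sum>i. ennreal (N w (f i))) = ennreal (\<Sum>i. N w (f i))"
          by (rule suminf_ennreal2) (use * N01 f in auto)
        ultimately show "(\<Sum>i. ennreal (N w (f i))) = ennreal (N w (\<Union>i. f i))" by simp
      qed
      show "a \<in> sets borel" by fact
    qed
    have "absolutely_continuous \<mu> \<nu>"
      unfolding absolutely_continuous_def
    proof
      fix a assume "a \<in> null_sets \<mu>"
      then have "a \<in> sets borel" "measure \<mu> a = 0" using sets\<mu> by (auto simp: null_sets_def measure_def)
      then show "a \<in> null_sets \<nu>" using em N01[of a w] sets\<nu> by (auto simp: null_sets_def)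
    qed
    then obtain g where g: "g \<in> borel_measurable \<mu>" "density \<mu> g = \<nu>"
      using Radon_Nikodym sets\<nu> sets\<mu> by metis
    have gb: "g \<in> borel_measurable borel" using g(1) sets\<mu> by (metis measurable_cong_sets)
    have "AE z in \<mu>. g z \<le> 1"
    proof -
      have "emeasure (density \<mu> g) a \<le> emeasure (density \<mu> (\<lambda>_. 1)) a" if "a \<in> sets \<mu>" for a
      proof -
        have a: "a \<in> sets borel" using that sets\<mu> by simp
        have "emeasure \<nu> a \<le> emeasure \<mu> a" 
          using em[OF a] N01[OF a, of w] by (simp add: emeasure_eq_measure)
        then show ?thesis using g that by (simp add: density_1)
      qed
      then show ?thesis
      proof -
        assume le: "\<And>a. a \<in> sets \<mu> \<Longrightarrow> emeasure (density \<mu> g) a \<le> emeasure (density \<mu> (\<lambda>_. 1)) a"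
        \<comment> \<open>On the set where the density exceeds 1, domination of \<open>\<nu>\<close>
          by \<open>\<mu>\<close> forces the excess \<open>g z - 1\<close> to have integral
          0.\<close>
        define B where "B = {z \<in> space \<mu>. g z > 1}"
        have B: "B \<in> sets \<mu>" unfolding B_def using g(1) by measurable
        have "emeasure (density \<mu> g) B \<le> emeasure \<mu> B" using le[OF B] by (simp add: density_1)
        then have "(\<integral>\<^sup>+z. g z * indicator B z \<partial>\<mu>) \<le> (\<integral>\<^sup>+z. indicator B z \<partial>\<mu>)"
          using g(1) B by (simp add: emeasure_density)
        moreover have "(\<integral>\<^sup>+z. indicator B z \<partial>\<mu>) + (\<integral>\<^sup>+z. (g z - 1) * indicator B z \<partial>\<mu>) = (\<integral>\<^sup>+z. g z * indicator B z \<partial>\<mu>)"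
          using g(1) B by (subst nn_integral_add[symmetric])
             (auto simp: B_def indicator_def intro!: nn_integral_cong)
        ultimately have "(\<integral>\<^sup>+z. indicator B z \<partial>\<mu>) + (\<integral>\<^sup>+z. (g z - 1) * indicator B z \<partial>\<mu>) \<le> (\<integral>\<^sup>+z. indicator B z \<partial>\<mu>) + 0" by simp
        moreover have "(\<integral>\<^sup>+z. indicator B z \<partial>\<mu>) \<noteq> \<infinity>" using B by simp
        ultimately have "(\<integral>\<^sup>+z. (g z - 1) * indicator B z \<partial>\<mu>) = 0"
          by (metis add.right_neutral ennreal_add_left_cancel_le le_zero_eq infinity_ennreal_def)
        then have "AE z in \<mu>. (g z - 1) * indicator B z = 0"
          using g(1) B by (subst (asm) nn_integral_0_iff_AE) auto
        then show ?thesis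
          by eventually_elim (auto simp: B_def space\<mu> indicator_def not_less diff_eq_0_iff_ennreal split: if_splits)
      qed
    qed
    \<comment> \<open>Truncation changes the density on a null set and makes the bounds hold at
      every point.\<close>
    define g' where "g' z = enn2real (min (g z) 1)" for z
    have 1: "g' \<in> borel_measurable borel" unfolding g'_def using gb by measurable
    have 2: "0 \<le> g' z \<and> g' z \<le> 1" for z
    proof -
      have "min (g z) 1 \<le> 1" by simp
      then have "enn2real (min (g z) 1) \<le> enn2real 1" by (intro enn2real_mono) auto
      then show ?thesis by (simp add: g'_def)
    qed
    have "N w a = (\<integral>z. indicator a z * g' z \<partial>\<mu>)" if a: "a \<in> sets borel" for a
    proof -
      have "ennreal (N w a) = (\<integral>\<^sup>+z. g z * indicator a z \<partial>\<mu>)"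
        using em[OF a] g a sets\<mu> by (metis emeasure_density)
      also have "\<dots> = (\<integral>\<^sup>+z. ennreal (indicator a z * g' z) \<partial>\<mu>)"
        using \<open>AE z in \<mu>. g z \<le> 1\<close>
      proof (intro nn_integral_cong_AE, eventually_elim)
        fix z assume "g z \<le> 1"
        then have "ennreal (g' z) = g z" unfolding g'_def
          by (metis ennreal_enn2real ennreal_one_less_top le_less_trans min.absorb1)
        then show "g z * indicator a z = ennreal (indicator a z * g' z)" by (auto simp: indicator_def)
      qed
      also have "\<dots> = ennreal (\<integral>z. indicator a z * g' z \<partial>\<mu>)"
      proof (rule nn_integral_eq_integral)
        show "integrable \<mu> (\<lambda>z. indicator a z * g' z)"
          by (rule integrable_const_bound[of _ 1])
             (use 1 2 a sets\<mu> in \<open>auto simp: indicator_def measurable_cong_sets[OF sets\<mu> refl]\<close>)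
      qed (use 2 in \<open>auto simp: indicator_def\<close>)
      finally show ?thesis using N01[OF a] 2
        by (subst (asm) ennreal_inj) (auto intro!: integral_nonneg_AE simp: indicator_def)
    qed
    then show ?thesis using 1 2 by blast
  qed
  then obtain g where "\<And>w. g w \<in> borel_measurable borel \<and> (\<forall>z. 0 \<le> g w z \<and> g w z \<le> (1::real)) \<and>
     (\<forall>A\<in>sets borel. N w A = (\<integral>z. indicator A z * g w z \<partial>\<mu>))" by metis
  then show ?thesis
    using r N unfolding m_def by (intro exI[of _ r] exI[of _ g]) auto
qed

text \<open>Simple functions are dense in L^1, and the approximation error is uniform in
  \<open>n\<close> because the indicators and \<open>g\<close> take values in [0,1].\<close>

lemma weak_star_limit_indicators_L1:
  fixes \<mu> :: "'z::second_countable_topology measure" and E :: "nat \<Rightarrow> 'z set" and g h :: "'z \<Rightarrow> real"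
  assumes fin: "finite_measure \<mu>" and sets\<mu>: "sets \<mu> = sets borel"
    and E: "\<And>n. E n \<in> sets borel"
    and g: "g \<in> borel_measurable borel" "\<And>z. 0 \<le> g z \<and> g z \<le> 1"
    and lim: "\<And>A. A \<in> sets borel \<Longrightarrow> (\<lambda>n. measure \<mu> (A \<inter> E n)) \<longlonglongrightarrow> (\<integral>z. indicator A z * g z \<partial>\<mu>)"
    and h: "integrable \<mu> h"
  shows "(\<lambda>n. \<integral>z. h z * indicator (E n) z \<partial>\<mu>) \<longlonglongrightarrow> (\<integral>z. h z * g z \<partial>\<mu>)"
  using h
proof (induction rule: integrable_induct)
  interpret finite_measure \<mu> by fact
  case (base A c)
  have 1: "(\<integral>z. (indicator A z *\<^sub>R c) * indicator (E n) z \<partial>\<mu>) = c * measure \<mu> (A \<inter> E n)" for n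
  proof -
    have "(\<lambda>z. (indicator A z *\<^sub>R c) * indicator (E n) z) = (\<lambda>z. c * indicator (A \<inter> E n) z)"
      by (auto simp: indicator_def fun_eq_iff)
    then show ?thesis using base E sets\<mu> by simp
  qed
  have 2: "(\<integral>z. (indicator A z *\<^sub>R c) * g z \<partial>\<mu>) = c * (\<integral>z. indicator A z * g z \<partial>\<mu>)"
    by (subst integral_mult_right_zero[symmetric]) (simp add: mult_ac)
  show ?case unfolding 1 2 using base sets\<mu> by (intro tendsto_intros lim) auto
next
  have g\<mu>: "g \<in> borel_measurable \<mu>" using g(1) sets\<mu> by (metis measurable_cong_sets)
  have E\<mu>[measurable]: "E n \<in> sets \<mu>" for n using E sets\<mu> by simp
  have ig: "integrable \<mu> (\<lambda>z. f z * g z)" if "integrable \<mu> f" for f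
    by (rule Bochner_Integration.integrable_bound[OF that])
       (use that g\<mu> g(2) in \<open>auto simp: abs_mult mult_left_le\<close>)
  have ie: "integrable \<mu> (\<lambda>z. f z * indicator (E n) z)" if "integrable \<mu> f" for f::"'z \<Rightarrow> real" and n
    by (rule Bochner_Integration.integrable_bound[OF that])
       (use that in \<open>auto simp: indicator_def\<close>)
  {
    case (add f1 f2)
    show ?case using tendsto_add[OF add(3,4)] by (simp add: distrib_right ig ie add)
  next
    case (lim f s)
    have "(\<lambda>i. \<integral>z. \<bar>s i z - f z\<bar> \<partial>\<mu>) \<longlonglongrightarrow> (\<integral>z. 0 \<partial>\<mu>)"
    proof (rule integral_dominated_convergence[where w="\<lambda>z. 3 * \<bar>f z\<bar>"])
      show "AE z in \<mu>. (\<lambda>i. \<bar>s i z - f z\<bar>) \<longlonglongrightarrow> 0"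
        using lim(2) by (intro AE_I2) (simp add: tendsto_rabs_zero_iff LIM_zero)
      show "AE z in \<mu>. norm \<bar>s i z - f z\<bar> \<le> 3 * \<bar>f z\<bar>" for i
      proof (rule AE_I2)
        fix z assume "z \<in> space \<mu>"
        from lim(3)[OF this, of i] show "norm \<bar>s i z - f z\<bar> \<le> 3 * \<bar>f z\<bar>" by simp
      qed
    qed (use lim in auto)
    then have s0: "(\<lambda>i. \<integral>z. \<bar>s i z - f z\<bar> \<partial>\<mu>) \<longlonglongrightarrow> 0" by simp
    show ?case
    proof (rule LIMSEQ_I)
      fix e :: real assume "e > 0"
      then obtain i where i: "(\<integral>z. \<bar>s i z - f z\<bar> \<partial>\<mu>) < e / 3"
        using LIMSEQ_D[OF s0, of "e/3"] by (auto simp: abs_less_iff)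
      obtain n0 where n0: "\<And>n. n \<ge> n0 \<Longrightarrow> \<bar>(\<integral>z. s i z * indicator (E n) z \<partial>\<mu>) - (\<integral>z. s i z * g z \<partial>\<mu>)\<bar> < e/3"
        using LIMSEQ_D[OF lim(5)[of i], of "e/3"] \<open>e > 0\<close> by auto
      have isf: "integrable \<mu> (\<lambda>z. \<bar>s i z - f z\<bar>)" using lim by auto
      \<comment> \<open>Stated for any multiplier \<open>k\<close> with values in [0,1]: it is
        applied to the indicator of \<open>E n\<close> and to \<open>g\<close>.\<close>
      have b: "\<bar>(\<integral>z. s i z * k z \<partial>\<mu>) - (\<integral>z. f z * k z \<partial>\<mu>)\<bar> \<le> (\<integral>z. \<bar>s i z - f z\<bar> \<partial>\<mu>)"
        if k: "integrable \<mu> (\<lambda>z. s i z * k z)" "integrable \<mu> (\<lambda>z. f z * k z)" "\<And>z. 0 \<le> k z \<and> k z \<le> 1" for k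
      proof -
        have "\<bar>(\<integral>z. s i z * k z \<partial>\<mu>) - (\<integral>z. f z * k z \<partial>\<mu>)\<bar> = \<bar>\<integral>z. s i z * k z - f z * k z \<partial>\<mu>\<bar>"
          using k by simp
        also have "\<dots> \<le> (\<integral>z. \<bar>s i z * k z - f z * k z\<bar> \<partial>\<mu>)" by (rule integral_abs_bound)
        also have "\<dots> \<le> (\<integral>z. \<bar>s i z - f z\<bar> \<partial>\<mu>)"
        proof (rule integral_mono)
          fix z
          have "\<bar>s i z * k z - f z * k z\<bar> = \<bar>s i z - f z\<bar> * k z"
            using k(3)[of z] by (simp add: left_diff_distrib[symmetric] abs_mult)
          also have "\<dots> \<le> \<bar>s i z - f z\<bar>" using k(3)[of z] by (simp add: mult_left_le)
          finally show "\<bar>s i z * k z - f z * k z\<bar> \<le> \<bar>s i z - f z\<bar>" .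
        qed (use k isf in auto)
        finally show ?thesis .
      qed
      show "\<exists>no. \<forall>n\<ge>no. norm ((\<integral>z. f z * indicator (E n) z \<partial>\<mu>) - (\<integral>z. f z * g z \<partial>\<mu>)) < e"
      proof (intro exI allI impI)
        fix n assume "n \<ge> n0"
        have "\<bar>(\<integral>z. s i z * indicator (E n) z \<partial>\<mu>) - (\<integral>z. f z * indicator (E n) z \<partial>\<mu>)\<bar> < e/3"
          by (rule le_less_trans[OF b i]) (use lim ie in \<open>auto simp: indicator_def\<close>)
        moreover have "\<bar>(\<integral>z. s i z * g z \<partial>\<mu>) - (\<integral>z. f z * g z \<partial>\<mu>)\<bar> < e/3"
          by (rule le_less_trans[OF b i]) (use lim ig g in auto)
        ultimately show "norm ((\<integral>z. f z * indicator (E n) z \<partial>\<mu>) - (\<integral>z. f z * g z \<partial>\<mu>)) < e"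
          using n0[OF \<open>n \<ge> n0\<close>] unfolding real_norm_def by linarith
      qed
    qed
  }
qed

section \<open>Measures from binary trees of probabilities\<close>

text \<open>Left endpoint of the interval of length \<open>p w\<close> that belongs to the word
  \<open>w\<close>. Each bit \<open>True\<close> skips the mass of its \<open>False\<close> sibling,
  so for additive \<open>p\<close> this is the total mass of the words of the same length that
  precede \<open>w\<close> lexicographically.\<close>

definition lft :: "(bool list \<Rightarrow> real) \<Rightarrow> bool list \<Rightarrow> real" where
  "lft p w = (\<Sum>i<length w. if w ! i then p (take i w @ [False]) else 0)"

text \<open>Follows the point \<open>s\<close> down the successive splittings of [0,1): the bit is
  \<open>True\<close> when \<open>s\<close> lies beyond the mass of the left child.\<close>

primrec branch :: "(bool list \<Rightarrow> real) \<Rightarrow> real \<Rightarrow> nat \<Rightarrow> bool list" where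
  "branch p s 0 = []"
| "branch p s (Suc n) = branch p s n @ [lft p (branch p s n) + p (branch p s n @ [False]) \<le> s]"

lemma lft_Nil: "lft p [] = 0" by (simp add: lft_def)

lemma lft_snoc: "lft p (w @ [b]) = lft p w + (if b then p (w @ [False]) else 0)"
proof -
  have "(\<Sum>i<length w. if (w @ [b]) ! i then p (take i (w @ [b]) @ [False]) else 0) = lft p w"
    unfolding lft_def by (intro sum.cong) (auto simp: nth_append)
  then show ?thesis by (simp add: lft_def)
qed

lemma length_branch: "length (branch p s n) = n" by (induction n) auto

lemma lft_bounds:
  assumes "\<And>w. 0 \<le> p w" "\<And>w. p w = p (w @ [False]) + p (w @ [True])" "p [] = 1"
  shows "0 \<le> lft p w \<and> lft p w + p w \<le> 1"
proof (induction w rule: rev_induct)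
  case Nil then show ?case using assms(3) by (simp add: lft_Nil)
next
  case (snoc b w)
  then show ?case using assms(1)[of "w @ [False]"] assms(1)[of "w @ [True]"] assms(2)[of w]
    by (cases b) (auto simp: lft_snoc)
qed

text \<open>The half-open intervals of the words of length \<open>n\<close> partition [0,1). A word
  of probability 0 has an empty interval and is never reached, which later keeps the branch away
  from empty cells.\<close>

lemma branch_iff:
  assumes p: "\<And>w. 0 \<le> p w" "\<And>w. p w = p (w @ [False]) + p (w @ [True])" "p [] = 1"
    and s: "0 \<le> s" "s < 1"
  shows "branch p s n = w \<longleftrightarrow> length w = n \<and> lft p w \<le> s \<and> s < lft p w + p w"
proof (induction n arbitrary: w)
  case 0 then show ?case using s p(3) by (auto simp: lft_Nil)
next
  case (Suc n)
  show ?case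
  proof (cases w rule: rev_cases)
    case Nil then show ?thesis by simp
  next
    case (snoc w' b)
    show ?thesis
      using Suc[of w'] p(1)[of "w' @ [False]"] p(1)[of "w' @ [True]"] p(2)[of w']
      by (cases b) (auto simp: snoc lft_snoc)
  qed
qed

lemma finite_words: "finite {w::bool list. length w = n}"
  using finite_lists_length_eq[of "UNIV::bool set" n] by simp

text \<open>Writes a function of the random branch as a finite combination of indicators of
  intervals. This form shows measurability in \<open>s\<close> and allows the expectation to be
  computed.\<close>

lemma branch_select:
  fixes g :: "bool list \<Rightarrow> 'b::real_vector"
  assumes p: "\<And>w. 0 \<le> p w" "\<And>w. p w = p (w @ [False]) + p (w @ [True])" "p [] = 1"
    and s: "0 \<le> s" "s < 1"
  shows "(\<Sum>w | length w = n. indicator {lft p w ..< lft p w + p w} s *\<^sub>R g w) = g (branch p s n)"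
proof -
  have "(\<Sum>w | length w = n. indicator {lft p w ..< lft p w + p w} s *\<^sub>R g w)
      = (\<Sum>w | length w = n. if w = branch p s n then g w else 0)"
  proof (intro sum.cong refl)
    fix w assume "w \<in> {w::bool list. length w = n}"
    then have "s \<in> {lft p w ..< lft p w + p w} \<longleftrightarrow> w = branch p s n"
      using branch_iff[OF p s, of n w] by auto
    then show "indicator {lft p w ..< lft p w + p w} s *\<^sub>R g w = (if w = branch p s n then g w else 0)" by auto
  qed
  then show ?thesis using finite_words length_branch by simp
qed

text \<open>The random branch of the tree with branch probabilities \<open>p\<close> is realised on \<open>[0,1)\<close> by
  successively splitting intervals; its cells shrink to a random point, whose law is the measure.\<close>

lemma measure_from_tree:
  fixes p :: "bool list \<Rightarrow> real" and c :: "bool list \<Rightarrow> 'a::euclidean_space set"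
  assumes p: "\<And>w. 0 \<le> p w" "\<And>w. p w = p (w @ [False]) + p (w @ [True])" "p [] = 1"
    and emp: "\<And>w. c w = {} \<Longrightarrow> p w = 0"
    and nested: "\<And>w b. c (w @ [b]) \<subseteq> c w"
    and small: "\<And>e. e > 0 \<Longrightarrow> \<exists>N. \<forall>w. length w \<ge> N \<longrightarrow> (\<forall>x\<in>c w. \<forall>y\<in>c w. dist x y < e)"
    and Z: "c [] \<subseteq> Z" "compact Z"
  shows "\<exists>P. prob_space P \<and> sets P = sets borel \<and> (AE x in P. x \<in> Z) \<and>
     (\<forall>f::'a \<Rightarrow> real. continuous_on UNIV f \<longrightarrow>
        (\<lambda>n. \<Sum>w | length w = n. f (SOME v. v \<in> c w) * p w) \<longlonglongrightarrow> (\<integral>x. f x \<partial>P))"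
proof -
  define y where "y w = (SOME v. v \<in> c w)" for w
  have y: "y w \<in> c w" if "c w \<noteq> {}" for w unfolding y_def using that some_in_eq by blast
  define I where "I w = {lft p w ..< lft p w + p w}" for w
  define Y where "Y n s = (\<Sum>w | length w = n. indicator (I w) s *\<^sub>R y w)" for n s
  have sel: "(\<Sum>w | length w = n. indicator (I w) s *\<^sub>R y w) = y (branch p s n)"
    "(\<Sum>w | length w = n. indicator (I w) s *\<^sub>R f (y w)) = f (y (branch p s n))"
    if s: "0 \<le> s" "s < 1" for n s and f :: "'a \<Rightarrow> real"
    unfolding I_def by (rule branch_select[OF p s])+
  have Yp: "Y n s = y (branch p s n)" if "0 \<le> s" "s < 1" for n s
    unfolding Y_def by (rule sel(1)[OF that])
  \<comment> \<open>\<open>s\<close> lies in the interval of its word, so that interval has positive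
    length and \<open>emp\<close> excludes an empty cell.\<close>
  have ne: "c (branch p s n) \<noteq> {}" if s: "0 \<le> s" "s < 1" for n s
  proof
    assume "c (branch p s n) = {}"
    then have "p (branch p s n) = 0" by (rule emp)
    moreover have "s < lft p (branch p s n) + p (branch p s n)" "lft p (branch p s n) \<le> s"
      using branch_iff[OF p s, of n "branch p s n"] by blast+
    ultimately show False by linarith
  qed
  have mono: "c (branch p s (n + k)) \<subseteq> c (branch p s n)" for n k s
  proof (induction k)
    case (Suc k)
    have "c (branch p s (n + Suc k)) \<subseteq> c (branch p s (n + k))" using nested by simp
    then show ?case using Suc by (rule order_trans)
  qed simp
  have YZ: "Y n s \<in> Z" if s: "0 \<le> s" "s < 1" for n s
    using Yp[OF s] y[OF ne[OF s]] mono[of s 0 n] Z(1) by auto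
  define X where "X s = lim (\<lambda>n. Y n s)" for s
  have conv: "(\<lambda>n. Y n s) \<longlonglongrightarrow> X s" if s: "0 \<le> s" "s < 1" for s
  proof -
    have "Cauchy (\<lambda>n. Y n s)"
    proof (rule metric_CauchyI)
      fix e :: real assume "e > 0"
      then obtain N where N: "\<And>w. length w \<ge> N \<Longrightarrow> (\<forall>x\<in>c w. \<forall>y\<in>c w. dist x y < e)" using small by blast
      have "Y n s \<in> c (branch p s N)" if "n \<ge> N" for n
        using Yp[OF s] y[OF ne[OF s], of n] mono[of s N "n - N"] that by auto
      then show "\<exists>M. \<forall>m\<ge>M. \<forall>n\<ge>M. dist (Y m s) (Y n s) < e"
        using N[of "branch p s N"] by (intro exI[of _ N]) (auto simp: length_branch)
    qed
    then show ?thesis unfolding X_def using Cauchy_convergent_iff convergent_LIMSEQ_iff by blast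
  qed
  have Ym[measurable]: "Y n \<in> borel_measurable borel" for n
    unfolding Y_def I_def by measurable
  have Xm[measurable]: "X \<in> borel_measurable borel"
    unfolding X_def by measurable
  \<comment> \<open>The uniform distribution on [0,1), which is the probability space carrying the
    random branch.\<close>
  define m where "m = density lborel (indicator {0..<1::real})"
  have sm: "sets m = sets borel" "space m = UNIV" by (simp_all add: m_def)
  have em: "emeasure m A = emeasure lborel (A \<inter> {0..<1})" if "A \<in> sets borel" for A
    unfolding m_def using that emeasure_restricted[of "{0..<1::real}" lborel A] by (simp add: Int_commute)
  interpret m: prob_space m
    by (rule prob_spaceI) (use em[of UNIV] in \<open>simp add: sm\<close>)
  have ae: "AE s in m. 0 \<le> s \<and> s < 1"
    unfolding m_def by (subst AE_density) (auto simp: indicator_def)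
  have Xm': "X \<in> measurable m borel" using Xm sm by (metis measurable_cong_sets)
  define P where "P = distr m borel X"
  have 1: "prob_space P" unfolding P_def by (rule m.prob_space_distr[OF Xm'])
  have XZ: "X s \<in> Z" if s: "0 \<le> s" "s < 1" for s
    using closed_sequentially[OF compact_imp_closed[OF Z(2)] _ conv[OF s]] YZ[OF s] by blast
  have Zb: "Z \<in> sets borel" using compact_imp_closed[OF Z(2)] by (rule borel_closed)
  have 2: "AE x in P. x \<in> Z"
    unfolding P_def using Zb ae XZ by (subst AE_distr_iff[OF Xm']) auto
  have 3: "(\<lambda>n. \<Sum>w | length w = n. f (y w) * p w) \<longlonglongrightarrow> (\<integral>x. f x \<partial>P)" if f: "continuous_on UNIV f" for f :: "'a \<Rightarrow> real"
  proof -
    have fm[measurable]: "f \<in> borel_measurable borel" using f by (rule borel_measurable_continuous_onI)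
    have "compact (f ` Z)" by (rule compact_continuous_image[OF continuous_on_subset[OF f] Z(2)]) simp
    then obtain B where B: "\<And>x. x \<in> Z \<Longrightarrow> \<bar>f x\<bar> \<le> B"
      using compact_imp_bounded bounded_iff by (metis image_eqI real_norm_def)
    have "(\<integral>x. f x \<partial>P) = (\<integral>s. f (X s) \<partial>m)"
      unfolding P_def by (rule integral_distr[OF Xm' fm])
    moreover have "(\<lambda>n. \<integral>s. f (Y n s) \<partial>m) \<longlonglongrightarrow> (\<integral>s. f (X s) \<partial>m)"
    proof (rule integral_dominated_convergence[where w="\<lambda>_. B"])
      show "AE s in m. (\<lambda>n. f (Y n s)) \<longlonglongrightarrow> f (X s)" using ae
      proof eventually_elim
        case (elim s)
        then show ?case using continuous_on_tendsto_compose[OF f conv[of s]] by simp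
      qed
      show "AE s in m. norm (f (Y n s)) \<le> B" for n using ae by eventually_elim (use YZ B in auto)
    qed (auto simp: measurable_cong_sets[OF sm(1) refl])
    moreover have "(\<integral>s. f (Y n s) \<partial>m) = (\<Sum>w | length w = n. f (y w) * p w)" for n
    proof -
      have "(\<integral>s. f (Y n s) \<partial>m) = (\<integral>s. (\<Sum>w | length w = n. indicator (I w) s *\<^sub>R f (y w)) \<partial>m)"
      proof (rule integral_cong_AE)
        show "AE s in m. f (Y n s) = (\<Sum>w | length w = n. indicator (I w) s *\<^sub>R f (y w))" using ae
        proof eventually_elim
          case (elim s)
          then show ?case using sel(2)[where f=f and s=s and n=n] Yp[of s n] by (simp only:)
        qed
      qed (auto simp: measurable_cong_sets[OF sm(1) refl] I_def)
      also have "\<dots> = (\<Sum>w | length w = n. measure m (I w) * f (y w))"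
        by (subst Bochner_Integration.integral_sum) (auto simp: sm I_def less_top[symmetric])
      also have "\<dots> = (\<Sum>w | length w = n. f (y w) * p w)"
      proof (intro sum.cong refl)
        fix w
        have "I w \<inter> {0..<1} = I w" using lft_bounds[OF p, of w] by (auto simp: I_def)
        then have "emeasure m (I w) = ennreal (p w)" using p(1)[of w] em[of "I w"] by (simp add: I_def)
        then show "measure m (I w) * f (y w) = f (y w) * p w" using p(1)[of w] by (simp add: measure_def)
      qed
      finally show ?thesis .
    qed
    ultimately show ?thesis by simp
  qed
  have 4: "sets P = sets borel" by (simp add: P_def)
  show ?thesis using 1 2 3 4 unfolding y_def by blast
qed

text \<open>Compactness covers \<open>Z\<close> by finitely many basis sets, each inside a ball of
  radius \<open>e/2\<close>. A point that shares the membership pattern of \<open>x\<close> on these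
  sets lies in the same small set as \<open>x\<close>.\<close>

lemma basis_cells_shrink:
  fixes B :: "nat \<Rightarrow> 'a::metric_space set"
  assumes B: "topological_basis (range B)" and Z: "compact Z" and e: "e > 0"
  shows "\<exists>N. \<forall>x\<in>Z. \<forall>y. (\<forall>i<N. x \<in> B i \<longleftrightarrow> y \<in> B i) \<longrightarrow> dist x y < e"
proof -
  define J where "J = {i. \<exists>v. B i \<subseteq> ball v (e/2)}"
  have "Z \<subseteq> (\<Union>i\<in>J. B i)"
  proof
    fix x
    obtain b where "b \<in> range B" "x \<in> b" "b \<subseteq> ball x (e/2)"
      using topological_basisE[OF B, of "ball x (e/2)" x] e by auto
    then show "x \<in> (\<Union>i\<in>J. B i)" by (auto simp: J_def)
  qed
  moreover have "open (B i)" for i using topological_basis_open[OF B] by blast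
  ultimately obtain J' where J': "J' \<subseteq> J" "finite J'" "Z \<subseteq> (\<Union>i\<in>J'. B i)"
    by (metis compactE_image[OF Z, of J B])
  show ?thesis
  proof (intro exI[of _ "Suc (Max (insert 0 J'))"] ballI allI impI)
    fix x y assume x: "x \<in> Z" and eq: "\<forall>i<Suc (Max (insert 0 J')). x \<in> B i \<longleftrightarrow> y \<in> B i"
    then obtain i where i: "i \<in> J'" "x \<in> B i" using J' by blast
    have "i \<le> Max (insert 0 J')" using i J' by (intro Max_ge) auto
    then have "y \<in> B i" using eq i by auto
    moreover obtain v where "B i \<subseteq> ball v (e/2)" using i J' by (auto simp: J_def)
    ultimately have "dist v x < e/2" "dist v y < e/2" using i by auto
    then show "dist x y < e" by (metis dist_commute dist_triangle_half_r)
  qed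
qed

text \<open>The weak-* limits of the indicators of {v_n in cell}, over a countable tree of cells,
  are at almost every \<open>z\<close> the consistent branch probabilities of a measure on the ball,
  which \<open>measure_from_tree\<close> produces. Uniform continuity on the ball reduces a
  continuous \<open>f\<close> to finite sums over the cells of one level.\<close>

theorem young_measure_exists:
  fixes \<mu> :: "'z::second_countable_topology measure" and v :: "nat \<Rightarrow> 'z \<Rightarrow> 'a::euclidean_space"
  assumes fin: "finite_measure \<mu>" and sets\<mu>: "sets \<mu> = sets borel"
    and v[measurable]: "\<And>n. v n \<in> borel_measurable borel" and vB: "\<And>n z. norm (v n z) \<le> B"
  shows "\<exists>(r::nat\<Rightarrow>nat) P. strict_mono r \<and> (\<forall>z. prob_space (P z) \<and> sets (P z) = sets borel \<and> (AE x in P z. norm x \<le> B)) \<and>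
     (\<forall>f::'a \<Rightarrow> real. continuous_on UNIV f \<longrightarrow> (\<lambda>z. \<integral>x. f x \<partial>(P z)) \<in> borel_measurable borel \<and>
       (\<forall>h. integrable \<mu> h \<longrightarrow> (\<lambda>n. \<integral>z. h z * f (v (r n) z) \<partial>\<mu>) \<longlonglongrightarrow> (\<integral>z. h z * (\<integral>x. f x \<partial>(P z)) \<partial>\<mu>)))"
proof -
  interpret finite_measure \<mu> by fact
  have space\<mu>: "space \<mu> = UNIV" using sets_eq_imp_space_eq[OF sets\<mu>] by simp
  have B0: "0 \<le> B" using vB[of 0 undefined] norm_ge_zero order_trans by blast
  obtain BB :: "'a set set" where BB: "countable BB" "topological_basis BB"
    using ex_countable_basis by blast
  have BBne: "BB \<noteq> {}" using topological_basisE[OF BB(2), of UNIV undefined] by auto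
  define b where "b = from_nat_into BB"
  have rb: "range b = BB" unfolding b_def using range_from_nat_into[OF BBne BB(1)] .
  have bo: "open (b i)" for i using topological_basis_open[OF BB(2)] rb by blast
  \<comment> \<open>The bits of \<open>w\<close> prescribe membership in the first
    \<open>length w\<close> basis sets. Cells of one level partition the ball, and some of them may
    be empty.\<close>
  define c where "c w = {x \<in> cball 0 B. \<forall>i<length w. (x \<in> b i) = w ! i}" for w
  have cm[measurable]: "c w \<in> sets borel" for w
  proof -
    have "c w = cball 0 B \<inter> (\<Inter>i\<in>{..<length w}. if w ! i then b i else - b i)"
      by (auto simp: c_def)
    moreover have "\<dots> \<in> sets borel"
    proof (cases "length w = 0")
      case False
      then show ?thesis using bo by (intro sets.Int sets.finite_INT) auto
    qed simp
    ultimately show ?thesis by simp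
  qed
  have nested: "c (w @ [d]) \<subseteq> c w" for w d
    by (auto simp: c_def nth_append)
  have split: "c w = c (w @ [False]) \<union> c (w @ [True])" "c (w @ [False]) \<inter> c (w @ [True]) = {}" for w
    by (auto simp: c_def nth_append less_Suc_eq)
  have small: "\<exists>N. \<forall>w. length w \<ge> N \<longrightarrow> (\<forall>x\<in>c w. \<forall>y\<in>c w. dist x y < e)" if epos: "e > 0" for e
  proof -
    obtain N where N: "\<And>x y. x \<in> cball 0 B \<Longrightarrow> (\<forall>i<N. x \<in> b i \<longleftrightarrow> y \<in> b i) \<Longrightarrow> dist x y < e"
      using basis_cells_shrink[of b "cball 0 B" e, OF _ compact_cball epos] BB(2) unfolding rb by blast
    show ?thesis
      by (intro exI[of _ N] allI impI ballI N) (auto simp: c_def)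
  qed
  define E where "E k n = v n -` c (from_nat k)" for k n
  have E: "E k n \<in> sets borel" for k n unfolding E_def
    using measurable_sets[OF v cm, of n "from_nat k"] by simp
  obtain r :: "nat \<Rightarrow> nat" and g where rg: "strict_mono r \<and> (\<forall>k. g k \<in> borel_measurable borel \<and>
      (\<forall>z. 0 \<le> g k z \<and> g k z \<le> (1::real)) \<and>
      (\<forall>A\<in>sets borel. (\<lambda>n. measure \<mu> (A \<inter> E k (r n))) \<longlonglongrightarrow> (\<integral>z. indicator A z * g k z \<partial>\<mu>)))"
    using weak_star_limit_indicators[OF fin sets\<mu>, of E, OF E] by (elim exE) blast
  then have r: "strict_mono r" and g: "\<And>k. g k \<in> borel_measurable borel" "\<And>k z. 0 \<le> g k z \<and> g k z \<le> (1::real)"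
    and lim: "\<And>k A. A \<in> sets borel \<Longrightarrow> (\<lambda>n. measure \<mu> (A \<inter> E k (r n))) \<longlonglongrightarrow> (\<integral>z. indicator A z * g k z \<partial>\<mu>)"
    by auto
  define q where "q w = g (to_nat (w::bool list))" for w
  have q[measurable]: "q w \<in> borel_measurable borel" and q01: "0 \<le> q w z \<and> q w z \<le> 1" for w z
    unfolding q_def using g by auto
  have q\<mu>: "q w \<in> borel_measurable \<mu>" for w using q sets\<mu> by (metis measurable_cong_sets)
  have iq: "integrable \<mu> (q w)" for w by (rule integrable_const_bound[of _ 1]) (use q01 q\<mu> in auto)
  have qlim: "(\<lambda>n. measure \<mu> (A \<inter> v (r n) -` c w)) \<longlonglongrightarrow> (\<integral>z. indicator A z * q w z \<partial>\<mu>)" if "A \<in> sets borel" for A w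
    using lim[OF that, of "to_nat w"] by (simp add: E_def q_def)
  have Em: "v n -` c w \<in> sets \<mu>" for n w using measurable_sets[OF v cm, of n w] sets\<mu> by simp
  have ae_eqI: "AE z in \<mu>. f1 z = f2 z" if f: "integrable \<mu> f1" "integrable \<mu> f2"
    and eq: "\<And>A. A \<in> sets borel \<Longrightarrow> (\<integral>z. indicator A z * f1 z \<partial>\<mu>) = (\<integral>z. indicator A z * f2 z \<partial>\<mu>)" for f1 f2 :: "'z \<Rightarrow> real"
  proof (rule density_unique_real[OF f])
    fix A assume "A \<in> sets \<mu>"
    then show "set_lebesgue_integral \<mu> A f1 = set_lebesgue_integral \<mu> A f2"
      using eq[of A] sets\<mu> by (simp add: set_lebesgue_integral_def)
  qed
  have ae1: "AE z in \<mu>. q [] z = 1"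
  proof (rule ae_eqI)
    fix A :: "'z set" assume A: "A \<in> sets borel"
    have "A \<inter> v (r n) -` c [] = A" for n using vB by (auto simp: c_def)
    then have "(\<lambda>n. measure \<mu> A) \<longlonglongrightarrow> (\<integral>z. indicator A z * q [] z \<partial>\<mu>)" using qlim[OF A, of "[]"] by simp
    then have "measure \<mu> A = (\<integral>z. indicator A z * q [] z \<partial>\<mu>)"
      using LIMSEQ_unique[OF tendsto_const] by blast
    then show "(\<integral>z. indicator A z * q [] z \<partial>\<mu>) = (\<integral>z. indicator A z * 1 \<partial>\<mu>)"
      using A sets\<mu> by simp
  qed (use iq in auto)
  have iiq: "integrable \<mu> (\<lambda>z. indicator A z * q w z)" if "A \<in> sets borel" for A w
    by (rule integrable_const_bound[of _ 1]) (use q01 q\<mu> that sets\<mu> in \<open>auto simp: indicator_def\<close>)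
  have ae2: "AE z in \<mu>. q w z = q (w @ [False]) z + q (w @ [True]) z" for w
  proof (rule ae_eqI)
    fix A :: "'z set" assume A: "A \<in> sets borel"
    have "measure \<mu> (A \<inter> v (r n) -` c w) = measure \<mu> (A \<inter> v (r n) -` c (w @ [False])) + measure \<mu> (A \<inter> v (r n) -` c (w @ [True]))" for n
    proof -
      have "A \<inter> v (r n) -` c w = (A \<inter> v (r n) -` c (w @ [False])) \<union> (A \<inter> v (r n) -` c (w @ [True]))"
        using split(1)[of w] by auto
      moreover have "(A \<inter> v (r n) -` c (w @ [False])) \<inter> (A \<inter> v (r n) -` c (w @ [True])) = {}"
        using split(2)[of w] by auto
      ultimately show ?thesis using Em A sets\<mu> by (metis finite_measure_Union sets.Int)
    qed
    then have "(\<lambda>n. measure \<mu> (A \<inter> v (r n) -` c w)) \<longlonglongrightarrow> (\<integral>z. indicator A z * q (w @ [False]) z \<partial>\<mu>) + (\<integral>z. indicator A z * q (w @ [True]) z \<partial>\<mu>)"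
      using tendsto_add[OF qlim[OF A, of "w @ [False]"] qlim[OF A, of "w @ [True]"]] by simp
    then have "(\<integral>z. indicator A z * q w z \<partial>\<mu>) = (\<integral>z. indicator A z * q (w @ [False]) z \<partial>\<mu>) + (\<integral>z. indicator A z * q (w @ [True]) z \<partial>\<mu>)"
      using LIMSEQ_unique[OF qlim[OF A, of w]] by blast
    then show "(\<integral>z. indicator A z * q w z \<partial>\<mu>) = (\<integral>z. indicator A z * (q (w @ [False]) z + q (w @ [True]) z) \<partial>\<mu>)"
      using iiq[OF A] by (simp add: distrib_left)
  qed (use iq in auto)
  have ae3: "AE z in \<mu>. c w = {} \<longrightarrow> q w z = 0" for w
  proof (cases "c w = {}")
    case True
    have "AE z in \<mu>. q w z = 0"
    proof (rule ae_eqI)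
      fix A :: "'z set" assume A: "A \<in> sets borel"
      have "(\<lambda>n. 0) \<longlonglongrightarrow> (\<integral>z. indicator A z * q w z \<partial>\<mu>)" using qlim[OF A, of w] True by simp
      then show "(\<integral>z. indicator A z * q w z \<partial>\<mu>) = (\<integral>z. indicator A z * 0 \<partial>\<mu>)"
        using LIMSEQ_unique[OF tendsto_const] by fastforce
    qed (use iq in auto)
    then show ?thesis by auto
  qed simp
  \<comment> \<open>The tree identities are countably many and each holds almost everywhere, so
    almost every point satisfies all of them.\<close>
  define Gd where "Gd = {z. q [] z = 1 \<and> (\<forall>w. q w z = q (w @ [False]) z + q (w @ [True]) z) \<and> (\<forall>w. c w = {} \<longrightarrow> q w z = 0)}"
  have Gdm[measurable]: "Gd \<in> sets borel"
  proof -
    have "Gd = {z \<in> space borel. q [] z = 1 \<and> (\<forall>w. q w z = q (w @ [False]) z + q (w @ [True]) z) \<and> (\<forall>w. c w = {} \<longrightarrow> q w z = 0)}"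
      by (simp add: Gd_def)
    also have "\<dots> \<in> sets borel" by measurable
    finally show ?thesis .
  qed
  have aeGd: "AE z in \<mu>. z \<in> Gd"
    using ae1 ae2 ae3 unfolding Gd_def by (simp add: AE_all_countable)
  \<comment> \<open>Off \<open>Gd\<close> the probabilities are those of the Dirac mass at 0. The
    tree identities then hold at every \<open>z\<close>, so that \<open>P z\<close> exists
    everywhere and depends measurably on \<open>z\<close>.\<close>
  define p where "p z w = (if z \<in> Gd then q w z else indicator (c w) 0)" for z w
  have pm[measurable]: "(\<lambda>z. p z w) \<in> borel_measurable borel" for w unfolding p_def by measurable
  have p: "0 \<le> p z w" "p z w \<le> 1" "p z w = p z (w @ [False]) + p z (w @ [True])" "p z [] = 1" "c w = {} \<Longrightarrow> p z w = 0" for z w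
  proof -
    have i: "indicator (c w) (0::'a) = (indicator (c (w @ [False])) 0 :: real) + indicator (c (w @ [True])) 0"
      using split[of w] by (auto simp: indicator_def)
    have c0: "(0::'a) \<in> c []" using B0 by (simp add: c_def)
    have G: "q [] z = 1" "q w z = q (w @ [False]) z + q (w @ [True]) z" "c w = {} \<Longrightarrow> q w z = 0" if "z \<in> Gd"
      using that unfolding Gd_def by blast+
    show "0 \<le> p z w" "p z w \<le> 1" using q01 by (auto simp: p_def indicator_def)
    show "p z w = p z (w @ [False]) + p z (w @ [True])"
      unfolding p_def using G(2) i by (cases "z \<in> Gd") (simp_all only: if_True if_False)
    show "p z [] = 1" unfolding p_def using G(1) c0 by simp
    show "c w = {} \<Longrightarrow> p z w = 0" unfolding p_def using G(3) by simp
  qed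
  define y where "y w = (SOME x. x \<in> c w)" for w
  have ex: "\<exists>P. prob_space P \<and> sets P = sets borel \<and> (AE x in P. x \<in> cball 0 B) \<and>
     (\<forall>f::'a \<Rightarrow> real. continuous_on UNIV f \<longrightarrow>
        (\<lambda>n. \<Sum>w | length w = n. f (y w) * p z w) \<longlonglongrightarrow> (\<integral>x. f x \<partial>P))" for z
    unfolding y_def
  proof (rule measure_from_tree[OF p(1) p(3) p(4) p(5) nested small])
    show "c [] \<subseteq> cball 0 B" by (auto simp: c_def)
  qed auto
  then have "\<forall>z. \<exists>P. prob_space P \<and> sets P = sets borel \<and> (AE x in P. x \<in> cball 0 B) \<and>
     (\<forall>f::'a \<Rightarrow> real. continuous_on UNIV f \<longrightarrow>
        (\<lambda>n. \<Sum>w | length w = n. f (y w) * p z w) \<longlonglongrightarrow> (\<integral>x. f x \<partial>P))" by (rule allI)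
  from choice[OF this]
  obtain P where PP: "\<forall>z. prob_space (P z) \<and> sets (P z) = sets borel \<and> (AE x in P z. x \<in> cball 0 B) \<and>
     (\<forall>f::'a \<Rightarrow> real. continuous_on UNIV f \<longrightarrow>
        (\<lambda>n. \<Sum>w | length w = n. f (y w) * p z w) \<longlonglongrightarrow> (\<integral>x. f x \<partial>(P z)))"
    by (elim exE) (rule that)
  have P: "\<And>z. prob_space (P z)" "\<And>z. sets (P z) = sets borel" "\<And>z. AE x in P z. x \<in> cball 0 B"
     and Plim: "\<And>z f. continuous_on UNIV f \<Longrightarrow> (\<lambda>n. \<Sum>w | length w = n. f (y w) * p z w) \<longlonglongrightarrow> (\<integral>x. f x \<partial>(P z))"
    using PP[rule_format] by simp_all
  have meas: "(\<lambda>z. \<integral>x. f x \<partial>(P z)) \<in> borel_measurable borel" if f: "continuous_on UNIV f" for f :: "'a \<Rightarrow> real"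
    by (rule borel_measurable_LIMSEQ_real[OF Plim[OF f]]) measurable
  have conv: "(\<lambda>n. \<integral>z. h z * f (v (r n) z) \<partial>\<mu>) \<longlonglongrightarrow> (\<integral>z. h z * (\<integral>x. f x \<partial>(P z)) \<partial>\<mu>)"
    if f: "continuous_on UNIV f" and h: "integrable \<mu> h" for f :: "'a \<Rightarrow> real" and h :: "'z \<Rightarrow> real"
  proof -
    have fm[measurable]: "f \<in> borel_measurable borel" using f by (rule borel_measurable_continuous_onI)
    have hm[measurable]: "h \<in> borel_measurable borel" using h sets\<mu> by (metis borel_measurable_integrable measurable_cong_sets)
    have uc: "uniformly_continuous_on (cball 0 B) f"
      by (rule compact_uniformly_continuous) (use f continuous_on_subset in auto)
    have osc: "\<exists>N. \<forall>w. length w \<ge> N \<longrightarrow> (\<forall>x\<in>c w. \<forall>y\<in>c w. \<bar>f x - f y\<bar> < e)" if "e > 0" for e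
    proof -
      obtain d where d: "d > 0" "\<And>x y. x \<in> cball 0 B \<Longrightarrow> y \<in> cball 0 B \<Longrightarrow> dist y x < d \<Longrightarrow> dist (f y) (f x) < e"
        using uc \<open>e > 0\<close> unfolding uniformly_continuous_on_def by metis
      obtain N where N: "\<forall>w. length w \<ge> N \<longrightarrow> (\<forall>x\<in>c w. \<forall>y\<in>c w. dist x y < d)" using small[OF d(1)] by blast
      show ?thesis
      proof (intro exI[of _ N] allI impI ballI)
        fix w x y assume "N \<le> length w" "x \<in> c w" "y \<in> c w"
        then have "dist x y < d" "x \<in> cball 0 B" "y \<in> cball 0 B" using N by (auto simp: c_def)
        then show "\<bar>f x - f y\<bar> < e" using d(2)[of y x] by (simp add: dist_real_def)
      qed
    qed
    \<comment> \<open>\<open>F\<close> and \<open>H\<close> replace \<open>f\<close> by its value at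
      the chosen point of each cell of level \<open>n\<close>. They are uniformly close to the
      integral of \<open>f\<close> against \<open>P z\<close> and to \<open>f (v k z)\<close>, while
      at fixed \<open>n\<close> the limit concerns a finite sum.\<close>
    define F where "F n z = (\<Sum>w | length w = n. f (y w) * p z w)" for n z
    define H where "H n k z = (\<Sum>w | length w = n. f (y w) * indicator (v k -` c w) z)" for n k z
    have yc: "y w \<in> c w" if "c w \<noteq> {}" for w unfolding y_def using that some_in_eq by blast
    \<comment> \<open>From level \<open>n\<close> to level \<open>m\<close> mass is redistributed
      only inside cells of level \<open>n\<close>, where \<open>f\<close> oscillates by less than
      \<open>e\<close>.\<close>
    have Fnear: "\<bar>F m z - F n z\<bar> \<le> e" if "n \<le> m" and N: "\<forall>w. length w \<ge> n \<longrightarrow> (\<forall>x\<in>c w. \<forall>y\<in>c w. \<bar>f x - f y\<bar> < e)" and "e > 0" for m n z e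
    proof -
      have words: "{w::bool list. length w = m} = (\<lambda>(a,b). a @ b) ` ({a. length a = n} \<times> {b. length b = m - n})"
      proof (intro equalityI subsetI)
        fix w :: "bool list" assume "w \<in> {w. length w = m}"
        then show "w \<in> (\<lambda>(a,b). a @ b) ` ({a. length a = n} \<times> {b. length b = m - n})"
          using that(1) by (intro image_eqI[of _ _ "(take n w, drop n w)"]) auto
      qed (use that(1) in auto)
      have inj: "inj_on (\<lambda>(a::bool list,b). a @ b) ({a. length a = n} \<times> {b. length b = m - n})"
        by (auto simp: inj_on_def)
      have psum: "(\<Sum>b | length b = k. p z (a @ b)) = p z a" for a k
      proof (induction k arbitrary: a)
        case 0
        have "{b::bool list. length b = 0} = {[]}" by auto
        then show ?case by simp
      next
        case (Suc k)
        have *: "{b::bool list. length b = Suc k} = (#) False ` {b. length b = k} \<union> (#) True ` {b. length b = k}"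
          by (auto simp: length_Suc_conv image_iff)
        have "(\<Sum>b | length b = Suc k. p z (a @ b)) = (\<Sum>b | length b = k. p z ((a @ [False]) @ b)) + (\<Sum>b | length b = k. p z ((a @ [True]) @ b))"
          unfolding * by (subst sum.union_disjoint) (auto simp: finite_words sum.reindex)
        also have "\<dots> = p z a" using p(3)[of z a] by (simp only: Suc)
        finally show ?case .
      qed
      have Fm: "F m z = (\<Sum>a | length a = n. \<Sum>b | length b = m - n. f (y (a @ b)) * p z (a @ b))"
        unfolding F_def words by (subst sum.reindex[OF inj]) (simp add: sum.cartesian_product case_prod_beta)
      have Fn: "F n z = (\<Sum>a | length a = n. \<Sum>b | length b = m - n. f (y a) * p z (a @ b))"
        unfolding F_def by (simp add: sum_distrib_left[symmetric] psum)
      have sub: "c (a @ b) \<subseteq> c a" for a b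
        by (auto simp: c_def nth_append)
      have "\<bar>F m z - F n z\<bar> \<le> (\<Sum>a | length a = n. \<Sum>b | length b = m - n. e * p z (a @ b))"
        unfolding Fm Fn sum_subtractf[symmetric]
      proof (intro order_trans[OF sum_abs] sum_mono)
        fix a b :: "bool list" assume "a \<in> {a. length a = n}"
        show "\<bar>f (y (a @ b)) * p z (a @ b) - f (y a) * p z (a @ b)\<bar> \<le> e * p z (a @ b)"
        proof (cases "c (a @ b) = {}")
          case True then show ?thesis using p(5) by simp
        next
          case False
          then have "y (a @ b) \<in> c a" "y a \<in> c a" using yc sub[of a b] by blast+
          then have "\<bar>f (y (a @ b)) - f (y a)\<bar> \<le> e" using N[rule_format, of a "y (a @ b)" "y a"] \<open>a \<in> _\<close> by simp
          then show ?thesis using p(1)[of z "a @ b"]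
            by (simp add: left_diff_distrib[symmetric] abs_mult mult_right_mono)
        qed
      qed
      also have "\<dots> = e" using psum[where a="[]"]
        by (simp add: sum_distrib_left[symmetric] psum p(4))
      finally show ?thesis .
    qed
    have FP: "\<bar>(\<integral>x. f x \<partial>(P z)) - F n z\<bar> \<le> e" if "\<forall>w. length w \<ge> n \<longrightarrow> (\<forall>x\<in>c w. \<forall>y\<in>c w. \<bar>f x - f y\<bar> < e)" "e > 0" for n z e
    proof (rule LIMSEQ_le_const2)
      show "(\<lambda>m. \<bar>F m z - F n z\<bar>) \<longlonglongrightarrow> \<bar>(\<integral>x. f x \<partial>(P z)) - F n z\<bar>"
        using Plim[OF f, of z] unfolding F_def by (intro tendsto_intros)
      show "\<exists>N. \<forall>m\<ge>N. \<bar>F m z - F n z\<bar> \<le> e" using Fnear that by blast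
    qed
    have HP: "\<bar>f (v k z) - H n k z\<bar> \<le> e" if N: "\<forall>w. length w \<ge> n \<longrightarrow> (\<forall>x\<in>c w. \<forall>y\<in>c w. \<bar>f x - f y\<bar> < e)" "e > 0" for n k z e
    proof -
      define w where "w = map (\<lambda>i. v k z \<in> b i) [0..<n]"
      have w: "length w = n" "v k z \<in> c w" using vB by (auto simp: w_def c_def)
      have "H n k z = (\<Sum>w' | length w' = n. if w' = w then f (y w') else 0)"
        unfolding H_def
      proof (intro sum.cong refl)
        fix w' assume w': "w' \<in> {w'::bool list. length w' = n}"
        have "v k z \<in> c w' \<longleftrightarrow> w' = w"
          using vB w' by (auto simp: c_def w_def list_eq_iff_nth_eq)
        then show "f (y w') * indicator (v k -` c w') z = (if w' = w then f (y w') else 0)"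
          by (auto simp: indicator_def)
      qed
      then have "H n k z = f (y w)" using w finite_words by simp
      moreover have "y w \<in> c w" using w yc by blast
      ultimately show ?thesis using N(1)[rule_format, of w "v k z" "y w"] w by simp
    qed
    have Hlim: "(\<lambda>k. \<integral>z. h z * H n (r k) z \<partial>\<mu>) \<longlonglongrightarrow> (\<integral>z. h z * F n z \<partial>\<mu>)" for n
    proof -
      have L1: "(\<lambda>k. \<integral>z. h z * indicator (v (r k) -` c w) z \<partial>\<mu>) \<longlonglongrightarrow> (\<integral>z. h z * q w z \<partial>\<mu>)" for w
        by (rule weak_star_limit_indicators_L1[OF fin sets\<mu> _ q q01 qlim h])
           (use Em sets\<mu> in auto)
      have ii: "integrable \<mu> (\<lambda>z. h z * indicator (v k -` c w) z)" for k w
      proof (rule Bochner_Integration.integrable_bound[OF h])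
        show "(\<lambda>z. h z * indicator (v k -` c w) z) \<in> borel_measurable \<mu>"
          using h Em by (intro borel_measurable_times borel_measurable_indicator) auto
      qed (auto simp: indicator_def)
      have ip: "integrable \<mu> (\<lambda>z. h z * p z w)" for w
      proof (rule Bochner_Integration.integrable_bound[OF h])
        show "(\<lambda>z. h z * p z w) \<in> borel_measurable \<mu>"
          unfolding measurable_cong_sets[OF sets\<mu> refl] by measurable
        show "AE z in \<mu>. norm (h z * p z w) \<le> norm (h z)"
          using p(1,2) by (auto simp: abs_mult mult_left_le)
      qed
      have qp: "(\<integral>z. h z * q w z \<partial>\<mu>) = (\<integral>z. h z * p z w \<partial>\<mu>)" for w
      proof (rule integral_cong_AE)
        show "AE z in \<mu>. h z * q w z = h z * p z w" using aeGd by eventually_elim (simp add: p_def)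
      qed (auto simp: measurable_cong_sets[OF sets\<mu> refl])
      have "(\<lambda>k. \<Sum>w | length w = n. f (y w) * (\<integral>z. h z * indicator (v (r k) -` c w) z \<partial>\<mu>)) \<longlonglongrightarrow> (\<Sum>w | length w = n. f (y w) * (\<integral>z. h z * p z w \<partial>\<mu>))"
        using L1 unfolding qp by (intro tendsto_intros)
      moreover have "(\<integral>z. h z * H n (r k) z \<partial>\<mu>) = (\<Sum>w | length w = n. f (y w) * (\<integral>z. h z * indicator (v (r k) -` c w) z \<partial>\<mu>))" for k
      proof -
        have "(\<lambda>z. h z * H n (r k) z) = (\<lambda>z. \<Sum>w | length w = n. f (y w) * (h z * indicator (v (r k) -` c w) z))"
          unfolding H_def sum_distrib_left by (simp add: mult_ac)
        then show ?thesis using ii by simp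
      qed
      moreover have "(\<integral>z. h z * F n z \<partial>\<mu>) = (\<Sum>w | length w = n. f (y w) * (\<integral>z. h z * p z w \<partial>\<mu>))"
      proof -
        have "(\<lambda>z. h z * F n z) = (\<lambda>z. \<Sum>w | length w = n. f (y w) * (h z * p z w))"
          unfolding F_def sum_distrib_left by (simp add: mult_ac)
        then show ?thesis using ip by simp
      qed
      ultimately show ?thesis by simp
    qed
    obtain Bf where Bf: "Bf \<ge> 0" "\<And>x. x \<in> cball 0 B \<Longrightarrow> \<bar>f x\<bar> \<le> Bf"
    proof -
      have "bounded (f ` cball 0 B)"
        by (intro compact_imp_bounded compact_continuous_image continuous_on_subset[OF f]) auto
      then obtain b where "\<forall>x\<in>cball 0 B. \<bar>f x\<bar> \<le> b" unfolding bounded_iff by auto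
      then show ?thesis using that[of "max 0 b"] by fastforce
    qed
    have ibd: "integrable \<mu> (\<lambda>z. h z * k z)" if "k \<in> borel_measurable borel" "\<And>z. \<bar>k z\<bar> \<le> C" for k C
    proof (rule Bochner_Integration.integrable_bound[of _ "\<lambda>z. C * \<bar>h z\<bar>"])
      show "AE z in \<mu>. norm (h z * k z) \<le> norm (C * \<bar>h z\<bar>)"
      proof (rule AE_I2)
        fix z
        have "\<bar>h z\<bar> * \<bar>k z\<bar> \<le> \<bar>h z\<bar> * C" using that(2)[of z] by (intro mult_left_mono) auto
        moreover have "0 \<le> C" using that(2)[of z] by linarith
        ultimately show "norm (h z * k z) \<le> norm (C * \<bar>h z\<bar>)" by (simp add: abs_mult mult.commute)
      qed
      show "(\<lambda>z. h z * k z) \<in> borel_measurable \<mu>" unfolding measurable_cong_sets[OF sets\<mu> refl]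
        using that(1) by measurable
    qed (use h in auto)
    have near: "\<bar>(\<integral>z. h z * k1 z \<partial>\<mu>) - (\<integral>z. h z * k2 z \<partial>\<mu>)\<bar> \<le> e * (\<integral>z. \<bar>h z\<bar> \<partial>\<mu>)"
      if "integrable \<mu> (\<lambda>z. h z * k1 z)" "integrable \<mu> (\<lambda>z. h z * k2 z)" "\<And>z. \<bar>k1 z - k2 z\<bar> \<le> e" for k1 k2 e
    proof -
      have "\<bar>(\<integral>z. h z * k1 z \<partial>\<mu>) - (\<integral>z. h z * k2 z \<partial>\<mu>)\<bar> = \<bar>\<integral>z. h z * k1 z - h z * k2 z \<partial>\<mu>\<bar>" using that by simp
      also have "\<dots> \<le> (\<integral>z. \<bar>h z * k1 z - h z * k2 z\<bar> \<partial>\<mu>)" by (rule integral_abs_bound)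
      also have "\<dots> \<le> (\<integral>z. e * \<bar>h z\<bar> \<partial>\<mu>)"
      proof (rule integral_mono)
        fix z
        have "\<bar>h z\<bar> * \<bar>k1 z - k2 z\<bar> \<le> \<bar>h z\<bar> * e" using that(3)[of z] by (rule mult_left_mono) simp
        then show "\<bar>h z * k1 z - h z * k2 z\<bar> \<le> e * \<bar>h z\<bar>"
          by (simp add: right_diff_distrib[symmetric] abs_mult mult.commute)
      qed (use that h in auto)
      finally show ?thesis by simp
    qed
    show ?thesis
    proof (rule LIMSEQ_I)
      fix e0 :: real assume e0: "e0 > 0"
      define Ih where "Ih = (\<integral>z. \<bar>h z\<bar> \<partial>\<mu>)"
      have Ih: "Ih \<ge> 0" unfolding Ih_def by simp
      \<comment> \<open>The two replacements cost at most \<open>e * Ih\<close> each and the limit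
        at fixed level one further third; adding 1 to \<open>Ih\<close> covers
        \<open>Ih = 0\<close>.\<close>
      define e where "e = e0 / (3 * (Ih + 1))"
      have e: "e > 0" "e * Ih < e0 / 3" using e0 Ih by (auto simp: e_def field_simps)
      obtain n where n: "\<forall>w. length w \<ge> n \<longrightarrow> (\<forall>x\<in>c w. \<forall>y\<in>c w. \<bar>f x - f y\<bar> < e)" using osc[OF e(1)] by blast
      obtain k0 where k0: "\<And>k. k \<ge> k0 \<Longrightarrow> \<bar>(\<integral>z. h z * H n (r k) z \<partial>\<mu>) - (\<integral>z. h z * F n z \<partial>\<mu>)\<bar> < e0/3"
        using LIMSEQ_D[OF Hlim[of n], of "e0/3"] e0 by auto
      have fv: "\<bar>f (v k z)\<bar> \<le> Bf" for k z using Bf vB by simp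
      have iv: "integrable \<mu> (\<lambda>z. h z * f (v k z))" for k by (rule ibd[where C=Bf]) (use fv in auto)
      have iH: "integrable \<mu> (\<lambda>z. h z * H n k z)" for k
      proof (rule ibd[where C="Bf + e"])
        show "H n k \<in> borel_measurable borel" unfolding H_def using Em sets\<mu> by measurable
        show "\<bar>H n k z\<bar> \<le> Bf + e" for z using HP[OF n e(1), of k z] fv[of k z] by linarith
      qed
      have Pm: "\<bar>\<integral>x. f x \<partial>(P z)\<bar> \<le> Bf" for z
      proof -
        interpret P: prob_space "P z" by (rule P)
        have "AE x in P z. \<bar>f x\<bar> \<le> Bf" using P(3)[of z] by eventually_elim (use Bf in auto)
        moreover have "f \<in> borel_measurable (P z)" using P(2) fm by (metis measurable_cong_sets)
        ultimately have i: "integrable (P z) f" by (intro P.integrable_const_bound[of _ Bf]) auto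
        have "\<bar>\<integral>x. f x \<partial>(P z)\<bar> \<le> (\<integral>x. \<bar>f x\<bar> \<partial>(P z))" by (rule integral_abs_bound)
        also have "\<dots> \<le> (\<integral>x. Bf \<partial>(P z))" by (rule integral_mono_AE) (use i \<open>AE x in P z. \<bar>f x\<bar> \<le> Bf\<close> in auto)
        finally show ?thesis by (simp add: P.prob_space)
      qed
      have iP: "integrable \<mu> (\<lambda>z. h z * (\<integral>x. f x \<partial>(P z)))" by (rule ibd[where C=Bf]) (use meas[OF f] Pm in auto)
      have iF: "integrable \<mu> (\<lambda>z. h z * F n z)"
      proof (rule ibd[where C="Bf + e"])
        show "F n \<in> borel_measurable borel" unfolding F_def by measurable
        show "\<bar>F n z\<bar> \<le> Bf + e" for z using FP[OF n e(1), of z] Pm[of z] by linarith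
      qed
      have "\<bar>(\<integral>z. h z * f (v (r k) z) \<partial>\<mu>) - (\<integral>z. h z * (\<integral>x. f x \<partial>(P z)) \<partial>\<mu>)\<bar> < e0" if "k \<ge> k0" for k
        using near[OF iv iH HP[OF n e(1)], of "r k"] near[OF iP iF FP[OF n e(1)]] k0[OF that] e(2)
        unfolding Ih_def by linarith
      then show "\<exists>no. \<forall>k\<ge>no. norm ((\<integral>z. h z * f (v (r k) z) \<partial>\<mu>) - (\<integral>z. h z * (\<integral>x. f x \<partial>(P z)) \<partial>\<mu>)) < e0"
        by auto
    qed
  qed
  have P3: "AE x in P z. norm x \<le> B" for z using P(3)[of z] by simp
  show ?thesis
    by (rule exI[of _ r], rule exI[of _ P]) (use r P P3 meas conv in blast)
qed

section \<open>Periodic simplicial meshes\<close>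

definition lattice :: "real^'d \<Rightarrow> (real^'d) set" where
  "lattice L = {z. \<forall>k. \<exists>m::int. z$k = of_int m * L$k}"

text \<open>Meshes and periodic functions are specified through the generators
  \<open>(L$k) *\<^sub>R axis k 1\<close>; this carries invariance over to arbitrary lattice
  vectors.\<close>

lemma lattice_induct [consumes 1, case_names zero plus minus]:
  fixes z :: "real^'d"
  assumes z: "z \<in> lattice L" and P0: "P 0"
   and plus: "\<And>z k. P z \<Longrightarrow> P (z + (L$k) *\<^sub>R axis k 1)"
   and minus: "\<And>z k. P z \<Longrightarrow> P (z - (L$k) *\<^sub>R axis k 1)"
  shows "P z"
proof -
  have "\<forall>k. \<exists>m::int. z$k = of_int m * L$k" using z unfolding lattice_def by simp
  from choice[OF this] obtain m :: "'d \<Rightarrow> int" where m: "\<forall>k. z$k = of_int (m k) * L$k" by blast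
  have step: "P (w + (of_int i * L$k) *\<^sub>R axis k 1)" if "P w" for w i k
  proof (induction i rule: int_induct[where k=0])
    case base then show ?case using that by simp
  next
    case (step1 i)
    then show ?case using plus[OF step1(2), of k] by (simp add: algebra_simps)
  next
    case (step2 i)
    then show ?case using minus[OF step2(2), of k] by (simp add: algebra_simps)
  qed
  have "P (\<Sum>k\<in>F. (of_int (m k) * L$k) *\<^sub>R axis k 1)" if "finite F" for F
    using that
  proof (induction F)
    case (insert x F)
    then show ?case using step[OF insert(3), of "m x" x] by (simp add: add.commute)
  qed (use P0 in simp)
  moreover have "(\<Sum>k\<in>UNIV. (of_int (m k) * L$k) *\<^sub>R axis k 1) = z"
    using m by (simp add: vec_eq_iff axis_def if_distrib cong: if_cong)
  ultimately show ?thesis using finite[of UNIV] by metis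
qed

lemma lat_per_lattice:
  assumes "lat_per L f" "z \<in> lattice L"
  shows "f (x + z) = f x"
proof -
  have "\<forall>x. f (x + z) = f x"
    using assms(2)
  proof (induction rule: lattice_induct)
    case (plus z k)
    then show ?case using assms(1) by (metis (no_types) add.assoc lat_per_def)
  next
    case (minus z k)
    show ?case
    proof
      fix x
      have "f (x + (z - (L$k) *\<^sub>R axis k 1)) = f (x + (z - (L$k) *\<^sub>R axis k 1) + (L$k) *\<^sub>R axis k 1)"
        using assms(1) by (simp only: lat_per_def)
      also have "\<dots> = f (x + z)" by (simp add: algebra_simps)
      finally show "f (x + (z - (L$k) *\<^sub>R axis k 1)) = f x" using minus by simp
    qed
  qed simp
  then show ?thesis by blast
qed

text \<open>Reduction modulo the lattice into the half-open box. At a vertex it yields the node that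
  carries the nodal value there.\<close>

definition rep :: "real^'d \<Rightarrow> real^'d \<Rightarrow> real^'d" where
  "rep L v = (\<chi> k. v$k - of_int \<lfloor>v$k / L$k\<rfloor> * L$k)"

lemma rep_halfbox: "\<forall>k. L$k > 0 \<Longrightarrow> rep L v \<in> halfbox L"
proof -
  assume L: "\<forall>k. L$k > 0"
  have "0 \<le> v$k - of_int \<lfloor>v$k / L$k\<rfloor> * L$k \<and> v$k - of_int \<lfloor>v$k / L$k\<rfloor> * L$k < L$k" for k
  proof -
    have Lk: "L$k > 0" using L by simp
    have 1: "of_int \<lfloor>v$k / L$k\<rfloor> \<le> v$k / L$k" "v$k / L$k < of_int \<lfloor>v$k / L$k\<rfloor> + 1"
      using floor_correct[of "v$k / L$k"] by auto
    have "of_int \<lfloor>v$k / L$k\<rfloor> * L$k \<le> v$k" "v$k < (of_int \<lfloor>v$k / L$k\<rfloor> + 1) * L$k"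
      using 1 pos_le_divide_eq[OF Lk] pos_divide_less_eq[OF Lk] by blast+
    then show ?thesis by (simp add: distrib_right)
  qed
  then show ?thesis by (simp add: halfbox_def rep_def)
qed

lemma rep_diff_lattice: "rep L v - v \<in> lattice L"
proof -
  have "(rep L v - v)$k = of_int (- \<lfloor>v$k / L$k\<rfloor>) * L$k" for k by (simp add: rep_def)
  then show ?thesis unfolding lattice_def by blast
qed

lemma lat_per_rep: "lat_per L f \<Longrightarrow> f (rep L v) = f v"
  using lat_per_lattice[OF _ rep_diff_lattice, of L f v v] by simp

lemma lat_equiv_iff_rep:
  assumes L: "\<forall>k. L$k > 0" and i: "i \<in> halfbox L"
  shows "lat_equiv L v i \<longleftrightarrow> rep L v = i"
proof
  assume "lat_equiv L v i"
  then have "\<forall>k. \<exists>m::int. i$k - v$k = of_int m * L$k" unfolding lat_equiv_def .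
  then have "rep L v $ k = i $ k" for k
  proof -
    assume "\<forall>k. \<exists>m::int. i$k - v$k = of_int m * L$k"
    then obtain m :: int where m: "i$k - v$k = of_int m * L$k" by blast
    have "L$k > 0" "0 \<le> i$k" "i$k < L$k" using L i by (auto simp: halfbox_def)
    then have "v$k / L$k = i$k / L$k - of_int m" "0 \<le> i$k / L$k" "i$k / L$k < 1" using m by (auto simp: field_simps)
    then have "\<lfloor>v$k / L$k\<rfloor> = - m" by (intro floor_unique) auto
    then show ?thesis using m by (simp add: rep_def)
  qed
  then show "rep L v = i" by (simp add: vec_eq_iff)
next
  assume "rep L v = i"
  then have "i - v \<in> lattice L" using rep_diff_lattice[of L v] by simp
  then show "lat_equiv L v i" by (simp add: lattice_def lat_equiv_def)
qed

text \<open>Differences with one fixed point \<open>v0\<close> are linearly independent, so a linear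
  functional with the prescribed increments exists; \<open>adjoint\<close> turns it into an inner
  product.\<close>

lemma affine_interpolation:
  fixes C :: "'a::euclidean_space set" and F :: "'a \<Rightarrow> real"
  assumes "\<not> affine_dependent C"
  shows "\<exists>a b. \<forall>v\<in>C. a \<bullet> v + b = F v"
proof (cases "C = {}")
  case False
  then obtain v0 where v0: "v0 \<in> C" by blast
  have ind: "independent ((\<lambda>x. - v0 + x) ` (C - {v0}))"
    using affine_dependent_iff_dependent2[OF v0] assms by blast
  obtain g where g: "linear g" "\<forall>x\<in>(\<lambda>x. - v0 + x) ` (C - {v0}). g x = F (x + v0) - F v0"
    using linear_independent_extend[OF ind, of "\<lambda>x. F (x + v0) - F v0"] by blast
  define A where "A = adjoint g 1"
  have ga: "g x = A \<bullet> x" for x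
    using adjoint_works[OF g(1), of x 1] by (simp add: inner_commute A_def)
  have "A \<bullet> v + (F v0 - A \<bullet> v0) = F v" if "v \<in> C" for v
  proof (cases "v = v0")
    case False
    then have "g (- v0 + v) = F v - F v0" using g(2) that by auto
    then show ?thesis unfolding ga by (simp add: inner_diff_right)
  qed simp
  then show ?thesis by blast
qed simp

lemma affine_eq_on_convex_hull:
  fixes a a' :: "'a::euclidean_space" and b b' :: real
  assumes "\<forall>v\<in>C. a \<bullet> v + b = a' \<bullet> v + b'" "x \<in> convex hull C"
  shows "a \<bullet> x + b = a' \<bullet> x + b'"
proof -
  have "{x. a \<bullet> x + b = a' \<bullet> x + b'} = {x. (a - a') \<bullet> x = b' - b}" by (auto simp: inner_diff_left)
  then have "convex {x. a \<bullet> x + b = a' \<bullet> x + b'}" using convex_hyperplane by metis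
  then have "convex hull C \<subseteq> {x. a \<bullet> x + b = a' \<bullet> x + b'}" using assms(1) by (intro hull_minimal) auto
  then show ?thesis using assms(2) by blast
qed

lemma bounded_halfbox: "bounded (halfbox L)"
proof (rule bounded_subset[of "cbox 0 L"])
  show "halfbox L \<subseteq> cbox 0 L" by (auto simp: halfbox_def mem_box_cart less_imp_le)
qed simp

section \<open>Cells, hat functions and barycentric coordinates\<close>

locale pmesh =
  fixes L :: "real^'d" and K :: "(real^'d) set set"
  assumes mesh: "periodic_mesh L K" and Lpos: "\<forall>k. L$k > 0"
begin

lemma simplex_verts:
  assumes "S \<in> K"
  shows "finite (verts S)" "\<not> affine_dependent (verts S)" "card (verts S) = CARD('d) + 1" "convex hull (verts S) = S"
proof -
  have "int CARD('d) simplex S" using mesh assms by (simp add: periodic_mesh_def)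
  then obtain C where C: "finite C" "\<not> affine_dependent C" "int (card C) = int CARD('d) + 1" "S = convex hull C"
    unfolding simplex by blast
  have "verts S = C" unfolding verts_def C(4) using extreme_point_of_convex_hull_affine_independent[OF C(2)] by blast
  then show "finite (verts S)" "\<not> affine_dependent (verts S)" "card (verts S) = CARD('d) + 1" "convex hull (verts S) = S"
    using C by auto
qed

lemma verts_subset: "S \<in> K \<Longrightarrow> verts S \<subseteq> S"
  by (auto simp: verts_def extreme_point_of_def)

lemma compact_cell: "S \<in> K \<Longrightarrow> compact S"
  using simplex_verts(1,4) finite_imp_compact_convex_hull by metis

lemma convex_cell: "S \<in> K \<Longrightarrow> convex S"
  using simplex_verts(4) convex_convex_hull by metis

lemma cell_cover: "\<exists>S\<in>K. x \<in> S"
proof -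
  have "\<Union>K = UNIV" using mesh by (simp add: periodic_mesh_def)
  then show ?thesis by blast
qed

lemma finite_meet: "bounded B \<Longrightarrow> finite {S\<in>K. S \<inter> B \<noteq> {}}"
  using mesh by (simp add: periodic_mesh_def)

lemma cell_inter: "S \<in> K \<Longrightarrow> S' \<in> K \<Longrightarrow> S \<noteq> S' \<Longrightarrow> S \<inter> S' = convex hull (verts S \<inter> verts S')"
  using mesh by (simp add: periodic_mesh_def)

lemma cell_shift:
  assumes "S \<in> K"
  shows "(\<lambda>x. x + (L$k) *\<^sub>R axis k 1) ` S \<in> K" "(\<lambda>x. x - (L$k) *\<^sub>R axis k 1) ` S \<in> K"
  using mesh assms by (simp_all add: periodic_mesh_def)

lemma cell_translate:
  assumes "z \<in> lattice L" "S \<in> K"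
  shows "(\<lambda>x. x + z) ` S \<in> K"
  using assms
proof (induction rule: lattice_induct)
  case (plus z k)
  have "(\<lambda>x. x + (L$k) *\<^sub>R axis k 1) ` ((\<lambda>x. x + z) ` S) \<in> K"
    using plus cell_shift(1) by blast
  then show ?case by (simp add: image_image add.assoc)
next
  case (minus z k)
  have "(\<lambda>x. x - (L$k) *\<^sub>R axis k 1) ` ((\<lambda>x. x + z) ` S) \<in> K"
    using minus cell_shift(2) by blast
  then show ?case by (simp add: image_image algebra_simps)
qed simp

lemma verts_translate: "verts ((\<lambda>x. x + z) ` S) = (\<lambda>x. x + z) ` verts S"
proof -
  have eq: "(\<lambda>x. x + z) ` S = (+) z ` S" for S by (auto simp: add.commute)
  have "v extreme_point_of ((+) z ` S) \<longleftrightarrow> (v - z) extreme_point_of S" for v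
    using extreme_point_of_translation_eq[of z "v - z" S] by simp
  then show ?thesis unfolding verts_def eq
    by (force simp: image_iff)
qed

lemma all_verts_translate: "v \<in> all_verts K \<Longrightarrow> z \<in> lattice L \<Longrightarrow> v + z \<in> all_verts K"
  unfolding all_verts_def using cell_translate[of z] verts_translate by blast

lemma rep_node: "v \<in> all_verts K \<Longrightarrow> rep L v \<in> nodes L K"
  using all_verts_translate[OF _ rep_diff_lattice, of v v] rep_halfbox[OF Lpos, of v]
  by (simp add: nodes_def)

lemma finite_nodes: "finite (nodes L K)"
proof (rule finite_subset)
  show "nodes L K \<subseteq> (\<Union>S\<in>{S\<in>K. S \<inter> halfbox L \<noteq> {}}. verts S)"
    unfolding nodes_def all_verts_def using verts_subset by blast
  show "finite (\<Union>S\<in>{S\<in>K. S \<inter> halfbox L \<noteq> {}}. verts S)"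
    using finite_meet[OF bounded_halfbox] simplex_verts(1) by blast
qed

text \<open>An affine function on a simplex is determined by its vertex values. This gives the
  uniqueness of hat functions and, applied to a translate, their periodicity.\<close>

lemma piecewise_affine_eqI:
  assumes "\<forall>S\<in>K. \<exists>a b. \<forall>x\<in>S. f x = a \<bullet> x + (b::real)" "\<forall>S\<in>K. \<exists>a b. \<forall>x\<in>S. g x = a \<bullet> x + b"
    and "\<forall>v\<in>all_verts K. f v = g v"
  shows "f = g"
proof
  fix x
  obtain S where S: "S \<in> K" "x \<in> S" using cell_cover by blast
  obtain a b where f: "\<forall>x\<in>S. f x = a \<bullet> x + b" using bspec[OF assms(1) S(1)] by blast
  obtain a' b' where g: "\<forall>x\<in>S. g x = a' \<bullet> x + b'" using bspec[OF assms(2) S(1)] by blast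
  have "\<forall>v\<in>verts S. a \<bullet> v + b = a' \<bullet> v + b'"
  proof
    fix v assume "v \<in> verts S"
    then have "v \<in> S" "v \<in> all_verts K" using S verts_subset[OF S(1)] by (auto simp: all_verts_def)
    then show "a \<bullet> v + b = a' \<bullet> v + b'" using f g assms(3) by auto
  qed
  then show "f x = g x" using affine_eq_on_convex_hull[of "verts S" a b a' b' x] f g S simplex_verts(4) by simp
qed

text \<open>Conformity of the mesh makes the pieces fit: two cells meet in the hull of their common
  vertices, where both affine pieces agree. Local finiteness then yields continuity.\<close>

lemma ex_piecewise_affine:
  "\<exists>f. continuous_on UNIV f \<and> (\<forall>S\<in>K. \<exists>a b. \<forall>x\<in>S. f x = a \<bullet> x + b) \<and> (\<forall>v\<in>all_verts K. f v = (F v :: real))"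
proof -
  have "\<forall>S. \<exists>ab. S \<in> K \<longrightarrow> (\<forall>v\<in>verts S. fst ab \<bullet> v + snd ab = F v)"
    using affine_interpolation[OF simplex_verts(2)] by (metis fst_conv snd_conv)
  from choice[OF this] obtain ab where ab: "\<forall>S. S \<in> K \<longrightarrow> (\<forall>v\<in>verts S. fst (ab S) \<bullet> v + snd (ab S) = F v)" by blast
  define a where "a S = fst (ab S)" for S
  define b where "b S = snd (ab S)" for S
  have v: "a S \<bullet> v + b S = F v" if "S \<in> K" "v \<in> verts S" for S v using ab that by (auto simp: a_def b_def)
  have agree: "a S \<bullet> x + b S = a S' \<bullet> x + b S'" if "S \<in> K" "S' \<in> K" "x \<in> S" "x \<in> S'" for S S' x
  proof (cases "S = S'")
    case False
    then have "x \<in> convex hull (verts S \<inter> verts S')" using cell_inter that by blast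
    then show ?thesis using v that by (intro affine_eq_on_convex_hull) auto
  qed simp
  define f where "f x = (let S = (SOME S. S \<in> K \<and> x \<in> S) in a S \<bullet> x + b S)" for x
  have f: "f x = a S \<bullet> x + b S" if "S \<in> K" "x \<in> S" for x S
  proof -
    have "(SOME S. S \<in> K \<and> x \<in> S) \<in> K \<and> x \<in> (SOME S. S \<in> K \<and> x \<in> S)"
      by (rule someI[of _ S]) (use that in simp)
    then show ?thesis unfolding f_def Let_def using agree that by blast
  qed
  have "continuous_on UNIV f"
  proof -
    have "continuous (at x) f" for x
    proof -
      let ?I = "{S\<in>K. S \<inter> ball x 1 \<noteq> {}}"
      have "continuous_on (\<Union>S\<in>?I. S) f"
      proof (rule continuous_on_closed_Union)
        show "continuous_on S f" if "S \<in> ?I" for S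
        proof -
          have "continuous_on S (\<lambda>x. a S \<bullet> x + b S)" by (intro continuous_intros)
          then show ?thesis using f that by (subst continuous_on_cong[OF refl, of _ _ "\<lambda>x. a S \<bullet> x + b S"]) auto
        qed
      qed (use finite_meet[OF bounded_ball] compact_cell compact_imp_closed in auto)
      moreover have "ball x 1 \<subseteq> (\<Union>S\<in>?I. S)" using cell_cover by fast
      ultimately have "continuous_on (ball x 1) f" using continuous_on_subset by blast
      then show ?thesis using continuous_on_interior[of "ball x 1" f x] by simp
    qed
    then show ?thesis by (simp add: continuous_on_eq_continuous_at)
  qed
  moreover have "\<forall>v\<in>all_verts K. f v = F v"
    unfolding all_verts_def using f v verts_subset by fastforce
  ultimately show ?thesis using f by blast
qed

text \<open>Justifies the definite description in \<open>hat\<close>. Periodicity is obtained from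
  uniqueness: a translate by a generator is again piecewise affine and has the same vertex values,
  because \<open>lat_equiv\<close> is invariant under the lattice.\<close>

lemma hat_exists:
  "\<exists>!f. P1 L K f \<and> (\<forall>v\<in>all_verts K. f v = (if lat_equiv L v i then 1 else 0))"
proof -
  obtain f where f: "continuous_on UNIV f" "\<forall>S\<in>K. \<exists>a b. \<forall>x\<in>S. f x = a \<bullet> x + b"
    "\<forall>v\<in>all_verts K. f v = (if lat_equiv L v i then 1 else (0::real))"
    using ex_piecewise_affine[of "\<lambda>v. if lat_equiv L v i then 1 else 0"] by blast
  have "(\<lambda>x. f (x + (L$k) *\<^sub>R axis k 1)) = f" for k
  proof (rule piecewise_affine_eqI)
    define z where "z = (L$k) *\<^sub>R axis k (1::real)"
    have zl: "z \<in> lattice L" unfolding lattice_def z_def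
    proof (rule CollectI, rule allI)
      fix j show "\<exists>m::int. ((L$k) *\<^sub>R axis k (1::real)) $ j = of_int m * L$j"
        by (rule exI[of _ "if j = k then 1 else 0"]) (simp add: axis_def)
    qed
    show "\<forall>S\<in>K. \<exists>a b. \<forall>x\<in>S. f (x + (L$k) *\<^sub>R axis k 1) = a \<bullet> x + b"
    proof
      fix S assume "S \<in> K"
      then obtain a b where ab: "\<forall>x\<in>(\<lambda>x. x + z) ` S. f x = a \<bullet> x + b" using f(2) cell_translate[OF zl] by metis
      have "\<forall>x\<in>S. f (x + (L$k) *\<^sub>R axis k 1) = a \<bullet> x + (a \<bullet> z + b)"
        using ab by (auto simp: z_def inner_add_right)
      then show "\<exists>a b. \<forall>x\<in>S. f (x + (L$k) *\<^sub>R axis k 1) = a \<bullet> x + b" by blast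
    qed
    show "\<forall>v\<in>all_verts K. f (v + (L$k) *\<^sub>R axis k 1) = f v"
    proof
      fix v assume v: "v \<in> all_verts K"
      have "lat_equiv L (v + z) i \<longleftrightarrow> lat_equiv L v i"
      proof -
        have "(\<exists>m::int. i$j - (v + z)$j = of_int m * L$j) \<longleftrightarrow> (\<exists>m::int. i$j - v$j = of_int m * L$j)" for j
        proof -
          obtain n :: int where n: "z$j = of_int n * L$j" using zl unfolding lattice_def by blast
          show ?thesis
          proof
            assume "\<exists>m::int. i$j - (v + z)$j = of_int m * L$j"
            then obtain m :: int where "i$j - (v + z)$j = of_int m * L$j" by blast
            then have "i$j - v$j = of_int (m + n) * L$j" using n by (simp add: algebra_simps)
            then show "\<exists>m::int. i$j - v$j = of_int m * L$j" by blast
          next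
            assume "\<exists>m::int. i$j - v$j = of_int m * L$j"
            then obtain m :: int where "i$j - v$j = of_int m * L$j" by blast
            then have "i$j - (v + z)$j = of_int (m - n) * L$j" using n by (simp add: algebra_simps)
            then show "\<exists>m::int. i$j - (v + z)$j = of_int m * L$j" by blast
          qed
        qed
        then show ?thesis by (simp add: lat_equiv_def)
      qed
      then show "f (v + (L$k) *\<^sub>R axis k 1) = f v"
        using f(3) v all_verts_translate[OF v zl] by (simp add: z_def)
    qed
  qed (use f in blast)
  then have "lat_per L f" unfolding lat_per_def by metis
  then have "P1 L K f" using f by (simp add: P1_def)
  then show ?thesis
  proof (intro ex1I[of _ f])
    fix g assume "P1 L K g \<and> (\<forall>v\<in>all_verts K. g v = (if lat_equiv L v i then 1 else 0))"
    then show "g = f" using f by (intro piecewise_affine_eqI) (auto simp: P1_def)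
  qed (use f in auto)
qed

lemma hat_P1: "P1 L K (hat L K i)"
  and hat_vert: "i \<in> halfbox L \<Longrightarrow> v \<in> all_verts K \<Longrightarrow> hat L K i v = (if rep L v = i then 1 else 0)"
proof -
  have *: "P1 L K (hat L K i) \<and> (\<forall>v\<in>all_verts K. hat L K i v = (if lat_equiv L v i then 1 else 0))"
    unfolding hat_def by (rule theI'[OF hat_exists])
  then show "P1 L K (hat L K i)" by blast
  show "i \<in> halfbox L \<Longrightarrow> v \<in> all_verts K \<Longrightarrow> hat L K i v = (if rep L v = i then 1 else 0)"
    using * lat_equiv_iff_rep[OF Lpos, of i v] by auto
qed

lemma hat_continuous: "continuous_on UNIV (hat L K i)"
  and hat_per: "lat_per L (hat L K i)"
  using hat_P1[of i] unfolding P1_def by auto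

lemma affine_convex_comb:
  fixes a :: "'a::euclidean_space"
  assumes "sum b C = 1"
  shows "a \<bullet> (\<Sum>v\<in>C. b v *\<^sub>R v) + c = (\<Sum>v\<in>C. b v * (a \<bullet> v + c))"
  using assms by (simp add: inner_sum_right distrib_left sum.distrib sum_distrib_right[symmetric])

text \<open>The value is a sum of barycentric coordinates rather than a single one, because on a
  coarse mesh several vertices of one cell may represent the same node.\<close>

lemma hat_on_cell:
  assumes S: "S \<in> K" and b: "sum b (verts S) = 1" "\<forall>v\<in>verts S. 0 \<le> b v" and j: "j \<in> nodes L K"
  shows "hat L K j (\<Sum>v\<in>verts S. b v *\<^sub>R v) = (\<Sum>v\<in>verts S. if rep L v = j then b v else 0)"
proof -
  let ?x = "\<Sum>v\<in>verts S. b v *\<^sub>R v"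
  have x: "?x \<in> S"
    by (rule convex_sum[OF simplex_verts(1)[OF S] convex_cell[OF S] b(1)]) (use b(2) verts_subset[OF S] in auto)
  obtain a c where ac: "\<forall>x\<in>S. hat L K j x = a \<bullet> x + c" using hat_P1[of j] S unfolding P1_def by blast
  have "hat L K j ?x = a \<bullet> ?x + c" using ac x by blast
  also have "\<dots> = (\<Sum>v\<in>verts S. b v * (a \<bullet> v + c))" by (rule affine_convex_comb[OF b(1)])
  also have "\<dots> = (\<Sum>v\<in>verts S. b v * hat L K j v)"
    using ac verts_subset[OF S] by (intro sum.cong) auto
  also have "\<dots> = (\<Sum>v\<in>verts S. if rep L v = j then b v else 0)"
  proof (intro sum.cong refl)
    fix v assume "v \<in> verts S"
    then have "v \<in> all_verts K" using S by (auto simp: all_verts_def)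
    then show "b v * hat L K j v = (if rep L v = j then b v else 0)"
      using hat_vert[of j v] j by (simp add: nodes_def)
  qed
  finally show ?thesis .
qed

lemma bary_coords:
  "\<exists>S b. S \<in> K \<and> x \<in> S \<and> sum b (verts S) = 1 \<and> (\<forall>v\<in>verts S. 0 \<le> b v) \<and> x = (\<Sum>v\<in>verts S. b v *\<^sub>R v) \<and>
     (\<forall>j\<in>nodes L K. hat L K j x = (\<Sum>v\<in>verts S. if rep L v = j then b v else 0))"
proof -
  obtain S where S: "S \<in> K" "x \<in> S" using cell_cover by blast
  have "x \<in> convex hull (verts S)" using S simplex_verts(4) by simp
  then obtain b where b: "\<forall>v\<in>verts S. 0 \<le> b v" "sum b (verts S) = 1" "(\<Sum>v\<in>verts S. b v *\<^sub>R v) = x"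
    unfolding convex_hull_finite[OF simplex_verts(1)[OF S(1)]] by blast
  then show ?thesis using S hat_on_cell[OF S(1) b(2,1)] by blast
qed

lemma vert_rep_node: "S \<in> K \<Longrightarrow> v \<in> verts S \<Longrightarrow> rep L v \<in> nodes L K"
  using rep_node by (auto simp: all_verts_def)

lemma sum_nodes_reindex:
  fixes U :: "real^'d \<Rightarrow> 'b::real_vector"
  assumes "finite C" "\<forall>v\<in>C. rep L v \<in> nodes L K"
  shows "(\<Sum>j\<in>nodes L K. (\<Sum>v\<in>C. if rep L v = j then b v else 0) *\<^sub>R U j) = (\<Sum>v\<in>C. b v *\<^sub>R U (rep L v))"
proof -
  have "(\<Sum>j\<in>nodes L K. (\<Sum>v\<in>C. if rep L v = j then b v else 0) *\<^sub>R U j)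
      = (\<Sum>j\<in>nodes L K. \<Sum>v\<in>C. if rep L v = j then b v *\<^sub>R U j else 0)"
    by (intro sum.cong refl) (auto simp: scaleR_sum_left intro!: sum.cong)
  also have "\<dots> = (\<Sum>v\<in>C. \<Sum>j\<in>nodes L K. if rep L v = j then b v *\<^sub>R U j else 0)" by (rule sum.swap)
  also have "\<dots> = (\<Sum>v\<in>C. b v *\<^sub>R U (rep L v))"
    using assms finite_nodes by (intro sum.cong refl) simp
  finally show ?thesis .
qed

lemma hat_nonneg: "j \<in> nodes L K \<Longrightarrow> 0 \<le> hat L K j x"
  using bary_coords[of x] by (auto intro!: sum_nonneg)

lemma sum_hat: "(\<Sum>j\<in>nodes L K. hat L K j x) = 1"
proof -
  obtain S b where S: "S \<in> K" "sum b (verts S) = 1"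
    "\<forall>j\<in>nodes L K. hat L K j x = (\<Sum>v\<in>verts S. if rep L v = j then b v else 0)" using bary_coords[of x] by blast
  have "(\<Sum>j\<in>nodes L K. hat L K j x) = (\<Sum>j\<in>nodes L K. (\<Sum>v\<in>verts S. if rep L v = j then b v else 0) *\<^sub>R 1)"
    using S(3) by (intro sum.cong) auto
  also have "\<dots> = 1" using S vert_rep_node simplex_verts(1)
    by (subst sum_nodes_reindex) auto
  finally show ?thesis .
qed

lemma hat_le_1: "j \<in> nodes L K \<Longrightarrow> hat L K j x \<le> 1"
  using sum_hat[of x] member_le_sum[of j "nodes L K" "\<lambda>j. hat L K j x"] hat_nonneg finite_nodes by simp

lemma uh_bound:
  fixes U :: "real^'d \<Rightarrow> 'b::real_normed_vector"
  assumes "\<forall>j\<in>nodes L K. norm (U j) \<le> M"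
  shows "norm (uh L K U x) \<le> M"
proof -
  have "norm (uh L K U x) \<le> (\<Sum>j\<in>nodes L K. norm (hat L K j x *\<^sub>R U j))" unfolding uh_def by (rule norm_sum)
  also have "\<dots> \<le> (\<Sum>j\<in>nodes L K. hat L K j x * M)"
    using assms hat_nonneg by (intro sum_mono) (auto intro!: mult_left_mono)
  finally show ?thesis by (simp add: sum_distrib_right[symmetric] sum_hat)
qed

lemma uh_continuous: "continuous_on UNIV (uh L K (U :: real^'d \<Rightarrow> 'b::real_normed_vector))"
  unfolding uh_def by (intro continuous_intros hat_continuous)

text \<open>\<open>mesh_size\<close> is a supremum over infinitely many cells. It is finite because
  every cell is a lattice translate of one of the finitely many cells that meet the half-open
  box.\<close>

lemma diameter_le_mesh_size: assumes "S \<in> K" shows "diameter S \<le> mesh_size K"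
proof -
  let ?F = "diameter ` {S\<in>K. S \<inter> halfbox L \<noteq> {}}"
  have fin: "finite ?F" using finite_meet[OF bounded_halfbox] by simp
  have "diameter S \<le> Max ?F" if S: "S \<in> K" for S
  proof -
    have "verts S \<noteq> {}" using simplex_verts(3)[OF S] by auto
    then obtain v where v: "v \<in> S" using verts_subset[OF S] by blast
    define z where "z = rep L v - v"
    let ?S = "(\<lambda>x. x + z) ` S"
    have SK: "?S \<in> K" unfolding z_def by (rule cell_translate[OF rep_diff_lattice S])
    have "rep L v \<in> ?S \<inter> halfbox L" using v rep_halfbox[OF Lpos] by (auto simp: z_def intro!: image_eqI[of _ _ v])
    then have "diameter ?S \<le> Max ?F" using SK fin by (intro Max_ge) auto
    moreover have "diameter S \<le> diameter ?S"
    proof (rule diameter_le)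
      show "norm (x - y) \<le> diameter ?S" if "x \<in> S" "y \<in> S" for x y
        using diameter_bounded_bound[of ?S "x + z" "y + z"] compact_imp_bounded[OF compact_cell[OF SK]] that
        by (simp add: dist_norm)
    qed (use v in auto)
    ultimately show ?thesis by simp
  qed
  then have "bdd_above (diameter ` K)" by (intro bdd_aboveI[of _ "Max ?F"]) auto
  then show ?thesis unfolding mesh_size_def using assms by (intro cSup_upper) auto
qed

text \<open>Such points lie on frontiers of cells; frontiers of convex sets are negligible, and only
  finitely many cells meet a bounded set.\<close>

lemma negligible_bad_points:
  assumes "bounded B"
  shows "negligible {x\<in>B. \<forall>S\<in>K. x \<notin> interior S}"
proof (rule negligible_subset)
  show "{x\<in>B. \<forall>S\<in>K. x \<notin> interior S} \<subseteq> (\<Union>S\<in>{S\<in>K. S \<inter> B \<noteq> {}}. frontier S)"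
  proof
    fix x assume x: "x \<in> {x\<in>B. \<forall>S\<in>K. x \<notin> interior S}"
    obtain S where S: "S \<in> K" "x \<in> S" using cell_cover by blast
    then have "x \<in> frontier S" using x closure_subset by (auto simp: frontier_def)
    then show "x \<in> (\<Union>S\<in>{S\<in>K. S \<inter> B \<noteq> {}}. frontier S)" using S x by blast
  qed
  show "negligible (\<Union>S\<in>{S\<in>K. S \<inter> B \<noteq> {}}. frontier S)"
    using finite_meet[OF assms] negligible_convex_frontier convex_cell by (intro negligible_Union) auto
qed

text \<open>Along a segment in the convex set \<open>B\<close> the function is affine on each of
  finitely many closed pieces that cover the segment, with slopes bounded by the gradients on the
  cells that meet \<open>B\<close>.\<close>

lemma P1_lipschitz:
  assumes f: "\<forall>S\<in>K. \<exists>a b. \<forall>x\<in>S. f x = a \<bullet> x + (b::real)" and B: "bounded B" "convex B"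
  shows "\<exists>C. C-lipschitz_on B f"
proof -
  let ?I = "{S\<in>K. S \<inter> B \<noteq> {}}"
  have "\<forall>S. \<exists>a. S \<in> K \<longrightarrow> (\<exists>b. \<forall>x\<in>S. f x = a \<bullet> x + b)" using f by blast
  from choice[OF this] obtain a where a: "\<And>S. S \<in> K \<Longrightarrow> \<exists>b. \<forall>x\<in>S. f x = a S \<bullet> x + b" by blast
  define C where "C = (\<Sum>S\<in>?I. norm (a S))"
  have C0: "C \<ge> 0" unfolding C_def by (intro sum_nonneg) auto
  have aC: "norm (a S) \<le> C" if "S \<in> ?I" for S
    unfolding C_def using that finite_meet[OF B(1)] by (intro member_le_sum) auto
  have "C-lipschitz_on B f"
  proof (rule lipschitz_onI[OF _ C0])
    fix x y assume xy: "x \<in> B" "y \<in> B"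
    define g where "g s = f (x + s *\<^sub>R (y - x))" for s
    define V where "V S = {s. x + s *\<^sub>R (y - x) \<in> S}" for S
    have lip: "(C * norm (y - x))-lipschitz_on {0..1} g"
    proof (rule lipschitz_on_closed_Union[where I="?I" and U=V])
      fix S assume S: "S \<in> ?I"
      obtain b where b: "\<forall>x\<in>S. f x = a S \<bullet> x + b" using a S by blast
      show "(C * norm (y - x))-lipschitz_on (V S) g"
      proof (rule lipschitz_onI)
        fix s t assume "s \<in> V S" "t \<in> V S"
        then have "g s - g t = (s - t) * (a S \<bullet> (y - x))"
          using b by (simp add: g_def V_def algebra_simps inner_add_right inner_diff_right)
        then have "dist (g s) (g t) = \<bar>s - t\<bar> * \<bar>a S \<bullet> (y - x)\<bar>" by (simp add: dist_real_def abs_mult)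
        also have "\<dots> \<le> \<bar>s - t\<bar> * (C * norm (y - x))"
          using Cauchy_Schwarz_ineq2[of "a S" "y - x"] aC[OF S]
          by (intro mult_left_mono) (auto intro: order_trans[OF _ mult_right_mono])
        finally show "dist (g s) (g t) \<le> C * norm (y - x) * dist s t" by (simp add: dist_real_def mult.commute)
      qed (use C0 in simp)
      have "closed S" using S compact_cell compact_imp_closed by blast
      moreover have "V S = (\<lambda>s. x + s *\<^sub>R (y - x)) -` S" by (auto simp: V_def)
      ultimately show "closed (V S)" by (auto intro!: continuous_closed_vimage continuous_intros)
    next
      show "{0..1} \<subseteq> (\<Union>S\<in>?I. V S)"
      proof
        fix s :: real assume "s \<in> {0..1}"
        then have "(1 - s) *\<^sub>R x + s *\<^sub>R y \<in> B" using xy B(2) by (intro convexD) auto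
        moreover have "(1 - s) *\<^sub>R x + s *\<^sub>R y = x + s *\<^sub>R (y - x)" by (simp add: algebra_simps)
        ultimately have "x + s *\<^sub>R (y - x) \<in> B" by simp
        then show "s \<in> (\<Union>S\<in>?I. V S)" using cell_cover[of "x + s *\<^sub>R (y - x)"] by (auto simp: V_def)
      qed
    qed (use finite_meet[OF B(1)] C0 in auto)
    have "dist (g 0) (g 1) \<le> (C * norm (y - x)) * dist 0 (1::real)"
      using lipschitz_onD[OF lip, of 0 1] by simp
    then show "dist (f x) (f y) \<le> C * dist x y" by (simp add: g_def dist_norm norm_minus_commute)
  qed
  then show ?thesis by blast
qed

end

lemma pd_eqI: "(f has_derivative f') (at x) \<Longrightarrow> pd f w x = f' w"
  using frechet_derivative_at[of f f' x] by (auto simp: pd_def differentiable_def)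

text \<open>The barycentric coordinates \<open>b\<close> of \<open>x\<close> with respect to the vertices \<open>C\<close> of a simplex of the periodic extension,
  with gradients \<open>\<beta>\<close>.\<close>

definition cell_data :: "real^'d \<Rightarrow> (real^'d) set set \<Rightarrow> real \<Rightarrow> real \<Rightarrow> real^'d \<Rightarrow> (real^'d) set
    \<Rightarrow> (real^'d \<Rightarrow> real) \<Rightarrow> (real^'d \<Rightarrow> real^'d) \<Rightarrow> bool" where
  "cell_data L K h \<kappa> x C b \<beta> \<longleftrightarrow> finite C \<and> card C = CARD('d) + 1 \<and>
     (\<forall>v\<in>C. 0 \<le> b v \<and> norm (v - x) \<le> h \<and> norm (\<beta> v) \<le> \<kappa> / h \<and> rep L v \<in> nodes L K) \<and>
     sum b C = 1 \<and> (\<Sum>v\<in>C. b v *\<^sub>R v) = x \<and> sum \<beta> C = 0 \<and> (\<forall>e. (\<Sum>v\<in>C. (\<beta> v \<bullet> e) *\<^sub>R v) = e) \<and>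
     (\<forall>v\<in>C. \<forall>w\<in>C. \<beta> w \<bullet> (v - x) = (if v = w then 1 else 0) - b w) \<and>
     (\<forall>j\<in>nodes L K. hat L K j x = (\<Sum>v\<in>C. if rep L v = j then b v else 0) \<and>
        (hat L K j has_derivative (\<lambda>e. (\<Sum>v\<in>C. if rep L v = j then \<beta> v else 0) \<bullet> e)) (at x) \<and>
        grad (hat L K j) x = (\<Sum>v\<in>C. if rep L v = j then \<beta> v else 0))"

context pmesh begin

text \<open>\<open>\<beta> v\<close> is the gradient of the affine function \<open>B v\<close> that
  is 1 at \<open>v\<close> and 0 at the other vertices. The identities for \<open>\<beta>\<close>
  arise by comparing the partition of unity and the reproduction of points at \<open>x\<close> and
  at a nearby point of the cell.\<close>

lemma cell_data_exists:
  assumes S: "S \<in> K" and x: "x \<in> interior S" and ball: "ball c r \<subseteq> S" "r > 0"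
    and h: "diameter S \<le> h" and \<kappa>: "2 / r \<le> \<kappa> / h"
  shows "\<exists>C b \<beta>. cell_data L K h \<kappa> x C b \<beta>"
proof -
  define C where "C = verts S"
  have C: "finite C" "\<not> affine_dependent C" "card C = CARD('d) + 1" "convex hull C = S"
    unfolding C_def using simplex_verts[OF S] by auto
  have "\<forall>v. \<exists>ab. \<forall>w\<in>C. fst ab \<bullet> w + snd ab = (if w = v then 1 else (0::real))"
  proof
    fix v
    obtain a b where "\<forall>w\<in>C. a \<bullet> w + b = (if w = v then 1 else (0::real))"
      using affine_interpolation[OF C(2), of "\<lambda>w. if w = v then 1 else 0"] by blast
    then show "\<exists>ab. \<forall>w\<in>C. fst ab \<bullet> w + snd ab = (if w = v then 1 else (0::real))" by (intro exI[of _ "(a,b)"]) simp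
  qed
  from choice[OF this] obtain ab where ab: "\<forall>v. \<forall>w\<in>C. fst (ab v) \<bullet> w + snd (ab v) = (if w = v then 1 else (0::real))" by blast
  define \<beta> where "\<beta> v = fst (ab v)" for v
  define B where "B v y = \<beta> v \<bullet> y + snd (ab v)" for v y
  have BC: "B v w = (if w = v then 1 else 0)" if "w \<in> C" for v w using ab that by (simp add: B_def \<beta>_def)
  have bary: "\<exists>\<mu>. (\<forall>v\<in>C. 0 \<le> \<mu> v) \<and> sum \<mu> C = 1 \<and> (\<Sum>v\<in>C. \<mu> v *\<^sub>R v) = y \<and> (\<forall>v\<in>C. B v y = \<mu> v)" if y: "y \<in> S" for y
  proof -
    have "y \<in> convex hull C" using y C by simp
    then obtain \<mu> where \<mu>: "\<forall>v\<in>C. 0 \<le> \<mu> v" "sum \<mu> C = 1" "(\<Sum>v\<in>C. \<mu> v *\<^sub>R v) = y"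
      unfolding convex_hull_finite[OF C(1)] by blast
    have "B v y = \<mu> v" if "v \<in> C" for v
    proof -
      have "B v y = (\<Sum>w\<in>C. \<mu> w * (\<beta> v \<bullet> w + snd (ab v)))"
        unfolding B_def \<mu>(3)[symmetric] by (rule affine_convex_comb[OF \<mu>(2)])
      also have "\<dots> = (\<Sum>w\<in>C. if w = v then \<mu> w else 0)"
        using BC unfolding B_def by (intro sum.cong) auto
      finally show ?thesis using that C(1) by simp
    qed
    then show ?thesis using \<mu> by blast
  qed
  have B0: "0 \<le> B v y" if "y \<in> S" "v \<in> C" for y v using bary[OF that(1)] that(2) by auto
  have B1: "(\<Sum>v\<in>C. B v y) = 1" "(\<Sum>v\<in>C. B v y *\<^sub>R v) = y" if yS: "y \<in> S" for y
  proof -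
    obtain \<mu> where \<mu>: "sum \<mu> C = 1" "(\<Sum>v\<in>C. \<mu> v *\<^sub>R v) = y" "\<forall>v\<in>C. B v y = \<mu> v" using bary[OF yS] by blast
    then show "(\<Sum>v\<in>C. B v y) = 1" "(\<Sum>v\<in>C. B v y *\<^sub>R v) = y" by simp_all
  qed
  have Ble: "B v y \<le> 1" if "y \<in> S" "v \<in> C" for y v
    using member_le_sum[of v C "\<lambda>v. B v y"] B0[OF that(1)] B1(1)[OF that(1)] that C(1) by simp
  have hatB: "hat L K j y = (\<Sum>v\<in>C. if rep L v = j then B v y else 0)" if y: "y \<in> S" and j: "j \<in> nodes L K" for y j
    using hat_on_cell[OF S, of "\<lambda>v. B v y" j] B0[OF y] B1[OF y] j unfolding C_def by simp
  have xS: "x \<in> S" using x interior_subset by blast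
  obtain d where d: "d > 0" "ball x d \<subseteq> S" using x mem_interior by blast
  have Badd: "B v (y + e) = B v y + \<beta> v \<bullet> e" for v y e by (simp add: B_def inner_add_right)
  \<comment> \<open>Since \<open>x\<close> is interior, every direction can be followed a little way
    inside the cell; this replaces differentiation, as all functions involved are affine.\<close>
  have move: "\<exists>t>0. x + t *\<^sub>R e \<in> S" for e
  proof -
    define t where "t = (if e = 0 then 1 else d / (2 * norm e))"
    have "t > 0" using d(1) by (simp add: t_def)
    moreover have "norm (t *\<^sub>R e) < d" using d(1) by (simp add: t_def)
    then have "x + t *\<^sub>R e \<in> ball x d" by (simp add: dist_norm)
    ultimately show ?thesis using d(2) by blast
  qed
  have s0: "(\<Sum>v\<in>C. \<beta> v \<bullet> e) = 0" for e
  proof -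
    obtain t where t: "t > 0" "x + t *\<^sub>R e \<in> S" using move by blast
    have "1 = (\<Sum>v\<in>C. B v x + t * (\<beta> v \<bullet> e))" using B1(1)[OF t(2)] by (simp add: Badd)
    then have "t * (\<Sum>v\<in>C. \<beta> v \<bullet> e) = 0" using B1(1)[OF xS] by (simp add: sum.distrib sum_distrib_left)
    then show ?thesis using t by simp
  qed
  have "sum \<beta> C \<bullet> sum \<beta> C = 0" using s0[of "sum \<beta> C"] by (simp add: inner_sum_left)
  then have s0': "sum \<beta> C = 0" by simp
  have s1: "(\<Sum>v\<in>C. (\<beta> v \<bullet> e) *\<^sub>R v) = e" for e
  proof -
    obtain t where t: "t > 0" "x + t *\<^sub>R e \<in> S" using move by blast
    have "x + t *\<^sub>R e = (\<Sum>v\<in>C. B v x *\<^sub>R v + (t * (\<beta> v \<bullet> e)) *\<^sub>R v)"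
      using B1(2)[OF t(2)] by (simp add: Badd scaleR_add_left)
    also have "\<dots> = x + t *\<^sub>R (\<Sum>v\<in>C. (\<beta> v \<bullet> e) *\<^sub>R v)"
      using B1(2)[OF xS] by (simp add: sum.distrib scaleR_sum_right)
    finally show ?thesis using t by simp
  qed
  have vS: "v \<in> S" if "v \<in> C" for v using that verts_subset[OF S] by (auto simp: C_def)
  have dist: "norm (v - x) \<le> h" if "v \<in> C" for v
    using diameter_bounded_bound[OF compact_imp_bounded[OF compact_cell[OF S]] vS[OF that] xS] h by (simp add: dist_norm)
  have \<beta>n: "norm (\<beta> v) \<le> \<kappa> / h" if v: "v \<in> C" for v
  proof (cases "\<beta> v = 0")
    case True
    have "0 \<le> 2 / r" using ball(2) by simp
    then have "0 \<le> \<kappa> / h" using \<kappa> by linarith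
    then show ?thesis using True by simp
  next
    case False
    \<comment> \<open>A step of length \<open>r / 2\<close> along the gradient, starting at the
      centre, stays in the ball. There \<open>B v\<close> remains between 0 and 1, so its increment
      \<open>r / 2 * norm (\<beta> v)\<close> is at most 1.\<close>
    let ?e = "(r / 2 / norm (\<beta> v)) *\<^sub>R \<beta> v"
    have cS: "c \<in> S" "c + ?e \<in> S" using ball False by (auto simp: subset_iff dist_norm)
    have "\<beta> v \<bullet> ?e = r / 2 * norm (\<beta> v)" using False by (simp add: power2_norm_eq_inner[symmetric] power2_eq_square)
    then have "r / 2 * norm (\<beta> v) \<le> 1" using Badd[of v c ?e] Ble[OF cS(2) v] B0[OF cS(1) v] by linarith
    then have "norm (\<beta> v) \<le> 2 / r" using ball(2) by (simp add: field_simps)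
    then show ?thesis using \<kappa> by linarith
  qed
  have bx: "\<beta> w \<bullet> (v - x) = (if v = w then 1 else 0) - B w x" if "v \<in> C" "w \<in> C" for v w
    using Badd[of w x "v - x"] BC[OF that(1), of w] by simp
  have der: "(hat L K j has_derivative (\<lambda>e. (\<Sum>v\<in>C. if rep L v = j then \<beta> v else 0) \<bullet> e)) (at x)" if j: "j \<in> nodes L K" for j
  proof (rule has_derivative_transform_within_open[of "\<lambda>y. \<Sum>v\<in>C. if rep L v = j then B v y else 0" _ _ _ "interior S"])
    show "((\<lambda>y. \<Sum>v\<in>C. if rep L v = j then B v y else 0) has_derivative (\<lambda>e. (\<Sum>v\<in>C. if rep L v = j then \<beta> v else 0) \<bullet> e)) (at x)"
    proof -
      have "((\<lambda>y. if rep L v = j then B v y else 0) has_derivative (\<lambda>e. (if rep L v = j then \<beta> v else 0) \<bullet> e)) (at x)" for v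
        by (cases "rep L v = j") (auto simp: B_def intro!: derivative_eq_intros)
      then show ?thesis unfolding inner_sum_left by (intro has_derivative_sum)
    qed
    show "\<And>y. y \<in> interior S \<Longrightarrow> (\<Sum>v\<in>C. if rep L v = j then B v y else 0) = hat L K j y"
      using hatB[OF _ j] interior_subset by fastforce
  qed (use x in auto)
  have gr: "grad (hat L K j) x = (\<Sum>v\<in>C. if rep L v = j then \<beta> v else 0)" if j: "j \<in> nodes L K" for j
    unfolding grad_def pd_eqI[OF der[OF j]] by (simp add: vec_eq_iff inner_axis)
  have "cell_data L K h \<kappa> x C (\<lambda>v. B v x) \<beta>"
    unfolding cell_data_def
    using C(1,3) B0[OF xS] dist \<beta>n vert_rep_node[OF S] B1[OF xS] s0' s1 bx hatB[OF xS] der gr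
    by (auto simp: C_def)
  then show ?thesis by blast
qed

end

section \<open>Periodic Lipschitz functions\<close>

lemma integral_translate_cbox:
  fixes f :: "'a::euclidean_space \<Rightarrow> real"
  assumes "f integrable_on cbox a b"
  shows "integral (cbox (a - c) (b - c)) (\<lambda>x. f (x + c)) = integral (cbox a b) f"
  using has_integral_affinity'[OF integrable_integral[OF assms], of 1 c] by (simp add: integral_unique)

lemma integral_periodic_shift:
  fixes f :: "real^'d \<Rightarrow> real"
  assumes f: "continuous_on UNIV f" "lat_per L f" and \<tau>: "0 \<le> \<tau>" "\<tau> \<le> L$k" and L: "\<forall>j. L$j > 0"
  shows "integral (cbox 0 L) (\<lambda>x. f (x + \<tau> *\<^sub>R axis k 1)) = integral (cbox 0 L) f"
proof -
  define e :: "real^'d" where "e = axis k 1"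
  have ek: "e $ j = (if j = k then 1 else 0)" for j by (simp add: e_def axis_def)
  have int: "f integrable_on cbox a b" for a b
    using f(1) continuous_on_subset by (intro integrable_continuous) blast
  have hi: "(f has_integral (integral (cbox a b) f)) (cbox a b)" for a b using int by (rule integrable_integral)
  have neg: "negligible {x::real^'d. x$k = c}" for c
    using negligible_standard_hyperplane[of "axis k 1 :: real^'d" c] by (simp add: inner_axis axis_in_Basis_iff)
  have Lj: "\<And>j. 0 \<le> L$j" using L less_imp_le by blast
  have 1: "integral (cbox (\<tau> *\<^sub>R e) (L + \<tau> *\<^sub>R e)) f = integral (cbox (\<tau> *\<^sub>R e) L) f + integral (cbox (L$k *\<^sub>R e) (L + \<tau> *\<^sub>R e)) f"
  proof -
    have *: "cbox (\<tau> *\<^sub>R e) (L + \<tau> *\<^sub>R e) = cbox (\<tau> *\<^sub>R e) L \<union> cbox (L$k *\<^sub>R e) (L + \<tau> *\<^sub>R e)"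
    proof (intro equalityI subsetI)
      fix x assume x: "x \<in> cbox (\<tau> *\<^sub>R e) (L + \<tau> *\<^sub>R e)"
      then have xj: "(if j = k then \<tau> else 0) \<le> x$j \<and> x$j \<le> L$j + (if j = k then \<tau> else 0)" for j
        by (auto simp: mem_box_cart ek dest: spec[of _ j])
      show "x \<in> cbox (\<tau> *\<^sub>R e) L \<union> cbox (L$k *\<^sub>R e) (L + \<tau> *\<^sub>R e)"
      proof (cases "x$k \<le> L$k")
        case True
        have "x \<in> cbox (\<tau> *\<^sub>R e) L" unfolding mem_box_cart
        proof
          fix i show "(\<tau> *\<^sub>R e)$i \<le> x$i \<and> x$i \<le> (L)$i"
            using xj[of i] True Lj[of i] by (cases "i = k") (auto simp: ek)
        qed
        then show ?thesis by blast
      next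
        case False
        have "x \<in> cbox (L$k *\<^sub>R e) (L + \<tau> *\<^sub>R e)" unfolding mem_box_cart
        proof
          fix i show "(L$k *\<^sub>R e)$i \<le> x$i \<and> x$i \<le> (L + \<tau> *\<^sub>R e)$i"
            using xj[of i] False Lj[of i] by (cases "i = k") (auto simp: ek)
        qed
        then show ?thesis by blast
      qed
    next
      fix x assume "x \<in> cbox (\<tau> *\<^sub>R e) L \<union> cbox (L$k *\<^sub>R e) (L + \<tau> *\<^sub>R e)"
      then have xx: "(if j = k then \<tau> else 0) \<le> x$j \<and> x$j \<le> L$j + (if j = k then \<tau> else 0)" for j
        using \<tau> by (auto simp: mem_box_cart ek dest!: spec[of _ j] split: if_splits)
      show "x \<in> cbox (\<tau> *\<^sub>R e) (L + \<tau> *\<^sub>R e)" unfolding mem_box_cart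
      proof
        fix i show "(\<tau> *\<^sub>R e)$i \<le> x$i \<and> x$i \<le> (L + \<tau> *\<^sub>R e)$i"
          using xx[of i] by (cases "i = k") (auto simp: ek)
      qed
    qed
    have "cbox (\<tau> *\<^sub>R e) L \<inter> cbox (L$k *\<^sub>R e) (L + \<tau> *\<^sub>R e) \<subseteq> {x. x$k = L$k}"
      by (auto simp: mem_box_cart ek dest!: spec[of _ k])
    then show ?thesis unfolding * using has_integral_Un[OF hi hi negligible_subset[OF neg]] by (simp add: integral_unique)
  qed
  have 2: "integral (cbox 0 L) f = integral (cbox 0 (L + (\<tau> - L$k) *\<^sub>R e)) f + integral (cbox (\<tau> *\<^sub>R e) L) f"
  proof -
    have *: "cbox 0 L = cbox 0 (L + (\<tau> - L$k) *\<^sub>R e) \<union> cbox (\<tau> *\<^sub>R e) L"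
    proof (intro equalityI subsetI)
      fix x assume x: "x \<in> cbox 0 L"
      then have xj: "0 \<le> x$j \<and> x$j \<le> L$j" for j by (auto simp: mem_box_cart dest: spec[of _ j])
      show "x \<in> cbox 0 (L + (\<tau> - L$k) *\<^sub>R e) \<union> cbox (\<tau> *\<^sub>R e) L"
      proof (cases "x$k \<le> \<tau>")
        case True
        have "x \<in> cbox 0 (L + (\<tau> - L$k) *\<^sub>R e)" unfolding mem_box_cart
        proof
          fix i show "(0::real^'d)$i \<le> x$i \<and> x$i \<le> (L + (\<tau> - L$k) *\<^sub>R e)$i"
            using xj[of i] True Lj[of i] by (cases "i = k") (auto simp: ek)
        qed
        then show ?thesis by blast
      next
        case False
        have "x \<in> cbox (\<tau> *\<^sub>R e) L" unfolding mem_box_cart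
        proof
          fix i show "(\<tau> *\<^sub>R e)$i \<le> x$i \<and> x$i \<le> (L)$i"
            using xj[of i] False Lj[of i] by (cases "i = k") (auto simp: ek)
        qed
        then show ?thesis by blast
      qed
    next
      fix x assume "x \<in> cbox 0 (L + (\<tau> - L$k) *\<^sub>R e) \<union> cbox (\<tau> *\<^sub>R e) L"
      then have "0 \<le> x$j \<and> x$j \<le> L$j" for j
        using \<tau> by (auto simp: mem_box_cart ek dest!: spec[of _ j] split: if_splits)
      then show "x \<in> cbox 0 L" by (auto simp: mem_box_cart ek)
    qed
    have "cbox 0 (L + (\<tau> - L$k) *\<^sub>R e) \<inter> cbox (\<tau> *\<^sub>R e) L \<subseteq> {x. x$k = \<tau>}"
      by (auto simp: mem_box_cart ek dest!: spec[of _ k])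
    then show ?thesis unfolding * using has_integral_Un[OF hi hi negligible_subset[OF neg]] by (simp add: integral_unique)
  qed
  have 3: "integral (cbox 0 L) (\<lambda>x. f (x + \<tau> *\<^sub>R e)) = integral (cbox (\<tau> *\<^sub>R e) (L + \<tau> *\<^sub>R e)) f"
    using integral_translate_cbox[OF int, of "\<tau> *\<^sub>R e" "\<tau> *\<^sub>R e" "L + \<tau> *\<^sub>R e"] by simp
  have "integral (cbox (L$k *\<^sub>R e) (L + \<tau> *\<^sub>R e)) f = integral (cbox 0 (L + (\<tau> - L$k) *\<^sub>R e)) (\<lambda>x. f (x + L$k *\<^sub>R e))"
    using integral_translate_cbox[OF int, of "L$k *\<^sub>R e" "L$k *\<^sub>R e" "L + \<tau> *\<^sub>R e"] by (simp add: algebra_simps)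
  also have "(\<lambda>x. f (x + L$k *\<^sub>R e)) = f" using f(2) by (simp add: lat_per_def e_def)
  finally show ?thesis using 1 2 3 unfolding e_def by simp
qed

lemma pd_LIMSEQ:
  fixes f :: "real^'d \<Rightarrow> real"
  assumes "f differentiable (at x)" "\<tau> \<longlonglongrightarrow> 0" "\<And>n. \<tau> n \<noteq> (0::real)"
  shows "(\<lambda>n. (f (x + \<tau> n *\<^sub>R e) - f x) / \<tau> n) \<longlonglongrightarrow> pd f e x"
proof -
  obtain f' where f': "(f has_derivative f') (at x)" using assms(1) by (auto simp: differentiable_def)
  have "((\<lambda>t. f (x + t *\<^sub>R e)) has_derivative (\<lambda>t. f' (t *\<^sub>R e))) (at 0)"
  proof -
    have "((\<lambda>t. x + t *\<^sub>R e) has_derivative (\<lambda>t. t *\<^sub>R e)) (at 0)" by (auto intro!: derivative_eq_intros)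
    then show ?thesis using has_derivative_compose[of "\<lambda>t. x + t *\<^sub>R e" "\<lambda>t. t *\<^sub>R e" 0 UNIV f f'] f' by simp
  qed
  moreover have "(\<lambda>t. f' (t *\<^sub>R e)) = (\<lambda>t. f' e * t)"
    using linear_scale[OF has_derivative_linear[OF f']] by (simp add: mult.commute)
  ultimately have "DERIV (\<lambda>t. f (x + t *\<^sub>R e)) 0 :> f' e" by (simp add: has_field_derivative_def)
  then have "((\<lambda>t. (f (x + t *\<^sub>R e) - f x) / t) \<longlongrightarrow> f' e) (at 0)" by (simp add: DERIV_def)
  then have "(\<lambda>n. (f (x + \<tau> n *\<^sub>R e) - f x) / \<tau> n) \<longlonglongrightarrow> f' e"
    using filterlim_compose[of _ _ "at 0" \<tau> sequentially] assms(2,3) by (fastforce simp: filterlim_at)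
  then show ?thesis using pd_eqI[OF f'] by simp
qed

text \<open>The derivative of a periodic Lipschitz function has mean zero: difference quotients do, by
  translation invariance, and they converge dominatedly.\<close>

lemma pd_periodic_lipschitz:
  fixes f :: "real^'d \<Rightarrow> real"
  assumes L: "\<forall>j. L$j > 0" and f: "continuous_on UNIV f" "lat_per L f" and lip: "C-lipschitz_on (cbox (-1) (L + 1)) f"
    and N: "negligible N" "\<And>x. x \<in> cbox 0 L - N \<Longrightarrow> f differentiable (at x)"
  shows "pd f (axis k 1) \<in> borel_measurable (lebesgue_on (cbox 0 L))"
    and "integral\<^sup>L (lebesgue_on (cbox 0 L)) (pd f (axis k 1)) = 0"
    and "x \<in> cbox 0 L \<Longrightarrow> \<bar>pd f (axis k 1) x\<bar> \<le> C"
proof -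
  define e :: "real^'d" where "e = axis k 1"
  \<comment> \<open>Steps below 1 keep shifted points in the enlarged box where the Lipschitz bound
    holds; steps below \<open>L$k\<close> allow \<open>integral_periodic_shift\<close>.\<close>
  obtain m0 :: nat where m0: "1 / real (Suc m0) < min 1 (L$k)"
    using L reals_Archimedean[of "min 1 (L$k)"] by (auto simp: inverse_eq_divide)
  define \<tau> where "\<tau> n = 1 / real (Suc (n + m0))" for n
  have \<tau>pos: "\<tau> n > 0" for n by (simp add: \<tau>_def)
  have \<tau>le: "\<tau> n \<le> min 1 (L$k)" for n
  proof -
    have "\<tau> n \<le> 1 / real (Suc m0)" unfolding \<tau>_def by (intro divide_left_mono) auto
    then show ?thesis using m0 by linarith
  qed
  have \<tau>0: "\<tau> \<longlonglongrightarrow> 0" unfolding \<tau>_def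
    using LIMSEQ_ignore_initial_segment[OF LIMSEQ_inverse_real_of_nat, of m0] by (simp add: inverse_eq_divide)
  define q where "q n x = (f (x + \<tau> n *\<^sub>R e) - f x) / \<tau> n" for n x
  have C0: "C \<ge> 0" using lip lipschitz_on_nonneg by blast
  have qC: "\<bar>q n x\<bar> \<le> C" if x: "x \<in> cbox 0 L" for n x
  proof -
    have xj: "0 \<le> x$j \<and> x$j \<le> L$j" for j using x by (auto simp: mem_box_cart dest: spec[of _ j])
    have 1: "x \<in> cbox (-1) (L + 1)" unfolding mem_box_cart
    proof
      fix j show "(-1::real^'d)$j \<le> x$j \<and> x$j \<le> (L + 1)$j" using xj[of j] by simp
    qed
    have 2: "x + \<tau> n *\<^sub>R e \<in> cbox (-1) (L + 1)" unfolding mem_box_cart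
    proof
      fix j show "(-1::real^'d)$j \<le> (x + \<tau> n *\<^sub>R e)$j \<and> (x + \<tau> n *\<^sub>R e)$j \<le> (L + 1)$j"
        using xj[of j] \<tau>le[of n] \<tau>pos[of n] by (cases "j = k") (auto simp: e_def axis_def)
    qed
    have "\<bar>f (x + \<tau> n *\<^sub>R e) - f x\<bar> \<le> C * \<tau> n"
      using lipschitz_onD[OF lip 2 1] \<tau>pos[of n] by (simp add: dist_norm e_def)
    then show ?thesis unfolding q_def using \<tau>pos[of n] by (simp add: abs_divide pos_divide_le_eq)
  qed
  have qlim: "(\<lambda>n. q n x) \<longlonglongrightarrow> pd f e x" if "f differentiable (at x)" for x
    unfolding q_def by (rule pd_LIMSEQ[OF that \<tau>0]) (use \<tau>pos less_imp_neq in \<open>metis\<close>)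
  have qcont: "continuous_on UNIV (q n)" for n
  proof -
    have "continuous_on UNIV (\<lambda>x. f (x + \<tau> n *\<^sub>R e))"
      by (rule continuous_on_compose2[OF f(1)]) (auto intro!: continuous_intros)
    then show ?thesis unfolding q_def using \<tau>pos[of n] f(1) by (intro continuous_intros) auto
  qed
  let ?\<Lambda> = "lebesgue_on (cbox 0 L)"
  have qm: "q n \<in> borel_measurable ?\<Lambda>" for n
    using continuous_imp_measurable_on_sets_lebesgue[OF continuous_on_subset[OF qcont]] by (simp add: lmeasurable_cbox)
  have fin: "finite_measure ?\<Lambda>" by (rule finite_measure_lebesgue_on) simp
  have qint: "integrable ?\<Lambda> (q n)" for n
    by (rule finite_measure.integrable_const_bound[OF fin, of _ C]) (use qC qm in \<open>auto intro!: AE_I2\<close>)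
  have q0: "integral\<^sup>L ?\<Lambda> (q n) = 0" for n
  proof -
    have "integral\<^sup>L ?\<Lambda> (q n) = integral (cbox 0 L) (q n)"
      by (rule lebesgue_integral_eq_integral[OF qint]) simp
    also have "\<dots> = (integral (cbox 0 L) (\<lambda>x. f (x + \<tau> n *\<^sub>R e)) - integral (cbox 0 L) f) / \<tau> n"
    proof -
      have i1: "(\<lambda>x. f (x + \<tau> n *\<^sub>R e)) integrable_on cbox 0 L"
        by (rule integrable_continuous, rule continuous_on_compose2[OF f(1)]) (auto intro!: continuous_intros)
      have i2: "f integrable_on cbox 0 L" using f(1) continuous_on_subset by (intro integrable_continuous) blast
      show ?thesis unfolding q_def using integral_diff[OF i1 i2] by simp
    qed
    also have "\<dots> = 0" using integral_periodic_shift[OF f, of "\<tau> n" k] \<tau>pos[of n] \<tau>le[of n] L by (simp add: e_def)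
    finally show ?thesis .
  qed
  have ae: "AE x in ?\<Lambda>. (\<lambda>n. q n x) \<longlonglongrightarrow> pd f e x"
  proof (rule AE_I'[of "N \<inter> cbox 0 L"])
    show "N \<inter> cbox 0 L \<in> null_sets ?\<Lambda>"
      using N(1) by (subst null_sets_restrict_space) (auto simp: negligible_iff_null_sets[symmetric] negligible_Int)
    show "{x \<in> space ?\<Lambda>. \<not> (\<lambda>n. q n x) \<longlonglongrightarrow> pd f e x} \<subseteq> N \<inter> cbox 0 L"
      using qlim N(2) by auto
  qed
  \<comment> \<open>Off \<open>N\<close> the derivative is the limit of continuous difference
    quotients; a change on a negligible set preserves Lebesgue measurability.\<close>
  have meas: "pd f e \<in> borel_measurable ?\<Lambda>"
  proof -
    have "(\<lambda>x. lim (\<lambda>n. q n x)) \<in> borel_measurable ?\<Lambda>" using qm by measurable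
    then have "(\<lambda>x. lim (\<lambda>n. q n x)) measurable_on cbox 0 L" by (simp add: measurable_on_iff_borel_measurable)
    then have "pd f e measurable_on cbox 0 L"
      by (rule measurable_on_spike[OF _ N(1)]) (use qlim N(2) limI in metis)
    then show ?thesis by (simp add: measurable_on_iff_borel_measurable)
  qed
  then show "pd f (axis k 1) \<in> borel_measurable ?\<Lambda>" by (simp add: e_def)
  have "(\<lambda>n. integral\<^sup>L ?\<Lambda> (q n)) \<longlonglongrightarrow> integral\<^sup>L ?\<Lambda> (pd f e)"
    by (rule integral_dominated_convergence[where w="\<lambda>_. C"])
       (use qm meas ae qC fin in \<open>auto simp: finite_measure.integrable_const intro!: AE_I2\<close>)
  then show "integral\<^sup>L ?\<Lambda> (pd f (axis k 1)) = 0" using q0 LIMSEQ_unique[OF tendsto_const] by (fastforce simp: e_def)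
  show "\<bar>pd f (axis k 1) x\<bar> \<le> C" if "x \<in> cbox 0 L"
  proof (cases "f differentiable (at x)")
    case True
    have "(\<lambda>n. \<bar>q n x\<bar>) \<longlonglongrightarrow> \<bar>pd f e x\<bar>" using qlim[OF True] by (rule tendsto_rabs)
    then show ?thesis unfolding e_def[symmetric] using qC[OF that] by (intro LIMSEQ_le_const2) auto
  next
    case False then show ?thesis using C0 by (simp add: pd_def)
  qed
qed

text \<open>The class in which integration by parts is carried out: it contains the hat functions,
  is closed under sums and products, and its derivatives have mean zero. The Lipschitz bound is
  asked on a larger box because difference quotients at points of the box reach outside it.\<close>

definition perlip :: "real^'d \<Rightarrow> (real^'d \<Rightarrow> real) \<Rightarrow> bool" where
  "perlip L f \<longleftrightarrow> continuous_on UNIV f \<and> lat_per L f \<and> (\<exists>C. C-lipschitz_on (cbox (-1) (L + 1)) f) \<and>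
     (\<exists>N. negligible N \<and> (\<forall>x\<in>cbox 0 L - N. f differentiable (at x)))"

lemma AE_lebesgue_on_cboxI:
  assumes "negligible N" "\<And>x. x \<in> cbox a b - N \<Longrightarrow> P x"
  shows "AE x in lebesgue_on (cbox a b). P x"
proof (rule AE_I'[of "N \<inter> cbox a b"])
  show "N \<inter> cbox a b \<in> null_sets (lebesgue_on (cbox a b))"
    using assms(1) by (subst null_sets_restrict_space) (auto simp: negligible_iff_null_sets[symmetric] negligible_Int)
qed (use assms(2) in auto)

lemma integrable_lebesgue_on_cboxI:
  fixes f :: "'a::euclidean_space \<Rightarrow> 'b::{banach,second_countable_topology}"
  assumes "f \<in> borel_measurable (lebesgue_on (cbox a b))" "\<And>x. x \<in> cbox a b \<Longrightarrow> norm (f x) \<le> C"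
  shows "integrable (lebesgue_on (cbox a b)) f"
  by (rule finite_measure.integrable_const_bound[OF finite_measure_lebesgue_on, of _ _ C])
     (use assms in \<open>auto intro!: AE_I2\<close>)

lemma continuous_measurable_lebesgue_on_cbox:
  "continuous_on UNIV f \<Longrightarrow> f \<in> borel_measurable (lebesgue_on (cbox a b))"
  by (rule continuous_imp_measurable_on_sets_lebesgue[OF continuous_on_subset]) auto

lemma perlip_pd:
  assumes "perlip L f" "\<forall>j. L$j > 0"
  shows "pd f (axis k 1) \<in> borel_measurable (lebesgue_on (cbox 0 L))"
    and "integral\<^sup>L (lebesgue_on (cbox 0 L)) (pd f (axis k 1)) = 0"
    and "\<exists>C. \<forall>x\<in>cbox 0 L. \<bar>pd f (axis k 1) x\<bar> \<le> C"
    and "integrable (lebesgue_on (cbox 0 L)) (pd f (axis k 1))"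
    and "AE x in lebesgue_on (cbox 0 L). f differentiable (at x)"
proof -
  obtain C N where f: "continuous_on UNIV f" "lat_per L f" "C-lipschitz_on (cbox (-1) (L + 1)) f"
    "negligible N" "\<forall>x\<in>cbox 0 L - N. f differentiable (at x)" using assms(1) unfolding perlip_def by blast
  note * = pd_periodic_lipschitz[OF assms(2) f(1-4), where k=k] 
  show 1: "pd f (axis k 1) \<in> borel_measurable (lebesgue_on (cbox 0 L))" using *(1) f(5) by blast
  show "integral\<^sup>L (lebesgue_on (cbox 0 L)) (pd f (axis k 1)) = 0" using *(2) f(5) by blast
  have 3: "\<And>x. x\<in>cbox 0 L \<Longrightarrow> \<bar>pd f (axis k 1) x\<bar> \<le> C" using *(3) f(5) by blast
  then show "\<exists>C. \<forall>x\<in>cbox 0 L. \<bar>pd f (axis k 1) x\<bar> \<le> C" by blast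
  show "integrable (lebesgue_on (cbox 0 L)) (pd f (axis k 1))"
    by (rule integrable_lebesgue_on_cboxI[OF 1, of C]) (use 3 in simp)
  show "AE x in lebesgue_on (cbox 0 L). f differentiable (at x)"
    by (rule AE_lebesgue_on_cboxI[OF f(4)]) (use f(5) in blast)
qed

lemma perlip_mult:
  assumes "perlip L f" "perlip L g"
  shows "perlip L (\<lambda>x. f x * g x)"
proof -
  obtain C N where f: "continuous_on UNIV f" "lat_per L f" "C-lipschitz_on (cbox (-1) (L + 1)) f"
    "negligible N" "\<forall>x\<in>cbox 0 L - N. f differentiable (at x)" using assms(1) unfolding perlip_def by blast
  obtain C' N' where g: "continuous_on UNIV g" "lat_per L g" "C'-lipschitz_on (cbox (-1) (L + 1)) g"
    "negligible N'" "\<forall>x\<in>cbox 0 L - N'. g differentiable (at x)" using assms(2) unfolding perlip_def by blast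
  let ?B = "cbox (-1) (L + 1)"
  have bd: "\<exists>B\<ge>0. \<forall>x\<in>?B. \<bar>k x\<bar> \<le> B" if "continuous_on UNIV k" for k :: "real^'a \<Rightarrow> real"
  proof -
    have "bounded (k ` ?B)" by (intro compact_imp_bounded compact_continuous_image continuous_on_subset[OF that]) auto
    then obtain B where "\<forall>x\<in>?B. \<bar>k x\<bar> \<le> B" unfolding bounded_iff by auto
    then show ?thesis by (intro exI[of _ "max 0 B"]) fastforce
  qed
  obtain Bf where Bf: "Bf \<ge> 0" "\<forall>x\<in>?B. \<bar>f x\<bar> \<le> Bf" using bd[OF f(1)] by blast
  obtain Bg where Bg: "Bg \<ge> 0" "\<forall>x\<in>?B. \<bar>g x\<bar> \<le> Bg" using bd[OF g(1)] by blast
  have C: "C \<ge> 0" "C' \<ge> 0" using f(3) g(3) lipschitz_on_nonneg by blast+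
  have "(Bf * C' + Bg * C)-lipschitz_on ?B (\<lambda>x. f x * g x)"
  proof (rule lipschitz_onI)
    fix x y assume xy: "x \<in> ?B" "y \<in> ?B"
    have "f x * g x - f y * g y = f x * (g x - g y) + g y * (f x - f y)" by (simp add: algebra_simps)
    then have "\<bar>f x * g x - f y * g y\<bar> \<le> \<bar>f x\<bar> * \<bar>g x - g y\<bar> + \<bar>g y\<bar> * \<bar>f x - f y\<bar>"
      by (simp add: abs_mult[symmetric] abs_triangle_ineq)
    also have "\<dots> \<le> Bf * (C' * dist x y) + Bg * (C * dist x y)"
      using lipschitz_onD[OF f(3) xy] lipschitz_onD[OF g(3) xy] Bf Bg xy
      by (intro add_mono mult_mono) (auto simp: dist_real_def)
    finally show "dist (f x * g x) (f y * g y) \<le> (Bf * C' + Bg * C) * dist x y" by (simp add: dist_real_def algebra_simps)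
  qed (use C Bf Bg in simp)
  moreover have "lat_per L (\<lambda>x. f x * g x)" using f(2) g(2) by (simp add: lat_per_def)
  moreover have "negligible (N \<union> N')" using f(4) g(4) by simp
  moreover have "\<forall>x\<in>cbox 0 L - (N \<union> N'). (\<lambda>x. f x * g x) differentiable (at x)" using f(5) g(5) by auto
  moreover have "continuous_on UNIV (\<lambda>x. f x * g x)" using f(1) g(1) by (intro continuous_intros)
  ultimately show ?thesis unfolding perlip_def by blast
qed

lemma perlip_add:
  assumes "perlip L f" "perlip L g"
  shows "perlip L (\<lambda>x. f x + g x)"
proof -
  obtain C N where f: "continuous_on UNIV f" "lat_per L f" "C-lipschitz_on (cbox (-1) (L + 1)) f"
    "negligible N" "\<forall>x\<in>cbox 0 L - N. f differentiable (at x)" using assms(1) unfolding perlip_def by blast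
  obtain C' N' where g: "continuous_on UNIV g" "lat_per L g" "C'-lipschitz_on (cbox (-1) (L + 1)) g"
    "negligible N'" "\<forall>x\<in>cbox 0 L - N'. g differentiable (at x)" using assms(2) unfolding perlip_def by blast
  have "(C + C')-lipschitz_on (cbox (-1) (L + 1)) (\<lambda>x. f x + g x)" using f(3) g(3) by (rule lipschitz_on_add)
  moreover have "lat_per L (\<lambda>x. f x + g x)" using f(2) g(2) by (simp add: lat_per_def)
  moreover have "negligible (N \<union> N')" using f(4) g(4) by simp
  moreover have "\<forall>x\<in>cbox 0 L - (N \<union> N'). (\<lambda>x. f x + g x) differentiable (at x)" using f(5) g(5) by auto
  moreover have "continuous_on UNIV (\<lambda>x. f x + g x)" using f(1) g(1) by (intro continuous_intros)
  ultimately show ?thesis unfolding perlip_def by blast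
qed

lemma perlip_const: "perlip L (\<lambda>x. c)"
  unfolding perlip_def
  by (auto simp: lat_per_def intro!: exI[of _ "0::real"] exI[of _ "{}"] lipschitz_intros)

lemma perlip_sum: "(\<And>i. i \<in> I \<Longrightarrow> perlip L (f i)) \<Longrightarrow> perlip L (\<lambda>x. \<Sum>i\<in>I. f i x)"
  by (induction I rule: infinite_finite_induct) (auto intro: perlip_const perlip_add)

lemma inner_grad: "a \<bullet> grad f x = (\<Sum>k\<in>UNIV. a $ k * pd f (axis k 1) x)"
  by (simp add: grad_def inner_vec_def)

lemma grad_eq_sum: "grad f x = (\<Sum>k\<in>UNIV. pd f (axis k 1) x *\<^sub>R axis k 1)"
  by (simp add: grad_def vec_eq_iff axis_def if_distrib cong: if_cong)

section \<open>The matrices of the scheme as integrals\<close>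

text \<open>Mesh regularity enters the estimates through the single constant
  \<open>\<kappa>\<close>, which bounds the barycentric gradients by
  \<open>\<kappa> / h\<close>.\<close>

locale cmesh = pmesh L K for L :: "real^'d" and K :: "(real^'d) set set" +
  fixes h \<kappa> :: real
  assumes hpos: "h > 0" and \<kappa>: "\<kappa> \<ge> 0"
    and good: "\<And>S x. S \<in> K \<Longrightarrow> x \<in> interior S \<Longrightarrow> \<exists>C b \<beta>. cell_data L K h \<kappa> x C b \<beta>"
begin

abbreviation "N \<equiv> nodes L K"
abbreviation "\<phi> \<equiv> hat L K"
abbreviation "\<Lambda> \<equiv> lebesgue_on (cbox 0 L)"

lemma AE_cell: "AE x in \<Lambda>. \<exists>C b \<beta>. cell_data L K h \<kappa> x C b \<beta>"
  by (rule AE_lebesgue_on_cboxI[OF negligible_bad_points[of "cbox 0 L"]]) (use good in auto)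

lemma hat_perlip: assumes "i \<in> N" shows "perlip L (\<phi> i)"
proof -
  let ?Z = "{x\<in>cbox 0 L. \<forall>S\<in>K. x \<notin> interior S}"
  have lip: "\<exists>C. C-lipschitz_on (cbox (-1) (L + 1)) (\<phi> i)"
    using hat_P1[of i] by (intro P1_lipschitz) (auto simp: P1_def)
  have diff: "\<forall>x\<in>cbox 0 L - ?Z. \<phi> i differentiable (at x)"
  proof
    fix x assume "x \<in> cbox 0 L - {x\<in>cbox 0 L. \<forall>S\<in>K. x \<notin> interior S}"
    then obtain S where "S \<in> K" "x \<in> interior S" by blast
    then obtain C b \<beta> where "cell_data L K h \<kappa> x C b \<beta>" using good by blast
    then show "\<phi> i differentiable (at x)" using assms unfolding cell_data_def differentiable_def by blast
  qed
  have "\<exists>Z. negligible Z \<and> (\<forall>x\<in>cbox 0 L - Z. \<phi> i differentiable (at x))"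
    by (rule exI[of _ ?Z], rule conjI[OF negligible_bad_points diff]) simp
  then show ?thesis unfolding perlip_def using hat_continuous hat_per lip by simp
qed

lemma grad_hat_measurable: "i \<in> N \<Longrightarrow> grad (\<phi> i) \<in> borel_measurable \<Lambda>"
  unfolding grad_eq_sum using perlip_pd(1)[OF hat_perlip Lpos] by measurable

lemma grad_hat_bounded: assumes "i \<in> N" shows "\<exists>C. \<forall>x\<in>cbox 0 L. norm (grad (\<phi> i) x) \<le> C"
proof -
  have "\<forall>k. \<exists>C. \<forall>x\<in>cbox 0 L. \<bar>pd (\<phi> i) (axis k 1) x\<bar> \<le> C" using perlip_pd(3)[OF hat_perlip[OF assms] Lpos] by blast
  from choice[OF this] obtain C where C: "\<forall>k. \<forall>x\<in>cbox 0 L. \<bar>pd (\<phi> i) (axis k 1) x\<bar> \<le> C k" by blast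
  have "norm (grad (\<phi> i) x) \<le> sum C UNIV" if "x \<in> cbox 0 L" for x
  proof -
    have "norm (grad (\<phi> i) x) \<le> (\<Sum>k\<in>UNIV. \<bar>grad (\<phi> i) x $ k\<bar>)" by (rule norm_le_l1_cart)
    also have "\<dots> \<le> sum C UNIV" using C that by (intro sum_mono) (simp add: grad_def)
    finally show ?thesis .
  qed
  then show ?thesis by blast
qed

lemma hat_measurable: "\<phi> i \<in> borel_measurable \<Lambda>"
  by (rule continuous_measurable_lebesgue_on_cbox[OF hat_continuous])

lemma integrable_hat_grad:
  assumes "i \<in> N" "j \<in> N"
  shows "integrable \<Lambda> (\<lambda>x. \<phi> i x *\<^sub>R grad (\<phi> j) x)"
proof -
  obtain C where C: "\<forall>x\<in>cbox 0 L. norm (grad (\<phi> j) x) \<le> C" using grad_hat_bounded[OF assms(2)] by blast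
  show ?thesis
  proof (rule integrable_lebesgue_on_cboxI[where C=C])
    fix x assume "x \<in> cbox 0 L"
    then show "norm (\<phi> i x *\<^sub>R grad (\<phi> j) x) \<le> C"
      using C hat_nonneg[OF assms(1), of x] hat_le_1[OF assms(1), of x]
        mult_mono[of "\<phi> i x" 1 "norm (grad (\<phi> j) x)" C] by simp
  qed (use hat_measurable grad_hat_measurable[OF assms(2)] in measurable)
qed

lemma cc_inner:
  assumes "i \<in> N" "j \<in> N"
  shows "integrable \<Lambda> (\<lambda>x. \<phi> i x * (a \<bullet> grad (\<phi> j) x))" "a \<bullet> cc L K i j = (\<integral>x. \<phi> i x * (a \<bullet> grad (\<phi> j) x) \<partial>\<Lambda>)"
proof -
  have i: "integrable \<Lambda> (\<lambda>x. \<phi> i x *\<^sub>R grad (\<phi> j) x)" by (rule integrable_hat_grad[OF assms])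
  have "cc L K i j = (\<integral>x. \<phi> i x *\<^sub>R grad (\<phi> j) x \<partial>\<Lambda>)"
    unfolding cc_def by (rule lebesgue_integral_eq_integral[symmetric, OF i]) simp
  then have "a \<bullet> cc L K i j = (\<integral>x. a \<bullet> (\<phi> i x *\<^sub>R grad (\<phi> j) x) \<partial>\<Lambda>)"
    using integral_inner_right[of a \<Lambda> "\<lambda>x. \<phi> i x *\<^sub>R grad (\<phi> j) x"] i by simp
  then show "a \<bullet> cc L K i j = (\<integral>x. \<phi> i x * (a \<bullet> grad (\<phi> j) x) \<partial>\<Lambda>)" by simp
  show "integrable \<Lambda> (\<lambda>x. \<phi> i x * (a \<bullet> grad (\<phi> j) x))"
    using integrable_inner_right[of a \<Lambda> "\<lambda>x. \<phi> i x *\<^sub>R grad (\<phi> j) x"] i by simp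
qed

text \<open>Moves a double sum over nodes under the integral, where it can be evaluated at almost
  every point by the data of one cell.\<close>

lemma sum_cc:
  shows "integrable \<Lambda> (\<lambda>x. \<Sum>i\<in>N. \<Sum>j\<in>N. \<phi> i x * (a i j \<bullet> grad (\<phi> j) x))"
   and "(\<Sum>i\<in>N. \<Sum>j\<in>N. a i j \<bullet> cc L K i j) = (\<integral>x. (\<Sum>i\<in>N. \<Sum>j\<in>N. \<phi> i x * (a i j \<bullet> grad (\<phi> j) x)) \<partial>\<Lambda>)"
proof -
  show "integrable \<Lambda> (\<lambda>x. \<Sum>i\<in>N. \<Sum>j\<in>N. \<phi> i x * (a i j \<bullet> grad (\<phi> j) x))"
    by (intro Bochner_Integration.integrable_sum cc_inner(1))
  have "(\<integral>x. (\<Sum>i\<in>N. \<Sum>j\<in>N. \<phi> i x * (a i j \<bullet> grad (\<phi> j) x)) \<partial>\<Lambda>) = (\<Sum>i\<in>N. \<integral>x. (\<Sum>j\<in>N. \<phi> i x * (a i j \<bullet> grad (\<phi> j) x)) \<partial>\<Lambda>)"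
    by (intro Bochner_Integration.integral_sum Bochner_Integration.integrable_sum cc_inner(1))
  also have "\<dots> = (\<Sum>i\<in>N. \<Sum>j\<in>N. a i j \<bullet> cc L K i j)"
  proof (intro sum.cong refl)
    fix i assume "i \<in> N"
    then show "(\<integral>x. (\<Sum>j\<in>N. \<phi> i x * (a i j \<bullet> grad (\<phi> j) x)) \<partial>\<Lambda>) = (\<Sum>j\<in>N. a i j \<bullet> cc L K i j)"
      by (subst Bochner_Integration.integral_sum) (auto intro!: cc_inner(1) sum.cong simp: cc_inner(2)[symmetric])
  qed
  finally show "(\<Sum>i\<in>N. \<Sum>j\<in>N. a i j \<bullet> cc L K i j) = (\<integral>x. (\<Sum>i\<in>N. \<Sum>j\<in>N. \<phi> i x * (a i j \<bullet> grad (\<phi> j) x)) \<partial>\<Lambda>)" by simp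
qed

lemma pd_mult:
  fixes f g :: "real^'d \<Rightarrow> real"
  assumes "f differentiable (at x)" "g differentiable (at x)"
  shows "pd (\<lambda>x. f x * g x) e x = f x * pd g e x + pd f e x * g x"
proof -
  obtain f' g' where d: "(f has_derivative f') (at x)" "(g has_derivative g') (at x)" using assms by (auto simp: differentiable_def)
  show ?thesis using pd_eqI[OF has_derivative_mult[OF d]] pd_eqI[OF d(1)] pd_eqI[OF d(2)] by simp
qed

text \<open>The product of two hat functions is periodic and Lipschitz, so its partial derivatives
  have mean zero; no boundary term appears on the torus.\<close>

lemma cc_antisym: assumes "i \<in> N" "j \<in> N" shows "cc L K i j = - cc L K j i"
proof -
  have "axis k 1 \<bullet> cc L K i j + axis k 1 \<bullet> cc L K j i = 0" for k
  proof -
    note P = hat_perlip[OF assms(1)] hat_perlip[OF assms(2)]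
    have "axis k 1 \<bullet> cc L K i j + axis k 1 \<bullet> cc L K j i
       = (\<integral>x. \<phi> i x * (axis k 1 \<bullet> grad (\<phi> j) x) + \<phi> j x * (axis k 1 \<bullet> grad (\<phi> i) x) \<partial>\<Lambda>)"
      using cc_inner[OF assms] cc_inner[OF assms(2,1)] by simp
    also have "\<dots> = (\<integral>x. pd (\<lambda>x. \<phi> i x * \<phi> j x) (axis k 1) x \<partial>\<Lambda>)"
    proof (rule integral_cong_AE)
      show "AE x in \<Lambda>. \<phi> i x * (axis k 1 \<bullet> grad (\<phi> j) x) + \<phi> j x * (axis k 1 \<bullet> grad (\<phi> i) x) = pd (\<lambda>x. \<phi> i x * \<phi> j x) (axis k 1) x"
        using perlip_pd(5)[OF P(1) Lpos] perlip_pd(5)[OF P(2) Lpos]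
        by eventually_elim (simp add: pd_mult inner_axis' grad_def)
    qed (use cc_inner(1)[OF assms] cc_inner(1)[OF assms(2,1)] perlip_pd(1)[OF perlip_mult[OF P] Lpos] in \<open>auto intro!: borel_measurable_add borel_measurable_integrable\<close>)
    also have "\<dots> = 0" by (rule perlip_pd(2)[OF perlip_mult[OF P] Lpos])
    finally show ?thesis .
  qed
  then have "cc L K i j $ k + cc L K j i $ k = 0" for k by (simp add: inner_axis')
  then show ?thesis by (simp add: vec_eq_iff eq_neg_iff_add_eq_0)
qed

lemma hat_mult_integrable: "i \<in> N \<Longrightarrow> j \<in> N \<Longrightarrow> integrable \<Lambda> (\<lambda>x. \<phi> i x * \<phi> j x)"
  by (rule integrable_lebesgue_on_cboxI[where C=1])
     (use hat_measurable hat_nonneg hat_le_1 in \<open>auto simp: abs_mult intro!: mult_le_one\<close>)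

lemma mm_eq: "i \<in> N \<Longrightarrow> j \<in> N \<Longrightarrow> mm L K i j = (\<integral>x. \<phi> i x * \<phi> j x \<partial>\<Lambda>)"
  unfolding mm_def by (rule lebesgue_integral_eq_integral[symmetric]) (auto intro: hat_mult_integrable)

lemma mm_sym: "mm L K i j = mm L K j i"
  unfolding mm_def by (simp add: mult.commute)

lemma mm_nonneg: "i \<in> N \<Longrightarrow> j \<in> N \<Longrightarrow> 0 \<le> mm L K i j"
  unfolding mm_eq using hat_nonneg by (intro integral_nonneg_AE) auto

lemma sum_mm:
  shows "integrable \<Lambda> (\<lambda>x. \<Sum>i\<in>N. \<Sum>j\<in>N. \<phi> i x * \<phi> j x * a i j)"
   and "(\<Sum>i\<in>N. \<Sum>j\<in>N. mm L K i j * a i j) = (\<integral>x. (\<Sum>i\<in>N. \<Sum>j\<in>N. \<phi> i x * \<phi> j x * a i j) \<partial>\<Lambda>)"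
proof -
  have i: "integrable \<Lambda> (\<lambda>x. \<phi> i x * \<phi> j x * a i j)" if "i \<in> N" "j \<in> N" for i j using hat_mult_integrable[OF that] by simp
  then show "integrable \<Lambda> (\<lambda>x. \<Sum>i\<in>N. \<Sum>j\<in>N. \<phi> i x * \<phi> j x * a i j)"
    by (intro Bochner_Integration.integrable_sum)
  have "(\<integral>x. (\<Sum>i\<in>N. \<Sum>j\<in>N. \<phi> i x * \<phi> j x * a i j) \<partial>\<Lambda>) = (\<Sum>i\<in>N. \<integral>x. (\<Sum>j\<in>N. \<phi> i x * \<phi> j x * a i j) \<partial>\<Lambda>)"
    by (intro Bochner_Integration.integral_sum Bochner_Integration.integrable_sum i)
  also have "\<dots> = (\<Sum>i\<in>N. \<Sum>j\<in>N. mm L K i j * a i j)"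
  proof (intro sum.cong refl)
    fix i assume iN: "i \<in> N"
    then show "(\<integral>x. (\<Sum>j\<in>N. \<phi> i x * \<phi> j x * a i j) \<partial>\<Lambda>) = (\<Sum>j\<in>N. mm L K i j * a i j)"
      by (subst Bochner_Integration.integral_sum) (auto intro!: i sum.cong simp: mm_eq hat_mult_integrable)
  qed
  finally show "(\<Sum>i\<in>N. \<Sum>j\<in>N. mm L K i j * a i j) = (\<integral>x. (\<Sum>i\<in>N. \<Sum>j\<in>N. \<phi> i x * \<phi> j x * a i j) \<partial>\<Lambda>)" by simp
qed

lemma lm_eq: "i \<in> N \<Longrightarrow> lm L K i = (\<integral>x. \<phi> i x \<partial>\<Lambda>)" and hat_integrable: "i \<in> N \<Longrightarrow> integrable \<Lambda> (\<phi> i)"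
proof -
  show i: "i \<in> N \<Longrightarrow> integrable \<Lambda> (\<phi> i)"
    by (rule integrable_lebesgue_on_cboxI[where C=1]) (use hat_measurable hat_nonneg hat_le_1 in auto)
  show "i \<in> N \<Longrightarrow> lm L K i = (\<integral>x. \<phi> i x \<partial>\<Lambda>)"
    unfolding lm_def using i by (intro lebesgue_integral_eq_integral[symmetric]) auto
qed

lemma sum_lm: "(\<Sum>i\<in>N. lm L K i * a i) = (\<integral>x. (\<Sum>i\<in>N. \<phi> i x * a i) \<partial>\<Lambda>)"
  using hat_integrable by (subst Bochner_Integration.integral_sum) (auto simp: lm_eq intro!: sum.cong)

lemma aa_antisym: "aa L K U i j = - aa L K U j i"
proof -
  have "(\<lambda>x. \<phi> j x * (uh L K U x \<bullet> grad (\<phi> i) x) - \<phi> i x * (uh L K U x \<bullet> grad (\<phi> j) x))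
     = (\<lambda>x. - (\<phi> i x * (uh L K U x \<bullet> grad (\<phi> j) x) - \<phi> j x * (uh L K U x \<bullet> grad (\<phi> i) x)))" by auto
  then have "aa L K U j i = (1/2) * integral (cbox 0 L) (\<lambda>x. - (\<phi> i x * (uh L K U x \<bullet> grad (\<phi> j) x) - \<phi> j x * (uh L K U x \<bullet> grad (\<phi> i) x)))"
    unfolding aa_def by (simp only:)
  then show ?thesis unfolding aa_def integral_neg by simp
qed

lemma nbr_sym: "nbr L K i j \<longleftrightarrow> nbr L K j i" unfolding nbr_def by blast

lemma du_off_sym: "(\<And>a b. al a b = al b a) \<Longrightarrow> du_off L K al U i j = du_off L K al U j i"
  unfolding du_off_def using aa_antisym[of U i j] nbr_sym[of i j] by simp

lemma nbr_refl: assumes "i \<in> N" shows "nbr L K i i"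
proof -
  have i: "i \<in> halfbox L" "i \<in> all_verts K" using assms by (auto simp: nodes_def)
  have "lat_equiv L i i" unfolding lat_equiv_def by (auto intro!: exI[of _ "0::int"])
  then have "\<phi> i i = 1" using hat_vert[OF i] lat_equiv_iff_rep[OF Lpos i(1), of i] by simp
  then show ?thesis unfolding nbr_def by (intro exI[of _ i]) simp
qed

lemma mm_not_nbr: "i \<in> N \<Longrightarrow> j \<in> N \<Longrightarrow> \<not> nbr L K i j \<Longrightarrow> mm L K i j = 0"
proof -
  assume "\<not> nbr L K i j"
  then have "(\<lambda>x. \<phi> i x * \<phi> j x) = (\<lambda>x. 0)" unfolding nbr_def by auto
  then show ?thesis unfolding mm_def by simp
qed

text \<open>Where \<open>\<phi> i\<close> is nonzero, an open set, \<open>\<phi> j\<close> vanishes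
  identically, and hence so does its gradient.\<close>

lemma cc_not_nbr: assumes "i \<in> N" "j \<in> N" "\<not> nbr L K i j" shows "cc L K i j = 0"
proof -
  have "\<phi> i x *\<^sub>R grad (\<phi> j) x = 0" for x
  proof (cases "\<phi> i x = 0")
    case False
    have op: "open {y. \<phi> i y \<noteq> 0}" using hat_continuous[of i] by (intro open_Collect_neq) auto
    have "(\<phi> j has_derivative (\<lambda>_. 0)) (at x)"
      by (rule has_derivative_transform_within_open[of "\<lambda>_. 0", OF _ op]) (use False assms(3) in \<open>auto simp: nbr_def\<close>)
    then have "pd (\<phi> j) e x = 0" for e by (rule pd_eqI)
    then show ?thesis by (simp add: grad_def vec_eq_iff)
  qed simp
  then have "(\<lambda>x. \<phi> i x *\<^sub>R grad (\<phi> j) x) = (\<lambda>x. 0)" by (rule ext)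
  then show ?thesis unfolding cc_def by (simp only: integral_0)
qed

end

section \<open>Consistency and dissipation of the scheme on a fixed mesh\<close>

locale cell_at = cmesh L K h \<kappa> for L :: "real^'d" and K h \<kappa> +
  fixes x :: "real^'d" and C b \<beta>
  assumes cd: "cell_data L K h \<kappa> x C b \<beta>"
begin

abbreviation "r \<equiv> rep L"

lemma finC: "finite C" and cardC: "card C = CARD('d) + 1" and sb: "sum b C = 1" and sx: "(\<Sum>v\<in>C. b v *\<^sub>R v) = x"
  and s0: "sum \<beta> C = 0" and s1: "(\<Sum>v\<in>C. (\<beta> v \<bullet> e) *\<^sub>R v) = e"
  using cd unfolding cell_data_def by auto

lemma b0: "v \<in> C \<Longrightarrow> 0 \<le> b v" and vdist: "v \<in> C \<Longrightarrow> norm (v - x) \<le> h"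
  and \<beta>le: "v \<in> C \<Longrightarrow> norm (\<beta> v) \<le> \<kappa> / h" and rN: "v \<in> C \<Longrightarrow> r v \<in> N"
  and bx: "v \<in> C \<Longrightarrow> w \<in> C \<Longrightarrow> \<beta> w \<bullet> (v - x) = (if v = w then 1 else 0) - b w"
  and hatx: "j \<in> N \<Longrightarrow> \<phi> j x = (\<Sum>v\<in>C. if r v = j then b v else 0)"
  and derx: "j \<in> N \<Longrightarrow> (\<phi> j has_derivative (\<lambda>e. (\<Sum>v\<in>C. if r v = j then \<beta> v else 0) \<bullet> e)) (at x)"
  and gradx: "j \<in> N \<Longrightarrow> grad (\<phi> j) x = (\<Sum>v\<in>C. if r v = j then \<beta> v else 0)"
  using cd unfolding cell_data_def by auto

lemma reindex: "(\<Sum>j\<in>N. \<Sum>v\<in>C. if r v = j then f j v else 0) = (\<Sum>v\<in>C. f (r v) v :: 'b::comm_monoid_add)"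
proof -
  have "(\<Sum>j\<in>N. \<Sum>v\<in>C. if r v = j then f j v else 0) = (\<Sum>v\<in>C. \<Sum>j\<in>N. if r v = j then f j v else 0)" by (rule sum.swap)
  also have "\<dots> = (\<Sum>v\<in>C. f (r v) v)" using rN finite_nodes by (intro sum.cong refl) simp
  finally show ?thesis .
qed

lemma hat_point: "(\<Sum>j\<in>N. \<phi> j x * F j) = (\<Sum>v\<in>C. b v * F (r v))"
proof -
  have "(\<Sum>j\<in>N. \<phi> j x * F j) = (\<Sum>j\<in>N. \<Sum>v\<in>C. if r v = j then b v * F j else 0)"
    by (intro sum.cong refl) (auto simp: hatx sum_distrib_right intro!: sum.cong)
  also have "\<dots> = (\<Sum>v\<in>C. b v * F (r v))" by (rule reindex)
  finally show ?thesis .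
qed

lemma uh_x: "uh L K U x = (\<Sum>v\<in>C. b v *\<^sub>R U (r v))"
proof -
  have "uh L K U x = (\<Sum>j\<in>N. \<Sum>v\<in>C. if r v = j then b v *\<^sub>R U j else 0)"
    unfolding uh_def by (intro sum.cong refl) (auto simp: hatx scaleR_sum_left intro!: sum.cong)
  also have "\<dots> = (\<Sum>v\<in>C. b v *\<^sub>R U (r v))" by (rule reindex)
  finally show ?thesis .
qed

lemma grad_point: "(\<Sum>j\<in>N. a j \<bullet> grad (\<phi> j) x) = (\<Sum>v\<in>C. a (r v) \<bullet> \<beta> v)"
proof -
  have "(\<Sum>j\<in>N. a j \<bullet> grad (\<phi> j) x) = (\<Sum>j\<in>N. \<Sum>v\<in>C. if r v = j then a j \<bullet> \<beta> v else 0)"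
    by (intro sum.cong refl) (auto simp: gradx inner_sum_right intro!: sum.cong)
  also have "\<dots> = (\<Sum>v\<in>C. a (r v) \<bullet> \<beta> v)" by (rule reindex)
  finally show ?thesis .
qed

text \<open>At \<open>x\<close> only the vertices of one cell contribute, so a sum over all pairs of
  nodes has at most (d + 1)^2 terms, independently of the mesh.\<close>

lemma cc_point: "(\<Sum>i\<in>N. \<Sum>j\<in>N. \<phi> i x * (a i j \<bullet> grad (\<phi> j) x)) = (\<Sum>v\<in>C. \<Sum>w\<in>C. b v * (a (r v) (r w) \<bullet> \<beta> w))"
proof -
  have "(\<Sum>i\<in>N. \<Sum>j\<in>N. \<phi> i x * (a i j \<bullet> grad (\<phi> j) x)) = (\<Sum>i\<in>N. \<phi> i x * (\<Sum>w\<in>C. a i (r w) \<bullet> \<beta> w))"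
    by (simp add: sum_distrib_left[symmetric] grad_point)
  also have "\<dots> = (\<Sum>v\<in>C. b v * (\<Sum>w\<in>C. a (r v) (r w) \<bullet> \<beta> w))" by (rule hat_point)
  finally show ?thesis by (simp add: sum_distrib_left)
qed

lemma mm_point: "(\<Sum>i\<in>N. \<Sum>j\<in>N. \<phi> i x * \<phi> j x * a i j) = (\<Sum>v\<in>C. \<Sum>w\<in>C. b v * b w * a (r v) (r w))"
proof -
  have "(\<Sum>i\<in>N. \<Sum>j\<in>N. \<phi> i x * \<phi> j x * a i j) = (\<Sum>i\<in>N. \<phi> i x * (\<Sum>w\<in>C. b w * a i (r w)))"
    by (simp add: sum_distrib_left[symmetric] hat_point mult.assoc)
  also have "\<dots> = (\<Sum>v\<in>C. b v * (\<Sum>w\<in>C. b w * a (r v) (r w)))" by (rule hat_point)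
  finally show ?thesis by (simp add: sum_distrib_left mult.assoc)
qed

text \<open>An inequality, unlike \<open>cc_point\<close>: if several vertices represent the same
  node, the gradient of its hat function is a sum of barycentric gradients and the triangle
  inequality enters.\<close>

lemma norm_grad_point:
  assumes R: "\<And>i j. 0 \<le> R i j"
  shows "(\<Sum>i\<in>N. \<Sum>j\<in>N. \<phi> i x * norm (grad (\<phi> j) x) * R i j) \<le> (\<Sum>v\<in>C. \<Sum>w\<in>C. b v * norm (\<beta> w) * R (r v) (r w))"
proof -
  have "(\<Sum>i\<in>N. \<Sum>j\<in>N. \<phi> i x * norm (grad (\<phi> j) x) * R i j) \<le> (\<Sum>i\<in>N. \<Sum>j\<in>N. \<phi> i x * ((\<Sum>w\<in>C. if r w = j then norm (\<beta> w) else 0) * R i j))"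
  proof (intro sum_mono)
    fix i j assume ij: "i \<in> N" "j \<in> N"
    have "norm (grad (\<phi> j) x) \<le> (\<Sum>w\<in>C. norm (if r w = j then \<beta> w else 0))"
      unfolding gradx[OF ij(2)] by (rule norm_sum)
    also have "\<dots> = (\<Sum>w\<in>C. if r w = j then norm (\<beta> w) else 0)" by (intro sum.cong) auto
    finally show "\<phi> i x * norm (grad (\<phi> j) x) * R i j \<le> \<phi> i x * ((\<Sum>w\<in>C. if r w = j then norm (\<beta> w) else 0) * R i j)"
      unfolding mult.assoc using hat_nonneg[OF ij(1)] R by (intro mult_left_mono mult_right_mono)
  qed
  also have "\<dots> = (\<Sum>i\<in>N. \<phi> i x * (\<Sum>j\<in>N. \<Sum>w\<in>C. if r w = j then norm (\<beta> w) * R i j else 0))"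
    unfolding sum_distrib_left sum_distrib_right by (intro sum.cong refl) auto
  also have "\<dots> = (\<Sum>i\<in>N. \<phi> i x * (\<Sum>w\<in>C. norm (\<beta> w) * R i (r w)))" by (simp only: reindex)
  also have "\<dots> = (\<Sum>v\<in>C. b v * (\<Sum>w\<in>C. norm (\<beta> w) * R (r v) (r w)))" by (rule hat_point)
  finally show ?thesis by (simp add: sum_distrib_left mult.assoc)
qed

text \<open>The derivative of \<open>uh L K U\<close> at \<open>x\<close> in direction
  \<open>e\<close>, expressed by nodal values and barycentric gradients.\<close>

definition Du :: "(real^'d \<Rightarrow> real^'d) \<Rightarrow> real^'d \<Rightarrow> real^'d" where
  "Du U e = (\<Sum>v\<in>C. (\<beta> v \<bullet> e) *\<^sub>R U (r v))"

text \<open>Squared Frobenius norm of the gradient of u_h at \<open>x\<close>; integrated over the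
  box it gives \<open>h1semi\<close>.\<close>

definition G2 :: "(real^'d \<Rightarrow> real^'d) \<Rightarrow> real" where
  "G2 U = (\<Sum>k\<in>UNIV. (norm (grad (\<lambda>y. uh L K U y $ k) x))\<^sup>2)"

lemma Du_linear: "linear (Du U)"
  unfolding Du_def by (rule linearI) (simp_all add: inner_add_right scaleR_add_left sum.distrib scaleR_sum_right)

lemma Du_has_derivative: "(uh L K U has_derivative Du U) (at x)"
proof -
  have "((\<lambda>y. \<Sum>j\<in>N. \<phi> j y *\<^sub>R U j) has_derivative (\<lambda>e. \<Sum>j\<in>N. ((\<Sum>v\<in>C. if r v = j then \<beta> v else 0) \<bullet> e) *\<^sub>R U j)) (at x)"
    by (intro has_derivative_sum has_derivative_scaleR_left derx)
  moreover have "(\<Sum>j\<in>N. ((\<Sum>v\<in>C. if r v = j then \<beta> v else 0) \<bullet> e) *\<^sub>R U j) = Du U e" for e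
  proof -
    have "(\<Sum>j\<in>N. ((\<Sum>v\<in>C. if r v = j then \<beta> v else 0) \<bullet> e) *\<^sub>R U j) = (\<Sum>j\<in>N. \<Sum>v\<in>C. if r v = j then (\<beta> v \<bullet> e) *\<^sub>R U j else 0)"
      by (intro sum.cong refl) (auto simp: inner_sum_left scaleR_sum_left intro!: sum.cong)
    also have "\<dots> = Du U e" unfolding Du_def by (rule reindex)
    finally show ?thesis .
  qed
  moreover have "uh L K U = (\<lambda>y. \<Sum>j\<in>N. \<phi> j y *\<^sub>R U j)" by (simp add: uh_def fun_eq_iff)
  ultimately show ?thesis by simp
qed

lemma uh_component_derivative: "((\<lambda>y. uh L K U y $ k) has_derivative (\<lambda>e. Du U e $ k)) (at x)"
  using bounded_linear.has_derivative[OF bounded_linear_vec_nth Du_has_derivative] .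

lemma Du_component: "Du U e $ k = grad (\<lambda>y. uh L K U y $ k) x \<bullet> e"
proof -
  define \<gamma> where "\<gamma> = (\<Sum>v\<in>C. (U (r v) $ k) *\<^sub>R \<beta> v)"
  have 1: "Du U e $ k = \<gamma> \<bullet> e" for e
    unfolding Du_def \<gamma>_def by (simp add: inner_sum_left mult.commute)
  have "grad (\<lambda>y. uh L K U y $ k) x = \<gamma>"
    unfolding grad_def pd_eqI[OF uh_component_derivative] 1 by (simp add: vec_eq_iff inner_axis)
  then show ?thesis using 1 by simp
qed

lemma G2_nonneg: "0 \<le> G2 U" unfolding G2_def by (intro sum_nonneg) simp

lemma Du_bound: "norm (Du U e) \<le> sqrt (G2 U) * norm e"
proof -
  have "(norm (Du U e))\<^sup>2 = (\<Sum>k\<in>UNIV. (Du U e $ k)\<^sup>2)"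
    unfolding power2_norm_eq_inner inner_vec_def by (simp add: power2_eq_square)
  also have "\<dots> \<le> (\<Sum>k\<in>UNIV. (norm (grad (\<lambda>y. uh L K U y $ k) x))\<^sup>2 * (norm e)\<^sup>2)"
  proof (rule sum_mono)
    fix k
    have "\<bar>Du U e $ k\<bar> \<le> norm (grad (\<lambda>y. uh L K U y $ k) x) * norm e"
      unfolding Du_component by (rule Cauchy_Schwarz_ineq2)
    then have "\<bar>Du U e $ k\<bar>\<^sup>2 \<le> (norm (grad (\<lambda>y. uh L K U y $ k) x) * norm e)\<^sup>2" by (rule power_mono) simp
    then show "(Du U e $ k)\<^sup>2 \<le> (norm (grad (\<lambda>y. uh L K U y $ k) x))\<^sup>2 * (norm e)\<^sup>2" by (simp add: power_mult_distrib)
  qed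
  also have "\<dots> = G2 U * (norm e)\<^sup>2" unfolding G2_def by (rule sum_distrib_right[symmetric])
  also have "\<dots> = (sqrt (G2 U) * norm e)\<^sup>2" using G2_nonneg[of U] by (simp add: power_mult_distrib)
  finally show ?thesis by (rule power2_le_imp_le) (use G2_nonneg[of U] in simp)
qed

text \<open>Exact, with no remainder, because u_h is affine on the cell. With
  \<open>Du_bound\<close> it makes \<open>h * sqrt (G2 U)\<close> the size of the oscillation of u_h
  on the cell.\<close>

lemma Du_diff: assumes "v \<in> C" shows "Du U (v - x) = U (r v) - uh L K U x"
proof -
  have "Du U (v - x) = (\<Sum>w\<in>C. ((if v = w then 1 else 0) - b w) *\<^sub>R U (r w))"
    unfolding Du_def using bx[OF assms] by (intro sum.cong) auto
  also have "\<dots> = (\<Sum>w\<in>C. (if v = w then U (r w) else 0) - b w *\<^sub>R U (r w))"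
    by (intro sum.cong) (auto simp: scaleR_diff_left)
  also have "\<dots> = U (r v) - uh L K U x" using assms finC by (simp add: sum_subtractf uh_x)
  finally show ?thesis .
qed

lemma diff_bound: assumes "v \<in> C" shows "norm (U (r v) - uh L K U x) \<le> h * sqrt (G2 U)"
proof -
  have "norm (U (r v) - uh L K U x) \<le> sqrt (G2 U) * norm (v - x)" using Du_bound[of U "v - x"] Du_diff[OF assms] by simp
  also have "\<dots> \<le> sqrt (G2 U) * h" using vdist[OF assms] G2_nonneg by (intro mult_left_mono) auto
  finally show ?thesis by (simp add: mult.commute)
qed

lemma conv_comb_bound: assumes "\<And>v. v \<in> C \<Longrightarrow> \<bar>f v\<bar> \<le> B" shows "\<bar>\<Sum>v\<in>C. b v * f v\<bar> \<le> B"
proof -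
  have "\<bar>\<Sum>v\<in>C. b v * f v\<bar> \<le> (\<Sum>v\<in>C. b v * B)"
    by (rule order_trans[OF sum_abs]) (use assms b0 in \<open>auto simp: abs_mult intro!: sum_mono mult_left_mono\<close>)
  also have "\<dots> = B" by (simp add: sum_distrib_right[symmetric] sb)
  finally show ?thesis .
qed

lemma sum_\<beta>_inner: "(\<Sum>v\<in>C. \<beta> v \<bullet> e) = 0"
  using s0 by (simp add: inner_sum_left[symmetric])

end

text \<open>Here \<open>w\<close> is the test function and \<open>A\<close> its derivative at \<open>x\<close>.\<close>

locale cell_est = cell_at L K h \<kappa> x C b \<beta> for L :: "real^'d" and K h \<kappa> x C b \<beta> +
  fixes U w A :: "real^'d \<Rightarrow> real^'d" and P :: "real^'d \<Rightarrow> real" and M V \<epsilon> E :: real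
  assumes UM: "\<And>j. j \<in> N \<Longrightarrow> norm (U j) \<le> M" and PM: "\<And>j. j \<in> N \<Longrightarrow> \<bar>P j\<bar> \<le> M"
    and wper: "\<And>v. w (rep L v) = w v" and Alin: "linear A"
    and w2: "\<And>v. norm (v - x) \<le> h \<Longrightarrow> norm (w v - w x - A (v - x)) \<le> \<epsilon> * h"
    and w1: "\<And>v. norm (v - x) \<le> h \<Longrightarrow> norm (w v - w x) \<le> V * h"
    and w0: "\<And>v. norm (v - x) \<le> h \<Longrightarrow> norm (w v) \<le> V"
    and AV: "\<And>e. norm (A e) \<le> V * norm e"
    and E: "\<epsilon> \<le> E" "h \<le> E" "h * sqrt (G2 U) \<le> E" "h * h * G2 U \<le> E"
begin

abbreviation "ux \<equiv> uh L K U x"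

lemma M0: "0 \<le> M"
proof -
  have "C \<noteq> {}" using cardC by auto
  then obtain v where "v \<in> C" by blast
  then show ?thesis using UM[OF rN] norm_ge_zero order_trans by blast
qed

lemma V0: "0 \<le> V"
proof -
  have "norm (w x) \<le> V" using w0[of x] hpos by simp
  then show ?thesis using norm_ge_zero[of "w x"] by linarith
qed

lemma E0: "0 \<le> E" using E(2) hpos by linarith

lemma \<epsilon>0: "0 \<le> \<epsilon>"
proof -
  have "norm (w x - w x - A (x - x)) \<le> \<epsilon> * h" using hpos by (intro w2) simp
  then have "0 \<le> \<epsilon> * h" using norm_ge_zero[of "w x - w x - A (x - x)"] by linarith
  then show ?thesis using hpos by (simp add: zero_le_mult_iff)
qed

lemma uM: "norm ux \<le> M" using UM by (intro uh_bound) auto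

text \<open>The factor \<open>\<kappa> / h\<close> of a barycentric gradient cancels against the
  factor \<open>h\<close> in \<open>f\<close>, and the cell has d + 1 vertices.\<close>

lemma sum_weight_bound:
  assumes "\<And>v. v \<in> C \<Longrightarrow> norm (f v :: 'b::real_normed_vector) \<le> B * h" "\<And>v. v \<in> C \<Longrightarrow> \<bar>\<gamma> v\<bar> \<le> norm (\<beta> v) * l" "0 \<le> l"
  shows "norm (\<Sum>v\<in>C. \<gamma> v *\<^sub>R f v) \<le> (real CARD('d) + 1) * \<kappa> * B * l"
proof -
  have "norm (\<Sum>v\<in>C. \<gamma> v *\<^sub>R f v) \<le> (\<Sum>v\<in>C. \<kappa> * B * l)"
  proof (rule sum_norm_le)
    fix v assume v: "v \<in> C"
    have "norm (\<gamma> v *\<^sub>R f v) \<le> (\<kappa> / h * l) * (B * h)"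
    proof -
      have "\<bar>\<gamma> v\<bar> \<le> \<kappa> / h * l" using assms(2)[OF v] mult_right_mono[OF \<beta>le[OF v] assms(3)] by linarith
      moreover have "0 \<le> \<kappa> / h * l" using \<kappa> hpos assms(3) by simp
      ultimately show ?thesis using assms(1)[OF v] by (simp only: norm_scaleR) (rule mult_mono, auto)
    qed
    also have "\<dots> = \<kappa> * B * l" using hpos by simp
    finally show "norm (\<gamma> v *\<^sub>R f v) \<le> \<kappa> * B * l" .
  qed
  then show ?thesis by (simp add: cardC algebra_simps)
qed

text \<open>By \<open>s0\<close> and \<open>s1\<close> the barycentric gradients differentiate
  affine fields exactly, so only the Taylor remainders of \<open>w\<close>, each at most
  \<open>\<epsilon> * h\<close>, are left.\<close>

lemma grad_consistent: "norm ((\<Sum>v\<in>C. (\<beta> v \<bullet> e) *\<^sub>R w v) - A e) \<le> (real CARD('d) + 1) * \<kappa> * \<epsilon> * norm e"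
proof -
  have "(\<Sum>v\<in>C. (\<beta> v \<bullet> e) *\<^sub>R (w v - w x - A (v - x))) = (\<Sum>v\<in>C. (\<beta> v \<bullet> e) *\<^sub>R w v) - A e"
  proof -
    have a: "(\<Sum>v\<in>C. (\<beta> v \<bullet> e) *\<^sub>R A v) = A e"
      using linear_sum[OF Alin, of "\<lambda>v. (\<beta> v \<bullet> e) *\<^sub>R v" C] s1[of e] by (simp add: linear_scale[OF Alin] o_def)
    have z: "(\<Sum>v\<in>C. (\<beta> v \<bullet> e) *\<^sub>R c) = 0" for c :: "real^'d"
      by (simp add: scaleR_sum_left[symmetric] sum_\<beta>_inner)
    have "(\<Sum>v\<in>C. (\<beta> v \<bullet> e) *\<^sub>R (w v - w x - A (v - x)))
       = (\<Sum>v\<in>C. (\<beta> v \<bullet> e) *\<^sub>R w v) - (\<Sum>v\<in>C. (\<beta> v \<bullet> e) *\<^sub>R w x) - ((\<Sum>v\<in>C. (\<beta> v \<bullet> e) *\<^sub>R A v) - (\<Sum>v\<in>C. (\<beta> v \<bullet> e) *\<^sub>R A x))"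
      by (simp add: linear_diff[OF Alin] scaleR_diff_right sum_subtractf)
    then show ?thesis unfolding a z by simp
  qed
  moreover have "norm (\<Sum>v\<in>C. (\<beta> v \<bullet> e) *\<^sub>R (w v - w x - A (v - x))) \<le> (real CARD('d) + 1) * \<kappa> * \<epsilon> * norm e"
    by (rule sum_weight_bound) (use w2 vdist Cauchy_Schwarz_ineq2 in auto)
  ultimately show ?thesis by simp
qed

text \<open>The sum is the divergence on this cell of the interpolant of \<open>w\<close>. Its
  affine part contributes the trace of \<open>A\<close>, which is zero, and the Taylor remainders
  contribute at most \<open>\<kappa> * \<epsilon>\<close> each.\<close>

lemma div_consistent:
  assumes tr: "(\<Sum>k\<in>UNIV. A (axis k 1) $ k) = 0"
  shows "\<bar>\<Sum>v\<in>C. w v \<bullet> \<beta> v\<bar> \<le> (real CARD('d) + 1) * \<kappa> * \<epsilon>"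
proof -
  have a: "(\<Sum>v\<in>C. A v \<bullet> \<beta> v) = 0"
  proof -
    have "(\<Sum>v\<in>C. A v \<bullet> \<beta> v) = (\<Sum>v\<in>C. \<Sum>k\<in>UNIV. (\<beta> v \<bullet> axis k 1) * A v $ k)"
      by (intro sum.cong refl, subst inner_vec_def) (simp add: inner_axis mult.commute)
    also have "\<dots> = (\<Sum>k\<in>UNIV. (\<Sum>v\<in>C. (\<beta> v \<bullet> axis k 1) *\<^sub>R A v) $ k)"
      by (subst sum.swap) simp
    also have "\<dots> = (\<Sum>k\<in>UNIV. A (axis k 1) $ k)"
    proof (intro sum.cong refl)
      fix k
      show "(\<Sum>v\<in>C. (\<beta> v \<bullet> axis k 1) *\<^sub>R A v) $ k = A (axis k 1) $ k"
        using linear_sum[OF Alin, of "\<lambda>v. (\<beta> v \<bullet> axis k 1) *\<^sub>R v" C] s1[of "axis k 1"] by (simp add: linear_scale[OF Alin] o_def)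
    qed
    finally show ?thesis using tr by simp
  qed
  have z: "(\<Sum>v\<in>C. c \<bullet> \<beta> v) = 0" for c using sum_\<beta>_inner[of c] by (simp add: inner_commute)
  have "(\<Sum>v\<in>C. w v \<bullet> \<beta> v) = (\<Sum>v\<in>C. (w v - w x - A (v - x)) \<bullet> \<beta> v)"
    by (simp add: linear_diff[OF Alin] inner_diff_left sum_subtractf a z)
  also have "\<bar>\<dots>\<bar> \<le> (\<Sum>v\<in>C. \<kappa> * \<epsilon>)"
  proof (rule order_trans[OF sum_abs], rule sum_mono)
    fix v assume v: "v \<in> C"
    have "\<bar>(w v - w x - A (v - x)) \<bullet> \<beta> v\<bar> \<le> norm (w v - w x - A (v - x)) * norm (\<beta> v)" by (rule Cauchy_Schwarz_ineq2)
    also have "\<dots> \<le> (\<epsilon> * h) * (\<kappa> / h)" using w2[OF vdist[OF v]] \<beta>le[OF v] \<epsilon>0 hpos by (intro mult_mono) auto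
    also have "\<dots> = \<kappa> * \<epsilon>" using hpos by simp
    finally show "\<bar>(w v - w x - A (v - x)) \<bullet> \<beta> v\<bar> \<le> \<kappa> * \<epsilon>" .
  qed
  finally show ?thesis by (simp add: cardC algebra_simps)
qed

text \<open>Nodal pressures act only as bounded weights; smallness comes from the inner sum, the
  divergence of the interpolated test field.\<close>

lemma est_pressure:
  assumes tr: "(\<Sum>k\<in>UNIV. A (axis k 1) $ k) = 0"
  shows "\<bar>\<Sum>v\<in>C. \<Sum>v'\<in>C. b v * ((P (r v) *\<^sub>R w (r v')) \<bullet> \<beta> v')\<bar> \<le> M * ((real CARD('d) + 1) * \<kappa>) * E"
proof -
  have "(\<Sum>v\<in>C. \<Sum>v'\<in>C. b v * ((P (r v) *\<^sub>R w (r v')) \<bullet> \<beta> v')) = (\<Sum>v\<in>C. b v * (P (r v) * (\<Sum>v'\<in>C. w v' \<bullet> \<beta> v')))"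
    by (simp add: wper sum_distrib_left mult_ac)
  also have "\<bar>\<dots>\<bar> \<le> M * ((real CARD('d) + 1) * \<kappa> * \<epsilon>)"
  proof (rule conv_comb_bound)
    fix v assume "v \<in> C"
    then show "\<bar>P (r v) * (\<Sum>v'\<in>C. w v' \<bullet> \<beta> v')\<bar> \<le> M * ((real CARD('d) + 1) * \<kappa> * \<epsilon>)"
      unfolding abs_mult using PM[OF rN] div_consistent[OF tr] M0 by (intro mult_mono) auto
  qed
  also have "\<dots> \<le> M * ((real CARD('d) + 1) * \<kappa> * E)" using M0 \<kappa> E(1) by (intro mult_left_mono) auto
  finally show ?thesis by (simp add: mult_ac)
qed

text \<open>The half of the convective form in which the derivative falls on \<open>w\<close>. First
  the discrete derivative is replaced by \<open>A\<close>, then both velocities are moved from the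
  vertex to \<open>x\<close>, at the cost of the oscillation of u_h.\<close>

lemma est_conv1:
  "\<bar>(\<Sum>v\<in>C. \<Sum>v'\<in>C. b v * (((U (r v) \<bullet> w (r v')) *\<^sub>R U (r v)) \<bullet> \<beta> v')) - ux \<bullet> A ux\<bar>
     \<le> (M * M * ((real CARD('d) + 1) * \<kappa>) + 2 * M * V) * E"
proof -
  have "(\<Sum>v\<in>C. \<Sum>v'\<in>C. b v * (((U (r v) \<bullet> w (r v')) *\<^sub>R U (r v)) \<bullet> \<beta> v'))
      = (\<Sum>v\<in>C. b v * (U (r v) \<bullet> (\<Sum>v'\<in>C. (\<beta> v' \<bullet> U (r v)) *\<^sub>R w v')))"
    by (simp add: wper sum_distrib_left inner_sum_right inner_commute mult_ac)
  moreover have "ux \<bullet> A ux = (\<Sum>v\<in>C. b v * (ux \<bullet> A ux))" by (simp add: sum_distrib_right[symmetric] sb)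
  ultimately have "\<bar>(\<Sum>v\<in>C. \<Sum>v'\<in>C. b v * (((U (r v) \<bullet> w (r v')) *\<^sub>R U (r v)) \<bullet> \<beta> v')) - ux \<bullet> A ux\<bar>
     = \<bar>\<Sum>v\<in>C. b v * (U (r v) \<bullet> (\<Sum>v'\<in>C. (\<beta> v' \<bullet> U (r v)) *\<^sub>R w v') - ux \<bullet> A ux)\<bar>"
    by (simp only: right_diff_distrib sum_subtractf)
  also have "\<dots> \<le> (M * M * ((real CARD('d) + 1) * \<kappa>) + 2 * M * V) * E"
  proof (rule conv_comb_bound)
    fix v assume v: "v \<in> C"
    let ?U = "U (r v)" and ?s = "\<Sum>v'\<in>C. (\<beta> v' \<bullet> U (r v)) *\<^sub>R w v'"
    have Uv: "norm ?U \<le> M" using UM[OF rN[OF v]] .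
    have d: "norm (?U - ux) \<le> E" using diff_bound[OF v, of U] E(3) by linarith
    have "?U \<bullet> ?s - ux \<bullet> A ux = ?U \<bullet> (?s - A ?U) + (?U - ux) \<bullet> A ?U + ux \<bullet> A (?U - ux)"
      by (simp add: linear_diff[OF Alin] inner_diff_right inner_diff_left)
    moreover have "\<bar>?U \<bullet> (?s - A ?U)\<bar> \<le> M * ((real CARD('d) + 1) * \<kappa> * E * M)"
    proof -
      have "norm (?s - A ?U) \<le> (real CARD('d) + 1) * \<kappa> * \<epsilon> * norm ?U" by (rule grad_consistent)
      also have "\<dots> \<le> (real CARD('d) + 1) * \<kappa> * E * M" using Uv E(1) \<kappa> E0 \<epsilon>0 by (intro mult_mono) auto
      finally have "norm (?s - A ?U) \<le> (real CARD('d) + 1) * \<kappa> * E * M" .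
      then have "norm ?U * norm (?s - A ?U) \<le> M * ((real CARD('d) + 1) * \<kappa> * E * M)" using Uv M0 by (intro mult_mono) auto
      then show ?thesis using Cauchy_Schwarz_ineq2[of ?U "?s - A ?U"] by linarith
    qed
    moreover have "\<bar>(?U - ux) \<bullet> A ?U\<bar> \<le> E * (V * M)"
    proof -
      have "norm (A ?U) \<le> V * M" using AV[of ?U] mult_left_mono[OF Uv V0] by linarith
      then have "norm (?U - ux) * norm (A ?U) \<le> E * (V * M)" using d E0 by (intro mult_mono) auto
      then show ?thesis using Cauchy_Schwarz_ineq2[of "?U - ux" "A ?U"] by linarith
    qed
    moreover have "\<bar>ux \<bullet> A (?U - ux)\<bar> \<le> M * (V * E)"
    proof -
      have "norm (A (?U - ux)) \<le> V * E" using AV[of "?U - ux"] mult_left_mono[OF d V0] by linarith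
      then have "norm ux * norm (A (?U - ux)) \<le> M * (V * E)" using uM M0 by (intro mult_mono) auto
      then show ?thesis using Cauchy_Schwarz_ineq2[of ux "A (?U - ux)"] by linarith
    qed
    ultimately have "\<bar>?U \<bullet> ?s - ux \<bullet> A ux\<bar> \<le> M * ((real CARD('d) + 1) * \<kappa> * E * M) + E * (V * M) + M * (V * E)" by linarith
    also have "\<dots> = (M * M * ((real CARD('d) + 1) * \<kappa>) + 2 * M * V) * E" by (simp add: algebra_simps)
    finally show "\<bar>?U \<bullet> ?s - ux \<bullet> A ux\<bar> \<le> (M * M * ((real CARD('d) + 1) * \<kappa>) + 2 * M * V) * E" .
  qed
  finally show ?thesis .
qed

lemma sqrtG: "0 \<le> sqrt (G2 U)" "sqrt (G2 U) * sqrt (G2 U) = G2 U" using G2_nonneg[of U] by auto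

text \<open>The half in which the derivative falls on u_h. As \<nabla>u_h has no uniform bound,
  every error term must carry an increment of \<open>w\<close>, hence a factor
  \<open>h\<close>.\<close>

lemma est_conv2:
  "\<bar>(\<Sum>v\<in>C. \<Sum>v'\<in>C. b v * (((U (r v') \<bullet> w (r v)) *\<^sub>R U (r v)) \<bullet> \<beta> v')) - Du U ux \<bullet> w x\<bar> \<le> (V + M * V) * E"
proof -
  have "(\<Sum>v\<in>C. \<Sum>v'\<in>C. b v * (((U (r v') \<bullet> w (r v)) *\<^sub>R U (r v)) \<bullet> \<beta> v')) = (\<Sum>v\<in>C. b v * (Du U (U (r v)) \<bullet> w v))"
    by (simp add: wper Du_def sum_distrib_left inner_sum_left inner_sum_right inner_commute mult_ac)
  \<comment> \<open>Exact by linearity of \<open>Du\<close>, since \<open>ux\<close> is the weighted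
    mean of the vertex values. Replacing \<open>U (r v)\<close> by \<open>ux\<close> term by term
    would leave an error of size \<open>h * G2 U\<close>, which does not tend to 0 in L^1.\<close>
  moreover have "Du U ux \<bullet> w x = (\<Sum>v\<in>C. b v * (Du U (U (r v)) \<bullet> w x))"
    by (simp add: uh_x linear_sum[OF Du_linear] linear_scale[OF Du_linear] inner_sum_left)
  ultimately have "\<bar>(\<Sum>v\<in>C. \<Sum>v'\<in>C. b v * (((U (r v') \<bullet> w (r v)) *\<^sub>R U (r v)) \<bullet> \<beta> v')) - Du U ux \<bullet> w x\<bar>
     = \<bar>\<Sum>v\<in>C. b v * (Du U (U (r v)) \<bullet> w v - Du U (U (r v)) \<bullet> w x)\<bar>"
    by (simp only: right_diff_distrib sum_subtractf)
  also have "\<dots> \<le> (V + M * V) * E"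
  proof (rule conv_comb_bound)
    fix v assume v: "v \<in> C"
    let ?U = "U (r v)"
    have wv: "norm (w v - w x) \<le> V * h" by (rule w1[OF vdist[OF v]])
    have "Du U ?U \<bullet> w v - Du U ?U \<bullet> w x = Du U (?U - ux) \<bullet> (w v - w x) + Du U ux \<bullet> (w v - w x)"
      by (simp add: linear_diff[OF Du_linear] inner_diff_left inner_diff_right)
    moreover have "\<bar>Du U (?U - ux) \<bullet> (w v - w x)\<bar> \<le> V * E"
    proof -
      have "norm (Du U (?U - ux)) \<le> sqrt (G2 U) * norm (?U - ux)" by (rule Du_bound)
      also have "\<dots> \<le> sqrt (G2 U) * (h * sqrt (G2 U))" using diff_bound[OF v, of U] sqrtG by (intro mult_left_mono) auto
      finally have "norm (Du U (?U - ux)) \<le> h * G2 U" using sqrtG(2) by (simp add: mult_ac)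
      then have "norm (Du U (?U - ux)) * norm (w v - w x) \<le> (h * G2 U) * (V * h)" using wv G2_nonneg[of U] hpos by (intro mult_mono) auto
      also have "\<dots> = V * (h * h * G2 U)" by simp
      also have "\<dots> \<le> V * E" using E(4) V0 by (rule mult_left_mono)
      finally show ?thesis using Cauchy_Schwarz_ineq2[of "Du U (?U - ux)" "w v - w x"] by linarith
    qed
    moreover have "\<bar>Du U ux \<bullet> (w v - w x)\<bar> \<le> M * V * E"
    proof -
      have "norm (Du U ux) \<le> sqrt (G2 U) * M" using Du_bound[of U ux] mult_left_mono[OF uM sqrtG(1)] by linarith
      then have "norm (Du U ux) * norm (w v - w x) \<le> (sqrt (G2 U) * M) * (V * h)" using wv sqrtG(1) M0 by (intro mult_mono) auto
      also have "\<dots> = M * V * (h * sqrt (G2 U))" by simp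
      also have "\<dots> \<le> M * V * E" using E(3) M0 V0 by (intro mult_left_mono) auto
      finally show ?thesis using Cauchy_Schwarz_ineq2[of "Du U ux" "w v - w x"] by linarith
    qed
    ultimately show "\<bar>Du U ?U \<bullet> w v - Du U ?U \<bullet> w x\<bar> \<le> (V + M * V) * E" unfolding distrib_right by linarith
  qed
  finally show ?thesis .
qed

text \<open>The divergence factor is common to all vertices, so only the mean of
  \<open>U \<bullet> w\<close> has to be compared, and its part with \<open>w\<close> frozen at
  \<open>x\<close> is exactly \<open>ux \<bullet> w x\<close>. The square of the gradient therefore
  appears with \<open>h * h\<close>.\<close>

lemma est_div:
  "\<bar>(\<Sum>v\<in>C. \<Sum>v'\<in>C. b v * (((U (r v) \<bullet> w (r v)) *\<^sub>R U (r v')) \<bullet> \<beta> v')) - (\<Sum>k\<in>UNIV. Du U (axis k 1) $ k) * (ux \<bullet> w x)\<bar>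
    \<le> real CARD('d) * ((V + M * V) * E)"
proof -
  define dv where "dv = (\<Sum>k\<in>UNIV. Du U (axis k 1) $ k)"
  have dveq: "dv = (\<Sum>v\<in>C. U (r v) \<bullet> \<beta> v)"
  proof -
    have "dv = (\<Sum>k\<in>UNIV. \<Sum>v\<in>C. U (r v) $ k * \<beta> v $ k)"
      unfolding dv_def Du_def by (simp add: inner_axis mult.commute)
    also have "\<dots> = (\<Sum>v\<in>C. U (r v) \<bullet> \<beta> v)" by (subst sum.swap) (simp add: inner_vec_def)
    finally show ?thesis .
  qed
  have dvG: "\<bar>dv\<bar> \<le> real CARD('d) * sqrt (G2 U)"
  proof -
    have "\<bar>dv\<bar> \<le> (\<Sum>k\<in>(UNIV::'d set). sqrt (G2 U))"
      unfolding dv_def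
    proof (rule order_trans[OF sum_abs], rule sum_mono)
      fix k show "\<bar>Du U (axis k 1) $ k\<bar> \<le> sqrt (G2 U)"
        using component_le_norm_cart[of "Du U (axis k 1)" k] Du_bound[of U "axis k 1"] by simp
    qed
    then show ?thesis by simp
  qed
  have S: "\<bar>(\<Sum>v\<in>C. b v * (U (r v) \<bullet> w v)) - ux \<bullet> w x\<bar> \<le> V * h * (h * sqrt (G2 U)) + M * (V * h)"
  proof -
    have "ux \<bullet> w x = (\<Sum>v\<in>C. b v * (U (r v) \<bullet> w x))" by (simp add: uh_x inner_sum_left)
    then have "\<bar>(\<Sum>v\<in>C. b v * (U (r v) \<bullet> w v)) - ux \<bullet> w x\<bar> = \<bar>\<Sum>v\<in>C. b v * (U (r v) \<bullet> w v - U (r v) \<bullet> w x)\<bar>"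
      by (simp only: right_diff_distrib sum_subtractf)
    also have "\<dots> \<le> V * h * (h * sqrt (G2 U)) + M * (V * h)"
    proof (rule conv_comb_bound)
      fix v assume v: "v \<in> C"
      let ?U = "U (r v)"
      have wv: "norm (w v - w x) \<le> V * h" by (rule w1[OF vdist[OF v]])
      have "?U \<bullet> w v - ?U \<bullet> w x = (?U - ux) \<bullet> (w v - w x) + ux \<bullet> (w v - w x)" by (simp add: inner_diff_left inner_diff_right)
      moreover have "norm (?U - ux) * norm (w v - w x) \<le> (h * sqrt (G2 U)) * (V * h)"
        using diff_bound[OF v, of U] wv hpos sqrtG by (intro mult_mono) auto
      moreover have "norm ux * norm (w v - w x) \<le> M * (V * h)" using uM wv M0 by (intro mult_mono) auto
      ultimately show "\<bar>?U \<bullet> w v - ?U \<bullet> w x\<bar> \<le> V * h * (h * sqrt (G2 U)) + M * (V * h)"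
        using Cauchy_Schwarz_ineq2[of "?U - ux" "w v - w x"] Cauchy_Schwarz_ineq2[of ux "w v - w x"] by (simp add: mult_ac)
    qed
    finally show ?thesis .
  qed
  have "(\<Sum>v\<in>C. \<Sum>v'\<in>C. b v * (((U (r v) \<bullet> w (r v)) *\<^sub>R U (r v')) \<bullet> \<beta> v')) = dv * (\<Sum>v\<in>C. b v * (U (r v) \<bullet> w v))"
    unfolding dveq by (subst mult.commute) (simp add: wper sum_product mult.assoc)
  then have "\<bar>(\<Sum>v\<in>C. \<Sum>v'\<in>C. b v * (((U (r v) \<bullet> w (r v)) *\<^sub>R U (r v')) \<bullet> \<beta> v')) - dv * (ux \<bullet> w x)\<bar>
     = \<bar>dv\<bar> * \<bar>(\<Sum>v\<in>C. b v * (U (r v) \<bullet> w v)) - ux \<bullet> w x\<bar>" by (simp only: right_diff_distrib[symmetric] abs_mult)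
  also have "\<dots> \<le> (real CARD('d) * sqrt (G2 U)) * (V * h * (h * sqrt (G2 U)) + M * (V * h))"
    using dvG S sqrtG by (intro mult_mono) auto
  also have "\<dots> = real CARD('d) * (V * (h * h * (sqrt (G2 U) * sqrt (G2 U))) + M * V * (h * sqrt (G2 U)))" by (simp add: algebra_simps)
  also have "\<dots> \<le> real CARD('d) * (V * E + M * V * E)"
    unfolding sqrtG(2) using E(3,4) V0 M0 by (intro mult_left_mono add_mono) auto
  finally show ?thesis unfolding dv_def by (simp add: algebra_simps)
qed

lemma diff_pair:
  assumes "v \<in> C" "v' \<in> C"
  shows "norm (U (r v) - U (r v')) \<le> 2 * (h * sqrt (G2 U))" "norm (w v - w v') \<le> 2 * (V * h)"
proof -
  show "norm (U (r v) - U (r v')) \<le> 2 * (h * sqrt (G2 U))"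
    using diff_bound[OF assms(1), of U] diff_bound[OF assms(2), of U] norm_triangle_ineq4[of "U (r v) - ux" "U (r v') - ux"] by simp
  show "norm (w v - w v') \<le> 2 * (V * h)"
    using w1[OF vdist[OF assms(1)]] w1[OF vdist[OF assms(2)]] norm_triangle_ineq4[of "w v - w x" "w v' - w x"] by simp
qed

text \<open>The mass matrix involves no derivative, so bounded pressure increments may multiply the
  increment of \<open>U \<bullet> w\<close>, which is of the order of the oscillation on one
  cell.\<close>

lemma est_mass:
  "\<bar>\<Sum>v\<in>C. \<Sum>v'\<in>C. b v * b v' * ((P (r v') - P (r v)) * (U (r v') \<bullet> w (r v') - U (r v) \<bullet> w (r v)))\<bar>
     \<le> 4 * M * (V + M * V) * E"
proof -
  have "(\<Sum>v\<in>C. \<Sum>v'\<in>C. b v * b v' * ((P (r v') - P (r v)) * (U (r v') \<bullet> w (r v') - U (r v) \<bullet> w (r v))))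
     = (\<Sum>v\<in>C. b v * (\<Sum>v'\<in>C. b v' * ((P (r v') - P (r v)) * (U (r v') \<bullet> w v' - U (r v) \<bullet> w v))))"
    by (simp add: wper sum_distrib_left mult.assoc)
  also have "\<bar>\<dots>\<bar> \<le> (2 * M) * (2 * (V + M * V) * E)"
  proof (rule conv_comb_bound, rule conv_comb_bound)
    fix v v' assume v: "v \<in> C" "v' \<in> C"
    have 1: "\<bar>P (r v') - P (r v)\<bar> \<le> 2 * M" using PM[OF rN[OF v(1)]] PM[OF rN[OF v(2)]] by linarith
    have "U (r v') \<bullet> w v' - U (r v) \<bullet> w v = (U (r v') - U (r v)) \<bullet> w v' + U (r v) \<bullet> (w v' - w v)"
      by (simp add: inner_diff_left inner_diff_right)
    moreover have "norm (U (r v') - U (r v)) * norm (w v') \<le> 2 * (h * sqrt (G2 U)) * V"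
      using diff_pair(1)[OF v(2,1)] w0[OF vdist[OF v(2)]] hpos sqrtG by (intro mult_mono) auto
    moreover have "norm (U (r v)) * norm (w v' - w v) \<le> M * (2 * (V * h))"
      using UM[OF rN[OF v(1)]] diff_pair(2)[OF v(2,1)] M0 by (intro mult_mono) auto
    ultimately have "\<bar>U (r v') \<bullet> w v' - U (r v) \<bullet> w v\<bar> \<le> 2 * (h * sqrt (G2 U)) * V + M * (2 * (V * h))"
      using Cauchy_Schwarz_ineq2[of "U (r v') - U (r v)" "w v'"] Cauchy_Schwarz_ineq2[of "U (r v)" "w v' - w v"] by linarith
    also have "\<dots> = 2 * V * (h * sqrt (G2 U)) + 2 * (M * V) * h" by simp
    also have "\<dots> \<le> 2 * V * E + 2 * (M * V) * E" using E V0 M0 by (intro add_mono mult_left_mono) auto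
    also have "\<dots> = 2 * (V + M * V) * E" by (simp add: algebra_simps)
    finally show "\<bar>(P (r v') - P (r v)) * (U (r v') \<bullet> w v' - U (r v) \<bullet> w v)\<bar> \<le> (2 * M) * (2 * (V + M * V) * E)"
      unfolding abs_mult using 1 M0 by (intro mult_mono) auto
  qed
  also have "(2 * M) * (2 * (V + M * V) * E) = 4 * M * (V + M * V) * E" by simp
  finally show ?thesis .
qed

text \<open>One factor \<open>\<kappa> / h\<close> meets two increments, of u_h and of
  \<open>w\<close>, of sizes \<open>h * sqrt (G2 U)\<close> and \<open>V * h\<close>; a net factor
  \<open>h\<close> remains.\<close>

lemma est_visc:
  "(\<Sum>v\<in>C. \<Sum>v'\<in>C. b v * norm (\<beta> v') * (norm (U (r v) - U (r v')) * norm (w (r v) - w (r v'))))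
     \<le> 4 * ((real CARD('d) + 1) * \<kappa>) * V * E"
proof -
  have "(\<Sum>v\<in>C. \<Sum>v'\<in>C. b v * norm (\<beta> v') * (norm (U (r v) - U (r v')) * norm (w (r v) - w (r v'))))
     = (\<Sum>v\<in>C. b v * (\<Sum>v'\<in>C. norm (\<beta> v') * (norm (U (r v) - U (r v')) * norm (w v - w v'))))"
    by (simp add: wper sum_distrib_left mult.assoc)
  also have "\<dots> \<le> 4 * ((real CARD('d) + 1) * \<kappa>) * V * E"
  proof (rule order_trans[OF abs_ge_self], rule conv_comb_bound)
    fix v assume v: "v \<in> C"
    have "\<bar>\<Sum>v'\<in>C. norm (\<beta> v') * (norm (U (r v) - U (r v')) * norm (w v - w v'))\<bar> \<le> (\<Sum>v'\<in>C. 4 * \<kappa> * V * E)"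
    proof (rule order_trans[OF sum_abs], rule sum_mono)
      fix v' assume v': "v' \<in> C"
      have "norm (\<beta> v') * (norm (U (r v) - U (r v')) * norm (w v - w v')) \<le> (\<kappa> / h) * ((2 * (h * sqrt (G2 U))) * (2 * (V * h)))"
        using \<beta>le[OF v'] diff_pair[OF v v'] hpos \<kappa> sqrtG by (intro mult_mono) auto
      also have "\<dots> = 4 * \<kappa> * V * (h * sqrt (G2 U))" using hpos by (simp add: field_simps)
      also have "\<dots> \<le> 4 * \<kappa> * V * E" using E(3) \<kappa> V0 by (intro mult_left_mono) auto
      finally show "\<bar>norm (\<beta> v') * (norm (U (r v) - U (r v')) * norm (w v - w v'))\<bar> \<le> 4 * \<kappa> * V * E" by simp
    qed
    also have "\<dots> = 4 * ((real CARD('d) + 1) * \<kappa>) * V * E" by (simp add: cardC algebra_simps)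
    finally show "\<bar>\<Sum>v'\<in>C. norm (\<beta> v') * (norm (U (r v) - U (r v')) * norm (w v - w v'))\<bar> \<le> 4 * ((real CARD('d) + 1) * \<kappa>) * V * E" .
  qed
  finally show ?thesis .
qed

end

section \<open>Summation by parts and energy dissipation\<close>

text \<open>The Dirichlet form of a weighted graph Laplacian: the diagonal subtracts the row sum,
  and averaging over the exchange of the two indices produces products of differences.\<close>

lemma zero_row_sum_form:
  fixes f g :: "'i \<Rightarrow> 'b::real_inner"
  assumes "finite I" "\<And>i j. d i j = (d j i :: real)"
  shows "(\<Sum>i\<in>I. \<Sum>j\<in>I. (if j = i then - (\<Sum>k\<in>I - {i}. d i k) else d i j) * (f i \<bullet> g j))
       = - (1/2) * (\<Sum>i\<in>I. \<Sum>j\<in>I. d i j * ((f i - f j) \<bullet> (g i - g j)))"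
proof -
  have row: "(\<Sum>j\<in>I. (if j = i then - (\<Sum>k\<in>I - {i}. d i k) else d i j) * (f i \<bullet> g j)) = (\<Sum>j\<in>I. d i j * (f i \<bullet> (g j - g i)))" if "i \<in> I" for i
  proof -
    have "(\<Sum>j\<in>I. (if j = i then - (\<Sum>k\<in>I - {i}. d i k) else d i j) * (f i \<bullet> g j))
       = - (\<Sum>k\<in>I - {i}. d i k) * (f i \<bullet> g i) + (\<Sum>j\<in>I - {i}. d i j * (f i \<bullet> g j))"
      using assms(1) that by (subst sum.remove[of _ i]) (auto intro!: sum.cong)
    also have "\<dots> = (\<Sum>j\<in>I - {i}. d i j * (f i \<bullet> (g j - g i)))"
      by (simp add: inner_diff_right right_diff_distrib sum_subtractf sum_distrib_right)
    also have "\<dots> = (\<Sum>j\<in>I. d i j * (f i \<bullet> (g j - g i)))"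
      using assms(1) that by (subst (2) sum.remove[of _ i]) auto
    finally show ?thesis .
  qed
  define s where "s = (\<Sum>i\<in>I. \<Sum>j\<in>I. d i j * (f i \<bullet> (g j - g i)))"
  have "s = (\<Sum>j\<in>I. \<Sum>i\<in>I. d i j * (f i \<bullet> (g j - g i)))" unfolding s_def by (rule sum.swap)
  also have "\<dots> = (\<Sum>j\<in>I. \<Sum>i\<in>I. d j i * (f i \<bullet> (g j - g i)))"
    by (intro sum.cong refl arg_cong2[of _ _ _ _ "(*)"] assms(2))
  finally have s2: "s = (\<Sum>i\<in>I. \<Sum>j\<in>I. d i j * (f j \<bullet> (g i - g j)))" .
  have "2 * s = (\<Sum>i\<in>I. \<Sum>j\<in>I. d i j * (f i \<bullet> (g j - g i)) + d i j * (f j \<bullet> (g i - g j)))"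
    using s_def s2 by (simp add: sum.distrib)
  also have "\<dots> = (\<Sum>i\<in>I. \<Sum>j\<in>I. - (d i j * ((f i - f j) \<bullet> (g i - g j))))"
    by (intro sum.cong refl) (simp add: inner_diff_left inner_diff_right algebra_simps)
  finally have "s = - (1/2) * (\<Sum>i\<in>I. \<Sum>j\<in>I. d i j * ((f i - f j) \<bullet> (g i - g j)))" by (simp add: sum_negf)
  then show ?thesis unfolding s_def using row by simp
qed

text \<open>The scheme frozen at one time; \<open>U'\<close> holds the time derivatives of the nodal
  velocities.\<close>

locale scheme = cmesh L K h \<kappa> for L :: "real^'d" and K h \<kappa> +
  fixes \<omega> :: real and al :: "real^'d \<Rightarrow> real^'d \<Rightarrow> real" and U U' :: "real^'d \<Rightarrow> real^'d" and P :: "real^'d \<Rightarrow> real"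
  assumes \<omega>pos: "\<omega> > 0" and al: "\<And>i j. 0 \<le> al i j \<and> al i j \<le> 1" "\<And>i j. al i j = al j i"
    and S1: "\<And>i. i \<in> N \<Longrightarrow> lm L K i *\<^sub>R U' i =
       (\<Sum>j\<in>{j\<in>N. nbr L K i j}. (du L K al U i j - atil L K U i j) *\<^sub>R U j - P j *\<^sub>R cc L K i j)"
    and S2: "\<And>k. k \<in> N \<Longrightarrow> 0 = (\<Sum>j\<in>{j\<in>N. nbr L K k j}. dp \<omega> L K k j * P j - cc L K k j \<bullet> U j)"
begin

text \<open>Non-neighbours contribute zero, so the sum may run over all nodes; this makes the
  exchange of the two summation indices available.\<close>

lemma S1': assumes i: "i \<in> N"
  shows "lm L K i *\<^sub>R U' i = (\<Sum>j\<in>N. (du L K al U i j - atil L K U i j) *\<^sub>R U j - P j *\<^sub>R cc L K i j)"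
  unfolding S1[OF i]
proof (rule sum.mono_neutral_left)
  show "\<forall>j\<in>N - {j \<in> N. nbr L K i j}. (du L K al U i j - atil L K U i j) *\<^sub>R U j - P j *\<^sub>R cc L K i j = 0"
  proof
    fix j assume j: "j \<in> N - {j \<in> N. nbr L K i j}"
    then have "cc L K i j = 0" using cc_not_nbr i by blast
    moreover have "du L K al U i j = 0" using j nbr_refl[OF i] by (auto simp: du_def du_off_def)
    ultimately show "(du L K al U i j - atil L K U i j) *\<^sub>R U j - P j *\<^sub>R cc L K i j = 0" by (simp add: atil_def)
  qed
qed (use finite_nodes in auto)

lemma S2': assumes k: "k \<in> N" shows "(\<Sum>j\<in>N. cc L K k j \<bullet> U j) = (\<Sum>j\<in>N. dp \<omega> L K k j * P j)"
proof -
  have "(\<Sum>j\<in>{j\<in>N. nbr L K k j}. dp \<omega> L K k j * P j - cc L K k j \<bullet> U j) = (\<Sum>j\<in>N. dp \<omega> L K k j * P j - cc L K k j \<bullet> U j)"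
  proof (rule sum.mono_neutral_left)
    show "\<forall>j\<in>N - {j \<in> N. nbr L K k j}. dp \<omega> L K k j * P j - cc L K k j \<bullet> U j = 0"
    proof
      fix j assume j: "j \<in> N - {j \<in> N. nbr L K k j}"
      then have "cc L K k j = 0" "mm L K k j = 0" using cc_not_nbr mm_not_nbr k by blast+
      moreover have "j \<noteq> k" using j nbr_refl[OF k] by auto
      ultimately show "dp \<omega> L K k j * P j - cc L K k j \<bullet> U j = 0" by (simp add: dp_def)
    qed
  qed (use finite_nodes in auto)
  then show ?thesis using S2[OF k] by (simp add: sum_subtractf)
qed

lemma cc_swap: "(\<Sum>i\<in>N. \<Sum>j\<in>N. a i j \<bullet> cc L K i j) = - (\<Sum>i\<in>N. \<Sum>j\<in>N. a j i \<bullet> cc L K i j)"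
proof -
  have "(\<Sum>i\<in>N. \<Sum>j\<in>N. a i j \<bullet> cc L K i j) = (\<Sum>j\<in>N. \<Sum>i\<in>N. a i j \<bullet> cc L K i j)" by (rule sum.swap)
  also have "\<dots> = (\<Sum>j\<in>N. \<Sum>i\<in>N. - (a i j \<bullet> cc L K j i))"
    by (intro sum.cong refl) (metis cc_antisym inner_minus_right)
  finally show ?thesis by (simp add: sum_negf)
qed

lemma visc_form: "(\<Sum>i\<in>N. \<Sum>j\<in>N. du L K al U i j * (f i \<bullet> g j)) = - (1/2) * (\<Sum>i\<in>N. \<Sum>j\<in>N. du_off L K al U i j * ((f i - f j) \<bullet> (g i - g j)))"
  unfolding du_def by (rule zero_row_sum_form[OF finite_nodes du_off_sym]) (use al in simp)

lemma mass_form: "(\<Sum>i\<in>N. \<Sum>j\<in>N. dp \<omega> L K i j * (f i * g j)) = - (1/2) * (\<Sum>i\<in>N. \<Sum>j\<in>N. \<omega> * mm L K i j * ((f i - f j) * (g i - g j)))"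
  using zero_row_sum_form[OF finite_nodes, of "\<lambda>i j. \<omega> * mm L K i j" f g] mm_sym unfolding dp_def by simp

lemma du_off_bounds: "0 \<le> du_off L K al U i j" "du_off L K al U i j \<le> \<bar>aa L K U i j\<bar>"
proof -
  have "0 \<le> (1 - al i j) * \<bar>aa L K U i j\<bar>" "(1 - al i j) * \<bar>aa L K U i j\<bar> \<le> \<bar>aa L K U i j\<bar>"
    using al(1)[of i j] by (auto intro!: mult_left_le_one_le)
  then show "0 \<le> du_off L K al U i j" "du_off L K al U i j \<le> \<bar>aa L K U i j\<bar>" by (auto simp: du_off_def)
qed

lemma tested_scheme:
  "(\<Sum>i\<in>N. lm L K i * (w i \<bullet> U' i)) = (\<Sum>i\<in>N. \<Sum>j\<in>N. du L K al U i j * (w i \<bullet> U j))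
      - (\<Sum>i\<in>N. \<Sum>j\<in>N. atil L K U i j * (w i \<bullet> U j)) - (\<Sum>i\<in>N. \<Sum>j\<in>N. (P j *\<^sub>R w i) \<bullet> cc L K i j)"
proof -
  have "(\<Sum>i\<in>N. lm L K i * (w i \<bullet> U' i)) = (\<Sum>i\<in>N. w i \<bullet> (lm L K i *\<^sub>R U' i))" by simp
  also have "\<dots> = (\<Sum>i\<in>N. \<Sum>j\<in>N. du L K al U i j * (w i \<bullet> U j) - atil L K U i j * (w i \<bullet> U j) - (P j *\<^sub>R w i) \<bullet> cc L K i j)"
    by (intro sum.cong refl) (simp add: S1' inner_sum_right inner_diff_right left_diff_distrib)
  finally show ?thesis by (simp add: sum_subtractf)
qed

lemma energy_dissipation: "(\<Sum>i\<in>N. lm L K i * (U i \<bullet> U' i)) \<le> 0"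
proof -
  have "(\<Sum>i\<in>N. \<Sum>j\<in>N. du L K al U i j * (U i \<bullet> U j)) \<le> 0"
    unfolding visc_form using du_off_bounds(1) by (auto intro!: sum_nonneg mult_nonneg_nonneg)
  \<comment> \<open>The coefficient \<open>(U i \<bullet> U j) / 2\<close> and the averaged velocity
    are symmetric in the indices, whereas \<open>cc\<close> is antisymmetric.\<close>
  moreover have "(\<Sum>i\<in>N. \<Sum>j\<in>N. atil L K U i j * (U i \<bullet> U j)) = 0"
  proof -
    have eq: "(\<Sum>i\<in>N. \<Sum>j\<in>N. atil L K U i j * (U i \<bullet> U j)) = (\<Sum>i\<in>N. \<Sum>j\<in>N. (((U i \<bullet> U j) / 2) *\<^sub>R (U i + U j)) \<bullet> cc L K i j)"
      by (simp add: atil_def algebra_simps)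
    have "(\<Sum>i\<in>N. \<Sum>j\<in>N. (((U i \<bullet> U j) / 2) *\<^sub>R (U i + U j)) \<bullet> cc L K i j) = - (\<Sum>i\<in>N. \<Sum>j\<in>N. (((U j \<bullet> U i) / 2) *\<^sub>R (U j + U i)) \<bullet> cc L K i j)"
      by (rule cc_swap)
    then show ?thesis unfolding eq by (simp add: inner_commute add.commute)
  qed
  \<comment> \<open>The work of the pressure: by antisymmetry it becomes minus the discrete
    divergence tested with \<open>P\<close>, which (S2) turns into a sum of squares weighted by the
    nonnegative mass matrix.\<close>
  moreover have "0 \<le> (\<Sum>i\<in>N. \<Sum>j\<in>N. (P j *\<^sub>R U i) \<bullet> cc L K i j)"
  proof -
    have "(\<Sum>i\<in>N. \<Sum>j\<in>N. (P j *\<^sub>R U i) \<bullet> cc L K i j) = - (\<Sum>i\<in>N. \<Sum>j\<in>N. (P i *\<^sub>R U j) \<bullet> cc L K i j)" by (rule cc_swap)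
    also have "\<dots> = - (\<Sum>i\<in>N. P i * (\<Sum>j\<in>N. cc L K i j \<bullet> U j))" by (simp add: sum_distrib_left inner_commute)
    also have "\<dots> = - (\<Sum>i\<in>N. \<Sum>j\<in>N. dp \<omega> L K i j * (P i * P j))" by (simp add: S2' sum_distrib_left mult_ac)
    also have "\<dots> = (1/2) * (\<Sum>i\<in>N. \<Sum>j\<in>N. \<omega> * mm L K i j * ((P i - P j) * (P i - P j)))" unfolding mass_form by simp
    also have "\<dots> \<ge> 0"
    proof -
      have "0 \<le> \<omega> * mm L K i j * ((P i - P j) * (P i - P j))" if "i \<in> N" "j \<in> N" for i j
        using mult_nonneg_nonneg[of "\<omega> * mm L K i j" "(P i - P j) * (P i - P j)"] mm_nonneg[OF that] \<omega>pos zero_le_square by simp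
      then show ?thesis by (auto intro!: sum_nonneg)
    qed
    finally show ?thesis .
  qed
  ultimately show ?thesis unfolding tested_scheme[of U] by linarith
qed

text \<open>(S2) multiplied by nodal values \<open>a\<close> and summed. The discrete divergence
  does not vanish, but it sees only increments of \<open>a\<close> between nodes, which are small
  for interpolated fields.\<close>

lemma discrete_divergence: "(\<Sum>i\<in>N. \<Sum>j\<in>N. (a i *\<^sub>R U j) \<bullet> cc L K i j) = - (\<omega>/2) * (\<Sum>i\<in>N. \<Sum>j\<in>N. mm L K i j * ((P j - P i) * (a j - a i)))"
proof -
  have "(\<Sum>i\<in>N. \<Sum>j\<in>N. (a i *\<^sub>R U j) \<bullet> cc L K i j) = (\<Sum>i\<in>N. a i * (\<Sum>j\<in>N. cc L K i j \<bullet> U j))"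
    by (simp add: sum_distrib_left inner_commute)
  also have "\<dots> = (\<Sum>i\<in>N. \<Sum>j\<in>N. dp \<omega> L K i j * (a i * P j))" by (simp add: S2' sum_distrib_left mult_ac)
  also have "\<dots> = - (1/2) * (\<Sum>i\<in>N. \<Sum>j\<in>N. \<omega> * mm L K i j * ((a i - a j) * (P i - P j)))" by (rule mass_form)
  also have "\<dots> = - (\<omega>/2) * (\<Sum>i\<in>N. \<Sum>j\<in>N. mm L K i j * ((P j - P i) * (a j - a i)))"
    by (simp add: sum_distrib_left algebra_simps)
  finally show ?thesis .
qed

end

context cmesh begin

text \<open>Bounded measurable functions on the box form an algebra, so integrability of the many
  products below follows from their syntactic form.\<close>

definition bm :: "(real^'d \<Rightarrow> real) \<Rightarrow> bool" where
  "bm f \<longleftrightarrow> f \<in> borel_measurable \<Lambda> \<and> (\<exists>B. \<forall>x\<in>cbox 0 L. \<bar>f x\<bar> \<le> B)"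

lemma bm_integrable: assumes "bm f" shows "integrable \<Lambda> f"
proof -
  obtain B where "f \<in> borel_measurable \<Lambda>" "\<forall>x\<in>cbox 0 L. \<bar>f x\<bar> \<le> B" using assms unfolding bm_def by blast
  then show ?thesis by (intro integrable_lebesgue_on_cboxI[where C=B]) auto
qed

lemma bm_add: "bm f \<Longrightarrow> bm g \<Longrightarrow> bm (\<lambda>x. f x + g x)"
proof -
  assume a: "bm f" "bm g"
  then obtain B B' where "\<forall>x\<in>cbox 0 L. \<bar>f x\<bar> \<le> B" "\<forall>x\<in>cbox 0 L. \<bar>g x\<bar> \<le> B'" unfolding bm_def by blast
  then have "\<forall>x\<in>cbox 0 L. \<bar>f x + g x\<bar> \<le> B + B'" by (smt (verit))
  then show ?thesis using a unfolding bm_def by (auto intro!: borel_measurable_add)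
qed

lemma bm_mult: "bm f \<Longrightarrow> bm g \<Longrightarrow> bm (\<lambda>x. f x * g x)"
proof -
  assume a: "bm f" "bm g"
  then obtain B B' where B: "\<forall>x\<in>cbox 0 L. \<bar>f x\<bar> \<le> B" "\<forall>x\<in>cbox 0 L. \<bar>g x\<bar> \<le> B'" unfolding bm_def by blast
  have "\<bar>f x * g x\<bar> \<le> B * B'" if "x \<in> cbox 0 L" for x
  proof -
    have "\<bar>f x\<bar> \<le> B" "\<bar>g x\<bar> \<le> B'" using B that by auto
    then show ?thesis unfolding abs_mult by (intro mult_mono) auto
  qed
  then show ?thesis using a unfolding bm_def by (auto intro!: borel_measurable_times)
qed

lemma bm_const: "bm (\<lambda>x. c)" unfolding bm_def by auto

lemma bm_sum: "(\<And>i. i \<in> I \<Longrightarrow> bm (f i)) \<Longrightarrow> bm (\<lambda>x. \<Sum>i\<in>I. f i x)"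
  by (induction I rule: infinite_finite_induct) (auto intro: bm_const bm_add)

lemma bm_continuous: assumes "continuous_on UNIV f" shows "bm f"
proof -
  have "bounded (f ` cbox 0 L)" by (intro compact_imp_bounded compact_continuous_image continuous_on_subset[OF assms]) auto
  then show ?thesis unfolding bm_def bounded_iff using continuous_measurable_lebesgue_on_cbox[OF assms] by auto
qed

lemma bm_pd: "perlip L f \<Longrightarrow> bm (pd f (axis k 1))"
  unfolding bm_def using perlip_pd(1,3)[OF _ Lpos] by blast

lemma perlip_continuous: "perlip L f \<Longrightarrow> continuous_on UNIV f" unfolding perlip_def by simp

lemma perlip_uh: "perlip L (\<lambda>x. uh L K U x $ k)"
  unfolding uh_def by (simp, intro perlip_sum perlip_mult hat_perlip perlip_const)

definition G :: "(real^'d \<Rightarrow> real^'d) \<Rightarrow> real^'d \<Rightarrow> real" where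
  "G U x = (\<Sum>k\<in>UNIV. (norm (grad (\<lambda>y. uh L K U y $ k) x))\<^sup>2)"

lemma norm_grad_sq: "(norm (grad f x))\<^sup>2 = (\<Sum>l\<in>UNIV. pd f (axis l 1) x * pd f (axis l 1) x)"
  unfolding power2_norm_eq_inner inner_vec_def by (simp add: grad_def)

lemma bm_G: "bm (G U)"
  unfolding G_def norm_grad_sq by (intro bm_sum bm_mult bm_pd perlip_uh)

lemma G_nonneg: "0 \<le> G U x" unfolding G_def by (intro sum_nonneg) simp

lemma h1semi_eq: "h1semi L (uh L K U) = (\<integral>x. G U x \<partial>\<Lambda>)"
  unfolding h1semi_def G_def[symmetric] by (rule lebesgue_integral_eq_integral[symmetric, OF bm_integrable[OF bm_G]]) simp

end

context cmesh begin

lemma integral_AE_close: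
  fixes f g e :: "real^'d \<Rightarrow> real"
  assumes "integrable \<Lambda> f" "integrable \<Lambda> g" "integrable \<Lambda> e" "AE x in \<Lambda>. \<bar>f x - g x\<bar> \<le> c * e x"
  shows "\<bar>(\<integral>x. f x \<partial>\<Lambda>) - (\<integral>x. g x \<partial>\<Lambda>)\<bar> \<le> c * (\<integral>x. e x \<partial>\<Lambda>)"
proof -
  have "\<bar>(\<integral>x. f x \<partial>\<Lambda>) - (\<integral>x. g x \<partial>\<Lambda>)\<bar> = \<bar>\<integral>x. f x - g x \<partial>\<Lambda>\<bar>" using assms by simp
  also have "\<dots> \<le> (\<integral>x. \<bar>f x - g x\<bar> \<partial>\<Lambda>)" by (rule integral_abs_bound)
  also have "\<dots> \<le> (\<integral>x. c * e x \<partial>\<Lambda>)" by (rule integral_mono_AE) (use assms in auto)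
  finally show ?thesis by simp
qed

text \<open>The gradient norms remain under the integral, so that after summation over all pairs the
  viscosity can still be estimated cell by cell.\<close>

lemma aa_bound:
  assumes "i \<in> N" "j \<in> N" "\<forall>j\<in>N. norm (U j) \<le> M"
  shows "\<bar>aa L K U i j\<bar> \<le> M / 2 * (\<integral>x. \<phi> i x * norm (grad (\<phi> j) x) + \<phi> j x * norm (grad (\<phi> i) x) \<partial>\<Lambda>)"
proof -
  have M0: "0 \<le> M" using assms norm_ge_zero order_trans by blast
  have um: "uh L K U \<in> borel_measurable \<Lambda>" by (rule continuous_measurable_lebesgue_on_cbox[OF uh_continuous])
  have ub: "norm (uh L K U x) \<le> M" for x by (rule uh_bound[OF assms(3)])
  have ig: "integrable \<Lambda> (\<lambda>x. \<phi> i x * norm (grad (\<phi> j) x))" if "i \<in> N" "j \<in> N" for i j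
    using integrable_norm[OF integrable_hat_grad[OF that]] hat_nonneg[OF that(1)] by simp
  have pt: "\<bar>\<phi> i x * (uh L K U x \<bullet> grad (\<phi> j) x)\<bar> \<le> M * (\<phi> i x * norm (grad (\<phi> j) x))" if "i \<in> N" "j \<in> N" for i j x
  proof -
    have "\<bar>uh L K U x \<bullet> grad (\<phi> j) x\<bar> \<le> M * norm (grad (\<phi> j) x)"
      using Cauchy_Schwarz_ineq2[of "uh L K U x" "grad (\<phi> j) x"] mult_right_mono[OF ub[of x] norm_ge_zero[of "grad (\<phi> j) x"]] by linarith
    then have "\<phi> i x * \<bar>uh L K U x \<bullet> grad (\<phi> j) x\<bar> \<le> \<phi> i x * (M * norm (grad (\<phi> j) x))"
      by (rule mult_left_mono) (rule hat_nonneg[OF that(1)])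
    then show ?thesis using hat_nonneg[OF that(1), of x] by (simp add: abs_mult mult_ac)
  qed
  have ii: "integrable \<Lambda> (\<lambda>x. \<phi> i x * (uh L K U x \<bullet> grad (\<phi> j) x))" if "i \<in> N" "j \<in> N" for i j
  proof (rule Bochner_Integration.integrable_bound[OF integrable_mult_right[OF ig[OF that], of M]])
    show "(\<lambda>x. \<phi> i x * (uh L K U x \<bullet> grad (\<phi> j) x)) \<in> borel_measurable \<Lambda>"
      using um hat_measurable grad_hat_measurable[OF that(2)] by measurable
    show "AE x in \<Lambda>. norm (\<phi> i x * (uh L K U x \<bullet> grad (\<phi> j) x)) \<le> norm (M * (\<phi> i x * norm (grad (\<phi> j) x)))"
      using pt[OF that] M0 hat_nonneg[OF that(1)] by (intro AE_I2) (simp add: abs_mult)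
  qed
  let ?f = "\<lambda>x. \<phi> i x * (uh L K U x \<bullet> grad (\<phi> j) x) - \<phi> j x * (uh L K U x \<bullet> grad (\<phi> i) x)"
  have fi: "integrable \<Lambda> ?f" using ii[OF assms(1,2)] ii[OF assms(2,1)] by simp
  have "integral (cbox 0 L) ?f = (\<integral>x. ?f x \<partial>\<Lambda>)"
    by (rule lebesgue_integral_eq_integral[symmetric, OF fi]) simp
  moreover have "\<bar>\<integral>x. ?f x \<partial>\<Lambda>\<bar> \<le> (\<integral>x. \<bar>?f x\<bar> \<partial>\<Lambda>)" by (rule integral_abs_bound)
  moreover have "(\<integral>x. \<bar>?f x\<bar> \<partial>\<Lambda>) \<le> (\<integral>x. M * (\<phi> i x * norm (grad (\<phi> j) x) + \<phi> j x * norm (grad (\<phi> i) x)) \<partial>\<Lambda>)"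
  proof (rule integral_mono)
    fix x
    show "\<bar>?f x\<bar> \<le> M * (\<phi> i x * norm (grad (\<phi> j) x) + \<phi> j x * norm (grad (\<phi> i) x))"
      using pt[OF assms(1,2), of x] pt[OF assms(2,1), of x] unfolding distrib_left by linarith
  qed (use fi ig[OF assms(1,2)] ig[OF assms(2,1)] in auto)
  moreover have "(\<integral>x. M * (\<phi> i x * norm (grad (\<phi> j) x) + \<phi> j x * norm (grad (\<phi> i) x)) \<partial>\<Lambda>)
     = M * (\<integral>x. \<phi> i x * norm (grad (\<phi> j) x) + \<phi> j x * norm (grad (\<phi> i) x) \<partial>\<Lambda>)" by simp
  ultimately have "\<bar>integral (cbox 0 L) ?f\<bar> \<le> M * (\<integral>x. \<phi> i x * norm (grad (\<phi> j) x) + \<phi> j x * norm (grad (\<phi> i) x) \<partial>\<Lambda>)"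
    by linarith
  then show ?thesis unfolding aa_def by (simp add: abs_mult)
qed

end

section \<open>Consistency of the tested momentum equation\<close>

text \<open>\<open>w\<close> stands for a time slice of the test field and \<open>A\<close> for its
  trace-free spatial derivative. The bounds refer to points within distance \<open>h\<close> of the
  box, since the vertices of a cell may lie outside it.\<close>

locale tested_scheme = scheme L K h \<kappa> \<omega> al U U' P for L :: "real^'d" and K h \<kappa> \<omega> al U U' P +
  fixes w :: "real^'d \<Rightarrow> real^'d" and A :: "real^'d \<Rightarrow> real^'d \<Rightarrow> real^'d" and M V \<epsilon> :: real
  assumes UM: "\<And>j. j \<in> N \<Longrightarrow> norm (U j) \<le> M" and PM: "\<And>j. j \<in> N \<Longrightarrow> \<bar>P j\<bar> \<le> M"
    and wper: "lat_per L w" and wlip: "\<And>k. perlip L (\<lambda>x. w x $ k)"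
    and wder: "\<And>x. (w has_derivative A x) (at x)"
    and w2: "\<And>x v. x \<in> cbox 0 L \<Longrightarrow> norm (v - x) \<le> h \<Longrightarrow> norm (w v - w x - A x (v - x)) \<le> \<epsilon> * h"
    and w1: "\<And>x v. x \<in> cbox 0 L \<Longrightarrow> norm (v - x) \<le> h \<Longrightarrow> norm (w v - w x) \<le> V * h"
    and w0: "\<And>x v. x \<in> cbox 0 L \<Longrightarrow> norm (v - x) \<le> h \<Longrightarrow> norm (w v) \<le> V"
    and AV: "\<And>x e. x \<in> cbox 0 L \<Longrightarrow> norm (A x e) \<le> V * norm e"
    and tr: "\<And>x. (\<Sum>k\<in>UNIV. A x (axis k 1) $ k) = 0"
    and h1: "h \<le> 1" and \<epsilon>0: "0 \<le> \<epsilon>"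
begin

text \<open>A single integrable majorant of all local errors. Its integral involves u_h only through
  \<open>h * h1semi\<close>, the quantity whose time integral is bounded.\<close>

definition E :: "real^'d \<Rightarrow> real" where "E x = (\<epsilon> + sqrt h) * (1 + h * G U x)"

lemma h_le_sqrt: "h \<le> sqrt h"
proof -
  have "h * h \<le> h * 1" using h1 hpos by (intro mult_left_mono) auto
  then have "sqrt (h * h) \<le> sqrt h" by (simp only: real_sqrt_le_iff mult_1_right)
  then show ?thesis using hpos by simp
qed

lemma E_bounds: "\<epsilon> \<le> E x" "h \<le> E x" "h * sqrt (G U x) \<le> E x" "h * h * G U x \<le> E x"
proof -
  have g: "0 \<le> h * G U x" using hpos G_nonneg by simp
  have s: "0 \<le> sqrt h" using hpos by simp
  have e1: "\<epsilon> * 1 \<le> \<epsilon> * (1 + h * G U x)" using \<epsilon>0 g by (intro mult_left_mono) auto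
  have e2: "0 \<le> \<epsilon> * (1 + h * G U x)" using \<epsilon>0 g by simp
  have s1: "sqrt h * 1 \<le> sqrt h * (1 + h * G U x)" using s g by (intro mult_left_mono) auto
  have Eeq: "E x = \<epsilon> * (1 + h * G U x) + sqrt h * (1 + h * G U x)" by (simp add: E_def distrib_right)
  show "\<epsilon> \<le> E x" using e1 s1 s Eeq by linarith
  show "h \<le> E x" using e2 s1 h_le_sqrt Eeq by linarith
  \<comment> \<open>From \<open>sqrt s \<le> 1 + s\<close>, after writing
    \<open>h * sqrt (G U x)\<close> as \<open>sqrt h * sqrt (h * G U x)\<close>.\<close>
  have "sqrt (h * G U x) \<le> 1 + h * G U x"
  proof (rule real_le_lsqrt)
    have "(1 + h * G U x)\<^sup>2 = 1 + 2 * (h * G U x) + (h * G U x)\<^sup>2" by (simp add: power2_sum)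
    then show "h * G U x \<le> (1 + h * G U x)\<^sup>2" using g by simp
  qed (use g in auto)
  then have "sqrt h * sqrt (h * G U x) \<le> sqrt h * (1 + h * G U x)" using s by (rule mult_left_mono)
  moreover have "sqrt h * sqrt (h * G U x) = h * sqrt (G U x)" using hpos by (simp add: real_sqrt_mult)
  ultimately show "h * sqrt (G U x) \<le> E x" using e2 Eeq by linarith
  have "h * (h * G U x) \<le> sqrt h * (h * G U x)" using h_le_sqrt g by (rule mult_right_mono)
  moreover have "sqrt h * (h * G U x) \<le> sqrt h * (1 + h * G U x)" using s by (intro mult_left_mono) auto
  ultimately show "h * h * G U x \<le> E x" using e2 Eeq by (simp only: mult.assoc)
qed

lemma bm_E: "bm E"
  unfolding E_def by (intro bm_mult bm_add bm_const bm_G)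

definition IE where "IE = (\<integral>x. E x \<partial>\<Lambda>)"

lemma IE_eq: "IE = (\<epsilon> + sqrt h) * (measure lebesgue (cbox 0 L) + h * h1semi L (uh L K U))"
proof -
  have "IE = (\<epsilon> + sqrt h) * (\<integral>x. 1 + h * G U x \<partial>\<Lambda>)" unfolding IE_def E_def by simp
  also have "(\<integral>x. 1 + h * G U x \<partial>\<Lambda>) = (\<integral>x. 1 \<partial>\<Lambda>) + h * (\<integral>x. G U x \<partial>\<Lambda>)"
    using bm_integrable[OF bm_const[of 1]] bm_integrable[OF bm_G[of U]] by simp
  also have "(\<integral>x. 1 \<partial>\<Lambda>) = measure lebesgue (cbox 0 L)" by (simp add: measure_restrict_space)
  finally show ?thesis by (simp add: h1semi_eq)
qed

lemma cell_estI: "x \<in> cbox 0 L \<Longrightarrow> cell_data L K h \<kappa> x C b \<beta> \<Longrightarrow> cell_est L K h \<kappa> x C b \<beta> U w (A x) P M V \<epsilon> (E x)"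
proof -
  assume x: "x \<in> cbox 0 L" and cd: "cell_data L K h \<kappa> x C b \<beta>"
  interpret cell_at L K h \<kappa> x C b \<beta> by unfold_locales (rule cd)
  show ?thesis
  proof (intro cell_est.intro cell_est_axioms.intro)
    show "cell_at L K h \<kappa> x C b \<beta>" by (rule cell_at_axioms)
    show "w (rep L v) = w v" for v by (rule lat_per_rep[OF wper])
    show "linear (A x)" by (rule has_derivative_linear[OF wder])
  qed (use E_bounds[of x] in \<open>simp_all add: UM PM w2[OF x] w1[OF x] w0[OF x] AV[OF x] G2_def[folded G_def]\<close>)
qed

lemma AE_cell_est: "AE x in \<Lambda>. \<exists>C b \<beta>. cell_est L K h \<kappa> x C b \<beta> U w (A x) P M V \<epsilon> (E x)"
proof -
  have "AE x in \<Lambda>. x \<in> cbox 0 L" by (intro AE_I2) simp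
  with AE_cell show ?thesis by eventually_elim (meson cell_estI)
qed

lemma A_component: "A x e $ k = pd (\<lambda>y. w y $ k) e x"
  using pd_eqI[OF bounded_linear.has_derivative[OF bounded_linear_vec_nth wder], of k e x] by simp

lemma A_expand: "A x e = (\<Sum>l\<in>UNIV. e $ l *\<^sub>R A x (axis l 1))"
proof -
  have "e = (\<Sum>l\<in>UNIV. e $ l *\<^sub>R axis l 1)" by (simp add: vec_eq_iff axis_def if_distrib cong: if_cong)
  then show ?thesis using linear_sum[OF has_derivative_linear[OF wder], of x "\<lambda>l. e $ l *\<^sub>R axis l 1" UNIV]
      linear_scale[OF has_derivative_linear[OF wder]] by (simp add: o_def)
qed

abbreviation "u \<equiv> uh L K U"

text \<open>By the product rule \<open>X + Y + Z\<close> is the divergence of \<open>(u \<bullet> w) u\<close>.\<close>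

definition X where "X x = (\<Sum>k\<in>UNIV. \<Sum>l\<in>UNIV. u x $ k * u x $ l * pd (\<lambda>y. w y $ k) (axis l 1) x)"
definition Y where "Y x = (\<Sum>k\<in>UNIV. \<Sum>l\<in>UNIV. pd (\<lambda>y. u y $ k) (axis l 1) x * u x $ l * w x $ k)"
definition Z where "Z x = (\<Sum>k\<in>UNIV. pd (\<lambda>y. u y $ k) (axis k 1) x) * (\<Sum>k\<in>UNIV. u x $ k * w x $ k)"

lemma X_eq: "X x = u x \<bullet> A x (u x)"
  unfolding X_def A_expand[of x "u x"] by (simp add: inner_vec_def A_component sum_distrib_left mult.assoc)

lemma bm_uk: "bm (\<lambda>x. u x $ k)" by (rule bm_continuous[OF perlip_continuous[OF perlip_uh]])
lemma bm_wk: "bm (\<lambda>x. w x $ k)" by (rule bm_continuous[OF perlip_continuous[OF wlip]])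

lemma bm_X: "bm X" unfolding X_def by (intro bm_sum bm_mult bm_uk bm_pd wlip)
lemma bm_Y: "bm Y" unfolding Y_def by (intro bm_sum bm_mult bm_uk bm_wk bm_pd perlip_uh)
lemma bm_Z: "bm Z" unfolding Z_def by (intro bm_sum bm_mult bm_uk bm_wk bm_pd perlip_uh)

lemma cell_YZ:
  assumes "cell_at L K h \<kappa> x C b \<beta>"
  shows "Y x = cell_at.Du L C \<beta> U (u x) \<bullet> w x" "Z x = (\<Sum>k\<in>UNIV. cell_at.Du L C \<beta> U (axis k 1) $ k) * (u x \<bullet> w x)"
    "((\<lambda>y. u y $ k) has_derivative (\<lambda>e. cell_at.Du L C \<beta> U e $ k)) (at x)"
proof -
  interpret cell_at L K h \<kappa> x C b \<beta> by fact
  have d: "Du U e $ k = pd (\<lambda>y. u y $ k) e x" for e k using pd_eqI[OF uh_component_derivative] by simp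
  have "Du U (u x) = (\<Sum>l\<in>UNIV. u x $ l *\<^sub>R Du U (axis l 1))"
  proof -
    have "u x = (\<Sum>l\<in>UNIV. u x $ l *\<^sub>R axis l 1)" by (simp add: vec_eq_iff axis_def if_distrib cong: if_cong)
    then show ?thesis using linear_sum[OF Du_linear, of U "\<lambda>l. u x $ l *\<^sub>R axis l 1" UNIV] linear_scale[OF Du_linear] by (simp add: o_def)
  qed
  then show "Y x = Du U (u x) \<bullet> w x"
    unfolding Y_def by (simp add: inner_vec_def d sum_distrib_right sum_distrib_left mult_ac)
  show "Z x = (\<Sum>k\<in>UNIV. Du U (axis k 1) $ k) * (u x \<bullet> w x)"
    unfolding Z_def by (simp add: inner_vec_def d)
  show "((\<lambda>y. u y $ k) has_derivative (\<lambda>e. Du U e $ k)) (at x)" by (rule uh_component_derivative)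
qed

lemma integration_by_parts: "(\<integral>x. X x \<partial>\<Lambda>) + (\<integral>x. Y x \<partial>\<Lambda>) + (\<integral>x. Z x \<partial>\<Lambda>) = 0"
proof -
  define f where "f l x = u x $ l * (\<Sum>k\<in>UNIV. u x $ k * w x $ k)" for l x
  have fl: "perlip L (f l)" for l unfolding f_def by (intro perlip_mult perlip_sum perlip_uh wlip)
  have "AE x in \<Lambda>. X x + Y x + Z x = (\<Sum>l\<in>UNIV. pd (f l) (axis l 1) x)"
    using AE_cell
  proof eventually_elim
    case (elim x)
    then obtain C b \<beta> where cd: "cell_data L K h \<kappa> x C b \<beta>" by blast
    interpret cell_at L K h \<kappa> x C b \<beta> by unfold_locales (rule cd)
    have dw: "((\<lambda>y. w y $ k) has_derivative (\<lambda>e. A x e $ k)) (at x)" for k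
      by (rule bounded_linear.has_derivative[OF bounded_linear_vec_nth wder])
    have "(f l has_derivative (\<lambda>e. u x $ l * (\<Sum>k\<in>UNIV. u x $ k * A x e $ k + Du U e $ k * w x $ k) + Du U e $ l * (\<Sum>k\<in>UNIV. u x $ k * w x $ k))) (at x)" for l
      unfolding f_def by (intro has_derivative_mult has_derivative_sum uh_component_derivative dw)
    then have "pd (f l) (axis l 1) x = u x $ l * (\<Sum>k\<in>UNIV. u x $ k * A x (axis l 1) $ k + Du U (axis l 1) $ k * w x $ k) + Du U (axis l 1) $ l * (\<Sum>k\<in>UNIV. u x $ k * w x $ k)" for l
      by (rule pd_eqI)
    moreover have d: "Du U e $ k = pd (\<lambda>y. u y $ k) e x" for e k using pd_eqI[OF uh_component_derivative] by simp
    ultimately have eq: "pd (f l) (axis l 1) x = (\<Sum>k\<in>UNIV. u x $ k * u x $ l * pd (\<lambda>y. w y $ k) (axis l 1) x)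
       + (\<Sum>k\<in>UNIV. pd (\<lambda>y. u y $ k) (axis l 1) x * u x $ l * w x $ k) + pd (\<lambda>y. u y $ l) (axis l 1) x * (\<Sum>k\<in>UNIV. u x $ k * w x $ k)" for l
      by (simp add: A_component sum.distrib distrib_left sum_distrib_left mult_ac)
    have "(\<Sum>l\<in>UNIV. pd (f l) (axis l 1) x) = (\<Sum>l\<in>UNIV. \<Sum>k\<in>UNIV. u x $ k * u x $ l * pd (\<lambda>y. w y $ k) (axis l 1) x)
      + (\<Sum>l\<in>UNIV. \<Sum>k\<in>UNIV. pd (\<lambda>y. u y $ k) (axis l 1) x * u x $ l * w x $ k) + Z x"
      unfolding eq sum.distrib Z_def sum_distrib_right ..
    then show "X x + Y x + Z x = (\<Sum>l\<in>UNIV. pd (f l) (axis l 1) x)"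
      unfolding X_def Y_def by (subst (1 2) sum.swap) simp
  qed
  then have "(\<integral>x. X x + Y x + Z x \<partial>\<Lambda>) = (\<integral>x. (\<Sum>l\<in>UNIV. pd (f l) (axis l 1) x) \<partial>\<Lambda>)"
    by (intro integral_cong_AE borel_measurable_integrable bm_integrable bm_add bm_X bm_Y bm_Z bm_sum bm_pd fl)
  also have "\<dots> = (\<Sum>l\<in>UNIV. \<integral>x. pd (f l) (axis l 1) x \<partial>\<Lambda>)"
    by (intro Bochner_Integration.integral_sum bm_integrable bm_pd fl)
  also have "\<dots> = 0" using perlip_pd(2)[OF fl Lpos] by simp
  finally show ?thesis using bm_integrable[OF bm_X] bm_integrable[OF bm_Y] bm_integrable[OF bm_Z] by simp
qed

text \<open>\<open>J1\<close> to \<open>J3\<close> identify the limits of the three ways in which a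
  discrete derivative can fall on the triple product of velocity, velocity and test field: on
  \<open>w\<close>, on the velocity paired with \<open>w\<close>, or on the transporting
  velocity.\<close>

lemma J1: "\<bar>(\<Sum>i\<in>N. \<Sum>j\<in>N. ((U i \<bullet> w j) *\<^sub>R U i) \<bullet> cc L K i j) - (\<integral>x. X x \<partial>\<Lambda>)\<bar> \<le> (M * M * ((real CARD('d) + 1) * \<kappa>) + 2 * M * V) * IE"
  unfolding sum_cc(2) IE_def
proof (rule integral_AE_close[OF sum_cc(1) bm_integrable[OF bm_X] bm_integrable[OF bm_E]])
  show "AE x in \<Lambda>. \<bar>(\<Sum>i\<in>N. \<Sum>j\<in>N. \<phi> i x * (((U i \<bullet> w j) *\<^sub>R U i) \<bullet> grad (\<phi> j) x)) - X x\<bar> \<le> (M * M * ((real CARD('d) + 1) * \<kappa>) + 2 * M * V) * E x"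
    using AE_cell_est
  proof eventually_elim
    case (elim x)
    then obtain C b \<beta> where c: "cell_est L K h \<kappa> x C b \<beta> U w (A x) P M V \<epsilon> (E x)" by blast
    interpret cell_est L K h \<kappa> x C b \<beta> U w "A x" P M V \<epsilon> "E x" by fact
    show ?case unfolding cc_point X_eq by (rule est_conv1)
  qed
qed

lemma J2: "\<bar>(\<Sum>i\<in>N. \<Sum>j\<in>N. ((U j \<bullet> w i) *\<^sub>R U i) \<bullet> cc L K i j) - (\<integral>x. Y x \<partial>\<Lambda>)\<bar> \<le> (V + M * V) * IE"
  unfolding sum_cc(2) IE_def
proof (rule integral_AE_close[OF sum_cc(1) bm_integrable[OF bm_Y] bm_integrable[OF bm_E]])
  show "AE x in \<Lambda>. \<bar>(\<Sum>i\<in>N. \<Sum>j\<in>N. \<phi> i x * (((U j \<bullet> w i) *\<^sub>R U i) \<bullet> grad (\<phi> j) x)) - Y x\<bar> \<le> (V + M * V) * E x"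
    using AE_cell_est
  proof eventually_elim
    case (elim x)
    then obtain C b \<beta> where c: "cell_est L K h \<kappa> x C b \<beta> U w (A x) P M V \<epsilon> (E x)" by blast
    interpret cell_est L K h \<kappa> x C b \<beta> U w "A x" P M V \<epsilon> "E x" by fact
    show ?case unfolding cc_point cell_YZ(1)[OF cell_at_axioms] by (rule est_conv2)
  qed
qed

lemma J3: "\<bar>(\<Sum>i\<in>N. \<Sum>j\<in>N. ((U i \<bullet> w i) *\<^sub>R U j) \<bullet> cc L K i j) - (\<integral>x. Z x \<partial>\<Lambda>)\<bar> \<le> (real CARD('d) * (V + M * V)) * IE"
  unfolding sum_cc(2) IE_def
proof (rule integral_AE_close[OF sum_cc(1) bm_integrable[OF bm_Z] bm_integrable[OF bm_E]])
  show "AE x in \<Lambda>. \<bar>(\<Sum>i\<in>N. \<Sum>j\<in>N. \<phi> i x * (((U i \<bullet> w i) *\<^sub>R U j) \<bullet> grad (\<phi> j) x)) - Z x\<bar> \<le> (real CARD('d) * (V + M * V)) * E x"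
    using AE_cell_est
  proof eventually_elim
    case (elim x)
    then obtain C b \<beta> where c: "cell_est L K h \<kappa> x C b \<beta> U w (A x) P M V \<epsilon> (E x)" by blast
    interpret cell_est L K h \<kappa> x C b \<beta> U w "A x" P M V \<epsilon> "E x" by fact
    show ?case unfolding cc_point cell_YZ(2)[OF cell_at_axioms] using est_div by (simp only: mult.assoc)
  qed
qed

lemma J4: "\<bar>\<Sum>i\<in>N. \<Sum>j\<in>N. (P i *\<^sub>R w j) \<bullet> cc L K i j\<bar> \<le> (M * ((real CARD('d) + 1) * \<kappa>)) * IE"
proof -
  have "\<bar>(\<Sum>i\<in>N. \<Sum>j\<in>N. (P i *\<^sub>R w j) \<bullet> cc L K i j) - (\<integral>x. 0 \<partial>\<Lambda>)\<bar> \<le> (M * ((real CARD('d) + 1) * \<kappa>)) * IE"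
    unfolding sum_cc(2) IE_def
  proof (rule integral_AE_close[OF sum_cc(1) bm_integrable[OF bm_const] bm_integrable[OF bm_E]])
    show "AE x in \<Lambda>. \<bar>(\<Sum>i\<in>N. \<Sum>j\<in>N. \<phi> i x * ((P i *\<^sub>R w j) \<bullet> grad (\<phi> j) x)) - 0\<bar> \<le> (M * ((real CARD('d) + 1) * \<kappa>)) * E x"
      using AE_cell_est
    proof eventually_elim
      case (elim x)
      then obtain C b \<beta> where c: "cell_est L K h \<kappa> x C b \<beta> U w (A x) P M V \<epsilon> (E x)" by blast
      interpret cell_est L K h \<kappa> x C b \<beta> U w "A x" P M V \<epsilon> "E x" by fact
      show ?case unfolding cc_point using est_pressure[OF tr] by simp
    qed
  qed
  then show ?thesis by simp
qed

text \<open>The same double sum as in \<open>J3\<close>, now seen to be small by (S2) tested with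
  the nodal values of \<open>U \<bullet> w\<close>. Together the two lemmas make the integral of
  \<open>Z\<close> small.\<close>

lemma J5: "\<bar>\<Sum>i\<in>N. \<Sum>j\<in>N. ((U i \<bullet> w i) *\<^sub>R U j) \<bullet> cc L K i j\<bar> \<le> (\<omega> / 2 * (4 * M * (V + M * V))) * IE"
proof -
  have "\<bar>(\<Sum>i\<in>N. \<Sum>j\<in>N. mm L K i j * ((P j - P i) * (U j \<bullet> w j - U i \<bullet> w i))) - (\<integral>x. 0 \<partial>\<Lambda>)\<bar> \<le> (4 * M * (V + M * V)) * IE"
    unfolding sum_mm(2) IE_def
  proof (rule integral_AE_close[OF sum_mm(1) bm_integrable[OF bm_const] bm_integrable[OF bm_E]])
    show "AE x in \<Lambda>. \<bar>(\<Sum>i\<in>N. \<Sum>j\<in>N. \<phi> i x * \<phi> j x * ((P j - P i) * (U j \<bullet> w j - U i \<bullet> w i))) - 0\<bar> \<le> (4 * M * (V + M * V)) * E x"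
      using AE_cell_est
    proof eventually_elim
      case (elim x)
      then obtain C b \<beta> where c: "cell_est L K h \<kappa> x C b \<beta> U w (A x) P M V \<epsilon> (E x)" by blast
      interpret cell_est L K h \<kappa> x C b \<beta> U w "A x" P M V \<epsilon> "E x" by fact
      show ?case unfolding mm_point using est_mass by simp
    qed
  qed
  then have "\<omega> / 2 * \<bar>\<Sum>i\<in>N. \<Sum>j\<in>N. mm L K i j * ((P j - P i) * (U j \<bullet> w j - U i \<bullet> w i))\<bar> \<le> \<omega> / 2 * ((4 * M * (V + M * V)) * IE)"
    using \<omega>pos by (intro mult_left_mono) auto
  then show ?thesis unfolding discrete_divergence using \<omega>pos by (simp add: abs_mult mult.assoc)
qed

text \<open>The coefficients satisfy \<open>du_off \<le> \<bar>aa\<bar>\<close> whatever the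
  blending factors are. Both halves of the bound on \<open>aa\<close> contribute equally because the
  product of increments is symmetric in the indices.\<close>

lemma J6: "\<bar>\<Sum>i\<in>N. \<Sum>j\<in>N. du L K al U i j * (w i \<bullet> U j)\<bar> \<le> (M / 2 * (4 * ((real CARD('d) + 1) * \<kappa>) * V)) * IE"
proof -
  define R where "R i j = norm (U i - U j) * norm (w i - w j)" for i j
  have R0: "0 \<le> R i j" for i j by (simp add: R_def)
  have Rsym: "R i j = R j i" for i j by (simp add: R_def norm_minus_commute)
  have UMb: "\<forall>j\<in>N. norm (U j) \<le> M" using UM by blast
  define I where "I i j = (\<integral>x. \<phi> i x * norm (grad (\<phi> j) x) \<partial>\<Lambda>)" for i j
  have ig: "integrable \<Lambda> (\<lambda>x. \<phi> i x * norm (grad (\<phi> j) x))" if "i \<in> N" "j \<in> N" for i j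
    using integrable_norm[OF integrable_hat_grad[OF that]] hat_nonneg[OF that(1)] by simp
  have "\<bar>\<Sum>i\<in>N. \<Sum>j\<in>N. du L K al U i j * (w i \<bullet> U j)\<bar> = 1/2 * \<bar>\<Sum>i\<in>N. \<Sum>j\<in>N. du_off L K al U i j * ((w i - w j) \<bullet> (U i - U j))\<bar>"
    unfolding visc_form by (simp add: abs_mult)
  also have "\<dots> \<le> 1/2 * (\<Sum>i\<in>N. \<Sum>j\<in>N. M / 2 * (I i j + I j i) * R i j)"
  proof (intro mult_left_mono order_trans[OF sum_abs] sum_mono)
    fix i j assume ij: "i \<in> N" "j \<in> N"
    have 1: "\<bar>du_off L K al U i j\<bar> \<le> M / 2 * (I i j + I j i)"
      using du_off_bounds[of i j] aa_bound[OF ij UMb] ig[OF ij] ig[OF ij(2,1)] by (simp add: I_def)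
    have "\<bar>(w i - w j) \<bullet> (U i - U j)\<bar> \<le> R i j"
      using Cauchy_Schwarz_ineq2[of "w i - w j" "U i - U j"] by (simp add: R_def mult.commute)
    then show "\<bar>du_off L K al U i j * ((w i - w j) \<bullet> (U i - U j))\<bar> \<le> M / 2 * (I i j + I j i) * R i j"
      unfolding abs_mult using 1 by (intro mult_mono) auto
  qed simp
  also have "\<dots> = M / 2 * (\<Sum>i\<in>N. \<Sum>j\<in>N. I i j * R i j)"
  proof -
    have "(\<Sum>i\<in>N. \<Sum>j\<in>N. I j i * R i j) = (\<Sum>j\<in>N. \<Sum>i\<in>N. I j i * R i j)" by (rule sum.swap)
    also have "\<dots> = (\<Sum>j\<in>N. \<Sum>i\<in>N. I j i * R j i)" by (intro sum.cong refl arg_cong2[of _ _ _ _ "(*)"] Rsym)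
    finally have "(\<Sum>i\<in>N. \<Sum>j\<in>N. I j i * R i j) = (\<Sum>i\<in>N. \<Sum>j\<in>N. I i j * R i j)" .
    moreover have "(\<Sum>i\<in>N. \<Sum>j\<in>N. M / 2 * (I i j + I j i) * R i j) = M / 2 * ((\<Sum>i\<in>N. \<Sum>j\<in>N. I i j * R i j) + (\<Sum>i\<in>N. \<Sum>j\<in>N. I j i * R i j))"
      by (simp add: sum.distrib[symmetric] sum_distrib_left algebra_simps)
    ultimately show ?thesis by simp
  qed
  also have "\<dots> \<le> M / 2 * ((4 * ((real CARD('d) + 1) * \<kappa>) * V) * IE)"
  proof (rule mult_left_mono)
    have "(\<Sum>i\<in>N. \<Sum>j\<in>N. I i j * R i j) = (\<Sum>i\<in>N. \<Sum>j\<in>N. \<integral>x. \<phi> i x * norm (grad (\<phi> j) x) * R i j \<partial>\<Lambda>)"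
      unfolding I_def by simp
    also have "\<dots> = (\<Sum>i\<in>N. \<integral>x. (\<Sum>j\<in>N. \<phi> i x * norm (grad (\<phi> j) x) * R i j) \<partial>\<Lambda>)"
      by (intro sum.cong refl Bochner_Integration.integral_sum[symmetric] integrable_mult_left ig)
    also have "\<dots> = (\<integral>x. (\<Sum>i\<in>N. \<Sum>j\<in>N. \<phi> i x * norm (grad (\<phi> j) x) * R i j) \<partial>\<Lambda>)"
      by (intro Bochner_Integration.integral_sum[symmetric] Bochner_Integration.integrable_sum integrable_mult_left ig)
    also have "\<dots> \<le> (\<integral>x. (4 * ((real CARD('d) + 1) * \<kappa>) * V) * E x \<partial>\<Lambda>)"
    proof (rule integral_mono_AE)
      show "AE x in \<Lambda>. (\<Sum>i\<in>N. \<Sum>j\<in>N. \<phi> i x * norm (grad (\<phi> j) x) * R i j) \<le> (4 * ((real CARD('d) + 1) * \<kappa>) * V) * E x"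
        using AE_cell_est
      proof eventually_elim
        case (elim x)
        then obtain C b \<beta> where c: "cell_est L K h \<kappa> x C b \<beta> U w (A x) P M V \<epsilon> (E x)" by blast
        interpret cell_est L K h \<kappa> x C b \<beta> U w "A x" P M V \<epsilon> "E x" by fact
        show ?case using norm_grad_point[of R, OF R0] est_visc unfolding R_def by linarith
      qed
      show "integrable \<Lambda> (\<lambda>x. \<Sum>i\<in>N. \<Sum>j\<in>N. \<phi> i x * norm (grad (\<phi> j) x) * R i j)"
        by (intro Bochner_Integration.integrable_sum integrable_mult_left ig)
    qed (use bm_integrable[OF bm_E] in simp)
    finally show "(\<Sum>i\<in>N. \<Sum>j\<in>N. I i j * R i j) \<le> (4 * ((real CARD('d) + 1) * \<kappa>) * V) * IE" unfolding IE_def by simp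
  next
    have "N \<noteq> {}" using sum_hat by fastforce
    then obtain j where "j \<in> N" by blast
    then have "norm (U j) \<le> M" by (rule UM)
    then show "0 \<le> M / 2" using norm_ge_zero[of "U j"] by linarith
  qed
  finally show ?thesis by (simp only: mult.assoc)
qed

text \<open>\<open>(j1 - j2) / 2\<close> approximates \<open>(IX - IY) / 2\<close>, which equals
  \<open>IX + IZ / 2\<close> because \<open>IX + IY + IZ = 0\<close>. The surplus
  \<open>IZ / 2\<close> is close to \<open>j3 / 2\<close> by \<open>J3\<close>, and
  \<open>j3\<close> is small by \<open>J5\<close>; viscosity \<open>j6\<close> and pressure
  \<open>j4\<close> are errors as well.\<close>

lemma consistency:
  "\<bar>(\<Sum>i\<in>N. lm L K i * (w i \<bullet> U' i)) - (\<integral>x. X x \<partial>\<Lambda>)\<bar>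
     \<le> (2 * M * ((real CARD('d) + 1) * \<kappa>) * V + (M * M * ((real CARD('d) + 1) * \<kappa>) + 2 * M * V) / 2 + (V + M * V) / 2 * (1 + real CARD('d) + 2 * \<omega> * M) + M * ((real CARD('d) + 1) * \<kappa>)) * IE"
proof -
  define j1 where "j1 = (\<Sum>i\<in>N. \<Sum>j\<in>N. ((U i \<bullet> w j) *\<^sub>R U i) \<bullet> cc L K i j)"
  define j2 where "j2 = (\<Sum>i\<in>N. \<Sum>j\<in>N. ((U j \<bullet> w i) *\<^sub>R U i) \<bullet> cc L K i j)"
  define j3 where "j3 = (\<Sum>i\<in>N. \<Sum>j\<in>N. ((U i \<bullet> w i) *\<^sub>R U j) \<bullet> cc L K i j)"
  define j4 where "j4 = (\<Sum>i\<in>N. \<Sum>j\<in>N. (P i *\<^sub>R w j) \<bullet> cc L K i j)"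
  define j6 where "j6 = (\<Sum>i\<in>N. \<Sum>j\<in>N. du L K al U i j * (w i \<bullet> U j))"
  define IX where "IX = (\<integral>x. X x \<partial>\<Lambda>)"
  define IY where "IY = (\<integral>x. Y x \<partial>\<Lambda>)"
  define IZ where "IZ = (\<integral>x. Z x \<partial>\<Lambda>)"
  \<comment> \<open>The two summands of the averaged velocity. The one with \<open>U j\<close> is
    \<open>j1\<close> up to sign after exchanging the indices, which moves the derivative from u_h
    to \<open>w\<close>.\<close>
  have q: "(\<Sum>i\<in>N. \<Sum>j\<in>N. atil L K U i j * (w i \<bullet> U j)) = 1/2 * (j2 - j1)"
  proof -
    have "(\<Sum>i\<in>N. \<Sum>j\<in>N. atil L K U i j * (w i \<bullet> U j)) = 1/2 * (j2 + (\<Sum>i\<in>N. \<Sum>j\<in>N. ((U j \<bullet> w i) *\<^sub>R U j) \<bullet> cc L K i j))"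
      unfolding j2_def sum.distrib[symmetric] sum_distrib_left
      by (intro sum.cong refl) (simp add: atil_def inner_add_left inner_commute algebra_simps)
    also have "(\<Sum>i\<in>N. \<Sum>j\<in>N. ((U j \<bullet> w i) *\<^sub>R U j) \<bullet> cc L K i j) = - j1"
      unfolding j1_def by (rule cc_swap)
    finally show ?thesis by simp
  qed
  have p: "(\<Sum>i\<in>N. \<Sum>j\<in>N. (P j *\<^sub>R w i) \<bullet> cc L K i j) = - j4" unfolding j4_def by (rule cc_swap)
  have T: "(\<Sum>i\<in>N. lm L K i * (w i \<bullet> U' i)) = j6 - 1/2 * (j2 - j1) + j4"
    unfolding tested_scheme q p j6_def by simp
  have ibp: "IX + IY + IZ = 0" unfolding IX_def IY_def IZ_def by (rule integration_by_parts)
  have e: "j6 - 1/2 * (j2 - j1) + j4 - IX = j6 + 1/2 * (j1 - IX) - 1/2 * (j2 - IY) - 1/2 * (j3 - IZ) + 1/2 * j3 + j4"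
  proof -
    have IX: "IX = - IY - IZ" using ibp by linarith
    show ?thesis unfolding IX by (simp add: field_simps)
  qed
  have comb: "\<bar>f + 1/2 * a - 1/2 * b - 1/2 * c + 1/2 * d + e\<bar> \<le> F' + 1/2 * A' + 1/2 * B' + 1/2 * C' + 1/2 * D' + E'"
    if "\<bar>a\<bar> \<le> A'" "\<bar>b\<bar> \<le> B'" "\<bar>c\<bar> \<le> C'" "\<bar>e\<bar> \<le> E'" "\<bar>d\<bar> \<le> D'" "\<bar>f\<bar> \<le> F'"
    for a b c d e f A' B' C' D' E' F' :: real using that by linarith
  have "\<bar>j1 - IX\<bar> \<le> (M * M * ((real CARD('d) + 1) * \<kappa>) + 2 * M * V) * IE" "\<bar>j2 - IY\<bar> \<le> (V + M * V) * IE"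
    "\<bar>j3 - IZ\<bar> \<le> (real CARD('d) * (V + M * V)) * IE" "\<bar>j4\<bar> \<le> (M * ((real CARD('d) + 1) * \<kappa>)) * IE"
    "\<bar>j3\<bar> \<le> (\<omega> / 2 * (4 * M * (V + M * V))) * IE" "\<bar>j6\<bar> \<le> (M / 2 * (4 * ((real CARD('d) + 1) * \<kappa>) * V)) * IE"
    unfolding j1_def j2_def j3_def j4_def j6_def IX_def IY_def IZ_def by (rule J1 J2 J3 J4 J5 J6)+
  then have "\<bar>j6 + 1/2 * (j1 - IX) - 1/2 * (j2 - IY) - 1/2 * (j3 - IZ) + 1/2 * j3 + j4\<bar> \<le>
     (M / 2 * (4 * ((real CARD('d) + 1) * \<kappa>) * V)) * IE + 1/2 * ((M * M * ((real CARD('d) + 1) * \<kappa>) + 2 * M * V) * IE) + 1/2 * ((V + M * V) * IE) + 1/2 * ((real CARD('d) * (V + M * V)) * IE)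
      + 1/2 * ((\<omega> / 2 * (4 * M * (V + M * V))) * IE) + (M * ((real CARD('d) + 1) * \<kappa>)) * IE" by (rule comb)
  also have "\<dots> = (2 * M * ((real CARD('d) + 1) * \<kappa>) * V + (M * M * ((real CARD('d) + 1) * \<kappa>) + 2 * M * V) / 2 + (V + M * V) / 2 * (1 + real CARD('d) + 2 * \<omega> * M) + M * ((real CARD('d) + 1) * \<kappa>)) * IE"
    by (simp add: field_simps)
  finally show ?thesis unfolding T IX_def[symmetric] e .
qed

end

context cmesh begin

lemma jensen_uh:
  fixes U :: "real^'d \<Rightarrow> real^'d"
  shows "(\<integral>x. (norm (uh L K U x))\<^sup>2 / 2 \<partial>\<Lambda>) \<le> (\<Sum>i\<in>N. lm L K i * ((norm (U i))\<^sup>2 / 2))"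
  unfolding sum_lm
proof (rule integral_mono)
  show "integrable \<Lambda> (\<lambda>x. (norm (uh L K U x))\<^sup>2 / 2)"
    by (intro bm_integrable bm_continuous continuous_intros uh_continuous) simp
  show "integrable \<Lambda> (\<lambda>x. \<Sum>i\<in>N. \<phi> i x * ((norm (U i))\<^sup>2 / 2))"
    using hat_integrable by (intro Bochner_Integration.integrable_sum integrable_mult_left)
  fix x
  define v where "v = uh L K U x"
  \<comment> \<open>The variance of the nodal values with weights \<open>\<phi> i x\<close> about
    their mean \<open>v\<close> is nonnegative; expanding it is Jensen's inequality for the
    square.\<close>
  have "0 \<le> (\<Sum>i\<in>N. \<phi> i x * (norm (U i - v))\<^sup>2)" using hat_nonneg by (intro sum_nonneg) auto
  also have "\<dots> = (\<Sum>i\<in>N. \<phi> i x * (norm (U i))\<^sup>2 - 2 * (\<phi> i x * (U i \<bullet> v)) + \<phi> i x * (v \<bullet> v))"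
    by (intro sum.cong refl) (simp add: power2_norm_eq_inner inner_diff_left inner_diff_right inner_commute algebra_simps)
  also have "\<dots> = (\<Sum>i\<in>N. \<phi> i x * (norm (U i))\<^sup>2) - 2 * (\<Sum>i\<in>N. \<phi> i x * (U i \<bullet> v)) + (\<Sum>i\<in>N. \<phi> i x) * (v \<bullet> v)"
    by (simp add: sum.distrib sum_subtractf sum_distrib_left sum_distrib_right)
  also have "(\<Sum>i\<in>N. \<phi> i x * (U i \<bullet> v)) = v \<bullet> v" unfolding v_def uh_def by (simp add: inner_sum_left)
  finally have "v \<bullet> v \<le> (\<Sum>i\<in>N. \<phi> i x * (norm (U i))\<^sup>2)" by (simp add: sum_hat)
  then show "(norm (uh L K U x))\<^sup>2 / 2 \<le> (\<Sum>i\<in>N. \<phi> i x * ((norm (U i))\<^sup>2 / 2))"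
    by (simp add: v_def[symmetric] power2_norm_eq_inner sum_divide_distrib[symmetric])
qed

text \<open>Lumped masses integrate the interpolant of \<open>U \<bullet> w\<close> instead of the
  product with u_h. At a point the difference is a convex combination of
  \<open>U (r v) \<bullet> (w v - w x)\<close>.\<close>

lemma lumping_error:
  fixes U w :: "real^'d \<Rightarrow> real^'d"
  assumes UM: "\<forall>j\<in>N. norm (U j) \<le> M" and w: "lat_per L w" "continuous_on UNIV w"
    and \<delta>: "\<And>x v. x \<in> cbox 0 L \<Longrightarrow> norm (v - x) \<le> h \<Longrightarrow> norm (w v - w x) \<le> \<delta>"
  shows "\<bar>(\<Sum>i\<in>N. lm L K i * (U i \<bullet> w i)) - (\<integral>x. uh L K U x \<bullet> w x \<partial>\<Lambda>)\<bar> \<le> M * \<delta> * measure lebesgue (cbox 0 L)"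
proof -
  have "\<bar>(\<integral>x. (\<Sum>i\<in>N. \<phi> i x * (U i \<bullet> w i)) \<partial>\<Lambda>) - (\<integral>x. uh L K U x \<bullet> w x \<partial>\<Lambda>)\<bar> \<le> (M * \<delta>) * (\<integral>x. 1 \<partial>\<Lambda>)"
  proof (rule integral_AE_close)
    show "integrable \<Lambda> (\<lambda>x. \<Sum>i\<in>N. \<phi> i x * (U i \<bullet> w i))"
      using hat_integrable by (intro Bochner_Integration.integrable_sum integrable_mult_left)
    show "integrable \<Lambda> (\<lambda>x. uh L K U x \<bullet> w x)"
      by (intro bm_integrable bm_continuous continuous_intros uh_continuous w)
    show "integrable \<Lambda> (\<lambda>x. 1::real)" by (rule bm_integrable[OF bm_const])
    have "AE x in \<Lambda>. x \<in> cbox 0 L" by (intro AE_I2) simp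
    with AE_cell show "AE x in \<Lambda>. \<bar>(\<Sum>i\<in>N. \<phi> i x * (U i \<bullet> w i)) - uh L K U x \<bullet> w x\<bar> \<le> M * \<delta> * 1"
    proof eventually_elim
      case (elim x)
      then obtain C b \<beta> where cd: "cell_data L K h \<kappa> x C b \<beta>" by blast
      interpret cell_at L K h \<kappa> x C b \<beta> by unfold_locales (rule cd)
      have "(\<Sum>i\<in>N. \<phi> i x * (U i \<bullet> w i)) - uh L K U x \<bullet> w x = (\<Sum>v\<in>C. b v * (U (r v) \<bullet> (w v - w x)))"
        unfolding hat_point uh_x by (simp add: lat_per_rep[OF w(1)] inner_sum_left inner_diff_right right_diff_distrib sum_subtractf)
      also have "\<bar>\<dots>\<bar> \<le> M * \<delta>"
      proof (rule conv_comb_bound)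
        fix v assume v: "v \<in> C"
        have Uv: "norm (U (r v)) \<le> M" using UM rN[OF v] by blast
        then have "0 \<le> M" using norm_ge_zero[of "U (r v)"] by linarith
        then have "norm (U (r v)) * norm (w v - w x) \<le> M * \<delta>"
          using Uv \<delta>[OF elim(2) vdist[OF v]] by (intro mult_mono) auto
        then show "\<bar>U (r v) \<bullet> (w v - w x)\<bar> \<le> M * \<delta>" using Cauchy_Schwarz_ineq2[of "U (r v)" "w v - w x"] by linarith
      qed
      finally show ?case by simp
    qed
  qed
  then show ?thesis by (simp add: sum_lm measure_restrict_space)
qed

text \<open>A quadratic form in the nodal values with coefficients independent of time. It makes the
  seminorm continuous in time and thus integrable, which a bound on \<open>integral\<close> alone
  does not supply.\<close>

lemma h1semi_quadratic:
  "h1semi L (uh L K U) = (\<Sum>k\<in>UNIV. \<Sum>i\<in>N. \<Sum>j\<in>N. U i $ k * U j $ k * (\<integral>x. grad (\<phi> i) x \<bullet> grad (\<phi> j) x \<partial>\<Lambda>))"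
proof -
  have ii: "integrable \<Lambda> (\<lambda>x. grad (\<phi> i) x \<bullet> grad (\<phi> j) x)" if "i \<in> N" "j \<in> N" for i j
    unfolding inner_grad using that by (simp add: grad_def) (intro bm_integrable bm_sum bm_mult bm_pd hat_perlip)
  have "AE x in \<Lambda>. G U x = (\<Sum>k\<in>UNIV. \<Sum>i\<in>N. \<Sum>j\<in>N. U i $ k * U j $ k * (grad (\<phi> i) x \<bullet> grad (\<phi> j) x))"
    using AE_cell
  proof eventually_elim
    case (elim x)
    then obtain C b \<beta> where cd: "cell_data L K h \<kappa> x C b \<beta>" by blast
    interpret cell_at L K h \<kappa> x C b \<beta> by unfold_locales (rule cd)
    have g: "grad (\<lambda>y. uh L K U y $ k) x = (\<Sum>j\<in>N. U j $ k *\<^sub>R grad (\<phi> j) x)" for k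
    proof -
      have "grad (\<lambda>y. uh L K U y $ k) x \<bullet> e = (\<Sum>j\<in>N. U j $ k *\<^sub>R grad (\<phi> j) x) \<bullet> e" for e
      proof -
        have "(\<Sum>j\<in>N. U j $ k *\<^sub>R grad (\<phi> j) x) \<bullet> e = (\<Sum>j\<in>N. (U j $ k *\<^sub>R e) \<bullet> grad (\<phi> j) x)"
          by (simp add: inner_sum_left inner_sum_right inner_commute)
        also have "\<dots> = Du U e $ k" unfolding grad_point Du_def by (simp add: inner_commute mult.commute)
        finally show ?thesis unfolding Du_component by simp
      qed
      then show ?thesis by (rule vector_eq_rdot[THEN iffD1, OF allI])
    qed
    show ?case unfolding G_def g power2_norm_eq_inner
      by (simp add: inner_sum_left inner_sum_right sum_distrib_left mult_ac inner_commute)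
  qed
  then have "h1semi L (uh L K U) = (\<integral>x. (\<Sum>k\<in>UNIV. \<Sum>i\<in>N. \<Sum>j\<in>N. U i $ k * U j $ k * (grad (\<phi> i) x \<bullet> grad (\<phi> j) x)) \<partial>\<Lambda>)"
    unfolding h1semi_eq
    by (intro integral_cong_AE borel_measurable_integrable bm_integrable[OF bm_G] Bochner_Integration.integrable_sum integrable_mult_right ii)
  also have "\<dots> = (\<Sum>k\<in>UNIV. \<Sum>i\<in>N. \<Sum>j\<in>N. \<integral>x. U i $ k * U j $ k * (grad (\<phi> i) x \<bullet> grad (\<phi> j) x) \<partial>\<Lambda>)"
    by (subst Bochner_Integration.integral_sum, (intro Bochner_Integration.integrable_sum integrable_mult_right ii; assumption),
        intro sum.cong refl, subst Bochner_Integration.integral_sum, (intro Bochner_Integration.integrable_sum integrable_mult_right ii; assumption),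
        intro sum.cong refl, subst Bochner_Integration.integral_sum, (intro integrable_mult_right ii; assumption), rule refl)
  finally show ?thesis by simp
qed

end

context scheme begin

text \<open>(S2) tested with \<open>q\<close> equates two forms of one sum: by antisymmetry the
  gradient falls on the interpolant of \<open>q\<close>, giving the integral up to
  \<open>\<epsilon>\<close>, and the stabilisation sees only increments of \<open>q\<close>, of
  order \<open>h\<close>.\<close>

lemma divergence_consistency:
  fixes q :: "real^'d \<Rightarrow> real" and g :: "real^'d \<Rightarrow> real^'d"
  assumes UM: "\<And>j. j \<in> N \<Longrightarrow> norm (U j) \<le> M" and PM: "\<And>j. j \<in> N \<Longrightarrow> \<bar>P j\<bar> \<le> M"
    and q: "lat_per L q" and g: "continuous_on UNIV g"
    and q2: "\<And>x v. x \<in> cbox 0 L \<Longrightarrow> norm (v - x) \<le> h \<Longrightarrow> \<bar>q v - q x - g x \<bullet> (v - x)\<bar> \<le> \<epsilon> * h"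
    and q1: "\<And>x v. x \<in> cbox 0 L \<Longrightarrow> norm (v - x) \<le> h \<Longrightarrow> \<bar>q v - q x\<bar> \<le> V * h"
  shows "\<bar>\<integral>x. uh L K U x \<bullet> g x \<partial>\<Lambda>\<bar> \<le> (M * ((real CARD('d) + 1) * \<kappa> * \<epsilon>) + \<omega> / 2 * (4 * M * V * h)) * measure lebesgue (cbox 0 L)"
proof -
  have M0: "0 \<le> M"
  proof -
    have "N \<noteq> {}" using sum_hat by fastforce
    then obtain j where "j \<in> N" by blast
    then show ?thesis using UM[of j] norm_ge_zero[of "U j"] by linarith
  qed
  have vol: "(\<integral>x. 1 \<partial>\<Lambda>) = measure lebesgue (cbox 0 L)" by (simp add: measure_restrict_space)
  have aebox: "AE x in \<Lambda>. x \<in> cbox 0 L" by (intro AE_I2) simp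
  have 1: "\<bar>(\<Sum>i\<in>N. \<Sum>j\<in>N. mm L K i j * ((P j - P i) * (q j - q i))) - (\<integral>x. 0 \<partial>\<Lambda>)\<bar> \<le> (4 * M * V * h) * (\<integral>x. 1 \<partial>\<Lambda>)"
    unfolding sum_mm(2)
  proof (rule integral_AE_close[OF sum_mm(1) bm_integrable[OF bm_const] bm_integrable[OF bm_const]])
    show "AE x in \<Lambda>. \<bar>(\<Sum>i\<in>N. \<Sum>j\<in>N. \<phi> i x * \<phi> j x * ((P j - P i) * (q j - q i))) - 0\<bar> \<le> (4 * M * V * h) * 1"
      using AE_cell aebox
    proof eventually_elim
      case (elim x)
      then obtain C b \<beta> where cd: "cell_data L K h \<kappa> x C b \<beta>" by blast
      interpret cell_at L K h \<kappa> x C b \<beta> by unfold_locales (rule cd)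
      have "(\<Sum>i\<in>N. \<Sum>j\<in>N. \<phi> i x * \<phi> j x * ((P j - P i) * (q j - q i))) = (\<Sum>v\<in>C. b v * (\<Sum>v'\<in>C. b v' * ((P (r v') - P (r v)) * (q v' - q v))))"
        unfolding mm_point by (simp add: lat_per_rep[OF q] sum_distrib_left mult.assoc)
      also have "\<bar>\<dots>\<bar> \<le> (2 * M) * (2 * (V * h))"
      proof (rule conv_comb_bound, rule conv_comb_bound)
        fix v v' assume v: "v \<in> C" "v' \<in> C"
        have "\<bar>P (r v') - P (r v)\<bar> \<le> 2 * M" using PM[OF rN[OF v(1)]] PM[OF rN[OF v(2)]] by linarith
        moreover have "\<bar>q v' - q v\<bar> \<le> 2 * (V * h)" using q1[OF elim(2) vdist[OF v(1)]] q1[OF elim(2) vdist[OF v(2)]] by linarith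
        ultimately show "\<bar>(P (r v') - P (r v)) * (q v' - q v)\<bar> \<le> (2 * M) * (2 * (V * h))"
          unfolding abs_mult using M0 by (intro mult_mono) auto
      qed
      finally show ?case by simp
    qed
  qed
  have 2: "\<bar>(\<Sum>i\<in>N. \<Sum>j\<in>N. (q j *\<^sub>R U i) \<bullet> cc L K i j) - (\<integral>x. uh L K U x \<bullet> g x \<partial>\<Lambda>)\<bar> \<le> (M * ((real CARD('d) + 1) * \<kappa> * \<epsilon>)) * (\<integral>x. 1 \<partial>\<Lambda>)"
    unfolding sum_cc(2)
  proof (rule integral_AE_close[OF sum_cc(1) _ bm_integrable[OF bm_const]])
    show "integrable \<Lambda> (\<lambda>x. uh L K U x \<bullet> g x)"
      by (intro bm_integrable bm_continuous continuous_intros uh_continuous g)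
    show "AE x in \<Lambda>. \<bar>(\<Sum>i\<in>N. \<Sum>j\<in>N. \<phi> i x * ((q j *\<^sub>R U i) \<bullet> grad (\<phi> j) x)) - uh L K U x \<bullet> g x\<bar> \<le> (M * ((real CARD('d) + 1) * \<kappa> * \<epsilon>)) * 1"
      using AE_cell aebox
    proof eventually_elim
      case (elim x)
      then obtain C b \<beta> where cd: "cell_data L K h \<kappa> x C b \<beta>" by blast
      interpret cell_at L K h \<kappa> x C b \<beta> by unfold_locales (rule cd)
      \<comment> \<open>The transpose of \<open>s1\<close>: the gradient of the interpolant of a
        linear function is exact.\<close>
      have gv: "(\<Sum>v\<in>C. (g x \<bullet> v) *\<^sub>R \<beta> v) = g x"
      proof -
        have "(\<Sum>v\<in>C. (g x \<bullet> v) *\<^sub>R \<beta> v) \<bullet> e = g x \<bullet> e" for e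
        proof -
          have "g x \<bullet> e = g x \<bullet> (\<Sum>v\<in>C. (\<beta> v \<bullet> e) *\<^sub>R v)" by (simp only: s1)
          then show ?thesis by (simp add: inner_sum_left inner_sum_right mult.commute)
        qed
        then show ?thesis by (rule vector_eq_rdot[THEN iffD1, OF allI])
      qed
      have z: "(\<Sum>v\<in>C. c *\<^sub>R \<beta> v) = 0" for c by (simp add: scaleR_sum_right[symmetric] s0)
      have "(\<Sum>v\<in>C. (q v - q x - g x \<bullet> (v - x)) *\<^sub>R \<beta> v) = (\<Sum>v\<in>C. q v *\<^sub>R \<beta> v) - g x"
        by (simp add: scaleR_diff_left inner_diff_right sum_subtractf z gv)
      moreover have "norm (\<Sum>v\<in>C. (q v - q x - g x \<bullet> (v - x)) *\<^sub>R \<beta> v) \<le> (\<Sum>v\<in>C. \<kappa> * \<epsilon>)"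
      proof (rule sum_norm_le)
        fix v assume v: "v \<in> C"
        have "0 \<le> \<epsilon> * h" using q2[OF elim(2) vdist[OF v]] by linarith
        then have "\<bar>q v - q x - g x \<bullet> (v - x)\<bar> * norm (\<beta> v) \<le> (\<epsilon> * h) * (\<kappa> / h)"
          using q2[OF elim(2) vdist[OF v]] \<beta>le[OF v] by (intro mult_mono) auto
        also have "\<dots> = \<kappa> * \<epsilon>" using hpos by simp
        finally show "norm ((q v - q x - g x \<bullet> (v - x)) *\<^sub>R \<beta> v) \<le> \<kappa> * \<epsilon>" by simp
      qed
      ultimately have "norm ((\<Sum>v\<in>C. q v *\<^sub>R \<beta> v) - g x) \<le> (\<Sum>v\<in>C. \<kappa> * \<epsilon>)" by (simp only:)
      then have gc: "norm ((\<Sum>v\<in>C. q v *\<^sub>R \<beta> v) - g x) \<le> (real CARD('d) + 1) * \<kappa> * \<epsilon>"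
        by (simp add: cardC algebra_simps)
      have "(\<Sum>i\<in>N. \<Sum>j\<in>N. \<phi> i x * ((q j *\<^sub>R U i) \<bullet> grad (\<phi> j) x)) - uh L K U x \<bullet> g x = uh L K U x \<bullet> ((\<Sum>v\<in>C. q v *\<^sub>R \<beta> v) - g x)"
        unfolding cc_point uh_x by (simp add: lat_per_rep[OF q] inner_diff_right inner_sum_left inner_sum_right sum_distrib_left mult_ac) (rule sum.swap)
      also have "\<bar>\<dots>\<bar> \<le> M * ((real CARD('d) + 1) * \<kappa> * \<epsilon>)"
      proof -
        have "norm (uh L K U x) * norm ((\<Sum>v\<in>C. q v *\<^sub>R \<beta> v) - g x) \<le> M * ((real CARD('d) + 1) * \<kappa> * \<epsilon>)"
          using gc M0 UM by (intro mult_mono uh_bound) auto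
        then show ?thesis using Cauchy_Schwarz_ineq2[of "uh L K U x" "(\<Sum>v\<in>C. q v *\<^sub>R \<beta> v) - g x"] by linarith
      qed
      finally show ?case by simp
    qed
  qed
  have 3: "(\<Sum>i\<in>N. \<Sum>j\<in>N. (q j *\<^sub>R U i) \<bullet> cc L K i j) = \<omega>/2 * (\<Sum>i\<in>N. \<Sum>j\<in>N. mm L K i j * ((P j - P i) * (q j - q i)))"
    using cc_swap[of "\<lambda>i j. q j *\<^sub>R U i"] discrete_divergence[of q] by simp
  have "\<bar>(\<Sum>i\<in>N. \<Sum>j\<in>N. (q j *\<^sub>R U i) \<bullet> cc L K i j)\<bar> \<le> \<omega>/2 * ((4 * M * V * h) * (\<integral>x. 1 \<partial>\<Lambda>))"
    unfolding 3 abs_mult using 1 \<omega>pos by (intro mult_mono) auto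
  then have "\<bar>\<integral>x. uh L K U x \<bullet> g x \<partial>\<Lambda>\<bar> \<le> (M * ((real CARD('d) + 1) * \<kappa> * \<epsilon>)) * (\<integral>x. 1 \<partial>\<Lambda>) + \<omega>/2 * ((4 * M * V * h) * (\<integral>x. 1 \<partial>\<Lambda>))"
    using 2 by linarith
  also have "\<dots> = (M * ((real CARD('d) + 1) * \<kappa> * \<epsilon>) + \<omega>/2 * (4 * M * V * h)) * (\<integral>x. 1 \<partial>\<Lambda>)" by (simp only: distrib_right mult.assoc)
  finally show ?thesis unfolding vol .
qed

end

text \<open>The constant \<open>\<kappa> = 4\<sigma>/\<rho>\<close>: on a simplex with incircle radius \<open>r\<close> the barycentric coordinates vary
  between 0 and 1, so their gradients are at most \<open>2/r\<close>.\<close>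

lemma (in pmesh) cmesh_of_regular:
  assumes \<sigma>: "\<forall>S\<in>K. diameter S \<le> \<sigma> * inradius S" and \<rho>: "\<rho> > 0" "\<forall>S\<in>K. \<rho> * mesh_size K \<le> diameter S"
  shows "cmesh L K (mesh_size K) (4 * \<sigma> / \<rho>)" "\<sigma> > 0"
proof -
  have diam: "diameter S > 0" if S: "S \<in> K" for S
  proof -
    have "card (verts S) \<ge> 2" using simplex_verts(3)[OF S] by (simp add: Suc_le_eq)
    then obtain v w where "v \<in> verts S" "w \<in> verts S" "v \<noteq> w"
      by (metis One_nat_def card_le_Suc0_iff_eq numeral_2_eq_2 simplex_verts(1)[OF S] not_less_eq_eq)
    then have "0 < dist v w" "v \<in> S" "w \<in> S" using verts_subset[OF S] by auto
    then show ?thesis using diameter_bounded_bound[OF compact_imp_bounded[OF compact_cell[OF S]], of v w] by linarith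
  qed
  \<comment> \<open>\<open>inradius\<close> is a supremum that need not be attained, so a ball of
    more than half that radius is taken; this doubles the constant in
    \<open>\<kappa>\<close>.\<close>
  have ball: "\<exists>c r. ball c r \<subseteq> S \<and> r > inradius S / 2" and inr: "inradius S > 0 \<and> \<sigma> > 0" if S: "S \<in> K" for S
  proof -
    let ?R = "{r. \<exists>c. ball c r \<subseteq> S}"
    have bd: "bdd_above ?R"
    proof (rule bdd_aboveI[of _ "diameter S"])
      fix r assume "r \<in> ?R"
      then obtain c where c: "ball c r \<subseteq> S" by blast
      have "diameter (ball c r) \<le> diameter S" by (rule diameter_subset[OF c compact_imp_bounded[OF compact_cell[OF S]]])
      then show "r \<le> diameter S" using diam[OF S] by (auto simp: diameter_ball split: if_splits)
    qed
    have 0: "0 \<in> ?R" by auto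
    have "0 \<le> inradius S" unfolding inradius_def using 0 bd by (rule cSup_upper)
    moreover have "0 < \<sigma> * inradius S" using diam[OF S] \<sigma> S by fastforce
    ultimately show i: "inradius S > 0 \<and> \<sigma> > 0" by (simp add: zero_less_mult_iff)
    then have "inradius S / 2 < Sup ?R" unfolding inradius_def by simp
    then obtain r where "r \<in> ?R" "inradius S / 2 < r" using less_cSup_iff[OF _ bd] 0 by blast
    then show "\<exists>c r. ball c r \<subseteq> S \<and> r > inradius S / 2" by blast
  qed
  obtain S0 where S0: "S0 \<in> K" using cell_cover by blast
  have h: "mesh_size K > 0" using diam[OF S0] diameter_le_mesh_size[OF S0] by linarith
  show \<sigma>0: "\<sigma> > 0" using inr[OF S0] by blast
  have "\<exists>C b \<beta>. cell_data L K (mesh_size K) (4 * \<sigma> / \<rho>) x C b \<beta>" if S: "S \<in> K" and x: "x \<in> interior S" for S x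
  proof -
    obtain c r where cr: "ball c r \<subseteq> S" "r > inradius S / 2" using ball[OF S] by blast
    have r0: "r > 0" using cr inr[OF S] by linarith
    have "\<rho> * mesh_size K \<le> \<sigma> * inradius S" using \<rho>(2) \<sigma> S by (meson order_trans)
    also have "\<dots> \<le> \<sigma> * (2 * r)" using cr(2) \<sigma>0 by (intro mult_left_mono) auto
    finally have "2 / r \<le> 4 * \<sigma> / \<rho> / mesh_size K" using r0 h \<rho>(1) by (simp add: field_simps)
    then show ?thesis by (rule cell_data_exists[OF S x cr(1) r0 diameter_le_mesh_size[OF S]])
  qed
  then show "cmesh L K (mesh_size K) (4 * \<sigma> / \<rho>)"
    using h \<sigma>0 \<rho>(1) by unfold_locales auto
qed

section \<open>Limit of the balance laws\<close>

lemma smooth_C1: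
  assumes "smooth f"
  shows "f differentiable (at x)" "continuous_on UNIV (\<lambda>z. pd f e z)" "(f has_derivative (\<lambda>e. pd f e x)) (at x)" "continuous_on UNIV f"
proof -
  have "Ck (Suc 0) f" using assms unfolding smooth_def by blast
  then have d: "\<forall>x. f differentiable (at x)" and c: "\<forall>w. continuous_on UNIV (\<lambda>x. frechet_derivative f (at x) w)" by auto
  show "f differentiable (at x)" using d by blast
  show "continuous_on UNIV (\<lambda>z. pd f e z)" using c d by (simp add: pd_def)
  show "(f has_derivative (\<lambda>e. pd f e x)) (at x)" using d by (simp add: pd_def frechet_derivative_works[symmetric])
  show "continuous_on UNIV f" using d by (simp add: continuous_on_eq_continuous_at differentiable_imp_continuous_within)
qed

lemma pd_expand:
  fixes f :: "'a::euclidean_space \<Rightarrow> 'b::real_normed_vector"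
  assumes "(f has_derivative (\<lambda>e. pd f e x)) (at x)"
  shows "pd f e x = (\<Sum>i\<in>Basis. (e \<bullet> i) *\<^sub>R pd f i x)"
proof -
  have l: "linear (\<lambda>e. pd f e x)" by (rule has_derivative_linear[OF assms])
  have "pd f e x = pd f (\<Sum>i\<in>Basis. (e \<bullet> i) *\<^sub>R i) x" by (simp only: euclidean_representation)
  also have "\<dots> = (\<Sum>i\<in>Basis. (e \<bullet> i) *\<^sub>R pd f i x)"
    using linear_sum[OF l, of "\<lambda>i. (e \<bullet> i) *\<^sub>R i" Basis] linear_scale[OF l] by (simp add: o_def)
  finally show ?thesis .
qed

lemma smooth_bounds:
  fixes f :: "'a::euclidean_space \<Rightarrow> 'b::real_normed_vector"
  assumes f: "smooth f"
  shows "\<exists>V\<ge>0. (\<forall>z\<in>cball 0 R. norm (f z) \<le> V \<and> (\<forall>e. norm (pd f e z) \<le> V * norm e)) \<and>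
     (\<forall>z\<in>cball 0 R. \<forall>z'\<in>cball 0 R. norm (f z' - f z) \<le> V * norm (z' - z))"
proof -
  have bd: "\<exists>B\<ge>0. \<forall>z\<in>cball 0 R. norm (g z) \<le> B" if "continuous_on UNIV g" for g :: "'a \<Rightarrow> 'b"
  proof -
    have "bounded (g ` cball 0 R)" by (intro compact_imp_bounded compact_continuous_image continuous_on_subset[OF that]) auto
    then obtain B where "\<forall>z\<in>cball 0 R. norm (g z) \<le> B" unfolding bounded_iff by auto
    then show ?thesis by (intro exI[of _ "max 0 B"]) fastforce
  qed
  obtain V0 where V0: "V0 \<ge> 0" "\<forall>z\<in>cball 0 R. norm (f z) \<le> V0" using bd[OF smooth_C1(4)[OF f]] by blast
  have "\<forall>i. \<exists>B. B \<ge> 0 \<and> (\<forall>z\<in>cball 0 R. norm (pd f i z) \<le> B)" using bd[OF smooth_C1(2)[OF f]] by blast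
  from choice[OF this] obtain B where B: "\<forall>i. B i \<ge> 0 \<and> (\<forall>z\<in>cball 0 R. norm (pd f i z) \<le> B i)" by blast
  define V where "V = V0 + sum B Basis"
  have sB: "0 \<le> sum B Basis" using B by (intro sum_nonneg) auto
  have D: "norm (pd f e z) \<le> V * norm e" if z: "z \<in> cball 0 R" for e z
  proof -
    have "norm (pd f e z) \<le> (\<Sum>i\<in>Basis. B i * norm e)"
      unfolding pd_expand[OF smooth_C1(3)[OF f], of e]
    proof (rule sum_norm_le)
      fix i :: 'a assume "i \<in> Basis"
      then have "\<bar>e \<bullet> i\<bar> \<le> norm e" by (rule Basis_le_norm)
      moreover have "norm (pd f i z) \<le> B i" using B z by blast
      ultimately show "norm ((e \<bullet> i) *\<^sub>R pd f i z) \<le> B i * norm e" using mult_mono[of "\<bar>e \<bullet> i\<bar>" "norm e" "norm (pd f i z)" "B i"] by (simp add: mult.commute)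
    qed
    also have "\<dots> = sum B Basis * norm e" by (simp add: sum_distrib_right)
    also have "\<dots> \<le> V * norm e" unfolding V_def using V0 by (intro mult_right_mono) auto
    finally show ?thesis .
  qed
  have "norm (f z' - f z) \<le> V * norm (z' - z)" if "z \<in> cball 0 R" "z' \<in> cball 0 R" for z z'
    by (rule differentiable_bound[OF convex_cball, of 0 R f "\<lambda>x e. pd f e x" V z' z])
       (use that D smooth_C1(3)[OF f] in \<open>auto intro: has_derivative_at_withinI onorm_bound simp: V_def sB V0\<close>)
  then show ?thesis using D V0 sB by (intro exI[of _ V]) (auto simp: V_def intro: order_trans)
qed

text \<open>The remainder is measured by a modulus \<open>\<epsilon>\<close> that is uniform on a
  ball; it comes from uniform continuity of the finitely many partial derivatives.\<close>

lemma smooth_taylor: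
  fixes f :: "'a::euclidean_space \<Rightarrow> 'b::real_normed_vector"
  assumes f: "smooth f" and \<epsilon>: "\<epsilon> > 0"
  shows "\<exists>\<delta>>0. \<forall>z\<in>cball 0 R. \<forall>z'\<in>cball 0 R. norm (z' - z) < \<delta> \<longrightarrow> norm (f z' - f z - pd f (z' - z) z) \<le> \<epsilon> * norm (z' - z)"
proof -
  define n where "n = real (card (Basis::'a set))"
  have n: "n > 0" unfolding n_def by (simp add: card_gt_0_iff)
  have "\<exists>\<delta>>0. \<forall>z\<in>cball 0 R. \<forall>z'\<in>cball 0 R. dist z' z < \<delta> \<longrightarrow> dist (pd f i z') (pd f i z) < \<epsilon> / n" for i
  proof -
    have uc: "uniformly_continuous_on (cball 0 R) (pd f i)"
      by (intro compact_uniformly_continuous continuous_on_subset[OF smooth_C1(2)[OF f]]) auto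
    have "\<epsilon> / n > 0" using \<epsilon> n by simp
    then show ?thesis by (rule spec[OF uc[unfolded uniformly_continuous_on_def], of "\<epsilon> / n", THEN mp])
  qed
  then have "\<forall>i. \<exists>\<delta>. \<delta> > 0 \<and> (\<forall>z\<in>cball 0 R. \<forall>z'\<in>cball 0 R. dist z' z < \<delta> \<longrightarrow> dist (pd f i z') (pd f i z) < \<epsilon> / n)" by blast
  from choice[OF this] obtain d where d: "\<forall>i. d i > 0 \<and> (\<forall>z\<in>cball 0 R. \<forall>z'\<in>cball 0 R. dist z' z < d i \<longrightarrow> dist (pd f i z') (pd f i z) < \<epsilon> / n)" by blast
  define \<delta> where "\<delta> = Min (d ` Basis)"
  have \<delta>: "\<delta> > 0" "\<And>i. i \<in> Basis \<Longrightarrow> \<delta> \<le> d i" unfolding \<delta>_def using d by auto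
  show ?thesis
  proof (intro exI[of _ \<delta>] conjI ballI impI \<delta>(1))
    fix z z' :: 'a assume z: "z \<in> cball 0 R" "z' \<in> cball 0 R" and zz: "norm (z' - z) < \<delta>"
    have lin: "linear (\<lambda>e. pd f e x)" for x by (rule has_derivative_linear[OF smooth_C1(3)[OF f]])
    let ?S = "closed_segment z z'"
    have seg: "?S \<subseteq> cball 0 R" by (rule closed_segment_subset[OF z convex_cball])
    have bl: "bounded_linear (\<lambda>e. pd f e z)" by (rule has_derivative_bounded_linear[OF smooth_C1(3)[OF f]])
    \<comment> \<open>Mean value inequality for \<open>f\<close> minus its linearisation at
      \<open>z\<close>. The derivative of that function on the segment is a difference of
      derivatives of \<open>f\<close> at points closer than \<open>\<delta>\<close>.\<close>
    have "norm ((f z' - pd f z' z) - (f z - pd f z z)) \<le> \<epsilon> * norm (z' - z)"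
    proof (rule differentiable_bound[of ?S "\<lambda>x. f x - pd f x z" "\<lambda>x e. pd f e x - pd f e z" \<epsilon> z' z])
      show "((\<lambda>x. f x - pd f x z) has_derivative (\<lambda>e. pd f e x - pd f e z)) (at x within ?S)" for x
        by (intro has_derivative_diff has_derivative_at_withinI[OF smooth_C1(3)[OF f]] bounded_linear.has_derivative[OF bl] has_derivative_ident)
      show "onorm (\<lambda>e. pd f e x - pd f e z) \<le> \<epsilon>" if x: "x \<in> ?S" for x
      proof (rule onorm_bound)
        fix e
        have xz: "norm (x - z) < \<delta>" using segment_bound1[of x z z'] x zz by (metis le_less_trans norm_minus_commute closed_segment_commute)
        have "pd f e x - pd f e z = (\<Sum>i\<in>Basis. (e \<bullet> i) *\<^sub>R (pd f i x - pd f i z))"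
          unfolding pd_expand[OF smooth_C1(3)[OF f], of e] by (simp add: scaleR_diff_right sum_subtractf)
        also have "norm \<dots> \<le> (\<Sum>i\<in>(Basis::'a set). \<epsilon> / n * norm e)"
        proof (rule sum_norm_le)
          fix i :: 'a assume i: "i \<in> Basis"
          then have "\<bar>e \<bullet> i\<bar> \<le> norm e" by (rule Basis_le_norm)
          moreover have "norm (pd f i x - pd f i z) \<le> \<epsilon> / n"
          proof -
            have "dist x z < d i" using xz \<delta>(2)[OF i] by (simp add: dist_norm)
            moreover have "x \<in> cball 0 R" using seg x by blast
            ultimately have "dist (pd f i x) (pd f i z) < \<epsilon> / n" using d z(1) by blast
            then show ?thesis by (simp add: dist_norm)
          qed
          ultimately show "norm ((e \<bullet> i) *\<^sub>R (pd f i x - pd f i z)) \<le> \<epsilon> / n * norm e"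
            using mult_mono[of "\<bar>e \<bullet> i\<bar>" "norm e" "norm (pd f i x - pd f i z)" "\<epsilon> / n"] by (simp add: mult.commute)
        qed
        also have "\<dots> = \<epsilon> * norm e" using n by (simp add: n_def)
        finally show "norm (pd f e x - pd f e z) \<le> \<epsilon> * norm e" .
      qed (use \<epsilon> in simp)
    qed auto
    moreover have "(f z' - pd f z' z) - (f z - pd f z z) = f z' - f z - pd f (z' - z) z"
      unfolding linear_diff[OF lin] by simp
    ultimately show "norm (f z' - f z - pd f (z' - z) z) \<le> \<epsilon> * norm (z' - z)" by (simp only:)
  qed
qed

text \<open>Separability of uniform convergence on a compact set, for an arbitrary subfamily: finitely many
  values on a net, taken from a countable dense set, determine a function with known modulus of continuity.\<close>

lemma countable_uniformly_dense_subfamily: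
  fixes g :: "'i \<Rightarrow> 'a::metric_space \<Rightarrow> 'b::{metric_space, second_countable_topology}"
  assumes K: "compact K" and g: "\<And>i. i \<in> F \<Longrightarrow> continuous_on K (g i)"
  shows "\<exists>C\<subseteq>F. countable C \<and> (\<forall>i\<in>F. \<forall>e>0. \<exists>j\<in>C. \<forall>x\<in>K. dist (g i x) (g j x) < e)"
proof -
  obtain D :: "'b set" where D: "countable D" "\<And>X. open X \<Longrightarrow> X \<noteq> {} \<Longrightarrow> \<exists>d\<in>D. d \<in> X"
    using countable_dense_setE by blast
  have "\<forall>m::nat. \<exists>xs. set xs \<subseteq> K \<and> K \<subseteq> (\<Union>x\<in>set xs. ball x (1 / real (Suc m)))"
  proof
    fix m :: nat
    obtain X where "finite X" "X \<subseteq> K" "K \<subseteq> (\<Union>x\<in>X. ball x (1 / real (Suc m)))"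
      using compact_imp_seq_compact[OF K] seq_compact_imp_totally_bounded[of K] by (metis zero_less_divide_1_iff of_nat_0_less_iff zero_less_Suc)
    then show "\<exists>xs. set xs \<subseteq> K \<and> K \<subseteq> (\<Union>x\<in>set xs. ball x (1 / real (Suc m)))" using finite_list by metis
  qed
  from choice[OF this] obtain net where net: "\<forall>m. set (net m) \<subseteq> K \<and> K \<subseteq> (\<Union>x\<in>set (net m). ball x (1 / real (Suc m)))" by blast
  \<comment> \<open>A code consists of a net scale \<open>m\<close>, an accuracy \<open>n\<close>
    and values \<open>ys\<close> on the net rounded to the dense set. One realising index is chosen
    for each code that occurs, so \<open>C\<close> is countable and stays inside \<open>F\<close>;
    equal codes force functions to be close on all of \<open>K\<close>.\<close>
  define good where "good m n ys i \<longleftrightarrow> i \<in> F \<and> (\<forall>x\<in>K. \<forall>y\<in>K. dist x y < 1 / real (Suc m) \<longrightarrow> dist (g i x) (g i y) < 1 / real (Suc n)) \<and>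
      length ys = length (net m) \<and> (\<forall>k<length ys. dist (g i (net m ! k)) (ys ! k) < 1 / real (Suc n))" for m n :: nat and ys i
  define C where "C = (\<lambda>(m,n,ys). SOME i. good m n ys i) ` {(m,n,ys). ys \<in> lists D \<and> (\<exists>i. good m n ys i)}"
  have goodC: "\<exists>j\<in>C. good m n ys j" if "good m n ys i" "ys \<in> lists D" for m n ys i
  proof -
    have "(SOME i. good m n ys i) \<in> C" unfolding C_def using that by (intro image_eqI[of _ _ "(m,n,ys)"]) auto
    moreover have "good m n ys (SOME i. good m n ys i)" using someI[of "good m n ys"] that(1) by blast
    ultimately show ?thesis by blast
  qed
  have "countable ((UNIV::nat set) \<times> (UNIV::nat set) \<times> lists D)" using D(1) by auto
  then have 1: "countable C" unfolding C_def by (intro countable_image) (rule countable_subset[rotated], assumption, auto)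
  have 2: "C \<subseteq> F"
  proof
    fix j assume "j \<in> C"
    then obtain m n ys i where "good m n ys i" "j = (SOME i. good m n ys i)" unfolding C_def by auto
    then have "good m n ys j" using someI[of "good m n ys"] by simp
    then show "j \<in> F" unfolding good_def by simp
  qed
  have 3: "\<exists>j\<in>C. \<forall>x\<in>K. dist (g i x) (g j x) < e" if i: "i \<in> F" and e: "e > 0" for i e
  proof -
    obtain n where n: "1 / real (Suc n) < e / 4" using e reals_Archimedean[of "e/4"] by (auto simp: inverse_eq_divide)
    have "uniformly_continuous_on K (g i)" by (rule compact_uniformly_continuous[OF g[OF i] K])
    then obtain d where d: "d > 0" "\<And>x y. x \<in> K \<Longrightarrow> y \<in> K \<Longrightarrow> dist y x < d \<Longrightarrow> dist (g i y) (g i x) < 1 / real (Suc n)"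
      unfolding uniformly_continuous_on_def by (metis zero_less_divide_1_iff of_nat_0_less_iff zero_less_Suc)
    obtain m where m: "1 / real (Suc m) < d" using d(1) reals_Archimedean[of d] by (auto simp: inverse_eq_divide)
    have "\<forall>y. \<exists>z. z \<in> D \<and> dist y z < 1 / real (Suc n)" for y
    proof
      fix y
      show "\<exists>z. z \<in> D \<and> dist y z < 1 / real (Suc n)"
        using D(2)[of "ball y (1 / real (Suc n))"] by (auto simp: mem_ball)
    qed
    then obtain near where near: "\<And>y. near y \<in> D \<and> dist y (near y) < 1 / real (Suc n)" by metis
    define ys where "ys = map (\<lambda>x. near (g i x)) (net m)"
    have "good m n ys i" unfolding good_def
      using i d(2) m near by (auto simp: ys_def dist_commute)
    moreover have "ys \<in> lists D" using near by (auto simp: ys_def)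
    ultimately obtain j where j: "j \<in> C" "good m n ys j" using goodC by blast
    have "dist (g i x) (g j x) < e" if x: "x \<in> K" for x
    proof -
      obtain x' where "x' \<in> set (net m)" "x \<in> ball x' (1 / real (Suc m))" using net x by blast
      then obtain k where k: "k < length (net m)" "dist x (net m ! k) < 1 / real (Suc m)"
        by (metis in_set_conv_nth mem_ball dist_commute)
      have kK: "net m ! k \<in> K" using net k by (metis nth_mem subsetD)
      have "dist (g i x) (g i (net m ! k)) < 1 / real (Suc n)" using \<open>good m n ys i\<close> x kK k unfolding good_def by blast
      moreover have "dist (g j x) (g j (net m ! k)) < 1 / real (Suc n)" using j(2) x kK k unfolding good_def by blast
      moreover have "dist (g i (net m ! k)) (ys ! k) < 1 / real (Suc n)" "dist (g j (net m ! k)) (ys ! k) < 1 / real (Suc n)"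
        using \<open>good m n ys i\<close> j(2) k unfolding good_def by auto
      ultimately show ?thesis
        using n dist_triangle[of "g i x" "g j x" "g i (net m ! k)"] dist_triangle[of "g i (net m ! k)" "g j x" "ys ! k"]
          dist_triangle[of "ys ! k" "g j x" "g j (net m ! k)"] by (simp add: dist_commute)
    qed
    then show ?thesis using j(1) by blast
  qed
  show ?thesis using 1 2 3 by blast
qed

section \<open>Space-time integrals and their slices\<close>

text \<open>A density on all of space-time instead of a restricted space: its sigma-algebra is then
  \<open>borel\<close>, as \<open>young_measure_exists\<close> requires.\<close>

definition cylm :: "real^'d \<Rightarrow> real \<Rightarrow> ((real^'d) \<times> real) measure" where
  "cylm L T = density lborel (\<lambda>z. ennreal (indicator (cbox 0 L \<times> {0..T}) z))"

lemma cyl_cbox: "cbox 0 L \<times> {0..T} = cbox (0,0) (L, T::real)"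
  by (simp add: cbox_Pair_eq)

lemma cyl_sets[measurable]: "cbox 0 (L::real^'d) \<times> {0..T::real} \<in> sets borel"
  unfolding cyl_cbox by simp

lemma cylm_sets: "sets (cylm L T) = sets borel" and cylm_space: "space (cylm L T) = UNIV"
  by (simp_all add: cylm_def)

lemma cylm_finite: "finite_measure (cylm L T)"
proof (rule finite_measureI)
  have "emeasure (cylm L T) UNIV = emeasure lborel (cbox 0 L \<times> {0..T})"
    unfolding cylm_def ennreal_indicator using emeasure_restricted[of "cbox 0 L \<times> {0..T}" lborel UNIV] by simp
  also have "\<dots> < \<infinity>" unfolding cyl_cbox by (rule emeasure_lborel_cbox_finite)
  finally show "emeasure (cylm L T) (space (cylm L T)) \<noteq> \<infinity>" by (simp add: cylm_space)
qed

lemma cylm_integrable_iff: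
  fixes F :: "(real^'d) \<times> real \<Rightarrow> real"
  assumes "F \<in> borel_measurable borel"
  shows "integrable (cylm L T) F \<longleftrightarrow> integrable lborel (\<lambda>z. indicator (cbox 0 L \<times> {0..T}) z * F z)"
    "(\<integral>z. F z \<partial>(cylm L T)) = (\<integral>z. indicator (cbox 0 L \<times> {0..T}) z * F z \<partial>lborel)"
  unfolding cylm_def using assms by (simp_all add: integrable_density integral_density)

lemma cylm_integrable_bounded:
  fixes F :: "(real^'d) \<times> real \<Rightarrow> real"
  assumes "F \<in> borel_measurable borel" "\<And>z. z \<in> cbox 0 L \<times> {0..T} \<Longrightarrow> \<bar>F z\<bar> \<le> B"
  shows "integrable (cylm L T) F"
proof (rule finite_measure.integrable_const_bound[OF cylm_finite, where B=B])
  show "AE z in cylm L T. norm (F z) \<le> B"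
    unfolding cylm_def by (subst AE_density) (use assms(2) in \<open>auto simp: indicator_def\<close>)
  show "F \<in> borel_measurable (cylm L T)" using assms(1) by (simp add: measurable_cong_sets[OF cylm_sets refl])
qed

text \<open>Fubini's theorem as a bridge between Lebesgue integrals on space-time and the iterated
  gauge integrals of the statement. Slices are integrable for almost every \<open>t\<close> only, so
  the inner integrals are identified almost everywhere.\<close>

lemma iterated_integral:
  fixes F :: "(real^'d) \<times> real \<Rightarrow> real"
  assumes F: "F \<in> borel_measurable borel" and int: "integrable (cylm L T) F"
  shows "((\<lambda>t. integral (cbox 0 L) (\<lambda>x. F (x,t))) has_integral (\<integral>z. F z \<partial>(cylm L T))) {0..T}"
proof -
  define H where "H x t = indicator (cbox 0 L) x * (indicator {0..T} t * F (x,t))" for x t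
  have Heq: "(\<lambda>z. indicator (cbox 0 L \<times> {0..T}) z * F z) = (\<lambda>(x,t). H x t)"
    by (auto simp: H_def fun_eq_iff indicator_def)
  have HI: "integrable (lborel \<Otimes>\<^sub>M lborel) (\<lambda>(x,t). H x t)"
    using int unfolding cylm_integrable_iff(1)[OF F] Heq lborel_prod .
  have 1: "(\<integral>t. (\<integral>x. H x t \<partial>lborel) \<partial>lborel) = (\<integral>z. F z \<partial>(cylm L T))"
    using lborel_pair.integral_snd[OF HI] unfolding cylm_integrable_iff(2)[OF F] Heq lborel_prod by simp
  have 2: "integrable lborel (\<lambda>t. \<integral>x. H x t \<partial>lborel)" by (rule lborel_pair.integrable_snd[OF HI])
  have 3: "AE t in lborel. (\<integral>x. H x t \<partial>lborel) = (if t \<in> {0..T} then integral (cbox 0 L) (\<lambda>x. F (x,t)) else 0)"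
    using lborel_pair.AE_integrable_snd[OF HI]
  proof eventually_elim
    case (elim t)
    show ?case
    proof (cases "t \<in> {0..T}")
      case True
      then have Ht: "(\<lambda>x. H x t) = (\<lambda>x. indicator (cbox 0 L) x *\<^sub>R F (x,t))" by (simp add: H_def)
      have "set_integrable lborel (cbox 0 L) (\<lambda>x. F (x,t))" using elim unfolding Ht set_integrable_def .
      then show ?thesis using True set_borel_integral_eq_integral(2)[of "cbox 0 L" "\<lambda>x. F (x,t)"]
        unfolding Ht set_lebesgue_integral_def by simp
    next
      case False
      then show ?thesis by (auto simp: H_def)
    qed
  qed
  have "((\<lambda>t. \<integral>x. H x t \<partial>lborel) has_integral (\<integral>z. F z \<partial>(cylm L T))) UNIV"
    using has_integral_integral_lborel[OF 2] unfolding 1 .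
  then have "((\<lambda>t. if t \<in> {0..T} then integral (cbox 0 L) (\<lambda>x. F (x,t)) else 0) has_integral (\<integral>z. F z \<partial>(cylm L T))) UNIV"
    by (subst has_integral_AE[symmetric, where f="\<lambda>t. \<integral>x. H x t \<partial>lborel"]) (use 3 in auto)
  then show ?thesis unfolding has_integral_restrict_UNIV .
qed

lemma set_integrable_bounded_cbox:
  fixes f :: "'a::euclidean_space \<Rightarrow> real"
  assumes "f \<in> borel_measurable borel" "\<And>x. x \<in> cbox a b \<Longrightarrow> \<bar>f x\<bar> \<le> B"
  shows "set_integrable lborel (cbox a b) f"
  unfolding set_integrable_def
proof (rule Bochner_Integration.integrable_bound[of _ "\<lambda>x. indicator (cbox a b) x *\<^sub>R B"])
  show "integrable lborel (\<lambda>x. indicator (cbox a b) x *\<^sub>R B)"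
    using emeasure_lborel_cbox_finite[of a b] by (intro integrable_scaleR_left integrable_real_indicator) auto
  show "AE x in lborel. norm (indicator (cbox a b) x *\<^sub>R f x) \<le> norm (indicator (cbox a b) x *\<^sub>R B)"
    by (intro AE_I2) (use assms(2) in \<open>auto simp: indicator_def intro: order_trans abs_ge_self\<close>)
qed (use assms(1) in measurable)

lemma halfbox_borel[measurable]: "halfbox (L::real^'d) \<in> sets borel"
proof -
  have "halfbox L = (\<Inter>k\<in>UNIV. {x. 0 \<le> x$k} \<inter> {x. x$k < L$k})" by (auto simp: halfbox_def)
  moreover have "{x::real^'d. 0 \<le> x$k} \<in> sets borel" for k by (intro borel_closed closed_Collect_le continuous_intros)
  moreover have "{x::real^'d. x$k < L$k} \<in> sets borel" for k by (intro borel_open open_Collect_less continuous_intros)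
  ultimately show ?thesis by (auto intro!: sets.finite_INT)
qed

lemma AE_halfbox_cbox: "AE x in lborel. (indicator (halfbox L) x :: real) = indicator (cbox 0 L) (x::real^'d)"
proof (rule AE_I'[of "cbox 0 L - box 0 L"])
  have "cbox 0 L - box 0 L \<in> null_sets lebesgue"
    using negligible_frontier_interval[of 0 L] by (simp add: negligible_iff_null_sets)
  then show "cbox 0 L - box 0 L \<in> null_sets lborel" by (subst (asm) null_sets_completion_iff) auto
  have "box 0 L \<subseteq> halfbox L" "halfbox L \<subseteq> cbox 0 L" by (auto simp: halfbox_def mem_box_cart less_imp_le)
  then show "{x \<in> space lborel. (indicator (halfbox L) x :: real) \<noteq> indicator (cbox 0 L) x} \<subseteq> cbox 0 L - box 0 L"
    by (auto simp: indicator_def)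
qed

text \<open>The half-open box is a fundamental domain of the torus, so boundary points are not counted twice.\<close>

definition dens :: "real^'d \<Rightarrow> ((real^'d) \<times> real \<Rightarrow> real) \<Rightarrow> real \<Rightarrow> (real^'d) measure" where
  "dens L \<rho> t = density lborel (\<lambda>x. ennreal (indicator (halfbox L) x * \<rho> (x,t)))"

context
  fixes L :: "real^'d" and \<rho> :: "(real^'d) \<times> real \<Rightarrow> real" and B :: real
  assumes \<rho>[measurable]: "\<rho> \<in> borel_measurable borel" and \<rho>B: "\<And>z. 0 \<le> \<rho> z \<and> \<rho> z \<le> B"
begin

lemma dens_integral:
  assumes \<phi>: "continuous_on UNIV \<phi>"
  shows "(\<integral>x. \<phi> x \<partial>(dens L \<rho> t)) = integral (cbox 0 L) (\<lambda>x. \<phi> x * \<rho> (x,t))"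
    "(\<lambda>x. \<phi> x * \<rho> (x,t)) integrable_on cbox 0 L"
proof -
  have \<phi>m[measurable]: "\<phi> \<in> borel_measurable borel" using \<phi> by (rule borel_measurable_continuous_onI)
  have "bounded (\<phi> ` cbox 0 L)" by (intro compact_imp_bounded compact_continuous_image continuous_on_subset[OF \<phi>]) auto
  then obtain C where C: "\<forall>x\<in>cbox 0 L. \<bar>\<phi> x\<bar> \<le> C" unfolding bounded_iff by auto
  have si: "set_integrable lborel (cbox 0 L) (\<lambda>x. \<phi> x * \<rho> (x,t))"
  proof (rule set_integrable_bounded_cbox)
    fix x assume x: "x \<in> cbox 0 L"
    show "\<bar>\<phi> x * \<rho> (x,t)\<bar> \<le> C * B" unfolding abs_mult using C x \<rho>B[of "(x,t)"] by (intro mult_mono) (auto intro: order_trans[OF abs_ge_zero])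
  qed measurable
  have "(\<integral>x. \<phi> x \<partial>(dens L \<rho> t)) = (\<integral>x. (indicator (halfbox L) x * \<rho> (x,t)) *\<^sub>R \<phi> x \<partial>lborel)"
    unfolding dens_def by (rule integral_density) (use \<rho>B in auto)
  also have "\<dots> = (\<integral>x. indicator (cbox 0 L) x *\<^sub>R (\<phi> x * \<rho> (x,t)) \<partial>lborel)"
  proof (rule integral_cong_AE)
    show "AE x in lborel. (indicator (halfbox L) x * \<rho> (x,t)) *\<^sub>R \<phi> x = indicator (cbox 0 L) x *\<^sub>R (\<phi> x * \<rho> (x,t))"
      using AE_halfbox_cbox[of L] by eventually_elim simp
  qed measurable
  also have "\<dots> = integral (cbox 0 L) (\<lambda>x. \<phi> x * \<rho> (x,t))"
    using set_borel_integral_eq_integral(2)[OF si] unfolding set_lebesgue_integral_def .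
  finally show "(\<integral>x. \<phi> x \<partial>(dens L \<rho> t)) = integral (cbox 0 L) (\<lambda>x. \<phi> x * \<rho> (x,t))" .
  show "(\<lambda>x. \<phi> x * \<rho> (x,t)) integrable_on cbox 0 L" using set_borel_integral_eq_integral(1)[OF si] .
qed

lemma dens_emeasure: "emeasure (dens L \<rho> t) UNIV \<le> ennreal (B * measure lborel (cbox 0 L))"
proof -
  have B0: "0 \<le> B" using \<rho>B order_trans by blast
  have "emeasure (dens L \<rho> t) UNIV = (\<integral>\<^sup>+x. ennreal (indicator (halfbox L) x * \<rho> (x,t)) \<partial>lborel)"
    unfolding dens_def by (subst emeasure_density) auto
  also have "\<dots> \<le> (\<integral>\<^sup>+x. ennreal B * indicator (cbox 0 L) x \<partial>lborel)"
  proof (rule nn_integral_mono)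
    fix x
    have "halfbox L \<subseteq> cbox 0 L" by (auto simp: halfbox_def mem_box_cart less_imp_le)
    then show "ennreal (indicator (halfbox L) x * \<rho> (x,t)) \<le> ennreal B * indicator (cbox 0 L) x"
      using \<rho>B[of "(x,t)"] by (auto simp: indicator_def ennreal_leI)
  qed
  also have "\<dots> = ennreal B * emeasure lborel (cbox 0 L)" by (simp add: nn_integral_cmult_indicator)
  also have "\<dots> = ennreal (B * measure lborel (cbox 0 L))"
    using B0 emeasure_lborel_cbox_finite[of 0 L] by (simp add: ennreal_mult emeasure_eq_ennreal_measure less_top)
  finally show ?thesis .
qed

lemma dens_tmeas: "tmeas L (dens L \<rho> t)"
proof -
  have 1: "sets (dens L \<rho> t) = sets borel" by (simp add: dens_def)
  have 2: "finite_measure (dens L \<rho> t)"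
    by (rule finite_measureI) (use dens_emeasure[of t] in \<open>auto simp: dens_def top_unique\<close>)
  have "emeasure (dens L \<rho> t) (- halfbox L) = (\<integral>\<^sup>+x. ennreal (indicator (halfbox L) x * \<rho> (x,t)) * indicator (- halfbox L) x \<partial>lborel)"
    unfolding dens_def by (subst emeasure_density) auto
  also have "\<dots> = (\<integral>\<^sup>+x. 0 \<partial>(lborel :: (real^'d) measure))" by (intro nn_integral_cong) (auto simp: indicator_def)
  finally show ?thesis using 1 2 unfolding tmeas_def by simp
qed

lemma dens_measure: "measure (dens L \<rho> t) UNIV \<le> B * measure lborel (cbox 0 L)"
proof -
  have "0 \<le> B" using \<rho>B order_trans by blast
  then show ?thesis using dens_emeasure[of t] unfolding measure_def[of "dens L \<rho> t"] by (intro enn2real_leI) auto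
qed

lemma dens_measurable:
  fixes \<phi> :: "real^'d \<Rightarrow> real"
  assumes \<phi>: "continuous_on UNIV \<phi>"
  shows "(\<lambda>t. \<integral>x. \<phi> x \<partial>(dens L \<rho> t)) \<in> borel_measurable borel"
proof -
  have \<phi>m[measurable]: "\<phi> \<in> borel_measurable borel" using \<phi> by (rule borel_measurable_continuous_onI)
  have eq: "(\<integral>x. \<phi> x \<partial>(dens L \<rho> t)) = (\<integral>x. (indicator (halfbox L) x * \<rho> (x,t)) *\<^sub>R \<phi> x \<partial>lborel)" for t
    unfolding dens_def by (rule integral_density) (use \<rho>B in auto)
  have pm: "(\<lambda>(t,x). \<rho> (x,t)) \<in> borel_measurable (borel \<Otimes>\<^sub>M borel)"
  proof -
    have "(\<lambda>z::real \<times> (real^'d). \<rho> (snd z, fst z)) \<in> borel_measurable borel"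
      by (rule measurable_compose[OF _ \<rho>]) (auto intro!: borel_measurable_continuous_onI continuous_intros)
    then show ?thesis by (simp add: borel_prod case_prod_beta)
  qed
  have "(\<lambda>t. \<integral>x. (indicator (halfbox L) x * \<rho> (x,t)) *\<^sub>R \<phi> x \<partial>lborel) \<in> borel_measurable borel"
  proof (rule lborel.borel_measurable_lebesgue_integral)
    have "(\<lambda>z. (indicator (halfbox L) (snd z) * (case z of (t,x) \<Rightarrow> \<rho> (x,t))) *\<^sub>R \<phi> (snd z)) \<in> borel_measurable (borel \<Otimes>\<^sub>M borel)"
      using pm by measurable
    then show "(\<lambda>(t,x). (indicator (halfbox L) x * \<rho> (x,t)) *\<^sub>R \<phi> x) \<in> borel_measurable (borel \<Otimes>\<^sub>M lborel)"
      by (simp add: case_prod_beta)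
  qed
  then show ?thesis unfolding eq .
qed

lemma dens_LinfMpos: "LinfMpos L T (dens L \<rho>)"
  unfolding LinfMpos_def using dens_tmeas dens_measurable dens_measure
  by (auto simp: cont_per_def intro!: exI[of _ "B * measure lborel (cbox 0 L)"])

end

lemma cont_per_bounded:
  assumes L: "\<forall>k. L$k > 0" and f: "cont_per L f"
  shows "\<exists>B. \<forall>x. \<bar>f x\<bar> \<le> B"
proof -
  have c: "continuous_on UNIV f" and p: "lat_per L f" using f by (auto simp: cont_per_def)
  have "bounded (f ` cbox 0 L)" by (intro compact_imp_bounded compact_continuous_image continuous_on_subset[OF c]) auto
  then obtain B where B: "\<forall>x\<in>cbox 0 L. \<bar>f x\<bar> \<le> B" unfolding bounded_iff by auto
  have "\<bar>f x\<bar> \<le> B" for x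
  proof -
    have "rep L x \<in> cbox 0 L" using rep_halfbox[OF L, of x] by (auto simp: halfbox_def mem_box_cart less_imp_le)
    then show ?thesis using B lat_per_rep[OF p, of x] by metis
  qed
  then show ?thesis by blast
qed

text \<open>Tonelli's theorem in the form suited to test functions from \<open>testC\<close> and
  \<open>testL2\<close>, for which a gauge integrable bound on the L^1 norm of each slice is
  available.\<close>

lemma cylm_integrable_slices:
  fixes F :: "(real^'d) \<times> real \<Rightarrow> real"
  assumes F: "F \<in> borel_measurable borel"
    and b: "\<And>t. t \<in> {0..T} \<Longrightarrow> (\<integral>\<^sup>+x. ennreal \<bar>F (x,t)\<bar> * indicator (cbox 0 L) x \<partial>lborel) \<le> ennreal (b t)"
    and bi: "b integrable_on {0..T}" and b0: "\<And>t. t \<in> {0..T} \<Longrightarrow> 0 \<le> b t"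
  shows "integrable (cylm L T) F"
proof -
  have Hm: "(\<lambda>z. indicator (cbox 0 L \<times> {0..T}) z * F z) \<in> borel_measurable borel" using F by measurable
  have b_abs: "b absolutely_integrable_on {0..T}" using bi b0 by (rule nonnegative_absolutely_integrable_1)
  \<comment> \<open>\<open>b\<close> is known to be measurable only for the completed measure, so
    the outer integral is compared in \<open>lebesgue\<close>.\<close>
  have bl: "integrable lebesgue (\<lambda>t. indicator {0..T} t *\<^sub>R b t)" using b_abs unfolding set_integrable_def .
  have "(\<integral>\<^sup>+z. ennreal (norm (indicator (cbox 0 L \<times> {0..T}) z * F z)) \<partial>lborel)
      = (\<integral>\<^sup>+t. (\<integral>\<^sup>+x. ennreal (norm (indicator (cbox 0 L \<times> {0..T}) (x,t) * F (x,t))) \<partial>lborel) \<partial>lborel)"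
  proof -
    let ?g = "\<lambda>z. ennreal (norm (indicator (cbox 0 L \<times> {0..T}) z * F z))"
    have s: "sets (lborel \<Otimes>\<^sub>M lborel :: ((real^'d) \<times> real) measure) = sets borel" unfolding lborel_prod by simp
    have "?g \<in> borel_measurable (lborel \<Otimes>\<^sub>M lborel)" unfolding measurable_cong_sets[OF s refl] using Hm by measurable
    then have "(\<integral>\<^sup>+t. (\<integral>\<^sup>+x. ?g (x,t) \<partial>lborel) \<partial>lborel) = integral\<^sup>N (lborel \<Otimes>\<^sub>M lborel) ?g"
      by (rule lborel_pair.nn_integral_snd)
    then show ?thesis unfolding lborel_prod by simp
  qed
  also have "\<dots> \<le> (\<integral>\<^sup>+t. ennreal (indicator {0..T} t *\<^sub>R b t) \<partial>lebesgue)"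
  proof -
    have "(\<integral>\<^sup>+t. (\<integral>\<^sup>+x. ennreal (norm (indicator (cbox 0 L \<times> {0..T}) (x,t) * F (x,t))) \<partial>lborel) \<partial>lborel)
       = (\<integral>\<^sup>+t. (\<integral>\<^sup>+x. ennreal (norm (indicator (cbox 0 L \<times> {0..T}) (x,t) * F (x,t))) \<partial>lborel) \<partial>lebesgue)"
      by (rule nn_integral_completion[symmetric])
    also have "\<dots> \<le> (\<integral>\<^sup>+t. ennreal (indicator {0..T} t *\<^sub>R b t) \<partial>lebesgue)"
    proof (rule nn_integral_mono)
      fix t :: real
      have "(\<integral>\<^sup>+x. ennreal (norm (indicator (cbox 0 L \<times> {0..T}) (x,t) * F (x,t))) \<partial>lborel)
         = (\<integral>\<^sup>+x. indicator {0..T} t * (ennreal \<bar>F (x,t)\<bar> * indicator (cbox 0 L) x) \<partial>lborel)"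
        by (intro nn_integral_cong) (auto simp: indicator_def)
      also have "\<dots> \<le> ennreal (indicator {0..T} t *\<^sub>R b t)" using b[of t] by (auto simp: indicator_def)
      finally show "(\<integral>\<^sup>+x. ennreal (norm (indicator (cbox 0 L \<times> {0..T}) (x,t) * F (x,t))) \<partial>lborel) \<le> ennreal (indicator {0..T} t *\<^sub>R b t)" .
    qed
    finally show ?thesis .
  qed
  also have "\<dots> = ennreal (\<integral>t. indicator {0..T} t *\<^sub>R b t \<partial>lebesgue)"
    by (rule nn_integral_eq_integral[OF bl]) (use b0 in \<open>auto simp: indicator_def\<close>)
  also have "\<dots> < \<infinity>" by simp
  finally have "integrable lborel (\<lambda>z. indicator (cbox 0 L \<times> {0..T}) z * F z)"
    using Hm by (intro integrableI_bounded) auto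
  then show ?thesis unfolding cylm_integrable_iff(1)[OF F] .
qed

lemma near_box:
  fixes x v :: "real^'d"
  assumes "x \<in> cbox 0 L" "norm (v - x) \<le> 1"
  shows "v \<in> cbox (-1) (L + 1)" "x \<in> cbox (-1) (L + 1)"
proof -
  have xk: "0 \<le> x$k \<and> x$k \<le> L$k" for k using assms(1) by (simp add: mem_box_cart)
  have vk: "\<bar>v$k - x$k\<bar> \<le> 1" for k using component_le_norm_cart[of "v - x" k] assms(2) by simp
  have "-1 \<le> v$k \<and> v$k \<le> L$k + 1" for k using xk[of k] vk[of k] by linarith
  then show "v \<in> cbox (-1) (L + 1)" by (simp add: mem_box_cart)
  have "-1 \<le> x$k \<and> x$k \<le> L$k + 1" for k using xk[of k] by linarith
  then show "x \<in> cbox (-1) (L + 1)" by (simp add: mem_box_cart)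
qed

lemma grad_inner_pd:
  fixes q :: "real^'d \<Rightarrow> real"
  assumes "(q has_derivative (\<lambda>e. pd q e x)) (at x)"
  shows "grad q x \<bullet> e = pd q e x"
proof -
  have l: "linear (\<lambda>e. pd q e x)" by (rule has_derivative_linear[OF assms])
  have e: "e = (\<Sum>k\<in>UNIV. e $ k *\<^sub>R axis k 1)" by (simp add: vec_eq_iff axis_def if_distrib cong: if_cong)
  have "pd q e x = (\<Sum>k\<in>UNIV. e $ k *\<^sub>R pd q (axis k 1) x)"
    by (subst e) (simp add: linear_sum[OF l] linear_scale[OF l])
  then show ?thesis by (simp add: inner_vec_def grad_def mult.commute)
qed

lemma has_derivative_slice:
  assumes "(v has_derivative (\<lambda>e. pd v e (x,t))) (at (x,t))"
  shows "((\<lambda>x. v (x,t)) has_derivative (\<lambda>e. pd v (e,0) (x,t))) (at x)"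
  by (rule has_derivative_compose[of "\<lambda>x. (x,t)" "\<lambda>e. (e,0)" x UNIV v "\<lambda>e. pd v e (x,t)"])
     (use assms in \<open>auto intro!: has_derivative_Pair has_derivative_ident has_derivative_const\<close>)

lemma has_vector_derivative_slice:
  fixes v :: "(real^'d) \<times> real \<Rightarrow> 'b::real_normed_vector"
  assumes "(v has_derivative (\<lambda>e. pd v e (x,t))) (at (x,t))"
  shows "((\<lambda>t. v (x,t)) has_vector_derivative pd v (0,1) (x,t)) (at t)"
proof -
  have l: "linear (\<lambda>e. pd v e (x,t))" by (rule has_derivative_linear[OF assms])
  have "((\<lambda>t. v (x,t)) has_derivative (\<lambda>s. pd v (0,s) (x,t))) (at t)"
    by (rule has_derivative_compose[of "\<lambda>t. (x,t)" "\<lambda>s. (0,s)" t UNIV v "\<lambda>e. pd v e (x,t)"])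
       (intro has_derivative_Pair has_derivative_ident has_derivative_const, use assms in simp)
  moreover have "(\<lambda>s. pd v (0,s) (x,t)) = (\<lambda>s. s *\<^sub>R pd v (0,1) (x,t))"
  proof
    fix s
    have "pd v (s *\<^sub>R (0,1)) (x,t) = s *\<^sub>R pd v (0,1) (x,t)" by (rule linear_scale[OF l])
    moreover have "s *\<^sub>R (0::real^'d,1::real) = (0,s)" by (simp add: scaleR_Pair)
    ultimately show "pd v (0,s) (x,t) = s *\<^sub>R pd v (0,1) (x,t)" by (simp only:)
  qed
  ultimately show ?thesis unfolding has_vector_derivative_def by (simp only:)
qed

section \<open>The sequence of discrete solutions\<close>

locale approx =
  fixes L :: "real^'d" and T \<omega> M :: real
    and K :: "nat \<Rightarrow> (real^'d) set set"
    and \<alpha> :: "nat \<Rightarrow> real^'d \<Rightarrow> real^'d \<Rightarrow> real \<Rightarrow> real"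
    and u u' :: "nat \<Rightarrow> real^'d \<Rightarrow> real \<Rightarrow> real^'d"
    and p :: "nat \<Rightarrow> real^'d \<Rightarrow> real \<Rightarrow> real"
  assumes Lpos: "\<forall>k. L$k > 0" and Tpos: "T > 0" and \<omega>pos: "\<omega> > 0"
    and mesh: "\<forall>n. periodic_mesh L (K n)"
    and h_to_0: "(\<lambda>n. mesh_size (K n)) \<longlonglongrightarrow> 0"
    and shape_reg: "\<exists>\<sigma>. \<forall>n. \<forall>S\<in>K n. diameter S \<le> \<sigma> * inradius S"
    and quasi_unif: "\<exists>\<rho>>0. \<forall>n. \<forall>S\<in>K n. \<rho> * mesh_size (K n) \<le> diameter S"
    and alpha: "\<forall>n i j t. 0 \<le> \<alpha> n i j t \<and> \<alpha> n i j t \<le> 1 \<and> \<alpha> n i j t = \<alpha> n j i t"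
    and C1: "\<forall>n. \<forall>i\<in>nodes L (K n). continuous_on {0..T} (u' n i) \<and>
               (\<forall>t\<in>{0..T}. (u n i has_vector_derivative u' n i t) (at t within {0..T}))"
    and S1: "\<forall>n. \<forall>i\<in>nodes L (K n). \<forall>t\<in>{0..T}.
               lm L (K n) i *\<^sub>R u' n i t =
               (\<Sum>j\<in>{j\<in>nodes L (K n). nbr L (K n) i j}.
                  (du L (K n) (\<lambda>a b. \<alpha> n a b t) (\<lambda>k. u n k t) i j
                   - atil L (K n) (\<lambda>k. u n k t) i j) *\<^sub>R u n j t
                  - p n j t *\<^sub>R cc L (K n) i j)"
    and S2: "\<forall>n. \<forall>k\<in>nodes L (K n). \<forall>t\<in>{0..T}.
               0 = (\<Sum>j\<in>{j\<in>nodes L (K n). nbr L (K n) k j}.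
                      dp \<omega> L (K n) k j * p n j t - cc L (K n) k j \<bullet> u n j t)"
    and bounds: "\<forall>n. \<forall>i\<in>nodes L (K n). \<forall>t\<in>{0..T}.
               norm (u n i t) \<le> M \<and> \<bar>p n i t\<bar> \<le> M \<and> norm (u' n i t) \<le> M"
    and H1bound: "\<forall>n. integral {0..T} (\<lambda>t. mesh_size (K n) *
               h1semi L (uh L (K n) (\<lambda>i. u n i t))) \<le> M"
begin

abbreviation "hh n \<equiv> mesh_size (K n)"
text \<open>One constant for all \<open>n\<close>: shape regularity and quasi-uniformity hold with
  constants independent of the mesh.\<close>

definition "\<kappa> = (SOME \<kappa>. \<forall>n. cmesh L (K n) (hh n) \<kappa>)"
abbreviation "vol \<equiv> measure lebesgue (cbox 0 L)"

lemma cm: "cmesh L (K n) (hh n) \<kappa>"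
proof -
  obtain \<sigma> where \<sigma>: "\<forall>n. \<forall>S\<in>K n. diameter S \<le> \<sigma> * inradius S" using shape_reg by blast
  obtain \<rho> where \<rho>: "\<rho> > 0" "\<forall>n. \<forall>S\<in>K n. \<rho> * hh n \<le> diameter S" using quasi_unif by blast
  have "cmesh L (K n) (hh n) (4 * \<sigma> / \<rho>)" for n
  proof -
    interpret pmesh L "K n" using mesh Lpos by unfold_locales auto
    show ?thesis by (rule cmesh_of_regular) (use \<sigma> \<rho> in auto)
  qed
  then have "\<exists>\<kappa>. \<forall>n. cmesh L (K n) (hh n) \<kappa>" by blast
  then have "\<forall>n. cmesh L (K n) (hh n) \<kappa>" unfolding \<kappa>_def by (rule someI_ex)
  then show ?thesis by blast
qed

lemma \<kappa>0: "0 \<le> \<kappa>" using cmesh.\<kappa>[OF cm] .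
lemma hpos: "0 < hh n" using cmesh.hpos[OF cm] .

lemma sch: "t \<in> {0..T} \<Longrightarrow> scheme L (K n) (hh n) \<kappa> \<omega> (\<lambda>a b. \<alpha> n a b t) (\<lambda>i. u n i t) (\<lambda>i. u' n i t) (\<lambda>i. p n i t)"
  by (intro scheme.intro cm scheme_axioms.intro) (use alpha S1 S2 \<omega>pos in blast)+

lemma bounds': "i \<in> nodes L (K n) \<Longrightarrow> t \<in> {0..T} \<Longrightarrow> norm (u n i t) \<le> M"
  "i \<in> nodes L (K n) \<Longrightarrow> t \<in> {0..T} \<Longrightarrow> \<bar>p n i t\<bar> \<le> M" using bounds by blast+

lemma M0: "0 \<le> M"
proof -
  have "nodes L (K 0) \<noteq> {}" using pmesh.sum_hat[OF cmesh.axioms(1)[OF cm], of 0] by fastforce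
  then obtain i where "i \<in> nodes L (K 0)" by blast
  then have "norm (u 0 i 0) \<le> M" using bounds'(1) Tpos by simp
  then show ?thesis using norm_ge_zero[of "u 0 i 0"] by linarith
qed

lemma u_deriv: "i \<in> nodes L (K n) \<Longrightarrow> t \<in> {0..T} \<Longrightarrow> (u n i has_vector_derivative u' n i t) (at t within {0..T})"
  using C1 by blast

lemma u_cont: "i \<in> nodes L (K n) \<Longrightarrow> continuous_on {0..T} (u n i)"
  using u_deriv by (rule continuous_on_vector_derivative)

text \<open>Time is clamped to \<open>[0,T]\<close>: nothing is known about the coefficients outside this interval.\<close>

definition uu :: "nat \<Rightarrow> (real^'d) \<times> real \<Rightarrow> real^'d" where
  "uu n z = uh L (K n) (\<lambda>i. u n i (max 0 (min T (snd z)))) (fst z)"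

lemma clampT: "max 0 (min T s) \<in> {0..T}" using Tpos by auto

lemma uu_eq: "t \<in> {0..T} \<Longrightarrow> uu n (x,t) = uh L (K n) (\<lambda>i. u n i t) x"
  unfolding uu_def by (simp add: min_absorb2 max_absorb2)

lemma uu_bound: "norm (uu n z) \<le> M"
  unfolding uu_def using bounds'(1) clampT by (intro pmesh.uh_bound[OF cmesh.axioms(1)[OF cm]]) blast

lemma uu_cont: "continuous_on UNIV (uu n)"
proof -
  have 1: "continuous_on UNIV (\<lambda>z. hat L (K n) i (fst z))" for i
    by (rule continuous_on_compose2[OF pmesh.hat_continuous[OF cmesh.axioms(1)[OF cm]]]) (auto intro!: continuous_intros)
  have 2: "continuous_on UNIV (\<lambda>z. u n i (max 0 (min T (snd z))))" if "i \<in> nodes L (K n)" for i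
    by (rule continuous_on_compose2[OF u_cont[OF that]]) (use clampT in \<open>auto intro!: continuous_intros\<close>)
  show ?thesis unfolding uu_def uh_def by (intro continuous_on_sum continuous_on_scaleR 1 2)
qed

lemma uu_slice_cont: "continuous_on UNIV (\<lambda>x. uu n (x,t))"
  by (rule continuous_on_compose2[OF uu_cont]) (auto intro!: continuous_intros)

lemma energy_decay:
  assumes t: "t \<in> {0..T}"
  shows "(\<Sum>i\<in>nodes L (K n). lm L (K n) i * ((norm (u n i t))\<^sup>2 / 2)) \<le> (\<Sum>i\<in>nodes L (K n). lm L (K n) i * ((norm (u n i 0))\<^sup>2 / 2))"
proof -
  define e where "e s = (\<Sum>i\<in>nodes L (K n). lm L (K n) i * (1/2 * (u n i s \<bullet> u n i s)))" for s
  have d: "(e has_vector_derivative (\<Sum>i\<in>nodes L (K n). lm L (K n) i * (u n i s \<bullet> u' n i s))) (at s within {0..t})" if s: "s \<in> {0..t}" for s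
  proof -
    have sT: "s \<in> {0..T}" using s t by auto
    have "((\<lambda>s. lm L (K n) i * (1/2 * (u n i s \<bullet> u n i s))) has_vector_derivative lm L (K n) i * (1/2 * (u n i s \<bullet> u' n i s + u' n i s \<bullet> u n i s))) (at s within {0..t})"
      if i: "i \<in> nodes L (K n)" for i
    proof -
      have "(u n i has_vector_derivative u' n i s) (at s within {0..t})"
        by (rule has_vector_derivative_within_subset[OF u_deriv[OF i sT]]) (use t in auto)
      then show ?thesis
        by (intro has_vector_derivative_mult_right bounded_bilinear.has_vector_derivative[OF bounded_bilinear_inner])
    qed
    then have "(e has_vector_derivative (\<Sum>i\<in>nodes L (K n). lm L (K n) i * (1/2 * (u n i s \<bullet> u' n i s + u' n i s \<bullet> u n i s)))) (at s within {0..t})"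
      unfolding e_def by (intro has_vector_derivative_sum)
    then show ?thesis by (simp add: inner_commute)
  qed
  have "((\<lambda>s. \<Sum>i\<in>nodes L (K n). lm L (K n) i * (u n i s \<bullet> u' n i s)) has_integral e t - e 0) {0..t}"
    by (rule fundamental_theorem_of_calculus) (use t d in auto)
  then have "e t - e 0 \<le> 0"
  proof (rule has_integral_le[OF _ has_integral_0])
    fix s assume "s \<in> {0..t}"
    then have "s \<in> {0..T}" using t by auto
    then show "(\<Sum>i\<in>nodes L (K n). lm L (K n) i * (u n i s \<bullet> u' n i s)) \<le> 0"
      using scheme.energy_dissipation[OF sch] by blast
  qed
  then show ?thesis unfolding e_def by (simp add: power2_norm_eq_inner)
qed

lemma integral_box_eq:
  fixes f :: "real^'d \<Rightarrow> real"
  assumes "continuous_on UNIV f"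
  shows "integral (cbox 0 L) f = (\<integral>x. f x \<partial>(lebesgue_on (cbox 0 L)))"
  by (rule lebesgue_integral_eq_integral[symmetric, OF cmesh.bm_integrable[OF cm cmesh.bm_continuous[OF cm assms]]]) simp

lemma energy_uu:
  assumes t: "t \<in> {0..T}"
  shows "integral (cbox 0 L) (\<lambda>x. (norm (uu n (x,t)))\<^sup>2 / 2) \<le> (\<Sum>i\<in>nodes L (K n). lm L (K n) i * ((norm (u n i 0))\<^sup>2 / 2))"
proof -
  have "integral (cbox 0 L) (\<lambda>x. (norm (uu n (x,t)))\<^sup>2 / 2) = (\<integral>x. (norm (uh L (K n) (\<lambda>i. u n i t) x))\<^sup>2 / 2 \<partial>(lebesgue_on (cbox 0 L)))"
    unfolding uu_eq[OF t, symmetric] by (rule integral_box_eq) (intro continuous_intros uu_slice_cont, simp)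
  then show ?thesis using cmesh.jensen_uh[OF cm, of n "\<lambda>i. u n i t"] energy_decay[OF t, of n] by linarith
qed

text \<open>Uniform in \<open>t\<close>, so that it survives multiplication by an arbitrary
  indicator in time and integration over [0,T].\<close>

lemma div_small:
  assumes q: "smooth q" "lat_per L q" and e: "e > 0"
  shows "\<forall>\<^sub>F n in sequentially. \<forall>t\<in>{0..T}. \<bar>integral (cbox 0 L) (\<lambda>x. uu n (x,t) \<bullet> grad q x)\<bar> \<le> e"
proof -
  have "bounded (cbox (-1) (L + 1))" by simp
  then obtain R where R: "\<forall>x\<in>cbox (-1) (L + 1). norm x \<le> R" unfolding bounded_iff by blast
  obtain V where V: "V \<ge> 0" "\<forall>z\<in>cball 0 R. \<forall>z'\<in>cball 0 R. norm (q z' - q z) \<le> V * norm (z' - z)"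
    using smooth_bounds[OF q(1), of R] by blast
  define c where "c = M * ((real CARD('d) + 1) * \<kappa>) * vol"
  have c0: "0 \<le> c" unfolding c_def using M0 \<kappa>0 by simp
  \<comment> \<open>Half of \<open>e\<close> pays for the Taylor remainders and the other half for
    the terms of order \<open>hh n\<close>; adding 1 to \<open>c\<close> covers
    \<open>c = 0\<close>.\<close>
  define \<epsilon> where "\<epsilon> = e / (2 * (c + 1))"
  have \<epsilon>: "\<epsilon> > 0" "c * \<epsilon> \<le> e / 2" unfolding \<epsilon>_def using e c0 by (auto simp: field_simps)
  obtain \<delta> where \<delta>: "\<delta> > 0" "\<forall>z\<in>cball 0 R. \<forall>z'\<in>cball 0 R. norm (z' - z) < \<delta> \<longrightarrow> norm (q z' - q z - pd q (z' - z) z) \<le> \<epsilon> * norm (z' - z)"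
    using smooth_taylor[OF q(1) \<epsilon>(1), of R] by blast
  have lim: "(\<lambda>n. \<omega> / 2 * (4 * M * V * hh n) * vol) \<longlonglongrightarrow> \<omega> / 2 * (4 * M * V * 0) * vol"
    by (intro tendsto_intros h_to_0)
  have ev1: "\<forall>\<^sub>F n in sequentially. \<omega> / 2 * (4 * M * V * hh n) * vol < e / 2"
    by (rule order_tendstoD(2)[OF lim]) (use e in simp)
  have ev2: "\<forall>\<^sub>F n in sequentially. hh n < min \<delta> 1" by (rule order_tendstoD(2)[OF h_to_0]) (use \<delta> in simp)
  from ev1 ev2 show ?thesis
  proof eventually_elim
    case (elim n)
    show ?case
    proof
      fix t assume t: "t \<in> {0..T}"
      have gc: "continuous_on UNIV (grad q)"
        unfolding grad_eq_sum by (intro continuous_intros smooth_C1(2)[OF q(1)])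
      interpret S: scheme L "K n" "hh n" \<kappa> \<omega> "\<lambda>a b. \<alpha> n a b t" "\<lambda>i. u n i t" "\<lambda>i. u' n i t" "\<lambda>i. p n i t" by (rule sch[OF t])
      have nb: "v \<in> cball 0 R" "x \<in> cball 0 R" if "x \<in> cbox 0 L" "norm (v - x) \<le> hh n" for v x
        using near_box[OF that(1), of v] that elim(2) R by auto
      have "\<bar>\<integral>x. uh L (K n) (\<lambda>i. u n i t) x \<bullet> grad q x \<partial>(lebesgue_on (cbox 0 L))\<bar> \<le> (M * ((real CARD('d) + 1) * \<kappa> * \<epsilon>) + \<omega> / 2 * (4 * M * V * hh n)) * vol"
      proof (rule S.divergence_consistency[OF _ _ q(2) gc])
        fix x v assume xv: "x \<in> cbox 0 L" "norm (v - x) \<le> hh n"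
        have "norm (v - x) < \<delta>" using xv elim(2) by linarith
        then have "\<bar>q v - q x - grad q x \<bullet> (v - x)\<bar> \<le> \<epsilon> * norm (v - x)"
          using \<delta>(2) nb[OF xv] grad_inner_pd[OF smooth_C1(3)[OF q(1)], of x "v - x"] by (metis real_norm_def)
        also have "\<dots> \<le> \<epsilon> * hh n" using xv \<epsilon>(1) by (intro mult_left_mono) auto
        finally show "\<bar>q v - q x - grad q x \<bullet> (v - x)\<bar> \<le> \<epsilon> * hh n" .
        have "\<bar>q v - q x\<bar> \<le> V * norm (v - x)" using V(2) nb[OF xv] by (metis real_norm_def)
        also have "\<dots> \<le> V * hh n" using xv V(1) by (intro mult_left_mono) auto
        finally show "\<bar>q v - q x\<bar> \<le> V * hh n" .
      qed (use bounds' t in auto)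
      also have "\<dots> = c * \<epsilon> + \<omega> / 2 * (4 * M * V * hh n) * vol" unfolding c_def by (simp add: algebra_simps)
      also have "\<dots> \<le> e" using elim(1) \<epsilon>(2) by linarith
      finally show "\<bar>integral (cbox 0 L) (\<lambda>x. uu n (x,t) \<bullet> grad q x)\<bar> \<le> e"
        unfolding uu_eq[OF t] using integral_box_eq[of "\<lambda>x. uh L (K n) (\<lambda>i. u n i t) x \<bullet> grad q x"]
          continuous_on_inner[OF uu_slice_cont[of n t] gc] unfolding uu_eq[OF t] by simp
    qed
  qed
qed

end

section \<open>The discrete momentum balance in weak form\<close>

context approx begin

definition momentum_flux :: "((real^'d) \<times> real \<Rightarrow> real^'d) \<Rightarrow> nat \<Rightarrow> (real^'d) \<times> real \<Rightarrow> real" where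
  "momentum_flux v n z = uu n z \<bullet> pd v (0,1) z + (\<Sum>k\<in>UNIV. \<Sum>l\<in>UNIV. uu n z $ k * uu n z $ l * pd v (axis l 1, 0) z $ k)"

text \<open>The nodal equations are tested with \<open>v (i,t)\<close> and integrated in time, which
  moves the time derivative to \<open>v\<close> and leaves the initial momentum. The defect in the
  continuous weak form then consists of two lumping errors and the time integral of the consistency
  error.\<close>

lemma momentum_limit:
  fixes v :: "(real^'d) \<times> real \<Rightarrow> real^'d"
  assumes v: "smooth v" "\<forall>t. lat_per L (\<lambda>x. v (x,t))" and vT: "\<forall>x. v (x,T) = 0"
    and divv: "\<forall>x t. (\<Sum>k\<in>UNIV. pd v (axis k 1, 0) (x,t) $ k) = 0"
  shows "(\<lambda>n. (\<integral>z. momentum_flux v n z \<partial>(cylm L T)) + integral (cbox 0 L) (\<lambda>x. uu n (x,0) \<bullet> v (x,0))) \<longlonglongrightarrow> 0"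
proof -
  \<comment> \<open>A space-time ball large enough for the cylinder and for all vertices within
    distance 1 of the box, on which the bounds for \<open>v\<close> are uniform.\<close>
  have "bounded (cbox (-1) (L + 1) \<times> {0..T})" by (intro bounded_Times) auto
  then obtain R where R: "\<forall>z\<in>cbox (-1) (L + 1) \<times> {0..T}. norm z \<le> R" unfolding bounded_iff by blast
  have inR: "(y,t) \<in> cball 0 R" if "y \<in> cbox (-1) (L + 1)" "t \<in> {0..T}" for y t using R that by auto
  obtain V where V: "V \<ge> 0" "\<forall>z\<in>cball 0 R. norm (v z) \<le> V \<and> (\<forall>e. norm (pd v e z) \<le> V * norm e)"
    "\<forall>z\<in>cball 0 R. \<forall>z'\<in>cball 0 R. norm (v z' - v z) \<le> V * norm (z' - z)"
    using smooth_bounds[OF v(1), of R] by blast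
  \<comment> \<open>The constant of \<open>consistency\<close>.\<close>
  define Cst where "Cst = 2 * M * ((real CARD('d) + 1) * \<kappa>) * V + (M * M * ((real CARD('d) + 1) * \<kappa>) + 2 * M * V) / 2
     + (V + M * V) / 2 * (1 + real CARD('d) + 2 * \<omega> * M) + M * ((real CARD('d) + 1) * \<kappa>)"
  have Cst0: "0 \<le> Cst" unfolding Cst_def using M0 V(1) \<kappa>0 \<omega>pos by simp
  define D where "D n = (\<integral>z. momentum_flux v n z \<partial>(cylm L T)) + integral (cbox 0 L) (\<lambda>x. uu n (x,0) \<bullet> v (x,0))" for n
  have cpd: "continuous_on UNIV (pd v e)" for e by (rule smooth_C1(2)[OF v(1)])
  have cv: "continuous_on UNIV v" by (rule smooth_C1(4)[OF v(1)])
  have slice: "continuous_on UNIV (\<lambda>x. f (x,t))" if "continuous_on UNIV f" for f :: "(real^'d) \<times> real \<Rightarrow> real^'d" and t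
    by (rule continuous_on_compose2[OF that]) (auto intro!: continuous_intros)
  have slice_t: "continuous_on {0..T} (\<lambda>t. f (x,t))" if "continuous_on UNIV f" for f :: "(real^'d) \<times> real \<Rightarrow> real^'d" and x
    by (rule continuous_on_compose2[OF that]) (auto intro!: continuous_intros)
  \<comment> \<open>\<open>\<epsilon>\<close> fixes the Taylor remainder and the modulus of
    continuity of the time derivative; once the mesh is fine enough for both, the remaining error
    vanishes with \<open>hh n\<close>.\<close>
  have main: "\<forall>\<^sub>F n in sequentially. \<bar>D n\<bar> \<le> (Cst * (vol * T + M) + M * vol * T) * \<epsilon> + (Cst * (vol * T + M) * sqrt (hh n) + M * V * vol * hh n)"
    if \<epsilon>: "\<epsilon> > 0" for \<epsilon>
  proof -
    obtain \<delta>1 where \<delta>1: "\<delta>1 > 0" "\<forall>z\<in>cball 0 R. \<forall>z'\<in>cball 0 R. norm (z' - z) < \<delta>1 \<longrightarrow> norm (v z' - v z - pd v (z' - z) z) \<le> \<epsilon> * norm (z' - z)"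
      using smooth_taylor[OF v(1) \<epsilon>, of R] by blast
    have uc: "uniformly_continuous_on (cball 0 R) (pd v (0,1))"
      by (intro compact_uniformly_continuous continuous_on_subset[OF cpd]) auto
    obtain \<delta>2 where \<delta>2: "\<delta>2 > 0" "\<forall>z\<in>cball 0 R. \<forall>z'\<in>cball 0 R. dist z' z < \<delta>2 \<longrightarrow> dist (pd v (0,1) z') (pd v (0,1) z) < \<epsilon>"
      using spec[OF uc[unfolded uniformly_continuous_on_def], of \<epsilon>, THEN mp, OF \<epsilon>] by blast
    have "\<forall>\<^sub>F n in sequentially. hh n < min (min \<delta>1 \<delta>2) 1" by (rule order_tendstoD(2)[OF h_to_0]) (use \<delta>1 \<delta>2 in simp)
    then show ?thesis
    proof eventually_elim
      case (elim n)
      interpret cmesh L "K n" "hh n" \<kappa> by (rule cm)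
      have nb: "(y,t) \<in> cball 0 R" "(x,t) \<in> cball 0 R" if "x \<in> cbox 0 L" "norm (y - x) \<le> hh n" "t \<in> {0..T}" for x y t
      proof -
        have "norm (y - x) \<le> 1" using that(2) elim by linarith
        then show "(y,t) \<in> cball 0 R" "(x,t) \<in> cball 0 R" using near_box[OF that(1)] inR that(3) by blast+
      qed
      have nd: "norm ((y,t) - (x,t)) = norm (y - x)" for x y :: "real^'d" and t :: real by (simp add: norm_Pair)
      define Rn where "Rn t = (\<Sum>i\<in>N. lm L (K n) i * (v (i,t) \<bullet> u' n i t))" for t
      define Bn where "Bn t = (\<Sum>i\<in>N. lm L (K n) i * (u n i t \<bullet> pd v (0,1) (i,t)))" for t
      define Xn where "Xn t = integral (cbox 0 L) (\<lambda>x. \<Sum>k\<in>UNIV. \<Sum>l\<in>UNIV. uu n (x,t) $ k * uu n (x,t) $ l * pd v (axis l 1, 0) (x,t) $ k)" for t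
      define Yn where "Yn t = integral (cbox 0 L) (\<lambda>x. uu n (x,t) \<bullet> pd v (0,1) (x,t))" for t
      define m0 where "m0 = (\<Sum>i\<in>N. lm L (K n) i * (u n i 0 \<bullet> v (i,0)))"
      have A: "\<bar>Xn t - Rn t\<bar> \<le> Cst * ((\<epsilon> + sqrt (hh n)) * (vol + hh n * h1semi L (uh L (K n) (\<lambda>i. u n i t))))" if t: "t \<in> {0..T}" for t
      proof -
        have wd: "((\<lambda>x. v (x,t)) has_derivative (\<lambda>e. pd v (e,0) (x,t))) (at x)" for x by (rule has_derivative_slice[OF smooth_C1(3)[OF v(1)]])
        interpret TS: tested_scheme L "K n" "hh n" \<kappa> \<omega> "\<lambda>a b. \<alpha> n a b t" "\<lambda>i. u n i t" "\<lambda>i. u' n i t" "\<lambda>i. p n i t"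
          "\<lambda>x. v (x,t)" "\<lambda>x e. pd v (e,0) (x,t)" M V \<epsilon>
        proof (intro tested_scheme.intro tested_scheme_axioms.intro)
          show "scheme L (K n) (hh n) \<kappa> \<omega> (\<lambda>a b. \<alpha> n a b t) (\<lambda>i. u n i t) (\<lambda>i. u' n i t) (\<lambda>i. p n i t)" by (rule sch[OF t])
          show "norm (u n j t) \<le> M" "\<bar>p n j t\<bar> \<le> M" if "j \<in> N" for j using bounds' that t by auto
          show "lat_per L (\<lambda>x. v (x,t))" using v(2) by blast
          show "((\<lambda>x. v (x,t)) has_derivative (\<lambda>e. pd v (e,0) (x,t))) (at x)" for x by (rule wd)
          show "(\<Sum>k\<in>UNIV. pd v (axis k 1, 0) (x,t) $ k) = 0" for x using divv by blast
          show "hh n \<le> 1" "0 \<le> \<epsilon>" using elim \<epsilon> by auto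
          show "perlip L (\<lambda>x. v (x,t) $ k)" for k
          proof -
            have 1: "continuous_on UNIV (\<lambda>x. v (x,t) $ k)" by (intro continuous_intros slice[OF cv])
            have 2: "lat_per L (\<lambda>x. v (x,t) $ k)" using v(2) by (simp add: lat_per_def)
            have 3: "V-lipschitz_on (cbox (-1) (L + 1)) (\<lambda>x. v (x,t) $ k)"
            proof (rule lipschitz_onI)
              fix x y assume "x \<in> cbox (-1) (L + 1)" "y \<in> cbox (-1) (L + 1)"
              then have "norm (v (x,t) - v (y,t)) \<le> V * norm (x - y)" using V(3) inR[OF _ t] nd[of x t y] by metis
              then show "dist (v (x,t) $ k) (v (y,t) $ k) \<le> V * dist x y"
                using component_le_norm_cart[of "v (x,t) - v (y,t)" k] by (simp add: dist_norm)
            qed (rule V(1))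
            have 4: "(\<lambda>x. v (x,t) $ k) differentiable (at x)" for x
              using bounded_linear.has_derivative[OF bounded_linear_vec_nth wd[of x], of k] unfolding differentiable_def by blast
            have "\<exists>Z. negligible Z \<and> (\<forall>x\<in>cbox 0 L - Z. (\<lambda>x. v (x,t) $ k) differentiable (at x))"
              using 4 negligible_empty by blast
            then show ?thesis unfolding perlip_def using 1 2 3 by simp (rule exI)
          qed
          fix x y e :: "real^'d" assume x: "x \<in> cbox 0 L"
          have "(x,t) \<in> cball 0 R" using nb(2)[OF x, of x t] hpos t by simp
          then have "norm (pd v (e,0) (x,t)) \<le> V * norm (e, 0::real)" using V(2) by blast
          then show "norm (pd v (e,0) (x,t)) \<le> V * norm e" by (simp add: norm_Pair)
          assume y: "norm (y - x) \<le> hh n"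
          note n2 = nb[OF x y t]
          show "norm (v (y,t)) \<le> V" using V(2) n2 by blast
          have hm: "c * norm (y - x) \<le> c * hh n" if "0 \<le> c" for c using y that by (rule mult_left_mono)
          have "norm (v (y,t) - v (x,t)) \<le> V * norm (y - x)" using V(3) n2 nd[of y t x] by metis
          then show "norm (v (y,t) - v (x,t)) \<le> V * hh n" using hm[OF V(1)] by linarith
          have "norm ((y,t) - (x,t)) < \<delta>1" using y elim nd[of y t x] by linarith
          then have "norm (v (y,t) - v (x,t) - pd v ((y,t) - (x,t)) (x,t)) \<le> \<epsilon> * norm ((y,t) - (x,t))" using \<delta>1(2) n2 by blast
          then have "norm (v (y,t) - v (x,t) - pd v (y - x, 0) (x,t)) \<le> \<epsilon> * norm (y - x)"
            using nd[of y t x] by simp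
          then show "norm (v (y,t) - v (x,t) - pd v (y - x, 0) (x,t)) \<le> \<epsilon> * hh n"
            using hm[of \<epsilon>] \<epsilon> by linarith
        qed
        have Xe: "TS.X x = (\<Sum>k\<in>UNIV. \<Sum>l\<in>UNIV. uu n (x,t) $ k * uu n (x,t) $ l * pd v (axis l 1, 0) (x,t) $ k)" for x
          unfolding TS.X_def uu_eq[OF t] TS.A_component ..
        have "Xn t = (\<integral>x. TS.X x \<partial>\<Lambda>)" unfolding Xn_def Xe
          by (rule integral_box_eq) (intro continuous_intros uu_slice_cont slice[OF cpd])
        then show ?thesis using TS.consistency unfolding TS.IE_eq Rn_def Cst_def by (simp only: abs_minus_commute)
      qed
      have Bt: "\<bar>Yn t - Bn t\<bar> \<le> M * \<epsilon> * vol" if t: "t \<in> {0..T}" for t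
      proof -
        have ye: "Yn t = (\<integral>x. uh L (K n) (\<lambda>i. u n i t) x \<bullet> pd v (0,1) (x,t) \<partial>\<Lambda>)"
          unfolding Yn_def uu_eq[OF t, symmetric] by (rule integral_box_eq) (intro continuous_intros uu_slice_cont slice[OF cpd])
        have per: "lat_per L (\<lambda>x. pd v (0,1) (x,t))"
          unfolding lat_per_def
        proof (intro allI)
          fix x k
          let ?z = "(L$k) *\<^sub>R axis k (1::real) :: real^'d"
          have "((\<lambda>s. v (x + ?z, s)) has_vector_derivative pd v (0,1) (x + ?z, t)) (at t)"
            by (rule has_vector_derivative_slice[OF smooth_C1(3)[OF v(1)]])
          moreover have "(\<lambda>s. v (x + ?z, s)) = (\<lambda>s. v (x, s))" using v(2) unfolding lat_per_def by blast
          moreover have "((\<lambda>s. v (x, s)) has_vector_derivative pd v (0,1) (x, t)) (at t)"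
            by (rule has_vector_derivative_slice[OF smooth_C1(3)[OF v(1)]])
          ultimately show "pd v (0,1) (x + ?z, t) = pd v (0,1) (x, t)" using vector_derivative_unique_at by metis
        qed
        have "\<bar>(\<Sum>i\<in>N. lm L (K n) i * (u n i t \<bullet> pd v (0,1) (i,t))) - (\<integral>x. uh L (K n) (\<lambda>i. u n i t) x \<bullet> pd v (0,1) (x,t) \<partial>\<Lambda>)\<bar> \<le> M * \<epsilon> * vol"
        proof (rule lumping_error[OF _ per slice[OF cpd]])
          show "\<forall>j\<in>N. norm (u n j t) \<le> M" using bounds' t by blast
          fix x y assume xy: "x \<in> cbox 0 L" "norm (y - x) \<le> hh n"
          have "dist (y,t) (x,t) < \<delta>2" unfolding dist_norm nd using xy elim by linarith
          then have "dist (pd v (0,1) (y,t)) (pd v (0,1) (x,t)) < \<epsilon>" using \<delta>2(2) nb[OF xy t] by blast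
          then show "norm (pd v (0,1) (y,t) - pd v (0,1) (x,t)) \<le> \<epsilon>" by (simp add: dist_norm)
        qed
        then show ?thesis unfolding ye Bn_def by (simp only: abs_minus_commute)
      qed
      have I0: "\<bar>integral (cbox 0 L) (\<lambda>x. uu n (x,0) \<bullet> v (x,0)) - m0\<bar> \<le> M * (V * hh n) * vol"
      proof -
        have T0: "(0::real) \<in> {0..T}" using Tpos by simp
        have ye: "integral (cbox 0 L) (\<lambda>x. uu n (x,0) \<bullet> v (x,0)) = (\<integral>x. uh L (K n) (\<lambda>i. u n i 0) x \<bullet> v (x,0) \<partial>\<Lambda>)"
          unfolding uu_eq[OF T0, symmetric] by (rule integral_box_eq) (intro continuous_intros uu_slice_cont slice[OF cv])
        have "\<bar>(\<Sum>i\<in>N. lm L (K n) i * (u n i 0 \<bullet> v (i,0))) - (\<integral>x. uh L (K n) (\<lambda>i. u n i 0) x \<bullet> v (x,0) \<partial>\<Lambda>)\<bar> \<le> M * (V * hh n) * vol"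
        proof (rule lumping_error[OF _ _ slice[OF cv]])
          show "\<forall>j\<in>N. norm (u n j 0) \<le> M" using bounds' T0 by blast
          show "lat_per L (\<lambda>x. v (x,0))" using v(2) by blast
          fix x y assume xy: "x \<in> cbox 0 L" "norm (y - x) \<le> hh n"
          have "norm (v (y,0) - v (x,0)) \<le> V * norm (y - x)" using V(3) nb[OF xy T0] nd[of y 0 x] by metis
          also have "\<dots> \<le> V * hh n" using xy V(1) by (intro mult_left_mono) auto
          finally show "norm (v (y,0) - v (x,0)) \<le> V * hh n" .
        qed
        then show ?thesis unfolding ye m0_def by (simp only: abs_minus_commute)
      qed
      \<comment> \<open>Product rule for the lumped momentum tested with \<open>v\<close>; its value
        at \<open>T\<close> is zero together with \<open>v\<close>.\<close>
      have ftc: "((\<lambda>t. Bn t + Rn t) has_integral - m0) {0..T}"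
      proof -
        define m where "m t = (\<Sum>i\<in>N. lm L (K n) i * (u n i t \<bullet> v (i,t)))" for t
        have "((\<lambda>t. Bn t + Rn t) has_integral m T - m 0) {0..T}"
        proof (rule fundamental_theorem_of_calculus)
          show "0 \<le> T" using Tpos by simp
          fix t assume t: "t \<in> {0..T}"
          have "((\<lambda>t. lm L (K n) i * (u n i t \<bullet> v (i,t))) has_vector_derivative lm L (K n) i * (u n i t \<bullet> pd v (0,1) (i,t) + u' n i t \<bullet> v (i,t))) (at t within {0..T})"
            if i: "i \<in> N" for i
            by (intro has_vector_derivative_mult_right bounded_bilinear.has_vector_derivative[OF bounded_bilinear_inner]
                u_deriv[OF i t] has_vector_derivative_at_within[OF has_vector_derivative_slice[OF smooth_C1(3)[OF v(1)]]])
          then have "(m has_vector_derivative (\<Sum>i\<in>N. lm L (K n) i * (u n i t \<bullet> pd v (0,1) (i,t) + u' n i t \<bullet> v (i,t)))) (at t within {0..T})"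
            unfolding m_def by (intro has_vector_derivative_sum)
          then show "(m has_vector_derivative Bn t + Rn t) (at t within {0..T})"
            unfolding Bn_def Rn_def by (simp add: sum.distrib distrib_left inner_commute)
        qed
        moreover have "m T = 0" unfolding m_def using vT by simp
        ultimately show ?thesis unfolding m0_def m_def by simp
      qed
      have Bi: "Bn integrable_on {0..T}" unfolding Bn_def
        by (intro integrable_continuous_interval continuous_intros u_cont slice_t[OF cpd])
      have Ri: "Rn integrable_on {0..T}"
      proof -
        have "continuous_on {0..T} (u' n i)" if "i \<in> N" for i using C1 that by blast
        then show ?thesis unfolding Rn_def by (intro integrable_continuous_interval continuous_intros slice_t[OF cv])
      qed
      have BR: "integral {0..T} Bn + integral {0..T} Rn = - m0" using integral_unique[OF ftc] integral_add[OF Bi Ri] by simp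
      define Fa where "Fa z = uu n z \<bullet> pd v (0,1) z" for z
      define Fb where "Fb z = (\<Sum>k\<in>UNIV. \<Sum>l\<in>UNIV. uu n z $ k * uu n z $ l * pd v (axis l 1, 0) z $ k)" for z
      have Fc: "continuous_on UNIV Fa" "continuous_on UNIV Fb" unfolding Fa_def Fb_def by (intro continuous_intros uu_cont cpd)+
      have Fi: "integrable (cylm L T) F" "F \<in> borel_measurable borel" if F: "continuous_on UNIV F" for F :: "(real^'d) \<times> real \<Rightarrow> real"
      proof -
        show m: "F \<in> borel_measurable borel" using F by (rule borel_measurable_continuous_onI)
        have "bounded (F ` (cbox 0 L \<times> {0..T}))"
          by (intro compact_imp_bounded compact_continuous_image continuous_on_subset[OF F] compact_Times) auto
        then obtain B where "\<forall>z\<in>cbox 0 L \<times> {0..T}. \<bar>F z\<bar> \<le> B" unfolding bounded_iff by auto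
        then show "integrable (cylm L T) F" using m by (intro cylm_integrable_bounded[where B=B]) auto
      qed
      have Yi: "(Yn has_integral (\<integral>z. Fa z \<partial>(cylm L T))) {0..T}"
        using iterated_integral[OF Fi(2)[OF Fc(1)] Fi(1)[OF Fc(1)]] unfolding Yn_def Fa_def .
      have Xi: "(Xn has_integral (\<integral>z. Fb z \<partial>(cylm L T))) {0..T}"
        using iterated_integral[OF Fi(2)[OF Fc(2)] Fi(1)[OF Fc(2)]] unfolding Xn_def Fb_def .
      \<comment> \<open>\<open>BR\<close> inserts zero in such a way that each continuous term is
        paired with its discrete counterpart.\<close>
      have Deq: "D n = (integral {0..T} Yn - integral {0..T} Bn) + (integral {0..T} Xn - integral {0..T} Rn)
         + (integral (cbox 0 L) (\<lambda>x. uu n (x,0) \<bullet> v (x,0)) - m0)"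
      proof -
        have "(\<integral>z. momentum_flux v n z \<partial>(cylm L T)) = (\<integral>z. Fa z \<partial>(cylm L T)) + (\<integral>z. Fb z \<partial>(cylm L T))"
          unfolding momentum_flux_def Fa_def[symmetric] Fb_def[symmetric] using Fi(1)[OF Fc(1)] Fi(1)[OF Fc(2)] by simp
        then show ?thesis unfolding D_def using integral_unique[OF Yi] integral_unique[OF Xi] BR by simp
      qed
      have e1: "\<bar>integral {0..T} Yn - integral {0..T} Bn\<bar> \<le> M * \<epsilon> * vol * T"
      proof -
        have Yii: "Yn integrable_on {0..T}" using Yi by blast
        have "norm (integral {0..T} (\<lambda>t. Yn t - Bn t)) \<le> integral {0..T} (\<lambda>t. M * \<epsilon> * vol)"
          by (rule integral_norm_bound_integral) (use integrable_diff[OF Yii Bi] Bt in auto)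
        then show ?thesis using integral_diff[OF Yii Bi] Tpos by (simp add: mult_ac)
      qed
      have e2: "\<bar>integral {0..T} Xn - integral {0..T} Rn\<bar> \<le> Cst * ((\<epsilon> + sqrt (hh n)) * (vol * T + M))"
      proof -
        \<comment> \<open>Continuity in time, by \<open>h1semi_quadratic\<close>, makes the assumed
          bound on the integral usable as an upper bound of an integrable majorant.\<close>
        define g where "g t = hh n * h1semi L (uh L (K n) (\<lambda>i. u n i t))" for t
        have "continuous_on {0..T} g" unfolding g_def h1semi_quadratic by (intro continuous_intros u_cont)
        then have gi: "g integrable_on {0..T}" by (rule integrable_continuous_interval)
        have gM: "integral {0..T} g \<le> M" using H1bound unfolding g_def by blast
        have ci: "(\<lambda>t. vol) integrable_on {0..T}" by (rule integrable_const_ivl)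
        have Xii: "Xn integrable_on {0..T}" using Xi by blast
        have "norm (integral {0..T} (\<lambda>t. Xn t - Rn t)) \<le> integral {0..T} (\<lambda>t. Cst * ((\<epsilon> + sqrt (hh n)) * (vol + g t)))"
          by (rule integral_norm_bound_integral)
             (use integrable_diff[OF Xii Ri] integrable_add[OF ci gi] A in \<open>auto simp: g_def intro!: integrable_on_mult_right\<close>)
        also have "\<dots> = Cst * ((\<epsilon> + sqrt (hh n)) * (vol * T + integral {0..T} g))"
          using integral_add[OF ci gi] Tpos by (simp add: mult.commute)
        also have "\<dots> \<le> Cst * ((\<epsilon> + sqrt (hh n)) * (vol * T + M))"
          using Cst0 gM \<epsilon> hpos by (intro mult_left_mono add_left_mono) auto
        finally show ?thesis using integral_diff[OF Xii Ri] by simp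
      qed
      have "\<bar>D n\<bar> \<le> M * \<epsilon> * vol * T + Cst * ((\<epsilon> + sqrt (hh n)) * (vol * T + M)) + M * (V * hh n) * vol"
        unfolding Deq using e1 e2 I0 by linarith
      also have "\<dots> = (Cst * (vol * T + M) + M * vol * T) * \<epsilon> + (Cst * (vol * T + M) * sqrt (hh n) + M * V * vol * hh n)"
        by (simp add: algebra_simps)
      finally show ?case .
    qed
  qed
  define c where "c = Cst * (vol * T + M) + M * vol * T"
  have c0: "0 \<le> c" unfolding c_def using Cst0 M0 Tpos by simp
  have "D \<longlonglongrightarrow> 0"
  proof (rule tendstoI)
    fix e :: real assume e: "e > 0"
    define \<epsilon> where "\<epsilon> = e / (2 * (c + 1))"
    have \<epsilon>: "\<epsilon> > 0" "c * \<epsilon> \<le> e / 2" unfolding \<epsilon>_def using e c0 by (auto simp: field_simps)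
    have lim: "(\<lambda>n. Cst * (vol * T + M) * sqrt (hh n) + M * V * vol * hh n) \<longlonglongrightarrow> Cst * (vol * T + M) * sqrt 0 + M * V * vol * 0"
      by (intro tendsto_intros h_to_0)
    have "\<forall>\<^sub>F n in sequentially. Cst * (vol * T + M) * sqrt (hh n) + M * V * vol * hh n < e / 2"
      by (rule order_tendstoD(2)[OF lim]) (use e in simp)
    with main[OF \<epsilon>(1)] show "\<forall>\<^sub>F n in sequentially. dist (D n) 0 < e"
    proof eventually_elim
      case (elim n)
      then have "\<bar>D n\<bar> < e" using \<epsilon>(2) unfolding c_def by linarith
      then show ?case by (simp add: dist_real_def)
    qed
  qed
  then show ?thesis unfolding D_def .
qed

end

section \<open>From time averages to almost every time\<close>

text \<open>Applied to the set of times where \<open>J\<close> exceeds \<open>c\<close>: there the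
  nonnegative excess has a nonpositive integral and so vanishes almost everywhere.\<close>

lemma AE_le_if_integrals_le:
  fixes J :: "real \<Rightarrow> real"
  assumes J: "J \<in> borel_measurable borel" "\<And>t. \<bar>J t\<bar> \<le> B"
    and le: "\<And>A. A \<in> sets borel \<Longrightarrow> integral {0..T} (\<lambda>t. indicator A t * J t) \<le> integral {0..T} (\<lambda>t. indicator A t * c)"
  shows "AE t in lborel. t \<in> {0..T} \<longrightarrow> J t \<le> c"
proof -
  define A where "A = {t. J t > c}"
  have A[measurable]: "A \<in> sets borel" using J(1) unfolding A_def by measurable
  define g where "g t = indicator {0..T} t *\<^sub>R (indicator A t * (J t - c))" for t
  have si: "set_integrable lborel {0..T} (\<lambda>t. indicator A t * k t)" if "k \<in> borel_measurable borel" "\<And>t. \<bar>k t\<bar> \<le> C" for k :: "real \<Rightarrow> real" and C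
  proof -
    have "set_integrable lborel (cbox 0 T) (\<lambda>t. indicator A t * k t)"
    proof (rule set_integrable_bounded_cbox)
      show "\<bar>indicator A t * k t\<bar> \<le> C" for t using that(2)[of t] by (auto simp: indicator_def)
    qed (use that(1) in measurable)
    then show ?thesis by simp
  qed
  have s1: "set_integrable lborel {0..T} (\<lambda>t. indicator A t * J t)" by (rule si[OF J])
  have s2: "set_integrable lborel {0..T} (\<lambda>t. indicator A t * c)" by (rule si[of "\<lambda>_. c" "\<bar>c\<bar>"]) auto
  have s3: "set_integrable lborel {0..T} (\<lambda>t. indicator A t * (J t - c))"
    using set_integral_diff(1)[OF s1 s2] by (simp add: right_diff_distrib)
  have "(\<integral>t. g t \<partial>lborel) = integral {0..T} (\<lambda>t. indicator A t * (J t - c))"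
    using set_borel_integral_eq_integral(2)[OF s3] unfolding g_def set_lebesgue_integral_def .
  also have "\<dots> = integral {0..T} (\<lambda>t. indicator A t * J t) - integral {0..T} (\<lambda>t. indicator A t * c)"
    using integral_diff[OF set_borel_integral_eq_integral(1)[OF s1] set_borel_integral_eq_integral(1)[OF s2]] by (simp add: right_diff_distrib)
  also have "\<dots> \<le> 0" using le[OF A] by simp
  finally have le0: "(\<integral>t. g t \<partial>lborel) \<le> 0" .
  have gi: "integrable lborel g" using s3 unfolding g_def set_integrable_def .
  have g0: "0 \<le> g t" for t unfolding g_def A_def by (auto simp: indicator_def)
  have "0 \<le> (\<integral>t. g t \<partial>lborel)" using g0 by (intro integral_nonneg_AE) simp
  then have "(\<integral>t. g t \<partial>lborel) = 0" using le0 by simp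
  then have "AE t in lborel. g t = 0" using integral_nonneg_eq_0_iff_AE[OF gi] g0 by auto
  then show ?thesis by eventually_elim (auto simp: g_def A_def indicator_def split: if_splits)
qed

lemma signed_slice:
  fixes \<rho> :: "(real^'d) \<times> real \<Rightarrow> real" and \<phi> :: "real^'d \<Rightarrow> real"
  assumes \<rho>: "\<rho> \<in> borel_measurable borel" "\<And>z. \<bar>\<rho> z\<bar> \<le> B" and \<phi>: "continuous_on UNIV \<phi>"
  shows "(\<lambda>x. \<phi> x * \<rho> (x,t)) integrable_on cbox 0 L"
    "(\<lambda>t. integral (cbox 0 L) (\<lambda>x. \<phi> x * \<rho> (x,t))) \<in> borel_measurable borel"
    "\<exists>C. \<forall>t. \<bar>integral (cbox 0 L) (\<lambda>x. \<phi> x * \<rho> (x,t))\<bar> \<le> C"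
proof -
  \<comment> \<open>Adding the constant \<open>B\<close> makes the density nonnegative, which gives
    access to the lemmas on \<open>dens\<close>; the contribution of the constant is subtracted
    afterwards.\<close>
  define \<rho>' where "\<rho>' z = \<rho> z + B" for z
  have \<rho>'m: "\<rho>' \<in> borel_measurable borel" unfolding \<rho>'_def using \<rho>(1) by measurable
  have \<rho>'B: "0 \<le> \<rho>' z \<and> \<rho>' z \<le> 2 * B" for z using \<rho>(2)[of z] unfolding \<rho>'_def by linarith
  have i1: "(\<lambda>x. \<phi> x * \<rho>' (x,t)) integrable_on cbox 0 L" for t by (rule dens_integral(2)[OF \<rho>'m \<rho>'B \<phi>])
  have i2: "(\<lambda>x. \<phi> x * B) integrable_on cbox 0 L"
    by (intro integrable_continuous continuous_intros continuous_on_subset[OF \<phi>]) auto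
  have eq: "(\<lambda>x. \<phi> x * \<rho> (x,t)) = (\<lambda>x. \<phi> x * \<rho>' (x,t) - \<phi> x * B)" for t by (simp add: \<rho>'_def algebra_simps)
  show "(\<lambda>x. \<phi> x * \<rho> (x,t)) integrable_on cbox 0 L" for t unfolding eq by (rule integrable_diff[OF i1 i2])
  have ie: "integral (cbox 0 L) (\<lambda>x. \<phi> x * \<rho> (x,t)) = (\<integral>x. \<phi> x \<partial>(dens L \<rho>' t)) - integral (cbox 0 L) (\<lambda>x. \<phi> x * B)" for t
    unfolding eq integral_diff[OF i1 i2] dens_integral(1)[OF \<rho>'m \<rho>'B \<phi>] ..
  show "(\<lambda>t. integral (cbox 0 L) (\<lambda>x. \<phi> x * \<rho> (x,t))) \<in> borel_measurable borel"
    unfolding ie using dens_measurable[OF \<rho>'m \<rho>'B \<phi>] by measurable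
  have "bounded (\<phi> ` cbox 0 L)" by (intro compact_imp_bounded compact_continuous_image continuous_on_subset[OF \<phi>]) auto
  then obtain C where C: "\<forall>x\<in>cbox 0 L. \<bar>\<phi> x\<bar> \<le> C" unfolding bounded_iff by auto
  have "\<bar>integral (cbox 0 L) (\<lambda>x. \<phi> x * \<rho> (x,t))\<bar> \<le> integral (cbox 0 L) (\<lambda>x. \<bar>\<phi> x\<bar> * B)" for t
  proof -
    have "norm (integral (cbox 0 L) (\<lambda>x. \<phi> x * \<rho> (x,t))) \<le> integral (cbox 0 L) (\<lambda>x. \<bar>\<phi> x\<bar> * B)"
    proof (rule integral_norm_bound_integral)
      show "(\<lambda>x. \<phi> x * \<rho> (x,t)) integrable_on cbox 0 L" unfolding eq by (rule integrable_diff[OF i1 i2])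
      show "(\<lambda>x. \<bar>\<phi> x\<bar> * B) integrable_on cbox 0 L"
        by (intro integrable_continuous continuous_intros continuous_on_subset[OF \<phi>]) auto
      show "norm (\<phi> x * \<rho> (x,t)) \<le> \<bar>\<phi> x\<bar> * B" for x using \<rho>(2)[of "(x,t)"] by (simp add: abs_mult mult_left_mono)
    qed
    then show ?thesis by simp
  qed
  then show "\<exists>C. \<forall>t. \<bar>integral (cbox 0 L) (\<lambda>x. \<phi> x * \<rho> (x,t))\<bar> \<le> C" by blast
qed

lemma ennreal_power2_le_imp_le:
  assumes "x\<^sup>2 \<le> ennreal (c\<^sup>2)" "0 \<le> c"
  shows "x \<le> ennreal c"
proof (cases x)
  case (real r)
  then have "ennreal (r\<^sup>2) \<le> ennreal (c\<^sup>2)" using assms(1) by (simp add: ennreal_power)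
  then have "r\<^sup>2 \<le> c\<^sup>2" by (subst (asm) ennreal_le_iff) auto
  then have "r \<le> c" using assms(2) by (rule power2_le_imp_le)
  then show ?thesis using real by (simp add: ennreal_leI)
next
  case top
  then show ?thesis using assms(1) by (simp add: top_power_ennreal top_unique)
qed

text \<open>Cauchy-Schwarz on each slice bounds its L^1 norm by its L^2 norm times the square root
  of the volume, and the L^2 norm is integrable in time.\<close>

lemma testL2_integrable:
  assumes \<psi>: "testL2 L T \<psi>"
  shows "(\<lambda>z. \<psi> (snd z) (fst z) $ k) \<in> borel_measurable borel" "integrable (cylm L T) (\<lambda>z. \<psi> (snd z) (fst z) $ k)"
proof -
  have m0: "(\<lambda>z. \<psi> (snd z) (fst z)) \<in> borel_measurable borel" using conjunct1[OF \<psi>[unfolded testL2_def]] unfolding case_prod_beta .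
  have vm: "(\<lambda>v::real^'a. v $ k) \<in> borel_measurable borel" by (intro borel_measurable_continuous_onI continuous_intros)
  show m: "(\<lambda>z. \<psi> (snd z) (fst z) $ k) \<in> borel_measurable borel" by (rule measurable_compose[OF m0 vm])
  define s where "s t = sqrt (integral (cbox 0 L) (\<lambda>x. (norm (\<psi> t x))\<^sup>2))" for t
  have s0: "0 \<le> integral (cbox 0 L) (\<lambda>x. (norm (\<psi> t x))\<^sup>2)" for t
    using \<psi> unfolding testL2_def by (intro integral_nonneg) auto
  show "integrable (cylm L T) (\<lambda>z. \<psi> (snd z) (fst z) $ k)"
  proof (rule cylm_integrable_slices[where b="\<lambda>t. s t * sqrt (measure lborel (cbox 0 L))"])
    show "(\<lambda>t. s t * sqrt (measure lborel (cbox 0 L))) integrable_on {0..T}"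
      using \<psi> unfolding testL2_def s_def by (intro integrable_on_mult_left) auto
    show "0 \<le> s t * sqrt (measure lborel (cbox 0 L))" for t unfolding s_def using s0 by simp
    fix t assume "t \<in> {0..T}"
    have sl: "(\<lambda>x. \<psi> t x) \<in> borel_measurable borel"
    proof -
      have "(\<lambda>x. (x,t)) \<in> measurable borel borel" by (intro borel_measurable_continuous_onI continuous_intros)
      from measurable_compose[OF this m0] show ?thesis by simp
    qed
    then have slk[measurable]: "(\<lambda>x. \<psi> t x $ k) \<in> borel_measurable borel" by (rule measurable_compose[OF _ vm])
    let ?f = "\<lambda>x. ennreal \<bar>\<psi> t x $ k\<bar> * indicator (cbox 0 L) x"
    have "(\<integral>\<^sup>+x. ?f x * indicator (cbox 0 L) x \<partial>lborel)\<^sup>2 \<le> (\<integral>\<^sup>+x. (?f x)\<^sup>2 \<partial>lborel) * (\<integral>\<^sup>+x. (indicator (cbox 0 L) x)\<^sup>2 \<partial>lborel)"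
      by (rule Cauchy_Schwarz_nn_integral) measurable
    also have "(\<integral>\<^sup>+x. ?f x * indicator (cbox 0 L) x \<partial>lborel) = (\<integral>\<^sup>+x. ?f x \<partial>lborel)"
      by (intro nn_integral_cong) (auto simp: indicator_def)
    also have "(\<integral>\<^sup>+x. (indicator (cbox 0 L) x)\<^sup>2 \<partial>lborel) = ennreal (measure lborel (cbox 0 L))"
    proof -
      have "(\<integral>\<^sup>+x. (indicator (cbox 0 L) x)\<^sup>2 \<partial>lborel) = (\<integral>\<^sup>+x. indicator (cbox 0 L) x \<partial>lborel)"
        by (intro nn_integral_cong) (auto simp: indicator_def)
      also have "\<dots> = emeasure lborel (cbox 0 L)" by simp
      finally show ?thesis using emeasure_lborel_cbox_finite[of 0 L] by (simp add: emeasure_eq_ennreal_measure less_top)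
    qed
    also have "(\<integral>\<^sup>+x. (?f x)\<^sup>2 \<partial>lborel) \<le> ennreal ((s t)\<^sup>2)"
    proof -
      define g where "g x = (if x \<in> cbox 0 L then (norm (\<psi> t x))\<^sup>2 else 0)" for x
      have gm: "g \<in> borel_measurable borel" unfolding g_def using sl by measurable
      have "((\<lambda>x. (norm (\<psi> t x))\<^sup>2) has_integral (s t)\<^sup>2) (cbox 0 L)"
        using \<psi> s0[of t] unfolding testL2_def s_def by (auto intro: integrable_integral)
      then have "(g has_integral (s t)\<^sup>2) UNIV" unfolding g_def has_integral_restrict_UNIV .
      then have "(\<integral>\<^sup>+x. ennreal (g x) \<partial>lborel) = ennreal ((s t)\<^sup>2)"
        by (intro nn_integral_has_integral_lborel[OF gm]) (auto simp: g_def)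
      moreover have "(\<integral>\<^sup>+x. (?f x)\<^sup>2 \<partial>lborel) \<le> (\<integral>\<^sup>+x. ennreal (g x) \<partial>lborel)"
      proof (rule nn_integral_mono)
        fix x
        have "\<bar>\<psi> t x $ k\<bar>\<^sup>2 \<le> (norm (\<psi> t x))\<^sup>2" by (rule power_mono[OF component_le_norm_cart]) simp
        then show "(?f x)\<^sup>2 \<le> ennreal (g x)" by (auto simp: g_def indicator_def ennreal_power ennreal_leI simp del: abs_power2 power2_abs)
      qed
      ultimately show ?thesis by simp
    qed
    finally have "(\<integral>\<^sup>+x. ?f x \<partial>lborel)\<^sup>2 \<le> ennreal ((s t)\<^sup>2) * ennreal (measure lborel (cbox 0 L))"
      by (simp add: mult_right_mono)
    also have "\<dots> = ennreal ((s t * sqrt (measure lborel (cbox 0 L)))\<^sup>2)" by (simp add: power_mult_distrib ennreal_mult)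
    finally have "(\<integral>\<^sup>+x. ?f x \<partial>lborel) \<le> ennreal (s t * sqrt (measure lborel (cbox 0 L)))"
      by (rule ennreal_power2_le_imp_le) (use s0 in \<open>auto simp: s_def\<close>)
    then show "(\<integral>\<^sup>+x. ennreal \<bar>\<psi> (snd (x,t)) (fst (x,t)) $ k\<bar> * indicator (cbox 0 L) x \<partial>lborel) \<le> ennreal (s t * sqrt (measure lborel (cbox 0 L)))" by simp
  qed (rule m)
qed

lemma testC_integrable:
  assumes L: "\<forall>k. L$k > 0" and \<psi>: "testC L T \<psi>"
  shows "(\<lambda>z. \<psi> (snd z) (fst z)) \<in> borel_measurable borel" "integrable (cylm L T) (\<lambda>z. \<psi> (snd z) (fst z))"
proof -
  show m: "(\<lambda>z. \<psi> (snd z) (fst z)) \<in> borel_measurable borel" using conjunct1[OF \<psi>[unfolded testC_def]] unfolding case_prod_beta .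
  define s where "s t = (SUP x. \<bar>\<psi> t x\<bar>)" for t
  have le: "\<bar>\<psi> t x\<bar> \<le> s t" for t x
  proof -
    have "cont_per L (\<psi> t)" using \<psi> unfolding testC_def by blast
    then obtain B where "\<forall>x. \<bar>\<psi> t x\<bar> \<le> B" using cont_per_bounded[OF L] by blast
    then have "bdd_above (range (\<lambda>x. \<bar>\<psi> t x\<bar>))" by (intro bdd_aboveI[of _ B]) auto
    then show ?thesis unfolding s_def by (intro cSUP_upper) auto
  qed
  show "integrable (cylm L T) (\<lambda>z. \<psi> (snd z) (fst z))"
  proof (rule cylm_integrable_slices[where b="\<lambda>t. s t * measure lborel (cbox 0 L)"])
    show "(\<lambda>t. s t * measure lborel (cbox 0 L)) integrable_on {0..T}"
      using \<psi> unfolding testC_def s_def by (intro integrable_on_mult_left) auto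
    have s0: "0 \<le> s t" for t using le[of t 0] by linarith
    then show "0 \<le> s t * measure lborel (cbox 0 L)" for t by simp
    fix t
    have "(\<integral>\<^sup>+x. ennreal \<bar>\<psi> t x\<bar> * indicator (cbox 0 L) x \<partial>lborel) \<le> (\<integral>\<^sup>+x. ennreal (s t) * indicator (cbox 0 L) x \<partial>lborel)"
      using le by (intro nn_integral_mono mult_right_mono ennreal_leI) auto
    also have "\<dots> = ennreal (s t * measure lborel (cbox 0 L))"
      using s0[of t] emeasure_lborel_cbox_finite[of 0 L]
      by (simp add: nn_integral_cmult_indicator ennreal_mult emeasure_eq_ennreal_measure less_top)
    finally show "(\<integral>\<^sup>+x. ennreal \<bar>\<psi> (snd (x,t)) (fst (x,t))\<bar> * indicator (cbox 0 L) x \<partial>lborel) \<le> ennreal (s t * measure lborel (cbox 0 L))" by simp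
  qed (rule m)
qed

text \<open>The matrix norm bounds every entry, so entries may be estimated separately. The
  resulting factor d^2 is harmless, as the lemma serves to show finiteness or vanishing.\<close>

lemma tv_le:
  assumes "\<And>k l \<phi>. cont_per L \<phi> \<Longrightarrow> (\<forall>x. \<bar>\<phi> x\<bar> \<le> 1) \<Longrightarrow> sint \<phi> (Mm k l) \<le> c"
  shows "tv L (Mm :: 'd::finite \<Rightarrow> 'd \<Rightarrow> _) \<le> real CARD('d) * (real CARD('d) * c)"
  unfolding tv_def
proof (rule cSup_least)
  have "\<exists>\<Phi>::real^'d \<Rightarrow> real^'d^'d. (\<forall>k l. cont_per L (\<lambda>x. \<Phi> x $ k $ l)) \<and> (\<forall>x. norm (\<Phi> x) \<le> 1)"
    by (intro exI[of _ "\<lambda>_. 0"]) (auto simp: cont_per_def lat_per_def)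
  then show "{(\<Sum>k\<in>UNIV. \<Sum>l\<in>UNIV. sint (\<lambda>x. \<Phi> x $ k $ l) (Mm k l)) | \<Phi>. (\<forall>k l. cont_per L (\<lambda>x. \<Phi> x $ k $ l)) \<and> (\<forall>x. norm (\<Phi> x) \<le> 1)} \<noteq> {}" by blast
  fix y assume "y \<in> {(\<Sum>k\<in>UNIV. \<Sum>l\<in>UNIV. sint (\<lambda>x. \<Phi> x $ k $ l) (Mm k l)) | \<Phi>. (\<forall>k l. cont_per L (\<lambda>x. \<Phi> x $ k $ l)) \<and> (\<forall>x. norm (\<Phi> x) \<le> 1)}"
  then obtain \<Phi> :: "real^'d \<Rightarrow> real^'d^'d" where \<Phi>: "\<forall>k l. cont_per L (\<lambda>x. \<Phi> x $ k $ l)" "\<forall>x. norm (\<Phi> x) \<le> 1"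
    and y: "y = (\<Sum>k\<in>UNIV. \<Sum>l\<in>UNIV. sint (\<lambda>x. \<Phi> x $ k $ l) (Mm k l))" by blast
  have "\<bar>\<Phi> x $ k $ l\<bar> \<le> 1" for x k l
    using component_le_norm_cart[of "\<Phi> x $ k" l] Finite_Cartesian_Product.norm_nth_le[of "\<Phi> x" k] \<Phi>(2) by (metis order_trans)
  then have "y \<le> (\<Sum>k\<in>(UNIV::'d set). \<Sum>l\<in>(UNIV::'d set). c)" unfolding y using \<Phi>(1) assms by (intro sum_mono) auto
  then show "y \<le> real CARD('d) * (real CARD('d) * c)" by simp
qed

section \<open>The measure-valued limit\<close>

lemma integrable_bounded_support:
  fixes f :: "'a::euclidean_space \<Rightarrow> 'b::{banach,second_countable_topology}"
  assumes Q: "prob_space Q" "sets Q = sets borel" "AE x in Q. norm x \<le> M" and f: "continuous_on UNIV f"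
  shows "integrable Q f"
proof -
  interpret prob_space Q by (rule Q)
  have "bounded (f ` cball 0 M)" by (intro compact_imp_bounded compact_continuous_image continuous_on_subset[OF f]) auto
  then obtain B where B: "\<forall>x\<in>cball 0 M. norm (f x) \<le> B" unfolding bounded_iff by auto
  have "AE x in Q. norm (f x) \<le> B" using Q(3) by eventually_elim (use B in simp)
  moreover have "f \<in> borel_measurable Q"
    unfolding measurable_cong_sets[OF Q(2) refl] using f by (rule borel_measurable_continuous_onI)
  ultimately show ?thesis by (rule integrable_const_bound)
qed

lemma integral_bounded_support:
  fixes f :: "'a::euclidean_space \<Rightarrow> real"
  assumes Q: "prob_space Q" "sets Q = sets borel" "AE x in Q. norm x \<le> M" and f: "continuous_on UNIV f"
    and B: "\<And>x. norm x \<le> M \<Longrightarrow> \<bar>f x\<bar> \<le> B"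
  shows "\<bar>\<integral>x. f x \<partial>Q\<bar> \<le> B"
proof -
  interpret prob_space Q by (rule Q)
  have i: "integrable Q f" by (rule integrable_bounded_support[OF Q f])
  have "\<bar>\<integral>x. f x \<partial>Q\<bar> \<le> (\<integral>x. \<bar>f x\<bar> \<partial>Q)" by (rule integral_abs_bound)
  also have "\<dots> \<le> (\<integral>x. B \<partial>Q)"
  proof (rule integral_mono_AE)
    show "AE x in Q. \<bar>f x\<bar> \<le> B" using Q(3) by eventually_elim (rule B)
  qed (use i in auto)
  finally show ?thesis by (simp add: prob_space)
qed

text \<open>The conclusion of \<open>young_measure_exists\<close> for the clamped solutions. It
  covers every continuous \<open>f\<close>, in particular the quadratic ones, because all values lie
  in the ball of radius \<open>M\<close>.\<close>

locale young_limit = approx L T \<omega> M K \<alpha> u u' p for L :: "real^'d" and T \<omega> M K \<alpha> u u' p +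
  fixes r :: "nat \<Rightarrow> nat" and P :: "(real^'d) \<times> real \<Rightarrow> (real^'d) measure"
  assumes r: "strict_mono r"
    and Pp: "\<And>z. prob_space (P z)" and Ps: "\<And>z. sets (P z) = sets borel" and Pb: "\<And>z. AE x in P z. norm x \<le> M"
    and Pm: "\<And>f::real^'d \<Rightarrow> real. continuous_on UNIV f \<Longrightarrow> (\<lambda>z. \<integral>x. f x \<partial>(P z)) \<in> borel_measurable borel"
    and Pc: "\<And>(f::real^'d \<Rightarrow> real) h. continuous_on UNIV f \<Longrightarrow> integrable (cylm L T) h \<Longrightarrow>
      (\<lambda>n. \<integral>z. h z * f (uu (r n) z) \<partial>(cylm L T)) \<longlonglongrightarrow> (\<integral>z. h z * (\<integral>x. f x \<partial>(P z)) \<partial>(cylm L T))"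
begin

definition U :: "real^'d \<Rightarrow> real \<Rightarrow> (real^'d) measure" where "U x t = P (x,t)"
definition m1 where "m1 k z = (\<integral>v. v $ k \<partial>(P z))"
definition m2 where "m2 z = (\<integral>v. (norm v)\<^sup>2 \<partial>(P z))"
definition tt where "tt k l z = (\<integral>v. v $ k * v $ l \<partial>(P z))"

lemma cont: "continuous_on UNIV (\<lambda>v::real^'d. v $ k)" "continuous_on UNIV (\<lambda>v::real^'d. (norm v)\<^sup>2)" "continuous_on UNIV (\<lambda>v::real^'d. v $ k * v $ l)"
  by (intro continuous_intros)+

lemma mom1_nth: "mom1 U x t $ k = m1 k (x,t)"
proof -
  have "integrable (P (x,t)) (\<lambda>v. v)" by (rule integrable_bounded_support[OF Pp Ps Pb]) (rule continuous_on_id)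
  then show ?thesis unfolding mom1_def m1_def U_def
    using integral_bounded_linear[OF bounded_linear_vec_nth, of "P (x,t)" "\<lambda>v. v" k] by simp
qed

lemma mom2_eq: "mom2 U x t = m2 (x,t)" and tens_eq: "tens U x t $ k $ l = tt k l (x,t)"
  by (simp_all add: mom2_def m2_def tens_def tt_def U_def)

lemma inner_mom1: "mom1 U x t \<bullet> w = (\<Sum>k\<in>UNIV. w $ k * m1 k (x,t))"
  by (simp add: inner_vec_def mom1_nth mult.commute)

lemma m_measurable[measurable]: "m1 k \<in> borel_measurable borel" "m2 \<in> borel_measurable borel" "tt k l \<in> borel_measurable borel"
  unfolding m1_def[abs_def] m2_def[abs_def] tt_def[abs_def] by (intro Pm cont)+

lemma m1_bound: "\<bar>m1 k z\<bar> \<le> M" unfolding m1_def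
  by (rule integral_bounded_support[OF Pp Ps Pb cont(1)]) (use component_le_norm_cart order_trans in blast)

lemma m2_bound: "0 \<le> m2 z \<and> m2 z \<le> M\<^sup>2"
proof -
  have "\<bar>m2 z\<bar> \<le> M\<^sup>2" unfolding m2_def
    by (rule integral_bounded_support[OF Pp Ps Pb cont(2)]) (simp add: power_mono)
  moreover have "0 \<le> m2 z" unfolding m2_def by simp
  ultimately show ?thesis by simp
qed

lemma tt_bound: "\<bar>tt k l z\<bar> \<le> M\<^sup>2" unfolding tt_def
proof (rule integral_bounded_support[OF Pp Ps Pb cont(3)])
  fix x :: "real^'d" assume "norm x \<le> M"
  then have "\<bar>x$k\<bar> \<le> M" "\<bar>x$l\<bar> \<le> M" using component_le_norm_cart order_trans by blast+
  then show "\<bar>x$k * x$l\<bar> \<le> M\<^sup>2" unfolding abs_mult power2_eq_square using M0 by (intro mult_mono) auto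
qed

lemma young_U: "young U"
  unfolding young_def U_def case_prod_beta prod.collapse using Pp Ps Pm by blast

lemma integrable_U: "integrable (U x t) (\<lambda>v. (norm v)\<^sup>2)"
  unfolding U_def by (rule integrable_bounded_support[OF Pp Ps Pb cont(2)])

lemma integrable_prod:
  assumes h: "integrable (cylm L T) h" "h \<in> borel_measurable borel" and k: "k \<in> borel_measurable borel" "\<And>z. \<bar>k z\<bar> \<le> C"
  shows "integrable (cylm L T) (\<lambda>z. h z * (k z :: real))" "(\<lambda>z. h z * k z) \<in> borel_measurable borel"
proof -
  show m: "(\<lambda>z. h z * k z) \<in> borel_measurable borel" using h(2) k(1) by measurable
  show "integrable (cylm L T) (\<lambda>z. h z * k z)"
  proof (rule Bochner_Integration.integrable_bound[of _ "\<lambda>z. C * \<bar>h z\<bar>"])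
    show "integrable (cylm L T) (\<lambda>z. C * \<bar>h z\<bar>)" using h(1) by simp
    show "(\<lambda>z. h z * k z) \<in> borel_measurable (cylm L T)" unfolding measurable_cong_sets[OF cylm_sets refl] by (rule m)
    show "AE z in cylm L T. norm (h z * k z) \<le> norm (C * \<bar>h z\<bar>)"
    proof (rule AE_I2)
      fix z
      have "\<bar>h z\<bar> * \<bar>k z\<bar> \<le> \<bar>h z\<bar> * C" using k(2)[of z] by (rule mult_left_mono) simp
      moreover have "0 \<le> C" using k(2)[of z] by linarith
      ultimately show "norm (h z * k z) \<le> norm (C * \<bar>h z\<bar>)" by (simp add: abs_mult mult.commute)
    qed
  qed
qed

lemma f_uu: assumes f: "continuous_on UNIV (f :: real^'d \<Rightarrow> real)"
  shows "(\<lambda>z. f (uu n z)) \<in> borel_measurable borel" "\<exists>C. \<forall>n z. \<bar>f (uu n z)\<bar> \<le> C"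
proof -
  have "continuous_on UNIV (\<lambda>z. f (uu n z))" by (rule continuous_on_compose2[OF f uu_cont]) simp
  then show "(\<lambda>z. f (uu n z)) \<in> borel_measurable borel" by (rule borel_measurable_continuous_onI)
  have "bounded (f ` cball 0 M)" by (intro compact_imp_bounded compact_continuous_image continuous_on_subset[OF f]) auto
  then obtain C where "\<forall>x\<in>cball 0 M. \<bar>f x\<bar> \<le> C" unfolding bounded_iff by auto
  then show "\<exists>C. \<forall>n z. \<bar>f (uu n z)\<bar> \<le> C" using uu_bound by (intro exI[of _ C]) simp
qed

lemma int_f_uu:
  assumes h: "integrable (cylm L T) h" "h \<in> borel_measurable borel" and f: "continuous_on UNIV (f :: real^'d \<Rightarrow> real)"
  shows "integrable (cylm L T) (\<lambda>z. h z * f (uu n z))" "(\<lambda>z. h z * f (uu n z)) \<in> borel_measurable borel"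
proof -
  obtain C where C: "\<forall>n z. \<bar>f (uu n z)\<bar> \<le> C" using f_uu(2)[OF f] by blast
  then show "integrable (cylm L T) (\<lambda>z. h z * f (uu n z))" "(\<lambda>z. h z * f (uu n z)) \<in> borel_measurable borel"
    using integrable_prod[OF h f_uu(1)[OF f]] by blast+
qed

lemma integral_slices: "(F :: (real^'d) \<times> real \<Rightarrow> real) \<in> borel_measurable borel \<Longrightarrow> integrable (cylm L T) F \<Longrightarrow>
   integral {0..T} (\<lambda>t. integral (cbox 0 L) (\<lambda>x. F (x,t))) = (\<integral>z. F z \<partial>(cylm L T))"
  by (rule integral_unique[OF iterated_integral])

lemma weak_L2:
  assumes \<psi>: "testL2 L T \<psi>"
  shows "(\<lambda>n. integral {0..T} (\<lambda>t. integral (cbox 0 L) (\<lambda>x. uh L (K (r n)) (\<lambda>i. u (r n) i t) x \<bullet> \<psi> t x)))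
        \<longlonglongrightarrow> integral {0..T} (\<lambda>t. integral (cbox 0 L) (\<lambda>x. mom1 U x t \<bullet> \<psi> t x))"
proof -
  define h where "h k z = \<psi> (snd z) (fst z) $ k" for k z
  have h: "h k \<in> borel_measurable borel" "integrable (cylm L T) (h k)" for k unfolding h_def[abs_def] by (rule testL2_integrable[OF \<psi>])+
  have 1: "integral {0..T} (\<lambda>t. integral (cbox 0 L) (\<lambda>x. uh L (K (r n)) (\<lambda>i. u (r n) i t) x \<bullet> \<psi> t x)) = (\<Sum>k\<in>UNIV. \<integral>z. h k z * (uu (r n) z $ k) \<partial>(cylm L T))" for n
  proof -
    note i = int_f_uu[OF h(2) h(1) cont(1), of _ "r n"]
    have "integral {0..T} (\<lambda>t. integral (cbox 0 L) (\<lambda>x. uh L (K (r n)) (\<lambda>i. u (r n) i t) x \<bullet> \<psi> t x))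
       = integral {0..T} (\<lambda>t. integral (cbox 0 L) (\<lambda>x. \<Sum>k\<in>UNIV. h k (x,t) * (uu (r n) (x,t) $ k)))"
      by (intro Henstock_Kurzweil_Integration.integral_cong) (simp add: uu_eq h_def inner_vec_def mult.commute)
    also have "\<dots> = (\<integral>z. (\<Sum>k\<in>UNIV. h k z * (uu (r n) z $ k)) \<partial>(cylm L T))"
      by (rule integral_slices) (use i in \<open>auto intro!: borel_measurable_sum Bochner_Integration.integrable_sum\<close>)
    also have "\<dots> = (\<Sum>k\<in>UNIV. \<integral>z. h k z * (uu (r n) z $ k) \<partial>(cylm L T))" by (rule Bochner_Integration.integral_sum) (rule i(1))
    finally show ?thesis .
  qed
  have 2: "integral {0..T} (\<lambda>t. integral (cbox 0 L) (\<lambda>x. mom1 U x t \<bullet> \<psi> t x)) = (\<Sum>k\<in>UNIV. \<integral>z. h k z * m1 k z \<partial>(cylm L T))"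
  proof -
    note i = integrable_prod[OF h(2) h(1) m_measurable(1) m1_bound]
    have "integral {0..T} (\<lambda>t. integral (cbox 0 L) (\<lambda>x. mom1 U x t \<bullet> \<psi> t x))
       = integral {0..T} (\<lambda>t. integral (cbox 0 L) (\<lambda>x. \<Sum>k\<in>UNIV. h k (x,t) * m1 k (x,t)))"
      unfolding inner_mom1 h_def by simp
    also have "\<dots> = (\<integral>z. (\<Sum>k\<in>UNIV. h k z * m1 k z) \<partial>(cylm L T))"
      by (rule integral_slices) (use i in \<open>auto intro!: borel_measurable_sum Bochner_Integration.integrable_sum\<close>)
    also have "\<dots> = (\<Sum>k\<in>UNIV. \<integral>z. h k z * m1 k z \<partial>(cylm L T))" by (rule Bochner_Integration.integral_sum) (rule i(1))
    finally show ?thesis .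
  qed
  show ?thesis unfolding 1 2 m1_def by (intro tendsto_sum Pc cont h)
qed

text \<open>The common form of the energy and tensor limits: weak-* convergence on the cylinder
  rewritten in iterated integrals.\<close>

lemma weak_slices:
  assumes h: "integrable (cylm L T) h" "h \<in> borel_measurable borel" and f: "continuous_on UNIV (f :: real^'d \<Rightarrow> real)"
    and g: "\<And>z. g z = (\<integral>v. f v \<partial>(P z))" "g \<in> borel_measurable borel" "\<And>z. \<bar>g z\<bar> \<le> C"
  shows "(\<lambda>n. integral {0..T} (\<lambda>t. integral (cbox 0 L) (\<lambda>x. h (x,t) * f (uh L (K (r n)) (\<lambda>i. u (r n) i t) x))))
        \<longlonglongrightarrow> integral {0..T} (\<lambda>t. integral (cbox 0 L) (\<lambda>x. h (x,t) * g (x,t)))"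
proof -
  have 1: "integral {0..T} (\<lambda>t. integral (cbox 0 L) (\<lambda>x. h (x,t) * f (uh L (K (r n)) (\<lambda>i. u (r n) i t) x))) = (\<integral>z. h z * f (uu (r n) z) \<partial>(cylm L T))" for n
  proof -
    have "integral {0..T} (\<lambda>t. integral (cbox 0 L) (\<lambda>x. h (x,t) * f (uh L (K (r n)) (\<lambda>i. u (r n) i t) x)))
       = integral {0..T} (\<lambda>t. integral (cbox 0 L) (\<lambda>x. h (x,t) * f (uu (r n) (x,t))))"
      by (intro Henstock_Kurzweil_Integration.integral_cong) (simp add: uu_eq)
    also have "\<dots> = (\<integral>z. h z * f (uu (r n) z) \<partial>(cylm L T))" by (rule integral_slices[OF int_f_uu(2,1)[OF h f]])
    finally show ?thesis .
  qed
  have 2: "integral {0..T} (\<lambda>t. integral (cbox 0 L) (\<lambda>x. h (x,t) * g (x,t))) = (\<integral>z. h z * g z \<partial>(cylm L T))"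
    by (rule integral_slices[OF integrable_prod(2,1)[OF h g(2,3)]])
  show ?thesis unfolding 1 2 using Pc[OF f h(1)] unfolding g(1)[symmetric] .
qed

text \<open>Test functions localised to an arbitrary Borel set of times; they are the means of
  extracting statements for almost every \<open>t\<close> from weak-* limits.\<close>

lemma time_indicator:
  assumes "A \<in> sets borel" and \<phi>: "continuous_on UNIV \<phi>"
  shows "(\<lambda>z::(real^'d) \<times> real. indicator A (snd z) * \<phi> (fst z)) \<in> borel_measurable borel" "integrable (cylm L T) (\<lambda>z. indicator A (snd z) * \<phi> (fst z) :: real)"
proof -
  have s: "snd \<in> measurable (borel :: ((real^'d) \<times> real) measure) borel" by (intro borel_measurable_continuous_onI continuous_intros)
  have c: "(\<lambda>z::(real^'d) \<times> real. \<phi> (fst z)) \<in> borel_measurable borel"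
    by (intro borel_measurable_continuous_onI continuous_on_compose2[OF \<phi>]) (auto intro!: continuous_intros)
  have "(\<lambda>z::(real^'d) \<times> real. indicator A (snd z) :: real) \<in> borel_measurable borel"
    by (rule measurable_compose[OF s]) (use assms(1) in measurable)
  with c show m: "(\<lambda>z::(real^'d) \<times> real. indicator A (snd z) * \<phi> (fst z)) \<in> borel_measurable borel" by measurable
  have "bounded (\<phi> ` cbox 0 L)" by (intro compact_imp_bounded compact_continuous_image continuous_on_subset[OF \<phi>]) auto
  then obtain B where B: "\<forall>x\<in>cbox 0 L. \<bar>\<phi> x\<bar> \<le> B" unfolding bounded_iff by auto
  show "integrable (cylm L T) (\<lambda>z. indicator A (snd z) * \<phi> (fst z) :: real)"
  proof (rule cylm_integrable_bounded[OF m])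
    fix z :: "(real^'d) \<times> real" assume "z \<in> cbox 0 L \<times> {0..T}"
    then have "\<bar>\<phi> (fst z)\<bar> \<le> B" using B by auto
    then show "\<bar>indicator A (snd z) * \<phi> (fst z)\<bar> \<le> B" by (auto simp: indicator_def)
  qed
qed

text \<open>The discrete energy inequality holds at every time but passes to the limit only after
  integration over a set \<open>A\<close> of times. Since \<open>A\<close> is an arbitrary Borel
  set, the inequality returns for almost every time.\<close>

lemma energy_AE:
  assumes init: "(\<lambda>n. \<Sum>i\<in>nodes L (K n). lm L (K n) i * ((norm (u n i 0))\<^sup>2 / 2)) \<longlonglongrightarrow> E0"
  shows "AE t in lborel. t \<in> {0..T} \<longrightarrow> (1/2) * integral (cbox 0 L) (\<lambda>x. mom2 U x t) \<le> E0"
proof -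
  define e where "e n = (\<Sum>i\<in>nodes L (K n). lm L (K n) i * ((norm (u n i 0))\<^sup>2 / 2))" for n
  define J where "J t = integral (cbox 0 L) (\<lambda>x. 1 * (m2 (x,t) / 2))" for t
  have c1: "continuous_on UNIV (\<lambda>x::real^'d. 1::real)" by simp
  have g2: "(\<lambda>z. m2 z / 2) \<in> borel_measurable borel" by measurable
  have g3: "\<bar>m2 z / 2\<bar> \<le> M\<^sup>2" for z using m2_bound[of z] by auto
  have cn: "continuous_on UNIV (\<lambda>v::real^'d. (norm v)\<^sup>2 / 2)" by (intro continuous_intros) auto
  obtain CJ where CJ: "\<forall>t. \<bar>J t\<bar> \<le> CJ" using signed_slice(3)[OF g2 g3 c1] unfolding J_def by blast
  have "AE t in lborel. t \<in> {0..T} \<longrightarrow> J t \<le> E0"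
  proof (rule AE_le_if_integrals_le[where B=CJ])
    show "J \<in> borel_measurable borel" unfolding J_def[abs_def] by (rule signed_slice(2)[OF g2 g3 c1])
    show "\<bar>J t\<bar> \<le> CJ" for t using CJ by blast
    fix A :: "real set" assume A: "A \<in> sets borel"
    note tA = time_indicator[OF A c1]
    define I where "I n = integral {0..T} (\<lambda>t. integral (cbox 0 L) (\<lambda>x. indicator A t * 1 * ((norm (uh L (K n) (\<lambda>i. u n i t) x))\<^sup>2 / 2)))" for n
    have lim: "(\<lambda>n. I (r n)) \<longlonglongrightarrow> integral {0..T} (\<lambda>t. integral (cbox 0 L) (\<lambda>x. indicator A t * 1 * (m2 (x,t) / 2)))"
      unfolding I_def using weak_slices[OF tA(2,1) cn _ g2 g3] by (simp add: m2_def)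
    have eqJ: "integral {0..T} (\<lambda>t. integral (cbox 0 L) (\<lambda>x. indicator A t * 1 * (m2 (x,t) / 2))) = integral {0..T} (\<lambda>t. indicator A t * J t)"
      unfolding J_def by (simp add: mult.assoc)
    have Aint: "(\<lambda>t. indicator A t * c) integrable_on {0..T}" for c :: real
    proof -
      have "set_integrable lborel (cbox 0 T) (\<lambda>t. indicator A t * c)"
        by (rule set_integrable_bounded_cbox[where B="\<bar>c\<bar>"]) (use A in \<open>auto simp: indicator_def\<close>)
      then show ?thesis using set_borel_integral_eq_integral(1) by fastforce
    qed
    have le: "I n \<le> integral {0..T} (\<lambda>t. indicator A t * e n)" for n
    proof -
      have Ii: "(\<lambda>t. integral (cbox 0 L) (\<lambda>x. indicator A t * 1 * ((norm (uu n (x,t)))\<^sup>2 / 2))) integrable_on {0..T}"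
        using iterated_integral[OF int_f_uu(2,1)[OF tA(2,1) cn, of n]] unfolding fst_conv snd_conv by (rule has_integral_integrable)
      have "I n = integral {0..T} (\<lambda>t. integral (cbox 0 L) (\<lambda>x. indicator A t * 1 * ((norm (uu n (x,t)))\<^sup>2 / 2)))"
        unfolding I_def by (intro Henstock_Kurzweil_Integration.integral_cong) (simp add: uu_eq)
      also have "\<dots> \<le> integral {0..T} (\<lambda>t. indicator A t * e n)"
      proof (rule integral_le[OF Ii Aint])
        fix t assume t: "t \<in> {0..T}"
        show "integral (cbox 0 L) (\<lambda>x. indicator A t * 1 * ((norm (uu n (x,t)))\<^sup>2 / 2)) \<le> indicator A t * e n"
          using energy_uu[OF t, of n] unfolding e_def by (auto simp: indicator_def)
      qed
      finally show ?thesis .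
    qed
    have "(\<lambda>n. integral {0..T} (\<lambda>t. indicator A t * e (r n))) \<longlonglongrightarrow> integral {0..T} (\<lambda>t. indicator A t * E0)"
    proof -
      have "(\<lambda>n. e (r n)) \<longlonglongrightarrow> E0" using LIMSEQ_subseq_LIMSEQ[OF init r] unfolding e_def o_def .
      then have "(\<lambda>n. integral {0..T} (indicator A) * e (r n)) \<longlonglongrightarrow> integral {0..T} (indicator A) * E0" by (rule tendsto_mult_left)
      then show ?thesis by simp
    qed
    then show "integral {0..T} (\<lambda>t. indicator A t * J t) \<le> integral {0..T} (\<lambda>t. indicator A t * E0)"
      using LIMSEQ_le[OF lim _] le unfolding eqJ by blast
  qed
  then show ?thesis unfolding J_def by (simp add: mom2_eq)
qed

text \<open>The same localisation in time applied to both signs of \<open>J\<close>, with the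
  uniform smallness from \<open>div_small\<close>. The exceptional null set still depends on
  \<open>q\<close>.\<close>

lemma div_single:
  assumes q: "smooth q" "lat_per L q"
  shows "AE t in lborel. t \<in> {0..T} \<longrightarrow> integral (cbox 0 L) (\<lambda>x. mom1 U x t \<bullet> grad q x) = 0"
proof -
  have gk: "continuous_on UNIV (\<lambda>x. grad q x $ k)" for k unfolding grad_def by (simp add: smooth_C1(2)[OF q(1)])
  define J where "J t = integral (cbox 0 L) (\<lambda>x. mom1 U x t \<bullet> grad q x)" for t
  have Jeq: "J t = (\<Sum>k\<in>UNIV. integral (cbox 0 L) (\<lambda>x. grad q x $ k * m1 k (x,t)))" for t
    unfolding J_def inner_mom1 by (rule integral_sum) (auto intro!: signed_slice(1)[OF m_measurable(1) m1_bound gk])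
  have Jm: "J \<in> borel_measurable borel"
    unfolding Jeq[abs_def] by (intro borel_measurable_sum signed_slice(2)[OF m_measurable(1) m1_bound gk])
  have "\<forall>k. \<exists>C. \<forall>t. \<bar>integral (cbox 0 L) (\<lambda>x. grad q x $ k * m1 k (x,t))\<bar> \<le> C"
    using signed_slice(3)[OF m_measurable(1) m1_bound gk] by blast
  from choice[OF this] obtain C where C: "\<forall>k t. \<bar>integral (cbox 0 L) (\<lambda>x. grad q x $ k * m1 k (x,t))\<bar> \<le> C k" by blast
  have JB: "\<bar>J t\<bar> \<le> sum C UNIV" for t unfolding Jeq by (rule order_trans[OF sum_abs]) (use C in \<open>auto intro!: sum_mono\<close>)
  have zero: "integral {0..T} (\<lambda>t. indicator A t * J t) = 0" if A: "A \<in> sets borel" for A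
  proof -
    define I where "I n = integral {0..T} (\<lambda>t. indicator A t * integral (cbox 0 L) (\<lambda>x. uu n (x,t) \<bullet> grad q x))" for n
    define h where "h k z = indicator A (snd z) * (grad q (fst z) $ k)" for k and z :: "(real^'d) \<times> real"
    have h: "h k \<in> borel_measurable borel" "integrable (cylm L T) (h k)" for k unfolding h_def[abs_def] by (rule time_indicator[OF A gk])+
    have hi: "((\<lambda>t. indicator A t * integral (cbox 0 L) (\<lambda>x. uu n (x,t) \<bullet> grad q x)) has_integral (\<Sum>k\<in>UNIV. \<integral>z. h k z * (uu n z $ k) \<partial>(cylm L T))) {0..T}" for n
    proof -
      note i = int_f_uu[OF h(2) h(1) cont(1), of _ n]
      have "((\<lambda>t. integral (cbox 0 L) (\<lambda>x. \<Sum>k\<in>UNIV. h k (x,t) * (uu n (x,t) $ k))) has_integral (\<integral>z. (\<Sum>k\<in>UNIV. h k z * (uu n z $ k)) \<partial>(cylm L T))) {0..T}"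
        by (rule iterated_integral) (use i in \<open>auto intro!: borel_measurable_sum Bochner_Integration.integrable_sum\<close>)
      moreover have "integral (cbox 0 L) (\<lambda>x. \<Sum>k\<in>UNIV. h k (x,t) * (uu n (x,t) $ k)) = indicator A t * integral (cbox 0 L) (\<lambda>x. uu n (x,t) \<bullet> grad q x)" for t
        unfolding integral_mult_right[symmetric] by (simp add: h_def inner_vec_def sum_distrib_left mult_ac)
      moreover have "(\<integral>z. (\<Sum>k\<in>UNIV. h k z * (uu n z $ k)) \<partial>(cylm L T)) = (\<Sum>k\<in>UNIV. \<integral>z. h k z * (uu n z $ k) \<partial>(cylm L T))"
        by (rule Bochner_Integration.integral_sum) (rule i(1))
      ultimately show ?thesis by simp
    qed
    have "(\<lambda>n. I (r n)) \<longlonglongrightarrow> (\<Sum>k\<in>UNIV. \<integral>z. h k z * m1 k z \<partial>(cylm L T))"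
      unfolding I_def integral_unique[OF hi] m1_def by (intro tendsto_sum Pc cont h)
    moreover have "(\<Sum>k\<in>UNIV. \<integral>z. h k z * m1 k z \<partial>(cylm L T)) = integral {0..T} (\<lambda>t. indicator A t * J t)"
    proof -
      note i = integrable_prod[OF h(2) h(1) m_measurable(1) m1_bound]
      have "integral {0..T} (\<lambda>t. integral (cbox 0 L) (\<lambda>x. \<Sum>k\<in>UNIV. h k (x,t) * m1 k (x,t))) = (\<integral>z. (\<Sum>k\<in>UNIV. h k z * m1 k z) \<partial>(cylm L T))"
        by (rule integral_slices) (use i in \<open>auto intro!: borel_measurable_sum Bochner_Integration.integrable_sum\<close>)
      moreover have "integral (cbox 0 L) (\<lambda>x. \<Sum>k\<in>UNIV. h k (x,t) * m1 k (x,t)) = indicator A t * J t" for t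
        unfolding J_def inner_mom1 integral_mult_right[symmetric] by (simp add: h_def sum_distrib_left mult_ac)
      moreover have "(\<integral>z. (\<Sum>k\<in>UNIV. h k z * m1 k z) \<partial>(cylm L T)) = (\<Sum>k\<in>UNIV. \<integral>z. h k z * m1 k z \<partial>(cylm L T))"
        by (rule Bochner_Integration.integral_sum) (rule i(1))
      ultimately show ?thesis by simp
    qed
    moreover have "(\<lambda>n. I (r n)) \<longlonglongrightarrow> 0"
    proof (rule LIMSEQ_subseq_LIMSEQ[OF _ r, unfolded o_def], rule tendstoI)
      fix e :: real assume e: "e > 0"
      define e' where "e' = e / (2 * (T + 1))"
      have e': "e' > 0" "e' * T < e" unfolding e'_def using e Tpos by (auto simp: field_simps intro!: add_pos_pos mult_pos_pos)
      from div_small[OF q e'(1)] show "\<forall>\<^sub>F n in sequentially. dist (I n) 0 < e"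
      proof eventually_elim
        case (elim n)
        have "norm (I n) \<le> integral {0..T} (\<lambda>t. e')"
          unfolding I_def
        proof (rule integral_norm_bound_integral)
          show "(\<lambda>t. indicator A t * integral (cbox 0 L) (\<lambda>x. uu n (x,t) \<bullet> grad q x)) integrable_on {0..T}" using hi[of n] by blast
          fix t assume "t \<in> {0..T}"
          then show "norm (indicator A t * integral (cbox 0 L) (\<lambda>x. uu n (x,t) \<bullet> grad q x)) \<le> e'" using elim e'(1) by (auto simp: indicator_def)
        qed auto
        then have "\<bar>I n\<bar> \<le> e' * T" using Tpos by (simp add: mult.commute)
        then show ?case using e'(2) by (simp add: dist_real_def)
      qed
    qed
    ultimately show ?thesis using LIMSEQ_unique by metis
  qed
  have "AE t in lborel. t \<in> {0..T} \<longrightarrow> J t \<le> 0"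
    by (rule AE_le_if_integrals_le[OF Jm JB]) (use zero in simp)
  moreover have "AE t in lborel. t \<in> {0..T} \<longrightarrow> - J t \<le> 0"
    by (rule AE_le_if_integrals_le[where B="sum C UNIV"]) (use Jm JB zero in auto)
  ultimately show ?thesis unfolding J_def by eventually_elim auto
qed

text \<open>A countable family of test functions whose gradients are uniformly dense on the box
  gives a null set independent of \<open>q\<close>; boundedness of \<open>mom1\<close> then carries
  the identity over to all \<open>q\<close>.\<close>

lemma div_all:
  "AE t in lborel. t \<in> {0..T} \<longrightarrow> (\<forall>q::real^'d \<Rightarrow> real. smooth q \<and> lat_per L q \<longrightarrow> integral (cbox 0 L) (\<lambda>x. mom1 U x t \<bullet> grad q x) = 0)"
proof -
  define F where "F = {q::real^'d \<Rightarrow> real. smooth q \<and> lat_per L q}"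
  have gk: "continuous_on UNIV (\<lambda>x. grad q x $ k)" if "smooth q" for q k unfolding grad_def by (simp add: smooth_C1(2)[OF that])
  have gc: "continuous_on UNIV (grad q)" if "smooth q" for q
    unfolding grad_eq_sum by (intro continuous_intros smooth_C1(2)[OF that])
  \<comment> \<open>Approximants are taken inside the smooth periodic functions themselves, where
    \<open>div_single\<close> applies.\<close>
  obtain C where C: "C \<subseteq> F" "countable C" "\<forall>q\<in>F. \<forall>e>0. \<exists>q'\<in>C. \<forall>x\<in>cbox 0 L. dist (grad q x) (grad q' x) < e"
    using countable_uniformly_dense_subfamily[of "cbox 0 L" F grad] gc continuous_on_subset unfolding F_def by (metis (no_types, lifting) compact_cbox mem_Collect_eq subset_UNIV)
  have "AE t in lborel. \<forall>q\<in>C. t \<in> {0..T} \<longrightarrow> integral (cbox 0 L) (\<lambda>x. mom1 U x t \<bullet> grad q x) = 0"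
    by (subst AE_ball_countable[OF C(2)]) (use C(1) div_single in \<open>auto simp: F_def\<close>)
  then show ?thesis
  proof eventually_elim
    case (elim t)
    show ?case
    proof (intro impI allI)
      fix q :: "real^'d \<Rightarrow> real" assume t: "t \<in> {0..T}" and q: "smooth q \<and> lat_per L q"
      have ii: "(\<lambda>x. mom1 U x t \<bullet> grad q x) integrable_on cbox 0 L" if "smooth q" for q
        unfolding inner_mom1 by (rule integrable_sum) (auto intro!: signed_slice(1)[OF m_measurable(1) m1_bound gk[OF that]])
      have mb: "norm (mom1 U x t) \<le> real CARD('d) * M" for x
      proof -
        have "norm (mom1 U x t) \<le> (\<Sum>k\<in>UNIV. \<bar>mom1 U x t $ k\<bar>)" by (rule norm_le_l1_cart)
        also have "\<dots> \<le> (\<Sum>k\<in>(UNIV::'d set). M)" by (intro sum_mono) (simp add: mom1_nth m1_bound)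
        finally show ?thesis by simp
      qed
      define c where "c = real CARD('d) * M * measure lborel (cbox 0 L)"
      have "\<bar>integral (cbox 0 L) (\<lambda>x. mom1 U x t \<bullet> grad q x)\<bar> \<le> e * c" if e: "e > 0" for e
      proof -
        obtain q' where q': "q' \<in> C" "\<forall>x\<in>cbox 0 L. dist (grad q x) (grad q' x) < e" using C(3) q e unfolding F_def by blast
        have s': "smooth q'" using q'(1) C(1) unfolding F_def by blast
        have "integral (cbox 0 L) (\<lambda>x. mom1 U x t \<bullet> grad q x) = integral (cbox 0 L) (\<lambda>x. mom1 U x t \<bullet> grad q x - mom1 U x t \<bullet> grad q' x)"
          using integral_diff[OF ii[of q] ii[OF s']] q elim q'(1) t by simp
        also have "norm \<dots> \<le> integral (cbox 0 L) (\<lambda>x. real CARD('d) * M * e)"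
        proof (rule integral_norm_bound_integral)
          show "(\<lambda>x. mom1 U x t \<bullet> grad q x - mom1 U x t \<bullet> grad q' x) integrable_on cbox 0 L"
            by (rule integrable_diff[OF ii ii]) (use q s' in auto)
          fix x assume x: "x \<in> cbox 0 L"
          have "norm (mom1 U x t \<bullet> (grad q x - grad q' x)) \<le> norm (mom1 U x t) * norm (grad q x - grad q' x)"
            using Cauchy_Schwarz_ineq2 by simp
          also have "\<dots> \<le> real CARD('d) * M * e" using mb[of x] q'(2) x M0 by (intro mult_mono) (auto simp: dist_norm intro: less_imp_le)
          finally show "norm (mom1 U x t \<bullet> grad q x - mom1 U x t \<bullet> grad q' x) \<le> real CARD('d) * M * e" by (simp add: inner_diff_right)
        qed auto
        finally show ?thesis by (simp add: c_def mult_ac)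
      qed
      then have "\<bar>integral (cbox 0 L) (\<lambda>x. mom1 U x t \<bullet> grad q x)\<bar> \<le> 0"
      proof -
        assume H: "\<And>e. e > 0 \<Longrightarrow> \<bar>integral (cbox 0 L) (\<lambda>x. mom1 U x t \<bullet> grad q x)\<bar> \<le> e * c"
        have c0: "0 \<le> c" unfolding c_def using M0 by simp
        show ?thesis
        proof (rule field_le_epsilon)
          fix e :: real assume e: "e > 0"
          have "e / (c + 1) > 0" using e c0 by simp
          from H[OF this] have "\<bar>integral (cbox 0 L) (\<lambda>x. mom1 U x t \<bullet> grad q x)\<bar> \<le> e / (c + 1) * c" .
          also have "\<dots> \<le> 0 + e" using e c0 by (simp add: field_simps)
          finally show "\<bar>integral (cbox 0 L) (\<lambda>x. mom1 U x t \<bullet> grad q x)\<bar> \<le> 0 + e" .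
        qed
      qed
      then show "integral (cbox 0 L) (\<lambda>x. mom1 U x t \<bullet> grad q x) = 0" by simp
    qed
  qed
qed

end

section \<open>Initial data, momentum balance and the defects\<close>

context approx begin

lemma initial_limit:
  fixes w :: "real^'d \<Rightarrow> real^'d"
  assumes w: "continuous_on UNIV w"
    and u0: "u0 measurable_on cbox 0 L" "(\<lambda>x. (norm (u0 x))\<^sup>2) integrable_on cbox 0 L"
    and lim: "(\<lambda>n. integral (cbox 0 L) (\<lambda>x. (norm (uh L (K n) (\<lambda>i. u n i 0) x - u0 x))\<^sup>2)) \<longlonglongrightarrow> 0"
  shows "(\<lambda>n. integral (cbox 0 L) (\<lambda>x. uu n (x,0) \<bullet> w x)) \<longlonglongrightarrow> integral (cbox 0 L) (\<lambda>x. u0 x \<bullet> w x)"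
proof -
  let ?\<Lambda> = "lebesgue_on (cbox 0 L)"
  have T0: "(0::real) \<in> {0..T}" using Tpos by simp
  have fin: "integrable ?\<Lambda> (\<lambda>x. c::real)" for c by (rule cmesh.bm_integrable[OF cm cmesh.bm_const[OF cm]])
  have u0m[measurable]: "u0 \<in> borel_measurable ?\<Lambda>" using u0(1) by (simp add: measurable_on_iff_borel_measurable)
  have u02: "integrable ?\<Lambda> (\<lambda>x. (norm (u0 x))\<^sup>2)"
  proof -
    have "(\<lambda>x. (norm (u0 x))\<^sup>2) absolutely_integrable_on cbox 0 L" using u0(2) by (rule nonnegative_absolutely_integrable_1) simp
    then show ?thesis by (simp add: integrable_restrict_space set_integrable_def)
  qed
  have um[measurable]: "(\<lambda>x. uu n (x,0)) \<in> borel_measurable ?\<Lambda>" for n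
    by (rule continuous_measurable_lebesgue_on_cbox[OF uu_slice_cont])
  have wm[measurable]: "w \<in> borel_measurable ?\<Lambda>" by (rule continuous_measurable_lebesgue_on_cbox[OF w])
  have "bounded (w ` cbox 0 L)" by (intro compact_imp_bounded compact_continuous_image continuous_on_subset[OF w]) auto
  then obtain W0 where W0: "\<forall>x\<in>cbox 0 L. norm (w x) \<le> W0" unfolding bounded_iff by auto
  define W where "W = max 0 W0"
  have W: "W \<ge> 0" "\<And>x. x \<in> cbox 0 L \<Longrightarrow> norm (w x) \<le> W" using W0 by (auto simp: W_def intro: max.coboundedI2)
  have d2: "integrable ?\<Lambda> (\<lambda>x. (norm (uu n (x,0) - u0 x))\<^sup>2)" for n
  proof (rule Bochner_Integration.integrable_bound[of _ "\<lambda>x. 2 * M\<^sup>2 + 2 * (norm (u0 x))\<^sup>2"])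
    show "integrable ?\<Lambda> (\<lambda>x. 2 * M\<^sup>2 + 2 * (norm (u0 x))\<^sup>2)" using fin u02 by simp
    show "AE x in ?\<Lambda>. norm ((norm (uu n (x,0) - u0 x))\<^sup>2) \<le> norm (2 * M\<^sup>2 + 2 * (norm (u0 x))\<^sup>2)"
    proof (rule AE_I2)
      fix x
      have "(norm (uu n (x,0) - u0 x))\<^sup>2 \<le> (M + norm (u0 x))\<^sup>2"
        using norm_triangle_ineq4[of "uu n (x,0)" "u0 x"] uu_bound[of n "(x,0)"] by (intro power_mono) auto
      also have "\<dots> \<le> 2 * M\<^sup>2 + 2 * (norm (u0 x))\<^sup>2"
        using zero_le_power2[of "M - norm (u0 x)"] by (simp add: power2_sum power2_diff)
      finally show "norm ((norm (uu n (x,0) - u0 x))\<^sup>2) \<le> norm (2 * M\<^sup>2 + 2 * (norm (u0 x))\<^sup>2)" by simp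
    qed
  qed measurable
  define a where "a n = (\<integral>x. (norm (uu n (x,0) - u0 x))\<^sup>2 \<partial>?\<Lambda>)" for n
  have aeq: "a = (\<lambda>n. integral (cbox 0 L) (\<lambda>x. (norm (uu n (x,0) - u0 x))\<^sup>2))"
    unfolding a_def by (rule ext) (rule lebesgue_integral_eq_integral[OF d2], simp)
  have a0: "a \<longlonglongrightarrow> 0" unfolding aeq uu_eq[OF T0] by (rule lim)
  have uw: "integrable ?\<Lambda> (\<lambda>x. uu n (x,0) \<bullet> w x)" for n
    by (intro cmesh.bm_integrable[OF cm] cmesh.bm_continuous[OF cm] continuous_intros uu_slice_cont w)
  have u0w: "integrable ?\<Lambda> (\<lambda>x. u0 x \<bullet> w x)"
  proof (rule Bochner_Integration.integrable_bound[of _ "\<lambda>x. W * (1 + (norm (u0 x))\<^sup>2)"])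
    show "integrable ?\<Lambda> (\<lambda>x. W * (1 + (norm (u0 x))\<^sup>2))" using fin u02 by simp
    show "AE x in ?\<Lambda>. norm (u0 x \<bullet> w x) \<le> norm (W * (1 + (norm (u0 x))\<^sup>2))"
    proof (rule AE_I2)
      fix x assume "x \<in> space ?\<Lambda>"
      then have wx: "norm (w x) \<le> W" using W by simp
      have "0 \<le> (norm (u0 x) - 1)\<^sup>2" "0 \<le> norm (u0 x)" by simp_all
      then have "norm (u0 x) \<le> 1 + (norm (u0 x))\<^sup>2" unfolding power2_diff one_power2 by linarith
      then have "norm (u0 x) * norm (w x) \<le> (1 + (norm (u0 x))\<^sup>2) * W" using wx by (intro mult_mono) auto
      then show "norm (u0 x \<bullet> w x) \<le> norm (W * (1 + (norm (u0 x))\<^sup>2))"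
        using Cauchy_Schwarz_ineq2[of "u0 x" "w x"] W(1) by (simp add: mult.commute)
    qed
  qed measurable
  have est: "\<bar>(\<integral>x. uu n (x,0) \<bullet> w x \<partial>?\<Lambda>) - (\<integral>x. u0 x \<bullet> w x \<partial>?\<Lambda>)\<bar> \<le> W * (\<delta> * vol + a n / \<delta>)" if \<delta>: "\<delta> > 0" for n \<delta>
  proof -
    have "\<bar>(\<integral>x. uu n (x,0) \<bullet> w x \<partial>?\<Lambda>) - (\<integral>x. u0 x \<bullet> w x \<partial>?\<Lambda>)\<bar> = \<bar>\<integral>x. uu n (x,0) \<bullet> w x - u0 x \<bullet> w x \<partial>?\<Lambda>\<bar>" using uw u0w by simp
    also have "\<dots> \<le> (\<integral>x. \<bar>uu n (x,0) \<bullet> w x - u0 x \<bullet> w x\<bar> \<partial>?\<Lambda>)" by (rule integral_abs_bound)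
    also have "\<dots> \<le> (\<integral>x. W * (\<delta> + (norm (uu n (x,0) - u0 x))\<^sup>2 / \<delta>) \<partial>?\<Lambda>)"
    proof (rule integral_mono)
      fix x assume "x \<in> space ?\<Lambda>"
      then have wx: "norm (w x) \<le> W" using W by simp
      define s where "s = norm (uu n (x,0) - u0 x)"
      \<comment> \<open>This splitting, with \<open>\<delta>\<close> chosen before \<open>n\<close>,
        deduces L^1 convergence from L^2 convergence on the bounded box.\<close>
      have s: "s \<le> \<delta> + s\<^sup>2 / \<delta>"
      proof (cases "s \<le> \<delta>")
        case True then show ?thesis using \<delta> by (simp add: add_increasing2)
      next
        case False
        then have "s * \<delta> \<le> s * s" using \<delta> by (intro mult_left_mono) auto
        then have "s \<le> s\<^sup>2 / \<delta>" using \<delta> by (simp add: pos_le_divide_eq power2_eq_square)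
        then show ?thesis using \<delta> by linarith
      qed
      have "\<bar>uu n (x,0) \<bullet> w x - u0 x \<bullet> w x\<bar> \<le> s * norm (w x)"
        using Cauchy_Schwarz_ineq2[of "uu n (x,0) - u0 x" "w x"] by (simp add: inner_diff_left s_def)
      also have "\<dots> \<le> (\<delta> + s\<^sup>2 / \<delta>) * W" using s wx \<delta> by (intro mult_mono) auto
      finally show "\<bar>uu n (x,0) \<bullet> w x - u0 x \<bullet> w x\<bar> \<le> W * (\<delta> + (norm (uu n (x,0) - u0 x))\<^sup>2 / \<delta>)" by (simp add: s_def mult.commute)
    qed (use uw u0w fin d2 in auto)
    also have "\<dots> = W * (\<delta> * vol + a n / \<delta>)"
      using fin d2 unfolding a_def by (simp add: measure_restrict_space mult.commute)
    finally show ?thesis .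
  qed
  have "(\<lambda>n. \<integral>x. uu n (x,0) \<bullet> w x \<partial>?\<Lambda>) \<longlonglongrightarrow> (\<integral>x. u0 x \<bullet> w x \<partial>?\<Lambda>)"
  proof (rule tendstoI)
    fix e :: real assume e: "e > 0"
    define c where "c = W * vol"
    have c0: "0 \<le> c" unfolding c_def using W(1) by simp
    define \<delta> where "\<delta> = e / (2 * (c + 1))"
    have \<delta>: "\<delta> > 0" "c * \<delta> \<le> e / 2" unfolding \<delta>_def using e c0 by (auto simp: field_simps)
    have l: "(\<lambda>n. W * (a n / \<delta>)) \<longlonglongrightarrow> W * (0 / \<delta>)" by (intro tendsto_intros a0) (use \<delta> in simp)
    have "\<forall>\<^sub>F n in sequentially. W * (a n / \<delta>) < e / 2" by (rule order_tendstoD(2)[OF l]) (use e in simp)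
    then show "\<forall>\<^sub>F n in sequentially. dist (\<integral>x. uu n (x,0) \<bullet> w x \<partial>?\<Lambda>) (\<integral>x. u0 x \<bullet> w x \<partial>?\<Lambda>) < e"
    proof eventually_elim
      case (elim n)
      have "W * (\<delta> * vol + a n / \<delta>) = c * \<delta> + W * (a n / \<delta>)" by (simp add: c_def algebra_simps)
      then show ?case using est[OF \<delta>(1), of n] elim \<delta>(2) unfolding dist_real_def by linarith
    qed
  qed
  then show ?thesis using lebesgue_integral_eq_integral[OF uw] lebesgue_integral_eq_integral[OF u0w] by simp
qed

end

context young_limit begin

text \<open>The discrete weak form has two limits: zero by consistency, and the expression in the
  moments of the Young measure by weak-* convergence. Every integrand is a fixed continuous factor
  times a polynomial in u_h.\<close>

lemma momentum_balance:
  fixes v :: "(real^'d) \<times> real \<Rightarrow> real^'d"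
  assumes v: "smooth v" "\<forall>t. lat_per L (\<lambda>x. v (x,t))" and vT: "\<forall>x. v (x,T) = 0"
    and divv: "\<forall>x t. (\<Sum>k\<in>UNIV. pd v (axis k 1, 0) (x,t) $ k) = 0"
    and init: "(\<lambda>n. integral (cbox 0 L) (\<lambda>x. uu n (x,0) \<bullet> v (x,0))) \<longlonglongrightarrow> I0"
  shows "integral {0..T} (\<lambda>t. integral (cbox 0 L) (\<lambda>x. mom1 U x t \<bullet> pd v (0,1) (x,t)
      + (\<Sum>k\<in>UNIV. \<Sum>l\<in>UNIV. tens U x t $ k $ l * pd v (axis l 1, 0) (x,t) $ k))) + I0 = 0"
proof -
  define ha where "ha k z = pd v (0,1) z $ k" for k z
  define hb where "hb k l z = pd v (axis l 1, 0) z $ k" for k l z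
  have ci: "h \<in> borel_measurable borel" "integrable (cylm L T) h" if h: "continuous_on UNIV h" for h :: "(real^'d) \<times> real \<Rightarrow> real"
  proof -
    show m: "h \<in> borel_measurable borel" using h by (rule borel_measurable_continuous_onI)
    have "bounded (h ` (cbox 0 L \<times> {0..T}))"
      by (intro compact_imp_bounded compact_continuous_image continuous_on_subset[OF h] compact_Times) auto
    then obtain B where "\<forall>z\<in>cbox 0 L \<times> {0..T}. \<bar>h z\<bar> \<le> B" unfolding bounded_iff by auto
    then show "integrable (cylm L T) h" using m by (intro cylm_integrable_bounded[where B=B]) auto
  qed
  have hac: "continuous_on UNIV (ha k)" for k unfolding ha_def[abs_def] by (intro continuous_intros smooth_C1(2)[OF v(1)])
  have hbc: "continuous_on UNIV (hb k l)" for k l unfolding hb_def[abs_def] by (intro continuous_intros smooth_C1(2)[OF v(1)])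
  note ia = int_f_uu[OF ci(2,1)[OF hac] cont(1)]
  note ib = int_f_uu[OF ci(2,1)[OF hbc] cont(3)]
  note ja = integrable_prod[OF ci(2,1)[OF hac] m_measurable(1) m1_bound]
  note jb = integrable_prod[OF ci(2,1)[OF hbc] m_measurable(3) tt_bound]
  have split: "(\<integral>z. (\<Sum>k\<in>UNIV. fa k z) + (\<Sum>k\<in>UNIV. \<Sum>l\<in>UNIV. fb k l z) \<partial>(cylm L T))
      = (\<Sum>k\<in>UNIV. \<integral>z. fa k z \<partial>(cylm L T)) + (\<Sum>k\<in>UNIV. \<Sum>l\<in>UNIV. \<integral>z. fb k l z \<partial>(cylm L T))"
    if "\<And>k. integrable (cylm L T) (fa k)" "\<And>k l. integrable (cylm L T) (fb k l)" for fa :: "'d \<Rightarrow> _ \<Rightarrow> real" and fb :: "'d \<Rightarrow> 'd \<Rightarrow> _ \<Rightarrow> real"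
    using that by (simp add: Bochner_Integration.integral_sum)
  have flux: "(\<integral>z. momentum_flux v n z \<partial>(cylm L T)) = (\<Sum>k\<in>UNIV. \<integral>z. ha k z * (uu n z $ k) \<partial>(cylm L T)) + (\<Sum>k\<in>UNIV. \<Sum>l\<in>UNIV. \<integral>z. hb k l z * (uu n z $ k * uu n z $ l) \<partial>(cylm L T))" for n
  proof -
    have "(\<integral>z. momentum_flux v n z \<partial>(cylm L T)) = (\<integral>z. (\<Sum>k\<in>UNIV. ha k z * (uu n z $ k)) + (\<Sum>k\<in>UNIV. \<Sum>l\<in>UNIV. hb k l z * (uu n z $ k * uu n z $ l)) \<partial>(cylm L T))"
      unfolding momentum_flux_def ha_def hb_def inner_vec_def
      by (intro arg_cong[where f="integral\<^sup>L (cylm L T)"] ext arg_cong2[where f="(+)"] sum.cong refl) (simp_all add: mult_ac)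
    also have "\<dots> = (\<Sum>k\<in>UNIV. \<integral>z. ha k z * (uu n z $ k) \<partial>(cylm L T)) + (\<Sum>k\<in>UNIV. \<Sum>l\<in>UNIV. \<integral>z. hb k l z * (uu n z $ k * uu n z $ l) \<partial>(cylm L T))"
      by (rule split) (rule ia(1) ib(1))+
    finally show ?thesis .
  qed
  have A: "(\<lambda>n. (\<integral>z. momentum_flux v (r n) z \<partial>(cylm L T)) + integral (cbox 0 L) (\<lambda>x. uu (r n) (x,0) \<bullet> v (x,0))) \<longlonglongrightarrow> 0"
    using LIMSEQ_subseq_LIMSEQ[OF momentum_limit[OF v vT divv] r] unfolding o_def .
  have B: "(\<lambda>n. (\<integral>z. momentum_flux v (r n) z \<partial>(cylm L T)) + integral (cbox 0 L) (\<lambda>x. uu (r n) (x,0) \<bullet> v (x,0))) \<longlonglongrightarrow>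
      ((\<Sum>k\<in>UNIV. \<integral>z. ha k z * m1 k z \<partial>(cylm L T)) + (\<Sum>k\<in>UNIV. \<Sum>l\<in>UNIV. \<integral>z. hb k l z * tt k l z \<partial>(cylm L T))) + I0"
    unfolding flux m1_def tt_def
    by (intro tendsto_add tendsto_sum Pc[OF cont(1)] Pc[OF cont(3)] ci(2) hac hbc LIMSEQ_subseq_LIMSEQ[OF init r, unfolded o_def])
  have C: "integral {0..T} (\<lambda>t. integral (cbox 0 L) (\<lambda>x. mom1 U x t \<bullet> pd v (0,1) (x,t)
      + (\<Sum>k\<in>UNIV. \<Sum>l\<in>UNIV. tens U x t $ k $ l * pd v (axis l 1, 0) (x,t) $ k)))
    = (\<Sum>k\<in>UNIV. \<integral>z. ha k z * m1 k z \<partial>(cylm L T)) + (\<Sum>k\<in>UNIV. \<Sum>l\<in>UNIV. \<integral>z. hb k l z * tt k l z \<partial>(cylm L T))"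
  proof -
    have "integral {0..T} (\<lambda>t. integral (cbox 0 L) (\<lambda>x. mom1 U x t \<bullet> pd v (0,1) (x,t)
        + (\<Sum>k\<in>UNIV. \<Sum>l\<in>UNIV. tens U x t $ k $ l * pd v (axis l 1, 0) (x,t) $ k)))
      = integral {0..T} (\<lambda>t. integral (cbox 0 L) (\<lambda>x. (\<Sum>k\<in>UNIV. ha k (x,t) * m1 k (x,t)) + (\<Sum>k\<in>UNIV. \<Sum>l\<in>UNIV. hb k l (x,t) * tt k l (x,t))))"
      unfolding inner_mom1 tens_eq ha_def hb_def
      by (intro arg_cong[where f="integral _"] ext arg_cong2[where f="(+)"] sum.cong refl) (simp_all add: mult.commute)
    also have "\<dots> = (\<integral>z. (\<Sum>k\<in>UNIV. ha k z * m1 k z) + (\<Sum>k\<in>UNIV. \<Sum>l\<in>UNIV. hb k l z * tt k l z) \<partial>(cylm L T))"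
      by (rule integral_slices)
         (use ja jb in \<open>auto intro!: borel_measurable_add borel_measurable_sum Bochner_Integration.integrable_add Bochner_Integration.integrable_sum\<close>)
    also have "\<dots> = (\<Sum>k\<in>UNIV. \<integral>z. ha k z * m1 k z \<partial>(cylm L T)) + (\<Sum>k\<in>UNIV. \<Sum>l\<in>UNIV. \<integral>z. hb k l z * tt k l z \<partial>(cylm L T))"
      by (rule split) (rule ja(1) jb(1))+
    finally show ?thesis .
  qed
  show ?thesis unfolding C by (rule LIMSEQ_unique[OF B A])
qed

text \<open>Bounded u_h leave no singular part in the limit of the energies, which therefore has the
  density \<open>m2 z / 2\<close>.\<close>

definition Dbar :: "real \<Rightarrow> (real^'d) measure" where "Dbar = dens L (\<lambda>z. m2 z / 2)"
text \<open>Positive and negative parts of the second moments, matching the encoding of signed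
  measures as pairs.\<close>

definition Mbar :: "real \<Rightarrow> 'd \<Rightarrow> 'd \<Rightarrow> (real^'d) measure \<times> (real^'d) measure" where
  "Mbar t k l = (dens L (\<lambda>z. max 0 (tt k l z)) t, dens L (\<lambda>z. max 0 (- tt k l z)) t)"
text \<open>The second moments of the Young measure already exhaust the weak-* limits, so the defect
  is the zero measure, written as a density to share the lemmas on \<open>dens\<close>.\<close>

definition Dcd :: "real \<Rightarrow> (real^'d) measure" where "Dcd = dens L (\<lambda>z. 0)"
definition Mcd :: "real \<Rightarrow> 'd \<Rightarrow> 'd \<Rightarrow> (real^'d) measure \<times> (real^'d) measure" where
  "Mcd t k l = (dens L (\<lambda>z. 0) t, dens L (\<lambda>z. 0) t)"

lemma m2h: "(\<lambda>z. m2 z / 2) \<in> borel_measurable borel" "0 \<le> m2 z / 2 \<and> m2 z / 2 \<le> M\<^sup>2"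
proof -
  show "(\<lambda>z. m2 z / 2) \<in> borel_measurable borel" by measurable
  show "0 \<le> m2 z / 2 \<and> m2 z / 2 \<le> M\<^sup>2" using m2_bound[of z] by auto
qed

lemma ttp: "(\<lambda>z. max 0 (tt k l z)) \<in> borel_measurable borel" "0 \<le> max 0 (tt k l z) \<and> max 0 (tt k l z) \<le> M\<^sup>2"
  and ttn: "(\<lambda>z. max 0 (- tt k l z)) \<in> borel_measurable borel" "0 \<le> max 0 (- tt k l z) \<and> max 0 (- tt k l z) \<le> M\<^sup>2"
proof -
  show "(\<lambda>z. max 0 (tt k l z)) \<in> borel_measurable borel" "(\<lambda>z. max 0 (- tt k l z)) \<in> borel_measurable borel" by measurable
  show "0 \<le> max 0 (tt k l z) \<and> max 0 (tt k l z) \<le> M\<^sup>2" "0 \<le> max 0 (- tt k l z) \<and> max 0 (- tt k l z) \<le> M\<^sup>2"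
    using tt_bound[of k l z] by (auto simp: max_def abs_le_iff)
qed

lemma zero_dens: "(\<lambda>z::(real^'d) \<times> real. 0::real) \<in> borel_measurable borel" "0 \<le> (0::real) \<and> (0::real) \<le> 0" by auto

lemma Dbar_integral: "continuous_on UNIV \<phi> \<Longrightarrow> (\<integral>x. \<phi> x \<partial>(Dbar t)) = integral (cbox 0 L) (\<lambda>x. \<phi> x * (m2 (x,t) / 2))"
  unfolding Dbar_def by (rule dens_integral(1)[OF m2h])

lemma Mbar_sint: assumes "continuous_on UNIV \<phi>" shows "sint \<phi> (Mbar t k l) = integral (cbox 0 L) (\<lambda>x. \<phi> x * tt k l (x,t))"
proof -
  have eq: "(\<lambda>x. \<phi> x * tt k l (x,t)) = (\<lambda>x. \<phi> x * max 0 (tt k l (x,t)) - \<phi> x * max 0 (- tt k l (x,t)))"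
    by (auto simp: fun_eq_iff max_def right_diff_distrib[symmetric])
  show ?thesis unfolding eq sint_def Mbar_def fst_conv snd_conv dens_integral(1)[OF ttp assms] dens_integral(1)[OF ttn assms]
    by (rule integral_diff[symmetric, OF dens_integral(2)[OF ttp assms] dens_integral(2)[OF ttn assms]])
qed

lemma Dcd_integral: "continuous_on UNIV \<phi> \<Longrightarrow> (\<integral>x. \<phi> x \<partial>(Dcd t)) = (0::real)"
  unfolding Dcd_def by (simp add: dens_integral(1)[OF zero_dens])

lemma Mcd_sint: "continuous_on UNIV \<phi> \<Longrightarrow> sint \<phi> (Mcd t k l) = 0"
  unfolding Mcd_def sint_def by (simp add: dens_integral(1)[OF zero_dens])

lemma Dcd_measure: "measure (Dcd t) UNIV = 0"
  using dens_measure[OF zero_dens, of L t] unfolding Dcd_def by (simp add: measure_le_0_iff)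

lemma LinfM:
  "LinfMpos L T Dbar" "LinfMmat L T Mbar" "LinfMpos L T Dcd" "LinfMmat L T Mcd" "tv L (Mcd t) \<le> 0"
proof -
  show "LinfMpos L T Dbar" unfolding Dbar_def by (rule dens_LinfMpos[OF m2h])
  show "LinfMpos L T Dcd" unfolding Dcd_def by (rule dens_LinfMpos[OF zero_dens])
  have tv0: "tv L (Mcd t) \<le> real CARD('d) * (real CARD('d) * 0)" for t
    by (rule tv_le) (simp add: Mcd_sint cont_per_def)
  then show "tv L (Mcd t) \<le> 0" by simp
  have tvM: "tv L (Mbar t) \<le> real CARD('d) * (real CARD('d) * integral (cbox 0 L) (\<lambda>x. M\<^sup>2))" for t
  proof (rule tv_le)
    fix k l \<phi> assume \<phi>: "cont_per L \<phi>" "\<forall>x. \<bar>\<phi> x\<bar> \<le> 1"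
    have c: "continuous_on UNIV \<phi>" using \<phi>(1) by (simp add: cont_per_def)
    have "norm (integral (cbox 0 L) (\<lambda>x. \<phi> x * tt k l (x,t))) \<le> integral (cbox 0 L) (\<lambda>x. M\<^sup>2)"
    proof (rule integral_norm_bound_integral)
      show "(\<lambda>x. \<phi> x * tt k l (x,t)) integrable_on cbox 0 L" by (rule signed_slice(1)[OF m_measurable(3) tt_bound c])
      fix x
      have "\<bar>\<phi> x\<bar> * \<bar>tt k l (x,t)\<bar> \<le> 1 * M\<^sup>2" using \<phi>(2) tt_bound by (intro mult_mono) auto
      then show "norm (\<phi> x * tt k l (x,t)) \<le> M\<^sup>2" by (simp add: abs_mult)
    qed auto
    then show "sint \<phi> (Mbar t k l) \<le> integral (cbox 0 L) (\<lambda>x. M\<^sup>2)" unfolding Mbar_sint[OF c] by simp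
  qed
  have sm: "(\<lambda>t. sint \<phi> (Mbar t k l)) \<in> borel_measurable borel" if "cont_per L \<phi>" for \<phi> k l
  proof -
    have c: "continuous_on UNIV \<phi>" using that by (simp add: cont_per_def)
    show ?thesis unfolding Mbar_sint[OF c] by (rule signed_slice(2)[OF m_measurable(3) tt_bound c])
  qed
  show "LinfMmat L T Mbar" unfolding LinfMmat_def
  proof (intro conjI allI impI sm)
    show "tmeas L (fst (Mbar t k l))" "tmeas L (snd (Mbar t k l))" for t k l
      unfolding Mbar_def fst_conv snd_conv by (rule dens_tmeas[OF ttp] dens_tmeas[OF ttn])+
    show "\<exists>C. AE t in lborel. t \<in> {0..T} \<longrightarrow> tv L (Mbar t) \<le> C" using tvM by (intro exI AE_I2) blast
  qed
  show "LinfMmat L T Mcd" unfolding LinfMmat_def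
  proof (intro conjI allI impI)
    show "tmeas L (fst (Mcd t k l))" "tmeas L (snd (Mcd t k l))" for t k l
      unfolding Mcd_def fst_conv snd_conv by (rule dens_tmeas[OF zero_dens])+
    show "(\<lambda>t. sint \<phi> (Mcd t k l)) \<in> borel_measurable borel" if "cont_per L \<phi>" for \<phi> k l
      using that by (simp add: Mcd_sint cont_per_def)
    show "\<exists>C. AE t in lborel. t \<in> {0..T} \<longrightarrow> tv L (Mcd t) \<le> C" using tv0 by (intro exI AE_I2) blast
  qed
qed

lemma weak_energy:
  assumes \<psi>: "testC L T \<psi>"
  shows "(\<lambda>n. integral {0..T} (\<lambda>t. integral (cbox 0 L) (\<lambda>x. \<psi> t x * ((norm (uh L (K (r n)) (\<lambda>i. u (r n) i t) x))\<^sup>2 / 2))))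
        \<longlonglongrightarrow> integral {0..T} (\<lambda>t. \<integral>x. \<psi> t x \<partial>(Dbar t))"
proof -
  note i = testC_integrable[OF Lpos \<psi>]
  have c: "continuous_on UNIV (\<psi> t)" for t using \<psi> by (simp add: testC_def cont_per_def)
  have cn: "continuous_on UNIV (\<lambda>v::real^'d. (norm v)\<^sup>2 / 2)" by (intro continuous_intros) auto
  have b: "\<bar>m2 z / 2\<bar> \<le> M\<^sup>2" for z using m2h(2)[of z] by auto
  have g: "m2 z / 2 = (\<integral>v. (norm v)\<^sup>2 / 2 \<partial>(P z))" for z by (simp add: m2_def)
  show ?thesis unfolding Dbar_integral[OF c] using weak_slices[OF i(2,1) cn g m2h(1) b] by simp
qed

lemma weak_tensor:
  assumes \<psi>: "testC L T \<psi>"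
  shows "(\<lambda>n. integral {0..T} (\<lambda>t. integral (cbox 0 L) (\<lambda>x. \<psi> t x * (uh L (K (r n)) (\<lambda>i. u (r n) i t) x $ k * uh L (K (r n)) (\<lambda>i. u (r n) i t) x $ l))))
        \<longlonglongrightarrow> integral {0..T} (\<lambda>t. sint (\<psi> t) (Mbar t k l))"
proof -
  note i = testC_integrable[OF Lpos \<psi>]
  have c: "continuous_on UNIV (\<psi> t)" for t using \<psi> by (simp add: testC_def cont_per_def)
  show ?thesis unfolding Mbar_sint[OF c] using weak_slices[OF i(2,1) cont(3)[of k l] tt_def m_measurable(3) tt_bound] by simp
qed

lemma DMV_limit:
  assumes u0: "u0 measurable_on cbox 0 L" "(\<lambda>x. (norm (u0 x))\<^sup>2) integrable_on cbox 0 L"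
    and init_L2: "(\<lambda>n. integral (cbox 0 L) (\<lambda>x. (norm (uh L (K n) (\<lambda>i. u n i 0) x - u0 x))\<^sup>2)) \<longlonglongrightarrow> 0"
    and init_energy: "(\<lambda>n. \<Sum>i\<in>nodes L (K n). lm L (K n) i * ((norm (u n i 0))\<^sup>2 / 2))
               \<longlonglongrightarrow> (1/2) * integral (cbox 0 L) (\<lambda>x. (norm (u0 x))\<^sup>2)"
  shows "DMV L T u0 U Dcd Mcd"
  unfolding DMV_def
proof (intro conjI allI)
  show "young U" by (rule young_U)
  show "integrable (U x t) (\<lambda>v. (norm v)\<^sup>2)" for x t by (rule integrable_U)
  have b: "\<bar>m2 z\<bar> \<le> M\<^sup>2" for z using m2_bound[of z] by auto
  have "(\<lambda>x. mom2 U x t) integrable_on cbox 0 L" for t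
    using signed_slice(1)[OF m_measurable(2) b continuous_on_const[of UNIV "1::real"], of t L] by (simp add: mom2_eq)
  then show "AE t in lborel. t \<in> {0..T} \<longrightarrow> (\<lambda>x. mom2 U x t) integrable_on cbox 0 L" by simp
  show "LinfMpos L T Dcd" "LinfMmat L T Mcd" by (rule LinfM)+
  show "AE t in lborel. t \<in> {0..T} \<longrightarrow> (1/2) * integral (cbox 0 L) (\<lambda>x. mom2 U x t) + measure (Dcd t) UNIV
          \<le> (1/2) * integral (cbox 0 L) (\<lambda>x. (norm (u0 x))\<^sup>2)"
    using energy_AE[OF init_energy] unfolding Dcd_measure by simp
  show "AE t in lborel. t \<in> {0..T} \<longrightarrow> (\<forall>q::real^'d \<Rightarrow> real. smooth q \<and> lat_per L q \<longrightarrow>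
           integral (cbox 0 L) (\<lambda>x. mom1 U x t \<bullet> grad q x) = 0)" by (rule div_all)
  \<comment> \<open>Both sides concern zero defects, so the witness 1 serves.\<close>
  show "\<exists>c>0. AE t in lborel. t \<in> {0..T} \<longrightarrow> tv L (Mcd t) \<le> c * measure (Dcd t) UNIV"
    unfolding Dcd_measure using LinfM(5) by (intro exI[of _ 1]) simp
  fix v :: "(real^'d) \<times> real \<Rightarrow> real^'d"
  show "smooth v \<and> (\<forall>t. lat_per L (\<lambda>x. v (x,t))) \<and> (\<exists>\<tau><T. \<forall>x t. \<tau> \<le> t \<longrightarrow> v (x,t) = 0) \<and>
        (\<forall>x t. (\<Sum>k\<in>UNIV. pd v (axis k (1::real) :: real^'d, 0::real) (x,t) $ k) = 0) \<longrightarrow>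
        integral {0..T} (\<lambda>t. integral (cbox 0 L) (\<lambda>x.
            mom1 U x t \<bullet> pd v (0::real^'d, 1::real) (x,t)
          + (\<Sum>k\<in>UNIV. \<Sum>l\<in>UNIV. tens U x t $ k $ l * pd v (axis l (1::real) :: real^'d, 0::real) (x,t) $ k)))
        + integral {0..T} (\<lambda>t. \<Sum>k\<in>UNIV. \<Sum>l\<in>UNIV.
            sint (\<lambda>x. pd v (axis l (1::real) :: real^'d, 0::real) (x,t) $ k) (Mcd t k l))
        + integral (cbox 0 L) (\<lambda>x. u0 x \<bullet> v (x,0)) = 0"
  proof (intro impI, elim conjE exE)
    fix \<tau> assume v: "smooth v" "\<forall>t. lat_per L (\<lambda>x. v (x,t))" and \<tau>: "\<tau> < T" "\<forall>x t. \<tau> \<le> t \<longrightarrow> v (x,t) = 0"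
      and dv: "\<forall>x t. (\<Sum>k\<in>UNIV. pd v (axis k (1::real) :: real^'d, 0::real) (x,t) $ k) = 0"
    have vT: "\<forall>x. v (x,T) = 0" using \<tau> by auto
    have c0: "continuous_on UNIV (\<lambda>x. v (x,0))"
      by (rule continuous_on_compose2[OF smooth_C1(4)[OF v(1)]]) (auto intro!: continuous_intros)
    have cs: "continuous_on UNIV (\<lambda>x. pd v (axis l 1, 0) (x,t) $ k)" for k l t
    proof -
      have "continuous_on UNIV (\<lambda>x. pd v (axis l 1, 0) (x,t))"
        by (rule continuous_on_compose2[OF smooth_C1(2)[OF v(1)]]) (auto intro!: continuous_intros)
      then show ?thesis by (intro continuous_intros)
    qed
    show "integral {0..T} (\<lambda>t. integral (cbox 0 L) (\<lambda>x.
            mom1 U x t \<bullet> pd v (0::real^'d, 1::real) (x,t)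
          + (\<Sum>k\<in>UNIV. \<Sum>l\<in>UNIV. tens U x t $ k $ l * pd v (axis l (1::real) :: real^'d, 0::real) (x,t) $ k)))
        + integral {0..T} (\<lambda>t. \<Sum>k\<in>UNIV. \<Sum>l\<in>UNIV.
            sint (\<lambda>x. pd v (axis l (1::real) :: real^'d, 0::real) (x,t) $ k) (Mcd t k l))
        + integral (cbox 0 L) (\<lambda>x. u0 x \<bullet> v (x,0)) = 0"
      using momentum_balance[OF v vT dv initial_limit[OF c0 u0 init_L2]] by (simp add: Mcd_sint[OF cs])
  qed
qed

end

theorem theorem4:
  fixes L :: "real^'d" and T \<omega> M :: real
    and K :: "nat \<Rightarrow> (real^'d) set set"
    and \<alpha> :: "nat \<Rightarrow> real^'d \<Rightarrow> real^'d \<Rightarrow> real \<Rightarrow> real"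
    and u u' :: "nat \<Rightarrow> real^'d \<Rightarrow> real \<Rightarrow> real^'d"
    and p :: "nat \<Rightarrow> real^'d \<Rightarrow> real \<Rightarrow> real"
    and u0 :: "real^'d \<Rightarrow> real^'d"
  assumes dim: "CARD('d) = 2 \<or> CARD('d) = 3"
    and Lpos: "\<forall>k. L$k > 0" and Tpos: "T > 0" and \<omega>pos: "\<omega> > 0"
    and mesh: "\<forall>n. periodic_mesh L (K n)"
    and h_to_0: "(\<lambda>n. mesh_size (K n)) \<longlonglongrightarrow> 0"
    and shape_reg: "\<exists>\<sigma>. \<forall>n. \<forall>S\<in>K n. diameter S \<le> \<sigma> * inradius S"
    and quasi_unif: "\<exists>\<rho>>0. \<forall>n. \<forall>S\<in>K n. \<rho> * mesh_size (K n) \<le> diameter S"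
    and alpha: "\<forall>n i j t. 0 \<le> \<alpha> n i j t \<and> \<alpha> n i j t \<le> 1 \<and> \<alpha> n i j t = \<alpha> n j i t"
    and C1: "\<forall>n. \<forall>i\<in>nodes L (K n). continuous_on {0..T} (u' n i) \<and>
               (\<forall>t\<in>{0..T}. (u n i has_vector_derivative u' n i t) (at t within {0..T}))"
    and S1: "\<forall>n. \<forall>i\<in>nodes L (K n). \<forall>t\<in>{0..T}.
               lm L (K n) i *\<^sub>R u' n i t =
               (\<Sum>j\<in>{j\<in>nodes L (K n). nbr L (K n) i j}.
                  (du L (K n) (\<lambda>a b. \<alpha> n a b t) (\<lambda>k. u n k t) i j
                   - atil L (K n) (\<lambda>k. u n k t) i j) *\<^sub>R u n j t
                  - p n j t *\<^sub>R cc L (K n) i j)"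
    and S2: "\<forall>n. \<forall>k\<in>nodes L (K n). \<forall>t\<in>{0..T}.
               0 = (\<Sum>j\<in>{j\<in>nodes L (K n). nbr L (K n) k j}.
                      dp \<omega> L (K n) k j * p n j t - cc L (K n) k j \<bullet> u n j t)"
    and bounds: "\<forall>n. \<forall>i\<in>nodes L (K n). \<forall>t\<in>{0..T}.
               norm (u n i t) \<le> M \<and> \<bar>p n i t\<bar> \<le> M \<and> norm (u' n i t) \<le> M"
    and H1bound: "\<forall>n. integral {0..T} (\<lambda>t. mesh_size (K n) *
               h1semi L (uh L (K n) (\<lambda>i. u n i t))) \<le> M"
    and u0_per: "lat_per L u0"
    and u0_L2: "u0 measurable_on cbox 0 L" "(\<lambda>x. (norm (u0 x))\<^sup>2) integrable_on cbox 0 L"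
    and u0_div: "\<forall>q::real^'d \<Rightarrow> real. smooth q \<and> lat_per L q \<longrightarrow>
               integral (cbox 0 L) (\<lambda>x. u0 x \<bullet> grad q x) = 0"
    and init_L2: "(\<lambda>n. integral (cbox 0 L) (\<lambda>x. (norm (uh L (K n) (\<lambda>i. u n i 0) x - u0 x))\<^sup>2))
               \<longlonglongrightarrow> 0"
    and init_energy: "(\<lambda>n. \<Sum>i\<in>nodes L (K n). lm L (K n) i * ((norm (u n i 0))\<^sup>2 / 2))
               \<longlonglongrightarrow> (1/2) * integral (cbox 0 L) (\<lambda>x. (norm (u0 x))\<^sup>2)"
  shows "\<exists>r U Dbar Mbar Dcd Mcd. strict_mono r \<and>
     young U \<and>
     (\<forall>\<psi>. testL2 L T \<psi> \<longrightarrow>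
        (\<lambda>n. integral {0..T} (\<lambda>t. integral (cbox 0 L) (\<lambda>x.
              uh L (K (r n)) (\<lambda>i. u (r n) i t) x \<bullet> \<psi> t x)))
        \<longlonglongrightarrow> integral {0..T} (\<lambda>t. integral (cbox 0 L) (\<lambda>x. mom1 U x t \<bullet> \<psi> t x))) \<and>
     LinfMpos L T Dbar \<and>
     (\<forall>\<psi>. testC L T \<psi> \<longrightarrow>
        (\<lambda>n. integral {0..T} (\<lambda>t. integral (cbox 0 L) (\<lambda>x.
              \<psi> t x * ((norm (uh L (K (r n)) (\<lambda>i. u (r n) i t) x))\<^sup>2 / 2))))
        \<longlonglongrightarrow> integral {0..T} (\<lambda>t. \<integral>x. \<psi> t x \<partial>(Dbar t))) \<and>
     LinfMmat L T Mbar \<and>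
     (\<forall>\<psi> k l. testC L T \<psi> \<longrightarrow>
        (\<lambda>n. integral {0..T} (\<lambda>t. integral (cbox 0 L) (\<lambda>x.
              \<psi> t x * (uh L (K (r n)) (\<lambda>i. u (r n) i t) x $ k
                       * uh L (K (r n)) (\<lambda>i. u (r n) i t) x $ l))))
        \<longlonglongrightarrow> integral {0..T} (\<lambda>t. sint (\<psi> t) (Mbar t k l))) \<and>
     (AE t in lborel. t \<in> {0..T} \<longrightarrow> (\<forall>\<phi>. cont_per L \<phi> \<longrightarrow>
        (\<integral>x. \<phi> x \<partial>(Dcd t)) = (\<integral>x. \<phi> x \<partial>(Dbar t))
            - integral (cbox 0 L) (\<lambda>x. \<phi> x * (mom2 U x t / 2)) \<and>
        (\<forall>k l. sint \<phi> (Mcd t k l) = sint \<phi> (Mbar t k l)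
            - integral (cbox 0 L) (\<lambda>x. \<phi> x * tens U x t $ k $ l)))) \<and>
     DMV L T u0 U Dcd Mcd"
proof -
  interpret approx L T \<omega> M K \<alpha> u u' p
    by (rule approx.intro) fact+
  have uum: "uu n \<in> borel_measurable borel" for n by (rule borel_measurable_continuous_onI[OF uu_cont])
  obtain r :: "nat \<Rightarrow> nat" and P where rP: "strict_mono r \<and>
      (\<forall>z. prob_space (P z) \<and> sets (P z) = sets borel \<and> (AE x in P z. norm x \<le> M)) \<and>
      (\<forall>f::real^'d \<Rightarrow> real. continuous_on UNIV f \<longrightarrow> (\<lambda>z. \<integral>x. f x \<partial>(P z)) \<in> borel_measurable borel \<and>
       (\<forall>h. integrable (cylm L T) h \<longrightarrow> (\<lambda>n. \<integral>z. h z * f (uu (r n) z) \<partial>(cylm L T)) \<longlonglongrightarrow> (\<integral>z. h z * (\<integral>x. f x \<partial>(P z)) \<partial>(cylm L T))))"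
    \<comment> \<open>One subsequence serves all test functions and all continuous \<open>f\<close>,
      so the three weak-* limits and the balance laws hold along the same \<open>r\<close>.\<close>
    using young_measure_exists[OF cylm_finite cylm_sets, of uu M L T, OF uum uu_bound] by (elim exE) (rule that)
  interpret young_limit L T \<omega> M K \<alpha> u u' p r P
  proof (intro young_limit.intro young_limit_axioms.intro)
    show "approx L T \<omega> M K \<alpha> u u' p" by (rule approx_axioms)
  qed (use rP in blast)+
  \<comment> \<open>Holds at every \<open>t\<close>: the limit measures have exactly the moment
    densities that are subtracted, so both sides are zero.\<close>
  have ae: "(\<integral>x. \<phi> x \<partial>(Dcd t)) = (\<integral>x. \<phi> x \<partial>(Dbar t)) - integral (cbox 0 L) (\<lambda>x. \<phi> x * (mom2 U x t / 2)) \<and>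
        (\<forall>k l. sint \<phi> (Mcd t k l) = sint \<phi> (Mbar t k l) - integral (cbox 0 L) (\<lambda>x. \<phi> x * tens U x t $ k $ l))"
    if "cont_per L \<phi>" for \<phi> t
  proof -
    have c: "continuous_on UNIV \<phi>" using that by (simp add: cont_per_def)
    show ?thesis unfolding Dcd_integral[OF c] Dbar_integral[OF c] Mcd_sint[OF c] Mbar_sint[OF c] mom2_eq tens_eq by simp
  qed
  have "strict_mono r \<and> young U \<and>
     (\<forall>\<psi>. testL2 L T \<psi> \<longrightarrow>
        (\<lambda>n. integral {0..T} (\<lambda>t. integral (cbox 0 L) (\<lambda>x.
              uh L (K (r n)) (\<lambda>i. u (r n) i t) x \<bullet> \<psi> t x)))
        \<longlonglongrightarrow> integral {0..T} (\<lambda>t. integral (cbox 0 L) (\<lambda>x. mom1 U x t \<bullet> \<psi> t x))) \<and>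
     LinfMpos L T Dbar \<and>
     (\<forall>\<psi>. testC L T \<psi> \<longrightarrow>
        (\<lambda>n. integral {0..T} (\<lambda>t. integral (cbox 0 L) (\<lambda>x.
              \<psi> t x * ((norm (uh L (K (r n)) (\<lambda>i. u (r n) i t) x))\<^sup>2 / 2))))
        \<longlonglongrightarrow> integral {0..T} (\<lambda>t. \<integral>x. \<psi> t x \<partial>(Dbar t))) \<and>
     LinfMmat L T Mbar \<and>
     (\<forall>\<psi> k l. testC L T \<psi> \<longrightarrow>
        (\<lambda>n. integral {0..T} (\<lambda>t. integral (cbox 0 L) (\<lambda>x.
              \<psi> t x * (uh L (K (r n)) (\<lambda>i. u (r n) i t) x $ k
                       * uh L (K (r n)) (\<lambda>i. u (r n) i t) x $ l))))
        \<longlonglongrightarrow> integral {0..T} (\<lambda>t. sint (\<psi> t) (Mbar t k l))) \<and>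
     (AE t in lborel. t \<in> {0..T} \<longrightarrow> (\<forall>\<phi>. cont_per L \<phi> \<longrightarrow>
        (\<integral>x. \<phi> x \<partial>(Dcd t)) = (\<integral>x. \<phi> x \<partial>(Dbar t))
            - integral (cbox 0 L) (\<lambda>x. \<phi> x * (mom2 U x t / 2)) \<and>
        (\<forall>k l. sint \<phi> (Mcd t k l) = sint \<phi> (Mbar t k l)
            - integral (cbox 0 L) (\<lambda>x. \<phi> x * tens U x t $ k $ l)))) \<and>
     DMV L T u0 U Dcd Mcd"
  proof (intro conjI allI impI)
    show "strict_mono r" by (rule r)
    show "young U" by (rule young_U)
    show "LinfMpos L T Dbar" "LinfMmat L T Mbar" by (rule LinfM)+
    show "DMV L T u0 U Dcd Mcd" by (rule DMV_limit[OF u0_L2 init_L2 init_energy])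
    show "AE t in lborel. t \<in> {0..T} \<longrightarrow> (\<forall>\<phi>. cont_per L \<phi> \<longrightarrow>
        (\<integral>x. \<phi> x \<partial>(Dcd t)) = (\<integral>x. \<phi> x \<partial>(Dbar t))
            - integral (cbox 0 L) (\<lambda>x. \<phi> x * (mom2 U x t / 2)) \<and>
        (\<forall>k l. sint \<phi> (Mcd t k l) = sint \<phi> (Mbar t k l)
            - integral (cbox 0 L) (\<lambda>x. \<phi> x * tens U x t $ k $ l)))"
      using ae by (intro AE_I2) blast
  qed (rule weak_L2 weak_energy weak_tensor; assumption)+
  then show ?thesis by (intro exI)
qed

end
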